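(* Let $H$ be a semisimple Hopf algebra over a field $\Bbbk$ and let $A$ be an $H$-semiprimitive partial $H$-module algebra. If every irreducible right $A$-module is finite-dimensional over $\Bbbk$ (or every irreducible left $A$-module is finite-dimensional over $\Bbbk$), then the partial smash product $\underline{A\#H}$ is semiprimitive, i.e. its Jacobson radical is zero.
   Context: All algebras are associative and unital over a field $\Bbbk$. $H$ is a Hopf algebra over $\Bbbk$ with comultiplication $\Delta(h)=\sum h_1\otimes h_2$. "Semisimple" means semisimple as an algebra. A (left) partial $H$-module algebra is an algebra $A$ with a $\Bbbk$-linear map $H\otimes A\to A$, $h\otimes a\mapsto h\cdot a$, such that for all $a,b\in A$, $h,g\in H$: $1_H\cdot a=a$ and $h\cdot(a(g\cdot b))=\sum (h_1\cdot a)((h_2g)\cdot b)$. An ideal $I$ of $A$ is $H$-stable if $H\cdot I\subseteq I$; then $A/I$ is a partial $H$-module algebra via $h\cdot(a+I)=(h\cdot a)+I$. The vector space $A\otimes H$ with product $(a\# h)(b\# g)=\sum a(h_1\cdot b)\# h_2g$ (writing $a\#h$ for $a\otimes h$) is an associative algebra $A\#H$. The partial smash product is $\underline{A\#H}:=(A\#H)(1_A\#1_H)$, which is spanned by the elements $\underline{a\#h}:=\sum a(h_1\cdot 1_A)\#h_2$ and is a unital algebra with identity $1_A\#1_H$. A right partial $(A,H)$-module is a right $A$-module $M$ with a $\Bbbk$-linear map $M\otimes H\to M$, $m\otimes h\mapsto m\blacktriangleleft h$, such that $m\blacktriangleleft 1_H=m$ and $((m\blacktriangleleft h)a)\blacktriangleleft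 g=\sum (m(h_1\cdot a))\blacktriangleleft(h_2g)$ for all $m\in M$, $a\in A$, $h,g\in H$. It is irreducible if $M\ne 0$ and its only partial $(A,H)$-submodules are $0$ and $M$. A right $H$-primitive ideal of $A$ is an $H$-stable ideal $I$ such that $A/I$ has a faithful (annihilator zero in $A/I$) irreducible right partial $(A/I,H)$-module; equivalently, $I$ is the annihilator in $A$ of an irreducible right partial $(A,H)$-module. The $H$-Jacobson radical $J_H(A)$ is the intersection of all right $H$-primitive ideals of $A$ (the analogous left-handed definition gives the same ideal). $A$ is $H$-semiprimitive if $J_H(A)=0$. *)

theory Defs
  imports "HOL-Algebra.Module" "HOL-Algebra.QuotRing"
begin

text \<open>
  Vector spaces over a field \<open>K\<close> are records of type \<open>('k, 'v) module\<close> satisfying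
  \<^locale>\<open>module\<close>; algebras use the same record type, so that one carrier-based record carries
  both the ring structure and the scalar multiplication. The library locale \<^locale>\<open>algebra\<close> is
  restricted to commutative rings, hence \<open>unital_algebra\<close> below. The record fields \<open>mult\<close> and
  \<open>one\<close> are irrelevant for a record that is only used as a vector space.
\<close>

section \<open>Linear algebra\<close>

definition linear_map ::
  "'k ring \<Rightarrow> ('k, 'v) module \<Rightarrow> ('k, 'w) module \<Rightarrow> ('v \<Rightarrow> 'w) \<Rightarrow> bool"
  where "linear_map K V W f \<longleftrightarrow>
    f \<in> carrier V \<rightarrow> carrier W \<and>
    (\<forall>x\<in>carrier V. \<forall>y\<in>carrier V. f (x \<oplus>\<^bsub>V\<^esub> y) = f x \<oplus>\<^bsub>W\<^esub> f y) \<and>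
    (\<forall>c\<in>carrier K. \<forall>x\<in>carrier V. f (c \<odot>\<^bsub>V\<^esub> x) = c \<odot>\<^bsub>W\<^esub> f x)"

definition bilinear_map ::
  "'k ring \<Rightarrow> ('k, 'v) module \<Rightarrow> ('k, 'w) module \<Rightarrow> ('k, 'u) module \<Rightarrow> ('v \<Rightarrow> 'w \<Rightarrow> 'u) \<Rightarrow> bool"
  where "bilinear_map K V W U \<beta> \<longleftrightarrow>
    (\<forall>v\<in>carrier V. linear_map K W U (\<beta> v)) \<and>
    (\<forall>w\<in>carrier W. linear_map K V U (\<lambda>v. \<beta> v w))"

definition submodule_span :: "'k ring \<Rightarrow> ('k, 'v) module \<Rightarrow> 'v set \<Rightarrow> 'v set"
  where "submodule_span K V S = \<Inter>{N. submodule N K V \<and> S \<subseteq> N}"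

definition finite_dimensional :: "'k ring \<Rightarrow> ('k, 'v) module \<Rightarrow> bool"
  where "finite_dimensional K V \<longleftrightarrow>
    (\<exists>S. finite S \<and> S \<subseteq> carrier V \<and> submodule_span K V S = carrier V)"

definition quotient_module :: "('k, 'v) module \<Rightarrow> 'v set \<Rightarrow> ('k, 'v set) module"
  where "quotient_module V N =
    \<lparr>carrier = carrier (V Quot N), mult = mult (V Quot N), one = one (V Quot N),
     zero = zero (V Quot N), add = add (V Quot N),
     smult = (\<lambda>c X. \<Union>x\<in>X. N +>\<^bsub>V\<^esub> (c \<odot>\<^bsub>V\<^esub> x))\<rparr>"

definition scalar_module :: "'k ring \<Rightarrow> ('k, 'k) module"
  where "scalar_module K =
    \<lparr>carrier = carrier K, mult = mult K, one = one K, zero = zero K, add = add K, smult = mult K\<rparr>"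


section \<open>Tensor products\<close>

definition free_module :: "'k ring \<Rightarrow> 'x set \<Rightarrow> ('k, 'x \<Rightarrow> 'k) module"
  where "free_module K X =
    \<lparr>carrier = {f. range f \<subseteq> carrier K \<and> finite {x. f x \<noteq> \<zero>\<^bsub>K\<^esub>} \<and> {x. f x \<noteq> \<zero>\<^bsub>K\<^esub>} \<subseteq> X},
     mult = undefined, one = undefined,
     zero = (\<lambda>x. \<zero>\<^bsub>K\<^esub>), add = (\<lambda>f g x. f x \<oplus>\<^bsub>K\<^esub> g x), smult = (\<lambda>c f x. c \<otimes>\<^bsub>K\<^esub> f x)\<rparr>"

definition free_basis :: "'k ring \<Rightarrow> 'x \<Rightarrow> 'x \<Rightarrow> 'k"
  where "free_basis K x = (\<lambda>y. if y = x then \<one>\<^bsub>K\<^esub> else \<zero>\<^bsub>K\<^esub>)"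

definition tensor_relators ::
  "'k ring \<Rightarrow> ('k, 'v) module \<Rightarrow> ('k, 'w) module \<Rightarrow> ('v \<times> 'w \<Rightarrow> 'k) set"
  where "tensor_relators K V W =
    (let F = free_module K (carrier V \<times> carrier W); e = (\<lambda>v w. free_basis K (v, w)) in
      {e (v \<oplus>\<^bsub>V\<^esub> v') w \<ominus>\<^bsub>F\<^esub> (e v w \<oplus>\<^bsub>F\<^esub> e v' w) | v v' w.
         v \<in> carrier V \<and> v' \<in> carrier V \<and> w \<in> carrier W} \<union>
      {e v (w \<oplus>\<^bsub>W\<^esub> w') \<ominus>\<^bsub>F\<^esub> (e v w \<oplus>\<^bsub>F\<^esub> e v w') | v w w'.
         v \<in> carrier V \<and> w \<in> carrier W \<and> w' \<in> carrier W} \<union>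
      {e (c \<odot>\<^bsub>V\<^esub> v) w \<ominus>\<^bsub>F\<^esub> (c \<odot>\<^bsub>F\<^esub> e v w) | c v w.
         c \<in> carrier K \<and> v \<in> carrier V \<and> w \<in> carrier W} \<union>
      {e v (c \<odot>\<^bsub>W\<^esub> w) \<ominus>\<^bsub>F\<^esub> (c \<odot>\<^bsub>F\<^esub> e v w) | c v w.
         c \<in> carrier K \<and> v \<in> carrier V \<and> w \<in> carrier W})"

definition tensor_kernel ::
  "'k ring \<Rightarrow> ('k, 'v) module \<Rightarrow> ('k, 'w) module \<Rightarrow> ('v \<times> 'w \<Rightarrow> 'k) set"
  where "tensor_kernel K V W =
    submodule_span K (free_module K (carrier V \<times> carrier W)) (tensor_relators K V W)"

definition tensor_product ::
  "'k ring \<Rightarrow> ('k, 'v) module \<Rightarrow> ('k, 'w) module \<Rightarrow> ('k, ('v \<times> 'w \<Rightarrow> 'k) set) module"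
  where "tensor_product K V W =
    quotient_module (free_module K (carrier V \<times> carrier W)) (tensor_kernel K V W)"

definition pure_tensor ::
  "'k ring \<Rightarrow> ('k, 'v) module \<Rightarrow> ('k, 'w) module \<Rightarrow> 'v \<Rightarrow> 'w \<Rightarrow> ('v \<times> 'w \<Rightarrow> 'k) set"
  where "pure_tensor K V W v w =
    tensor_kernel K V W +>\<^bsub>free_module K (carrier V \<times> carrier W)\<^esub> free_basis K (v, w)"

text \<open>
  The linear map out of a tensor product induced by a bilinear map \<open>\<beta>\<close>, evaluated at \<open>t\<close>; it
  renders the Sweedler notation: \<open>tensor_lift K U \<beta> (\<Delta> h)\<close> is \<open>\<Sum> \<beta> h\<^sub>1 h\<^sub>2\<close>, computed
  in \<open>U\<close>. It is only meaningful for \<open>\<beta>\<close> bilinear, where the choice of the representative \<open>f\<close>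
  is irrelevant; see \<open>tensor_lift_linear\<close> and \<open>tensor_lift_pure_tensor\<close>.
\<close>

definition tensor_lift ::
  "'k ring \<Rightarrow> ('k, 'u) module \<Rightarrow> ('v \<Rightarrow> 'w \<Rightarrow> 'u) \<Rightarrow> ('v \<times> 'w \<Rightarrow> 'k) set \<Rightarrow> 'u"
  where "tensor_lift K U \<beta> t =
    (let f = (SOME f. f \<in> t) in
      \<Oplus>\<^bsub>U\<^esub> p \<in> {p. f p \<noteq> \<zero>\<^bsub>K\<^esub>}. f p \<odot>\<^bsub>U\<^esub> \<beta> (fst p) (snd p))"


section \<open>Algebras, one-sided ideals and modules\<close>

locale unital_algebra = K: field K + module K A + A: ring A for K and A +
  assumes smult_mult_left: "\<lbrakk>c \<in> carrier K; x \<in> carrier A; y \<in> carrier A\<rbrakk> \<Longrightarrow>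
      (c \<odot>\<^bsub>A\<^esub> x) \<otimes>\<^bsub>A\<^esub> y = c \<odot>\<^bsub>A\<^esub> (x \<otimes>\<^bsub>A\<^esub> y)"
    and smult_mult_right: "\<lbrakk>c \<in> carrier K; x \<in> carrier A; y \<in> carrier A\<rbrakk> \<Longrightarrow>
      x \<otimes>\<^bsub>A\<^esub> (c \<odot>\<^bsub>A\<^esub> y) = c \<odot>\<^bsub>A\<^esub> (x \<otimes>\<^bsub>A\<^esub> y)"

definition right_ideal :: "'a set \<Rightarrow> ('a, 'b) ring_scheme \<Rightarrow> bool"
  where "right_ideal I R \<longleftrightarrow>
    additive_subgroup I R \<and> (\<forall>x\<in>I. \<forall>r\<in>carrier R. x \<otimes>\<^bsub>R\<^esub> r \<in> I)"

definition maximal_right_ideal :: "'a set \<Rightarrow> ('a, 'b) ring_scheme \<Rightarrow> bool"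
  where "maximal_right_ideal I R \<longleftrightarrow>
    right_ideal I R \<and> I \<noteq> carrier R \<and>
    (\<forall>J. right_ideal J R \<and> I \<subseteq> J \<longrightarrow> J = I \<or> J = carrier R)"

definition jacobson_radical :: "('a, 'b) ring_scheme \<Rightarrow> 'a set"
  where "jacobson_radical R = {x \<in> carrier R. \<forall>I. maximal_right_ideal I R \<longrightarrow> x \<in> I}"

definition semiprimitive :: "('a, 'b) ring_scheme \<Rightarrow> bool"
  where "semiprimitive R \<longleftrightarrow> jacobson_radical R = {\<zero>\<^bsub>R\<^esub>}"

text \<open>The regular right module is semisimple: each of its submodules is a direct summand.\<close>

definition semisimple :: "('a, 'b) ring_scheme \<Rightarrow> bool"
  where "semisimple R \<longleftrightarrow>
    (\<forall>I. right_ideal I R \<longrightarrow>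
      (\<exists>J. right_ideal J R \<and> I \<inter> J = {\<zero>\<^bsub>R\<^esub>} \<and> I <+>\<^bsub>R\<^esub> J = carrier R))"

locale right_module = module K M for K and M and A :: "('k, 'a) module" and rmul +
  assumes rmul_bilinear: "bilinear_map K M A M rmul"
    and rmul_one: "m \<in> carrier M \<Longrightarrow> rmul m \<one>\<^bsub>A\<^esub> = m"
    and rmul_mult: "\<lbrakk>m \<in> carrier M; a \<in> carrier A; b \<in> carrier A\<rbrakk> \<Longrightarrow>
      rmul (rmul m a) b = rmul m (a \<otimes>\<^bsub>A\<^esub> b)"

locale left_module = module K M for K and M and A :: "('k, 'a) module" and lmul +
  assumes lmul_bilinear: "bilinear_map K A M M lmul"
    and lmul_one: "m \<in> carrier M \<Longrightarrow> lmul \<one>\<^bsub>A\<^esub> m = m"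
    and lmul_mult: "\<lbrakk>m \<in> carrier M; a \<in> carrier A; b \<in> carrier A\<rbrakk> \<Longrightarrow>
      lmul a (lmul b m) = lmul (a \<otimes>\<^bsub>A\<^esub> b) m"

definition irreducible_right_module ::
  "'k ring \<Rightarrow> ('k, 'a) module \<Rightarrow> ('k, 'm) module \<Rightarrow> ('m \<Rightarrow> 'a \<Rightarrow> 'm) \<Rightarrow> bool"
  where "irreducible_right_module K A M rmul \<longleftrightarrow>
    right_module K M A rmul \<and> carrier M \<noteq> {\<zero>\<^bsub>M\<^esub>} \<and>
    (\<forall>N. submodule N K M \<and> (\<forall>n\<in>N. \<forall>a\<in>carrier A. rmul n a \<in> N) \<longrightarrow>
      N = {\<zero>\<^bsub>M\<^esub>} \<or> N = carrier M)"

definition irreducible_left_module ::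
  "'k ring \<Rightarrow> ('k, 'a) module \<Rightarrow> ('k, 'm) module \<Rightarrow> ('a \<Rightarrow> 'm \<Rightarrow> 'm) \<Rightarrow> bool"
  where "irreducible_left_module K A M lmul \<longleftrightarrow>
    left_module K M A lmul \<and> carrier M \<noteq> {\<zero>\<^bsub>M\<^esub>} \<and>
    (\<forall>N. submodule N K M \<and> (\<forall>n\<in>N. \<forall>a\<in>carrier A. lmul a n \<in> N) \<longrightarrow>
      N = {\<zero>\<^bsub>M\<^esub>} \<or> N = carrier M)"


section \<open>Hopf algebras\<close>

locale hopf_algebra = unital_algebra K H for K and H :: "('k, 'h) module" +
  fixes \<Delta> :: "'h \<Rightarrow> ('h \<times> 'h \<Rightarrow> 'k) set"
    and \<epsilon> :: "'h \<Rightarrow> 'k"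
    and S :: "'h \<Rightarrow> 'h"
  assumes comult_linear: "linear_map K H (tensor_product K H H) \<Delta>"
    and counit_linear: "linear_map K H (scalar_module K) \<epsilon>"
    and antipode_linear: "linear_map K H H S"
    and comult_mult: "\<lbrakk>h \<in> carrier H; g \<in> carrier H\<rbrakk> \<Longrightarrow>
      \<Delta> (h \<otimes>\<^bsub>H\<^esub> g) =
        tensor_lift K (tensor_product K H H) (\<lambda>h1 h2.
          tensor_lift K (tensor_product K H H) (\<lambda>g1 g2.
            pure_tensor K H H (h1 \<otimes>\<^bsub>H\<^esub> g1) (h2 \<otimes>\<^bsub>H\<^esub> g2)) (\<Delta> g)) (\<Delta> h)"
    and comult_one: "\<Delta> \<one>\<^bsub>H\<^esub> = pure_tensor K H H \<one>\<^bsub>H\<^esub> \<one>\<^bsub>H\<^esub>"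
    and counit_mult: "\<lbrakk>h \<in> carrier H; g \<in> carrier H\<rbrakk> \<Longrightarrow>
      \<epsilon> (h \<otimes>\<^bsub>H\<^esub> g) = \<epsilon> h \<otimes>\<^bsub>K\<^esub> \<epsilon> g"
    and counit_one: "\<epsilon> \<one>\<^bsub>H\<^esub> = \<one>\<^bsub>K\<^esub>"
    and coassoc: "h \<in> carrier H \<Longrightarrow>
      tensor_lift K (tensor_product K H (tensor_product K H H)) (\<lambda>x y.
        tensor_lift K (tensor_product K H (tensor_product K H H)) (\<lambda>u v.
          pure_tensor K H (tensor_product K H H) u (pure_tensor K H H v y)) (\<Delta> x)) (\<Delta> h) =
      tensor_lift K (tensor_product K H (tensor_product K H H)) (\<lambda>x y.
        pure_tensor K H (tensor_product K H H) x (\<Delta> y)) (\<Delta> h)"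
    and counit_left: "h \<in> carrier H \<Longrightarrow> tensor_lift K H (\<lambda>x y. \<epsilon> x \<odot>\<^bsub>H\<^esub> y) (\<Delta> h) = h"
    and counit_right: "h \<in> carrier H \<Longrightarrow> tensor_lift K H (\<lambda>x y. \<epsilon> y \<odot>\<^bsub>H\<^esub> x) (\<Delta> h) = h"
    and antipode_left: "h \<in> carrier H \<Longrightarrow>
      tensor_lift K H (\<lambda>x y. S x \<otimes>\<^bsub>H\<^esub> y) (\<Delta> h) = \<epsilon> h \<odot>\<^bsub>H\<^esub> \<one>\<^bsub>H\<^esub>"
    and antipode_right: "h \<in> carrier H \<Longrightarrow>
      tensor_lift K H (\<lambda>x y. x \<otimes>\<^bsub>H\<^esub> S y) (\<Delta> h) = \<epsilon> h \<odot>\<^bsub>H\<^esub> \<one>\<^bsub>H\<^esub>"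


section \<open>Partial module algebras and their smash products\<close>

locale partial_module_algebra = unital_algebra K A for K and A :: "('k, 'a) module" +
  fixes H :: "('k, 'h) module"
    and \<Delta> :: "'h \<Rightarrow> ('h \<times> 'h \<Rightarrow> 'k) set"
    and act :: "'h \<Rightarrow> 'a \<Rightarrow> 'a"
  assumes act_bilinear: "bilinear_map K H A A act"
    and act_one: "a \<in> carrier A \<Longrightarrow> act \<one>\<^bsub>H\<^esub> a = a"
    and act_mult_act: "\<lbrakk>a \<in> carrier A; b \<in> carrier A; h \<in> carrier H; g \<in> carrier H\<rbrakk> \<Longrightarrow>
      act h (a \<otimes>\<^bsub>A\<^esub> act g b) =
        tensor_lift K A (\<lambda>h1 h2. act h1 a \<otimes>\<^bsub>A\<^esub> act (h2 \<otimes>\<^bsub>H\<^esub> g) b) (\<Delta> h)"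

definition smash_product ::
  "'k ring \<Rightarrow> ('k, 'h) module \<Rightarrow> ('h \<Rightarrow> ('h \<times> 'h \<Rightarrow> 'k) set) \<Rightarrow>
   ('k, 'a) module \<Rightarrow> ('h \<Rightarrow> 'a \<Rightarrow> 'a) \<Rightarrow> ('k, ('a \<times> 'h \<Rightarrow> 'k) set) module"
  where "smash_product K H \<Delta> A act =
    (tensor_product K A H)
      \<lparr>mult := (\<lambda>s t.
         tensor_lift K (tensor_product K A H) (\<lambda>a h.
           tensor_lift K (tensor_product K A H) (\<lambda>b g.
             tensor_lift K (tensor_product K A H) (\<lambda>h1 h2.
               pure_tensor K A H (a \<otimes>\<^bsub>A\<^esub> act h1 b) (h2 \<otimes>\<^bsub>H\<^esub> g)) (\<Delta> h)) t) s),
       one := pure_tensor K A H \<one>\<^bsub>A\<^esub> \<one>\<^bsub>H\<^esub>\<rparr>"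

definition partial_smash_product ::
  "'k ring \<Rightarrow> ('k, 'h) module \<Rightarrow> ('h \<Rightarrow> ('h \<times> 'h \<Rightarrow> 'k) set) \<Rightarrow>
   ('k, 'a) module \<Rightarrow> ('h \<Rightarrow> 'a \<Rightarrow> 'a) \<Rightarrow> ('k, ('a \<times> 'h \<Rightarrow> 'k) set) module"
  where "partial_smash_product K H \<Delta> A act =
    (let P = smash_product K H \<Delta> A act in
      P\<lparr>carrier := (\<lambda>s. s \<otimes>\<^bsub>P\<^esub> pure_tensor K A H \<one>\<^bsub>A\<^esub> \<one>\<^bsub>H\<^esub>) ` carrier P\<rparr>)"


section \<open>Partial modules and the H-Jacobson radical\<close>

locale right_partial_module = right_module K M A rmul
  for K and M :: "('k, 'm) module" and A :: "('k, 'a) module" and rmul +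
  fixes H :: "('k, 'h) module"
    and \<Delta> :: "'h \<Rightarrow> ('h \<times> 'h \<Rightarrow> 'k) set"
    and act :: "'h \<Rightarrow> 'a \<Rightarrow> 'a"
    and pact :: "'m \<Rightarrow> 'h \<Rightarrow> 'm"
  assumes pact_bilinear: "bilinear_map K M H M pact"
    and pact_one: "m \<in> carrier M \<Longrightarrow> pact m \<one>\<^bsub>H\<^esub> = m"
    and pact_rmul_pact:
      "\<lbrakk>m \<in> carrier M; a \<in> carrier A; h \<in> carrier H; g \<in> carrier H\<rbrakk> \<Longrightarrow>
      pact (rmul (pact m h) a) g =
        tensor_lift K M (\<lambda>h1 h2. pact (rmul m (act h1 a)) (h2 \<otimes>\<^bsub>H\<^esub> g)) (\<Delta> h)"

definition irreducible_right_partial_module ::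
  "'k ring \<Rightarrow> ('k, 'h) module \<Rightarrow> ('h \<Rightarrow> ('h \<times> 'h \<Rightarrow> 'k) set) \<Rightarrow>
   ('k, 'a) module \<Rightarrow> ('h \<Rightarrow> 'a \<Rightarrow> 'a) \<Rightarrow>
   ('k, 'm) module \<Rightarrow> ('m \<Rightarrow> 'a \<Rightarrow> 'm) \<Rightarrow> ('m \<Rightarrow> 'h \<Rightarrow> 'm) \<Rightarrow> bool"
  where "irreducible_right_partial_module K H \<Delta> A act M rmul pact \<longleftrightarrow>
    right_partial_module K M A rmul H \<Delta> act pact \<and> carrier M \<noteq> {\<zero>\<^bsub>M\<^esub>} \<and>
    (\<forall>N. submodule N K M \<and> (\<forall>n\<in>N. \<forall>a\<in>carrier A. rmul n a \<in> N) \<and>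
         (\<forall>n\<in>N. \<forall>h\<in>carrier H. pact n h \<in> N) \<longrightarrow>
      N = {\<zero>\<^bsub>M\<^esub>} \<or> N = carrier M)"

definition faithful_right_module ::
  "('k, 'a) module \<Rightarrow> ('k, 'm) module \<Rightarrow> ('m \<Rightarrow> 'a \<Rightarrow> 'm) \<Rightarrow> bool"
  where "faithful_right_module A M rmul \<longleftrightarrow>
    {a \<in> carrier A. \<forall>m\<in>carrier M. rmul m a = \<zero>\<^bsub>M\<^esub>} = {\<zero>\<^bsub>A\<^esub>}"

definition quotient_action ::
  "('k, 'a) module \<Rightarrow> ('h \<Rightarrow> 'a \<Rightarrow> 'a) \<Rightarrow> 'a set \<Rightarrow> 'h \<Rightarrow> 'a set \<Rightarrow> 'a set"
  where "quotient_action A act I h X = (\<Union>a\<in>X. I +>\<^bsub>A\<^esub> act h a)"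

text \<open>
  HOL cannot quantify over the type of the elements of a module inside a formula, so the modules
  in the next definition have their elements in a fixed type. No module is lost: an irreducible
  partial module is generated by any of its nonzero elements, and so is isomorphic to one whose
  elements are the classes of a partition of the free module on \<open>carrier (A/I) \<times> carrier H\<close>;
  see \<open>irreducible_right_partial_module_universe\<close>. In the same way, irreducible right or left
  \<open>A\<close>-modules are isomorphic to ones with elements in \<open>'a set\<close>; see
  \<open>irreducible_right_module_universe\<close> and \<open>irreducible_left_module_universe\<close>.
\<close>

definition right_H_primitive ::
  "'k ring \<Rightarrow> ('k, 'h) module \<Rightarrow> ('h \<Rightarrow> ('h \<times> 'h \<Rightarrow> 'k) set) \<Rightarrow>
   ('k, 'a) module \<Rightarrow> ('h \<Rightarrow> 'a \<Rightarrow> 'a) \<Rightarrow> 'a set \<Rightarrow> bool"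
  where "right_H_primitive K H \<Delta> A act I \<longleftrightarrow>
    ideal I A \<and> (\<forall>h\<in>carrier H. \<forall>a\<in>I. act h a \<in> I) \<and>
    (\<exists>(M :: ('k, ('a set \<times> 'h \<Rightarrow> 'k) set) module) rmul pact.
      irreducible_right_partial_module K H \<Delta>
        (quotient_module A I) (quotient_action A act I) M rmul pact \<and>
      faithful_right_module (quotient_module A I) M rmul)"

definition H_jacobson_radical ::
  "'k ring \<Rightarrow> ('k, 'h) module \<Rightarrow> ('h \<Rightarrow> ('h \<times> 'h \<Rightarrow> 'k) set) \<Rightarrow>
   ('k, 'a) module \<Rightarrow> ('h \<Rightarrow> 'a \<Rightarrow> 'a) \<Rightarrow> 'a set"
  where "H_jacobson_radical K H \<Delta> A act =
    {a \<in> carrier A. \<forall>I. right_H_primitive K H \<Delta> A act I \<longrightarrow> a \<in> I}"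

definition H_semiprimitive ::
  "'k ring \<Rightarrow> ('k, 'h) module \<Rightarrow> ('h \<Rightarrow> ('h \<times> 'h \<Rightarrow> 'k) set) \<Rightarrow>
   ('k, 'a) module \<Rightarrow> ('h \<Rightarrow> 'a \<Rightarrow> 'a) \<Rightarrow> bool"
  where "H_semiprimitive K H \<Delta> A act \<longleftrightarrow> H_jacobson_radical K H \<Delta> A act = {\<zero>\<^bsub>A\<^esub>}"


section \<open>Justification of the encodings\<close>

lemma linear_map_closed: "linear_map K V W f \<Longrightarrow> x \<in> carrier V \<Longrightarrow> f x \<in> carrier W"
  and linear_map_add: "linear_map K V W f \<Longrightarrow> x \<in> carrier V \<Longrightarrow> y \<in> carrier V \<Longrightarrow>
    f (x \<oplus>\<^bsub>V\<^esub> y) = f x \<oplus>\<^bsub>W\<^esub> f y"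
  and linear_map_smult: "linear_map K V W f \<Longrightarrow> c \<in> carrier K \<Longrightarrow> x \<in> carrier V \<Longrightarrow>
    f (c \<odot>\<^bsub>V\<^esub> x) = c \<odot>\<^bsub>W\<^esub> f x"
  by (auto simp: linear_map_def)

lemma linear_map_zero:
  assumes "module K V" "module K W" "linear_map K V W f"
  shows "f \<zero>\<^bsub>V\<^esub> = \<zero>\<^bsub>W\<^esub>"
proof -
  interpret V: module K V by fact
  interpret W: module K W by fact
  have "f (\<zero>\<^bsub>K\<^esub> \<odot>\<^bsub>V\<^esub> \<zero>\<^bsub>V\<^esub>) = \<zero>\<^bsub>K\<^esub> \<odot>\<^bsub>W\<^esub> f \<zero>\<^bsub>V\<^esub>"
    by (rule linear_map_smult[OF assms(3)]) auto
  then show ?thesis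
    using linear_map_closed[OF assms(3), of "\<zero>\<^bsub>V\<^esub>"] by simp
qed

lemma linear_map_finsum:
  assumes "module K V" "module K W" "linear_map K V W f" "finite B" "g \<in> B \<rightarrow> carrier V"
  shows "f (\<Oplus>\<^bsub>V\<^esub>i\<in>B. g i) = (\<Oplus>\<^bsub>W\<^esub>i\<in>B. f (g i))"
proof -
  interpret V: module K V by fact
  interpret W: module K W by fact
  show ?thesis
    using assms(4,5)
  proof (induction rule: finite_induct)
    case empty
    then show ?case using linear_map_zero[OF assms(1-3)] by simp
  next
    case (insert x F)
    have g: "g \<in> F \<rightarrow> carrier V" "g x \<in> carrier V" using insert by auto
    have fg: "(\<lambda>i. f (g i)) \<in> F \<rightarrow> carrier W" "f (g x) \<in> carrier W"
      using g linear_map_closed[OF assms(3)] by auto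
    show ?case
      using insert.hyps insert.IH g fg
      by (simp add: linear_map_add[OF assms(3)])
  qed
qed

lemma linear_map_image_submodule:
  assumes "module K V" "module K W" "linear_map K V W f"
  shows "submodule (f ` carrier V) K W"
proof -
  interpret V: module K V by fact
  interpret W: module K W by fact
  note cl = linear_map_closed[OF assms(3)] and ad = linear_map_add[OF assms(3)]
    and sm = linear_map_smult[OF assms(3)]
  show ?thesis
  proof (rule W.submoduleI)
    show "f ` carrier V \<subseteq> carrier W" using cl by auto
    show "\<zero>\<^bsub>W\<^esub> \<in> f ` carrier V"
      using linear_map_zero[OF assms] by (metis V.zero_closed image_eqI)
    fix y assume "y \<in> f ` carrier V"
    then obtain x where x: "x \<in> carrier V" "y = f x" by auto
    have "f ((\<ominus>\<^bsub>K\<^esub> \<one>\<^bsub>K\<^esub>) \<odot>\<^bsub>V\<^esub> x) = \<ominus>\<^bsub>W\<^esub> y"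
      using x cl by (subst sm) (auto simp: W.smult_l_minus)
    then show "\<ominus>\<^bsub>W\<^esub> y \<in> f ` carrier V" using x by (metis image_eqI V.R.a_inv_closed V.R.one_closed V.smult_closed)
  next
    fix a b assume "a \<in> f ` carrier V" "b \<in> f ` carrier V"
    then show "a \<oplus>\<^bsub>W\<^esub> b \<in> f ` carrier V"
      using ad by (auto simp flip: ad)
  next
    fix a b assume "a \<in> carrier K" "b \<in> f ` carrier V"
    then show "a \<odot>\<^bsub>W\<^esub> b \<in> f ` carrier V" by (auto simp flip: sm)
  qed
qed

lemma linear_map_vimage_submodule:
  assumes "module K V" "module K W" "linear_map K V W f" "submodule N K W"
  shows "submodule {x \<in> carrier V. f x \<in> N} K V"
proof -
  interpret V: module K V by fact
  interpret W: module K W by fact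
  note cl = linear_map_closed[OF assms(3)] and ad = linear_map_add[OF assms(3)]
    and sm = linear_map_smult[OF assms(3)]
  note N = W.submoduleE[OF assms(4)]
  have N0: "\<zero>\<^bsub>W\<^esub> \<in> N"
    using assms(4) by (metis submodule.axioms(1) subgroup.one_closed monoid.simps(2))
  show ?thesis
  proof (rule V.submoduleI)
    fix y assume y: "y \<in> {x \<in> carrier V. f x \<in> N}"
    have "f (\<ominus>\<^bsub>V\<^esub> y) = f ((\<ominus>\<^bsub>K\<^esub> \<one>\<^bsub>K\<^esub>) \<odot>\<^bsub>V\<^esub> y)"
      using y by (simp add: V.smult_l_minus)
    also have "\<dots> = \<ominus>\<^bsub>W\<^esub> f y"
      using y cl by (subst sm) (auto simp: W.smult_l_minus)
    finally show "\<ominus>\<^bsub>V\<^esub> y \<in> {x \<in> carrier V. f x \<in> N}" using y N by auto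
  qed (use N N0 linear_map_zero[OF assms(1-3)] in \<open>auto simp: ad sm\<close>)
qed

lemma submodule_zero:
  assumes "module K V"
  shows "submodule {\<zero>\<^bsub>V\<^esub>} K V"
proof -
  interpret V: module K V by fact
  show ?thesis by (rule V.submoduleI) auto
qed

lemma submodule_span_submodule:
  assumes "module K V" "S \<subseteq> carrier V"
  shows "submodule (submodule_span K V S) K V"
proof -
  interpret V: module K V by fact
  have car: "submodule (carrier V) K V" by (rule V.carrier_is_submodule)
  have z: "\<zero>\<^bsub>V\<^esub> \<in> N" if "submodule N K V" for N
    using that by (metis submodule.axioms(1) subgroup.one_closed monoid.simps(2))
  show ?thesis
  proof (rule V.submoduleI)
    show "submodule_span K V S \<subseteq> carrier V"
      using car assms(2) by (auto simp: submodule_span_def)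
    show "\<zero>\<^bsub>V\<^esub> \<in> submodule_span K V S" using z by (auto simp: submodule_span_def)
  next
    fix a assume "a \<in> submodule_span K V S"
    then show "\<ominus>\<^bsub>V\<^esub> a \<in> submodule_span K V S"
      using V.submoduleE(3) by (fastforce simp: submodule_span_def)
  next
    fix a b assume "a \<in> submodule_span K V S" "b \<in> submodule_span K V S"
    then show "a \<oplus>\<^bsub>V\<^esub> b \<in> submodule_span K V S"
      using V.submoduleE(5) by (fastforce simp: submodule_span_def)
  next
    fix a b assume "a \<in> carrier K" "b \<in> submodule_span K V S"
    then show "a \<odot>\<^bsub>V\<^esub> b \<in> submodule_span K V S"
      using V.submoduleE(4) by (fastforce simp: submodule_span_def)
  qed
qed

lemma submodule_span_subset: "S \<subseteq> submodule_span K V S"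
  and submodule_span_least: "submodule N K V \<Longrightarrow> S \<subseteq> N \<Longrightarrow> submodule_span K V S \<subseteq> N"
  by (auto simp: submodule_span_def)

lemma free_module_carrier_iff:
  "f \<in> carrier (free_module K X) \<longleftrightarrow>
    (\<forall>x. f x \<in> carrier K) \<and> finite {x. f x \<noteq> \<zero>\<^bsub>K\<^esub>} \<and> (\<forall>x. f x \<noteq> \<zero>\<^bsub>K\<^esub> \<longrightarrow> x \<in> X)"
  by (auto simp: free_module_def)

lemma free_module_module:
  assumes "cring K"
  shows "module K (free_module K X)"
proof -
  interpret K: cring K by fact
  have ops: "(f \<oplus>\<^bsub>free_module K X\<^esub> g) = (\<lambda>x. f x \<oplus>\<^bsub>K\<^esub> g x)" "\<zero>\<^bsub>free_module K X\<^esub> = (\<lambda>x. \<zero>\<^bsub>K\<^esub>)"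
    "(c \<odot>\<^bsub>free_module K X\<^esub> f) = (\<lambda>x. c \<otimes>\<^bsub>K\<^esub> f x)" for f g c by (auto simp: free_module_def)
  have add_cl: "f \<oplus>\<^bsub>free_module K X\<^esub> g \<in> carrier (free_module K X)"
    if f: "f \<in> carrier (free_module K X)" and g: "g \<in> carrier (free_module K X)" for f g
  proof -
    have "finite ({x. f x \<noteq> \<zero>\<^bsub>K\<^esub>} \<union> {x. g x \<noteq> \<zero>\<^bsub>K\<^esub>})"
      using f g by (simp add: free_module_carrier_iff)
    then have "finite {x. f x \<oplus>\<^bsub>K\<^esub> g x \<noteq> \<zero>\<^bsub>K\<^esub>}"
      by (rule rev_finite_subset) auto
    moreover have "x \<in> X" if "f x \<oplus>\<^bsub>K\<^esub> g x \<noteq> \<zero>\<^bsub>K\<^esub>" for x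
      using f g that by (cases "f x = \<zero>\<^bsub>K\<^esub>"; cases "g x = \<zero>\<^bsub>K\<^esub>") (auto simp: free_module_carrier_iff)
    ultimately show ?thesis using f g unfolding ops free_module_carrier_iff by simp
  qed
  have smult_cl: "c \<odot>\<^bsub>free_module K X\<^esub> f \<in> carrier (free_module K X)"
    if f: "f \<in> carrier (free_module K X)" and c: "c \<in> carrier K" for f c
  proof -
    have "finite {x. f x \<noteq> \<zero>\<^bsub>K\<^esub>}" using f by (simp add: free_module_carrier_iff)
    then have "finite {x. c \<otimes>\<^bsub>K\<^esub> f x \<noteq> \<zero>\<^bsub>K\<^esub>}"
      by (rule rev_finite_subset) (use c in auto)
    moreover have "x \<in> X" if "c \<otimes>\<^bsub>K\<^esub> f x \<noteq> \<zero>\<^bsub>K\<^esub>" for x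
      using f c that by (cases "f x = \<zero>\<^bsub>K\<^esub>") (auto simp: free_module_carrier_iff)
    ultimately show ?thesis using f c unfolding ops free_module_carrier_iff by simp
  qed
  have ab: "abelian_group (free_module K X)"
  proof (rule abelian_groupI)
    fix f assume f: "f \<in> carrier (free_module K X)"
    let ?g = "(\<ominus>\<^bsub>K\<^esub> \<one>\<^bsub>K\<^esub>) \<odot>\<^bsub>free_module K X\<^esub> f"
    have "?g \<oplus>\<^bsub>free_module K X\<^esub> f = \<zero>\<^bsub>free_module K X\<^esub>"
      using f by (simp add: ops fun_eq_iff free_module_carrier_iff K.l_minus K.l_neg)
    with smult_cl[OF f, of "\<ominus>\<^bsub>K\<^esub> \<one>\<^bsub>K\<^esub>"]
    show "\<exists>y\<in>carrier (free_module K X). y \<oplus>\<^bsub>free_module K X\<^esub> f = \<zero>\<^bsub>free_module K X\<^esub>"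
      by blast
  next
    show "\<zero>\<^bsub>free_module K X\<^esub> \<in> carrier (free_module K X)"
      by (simp add: ops free_module_carrier_iff)
  qed (rule add_cl | simp add: ops fun_eq_iff free_module_carrier_iff K.a_ac)+
  show ?thesis
    by (rule moduleI; (rule assms ab smult_cl)?;
        simp add: ops fun_eq_iff free_module_carrier_iff K.l_distr K.r_distr K.m_assoc)
qed

lemma free_basis_closed:
  "cring K \<Longrightarrow> x \<in> X \<Longrightarrow> free_basis K x \<in> carrier (free_module K X)"
  by (auto simp: free_basis_def free_module_carrier_iff cring.cring_simprules
      intro: finite_subset[of _ "{x}"])

definition free_lift ::
  "'k ring \<Rightarrow> ('k, 'u) module \<Rightarrow> ('x \<Rightarrow> 'u) \<Rightarrow> ('x \<Rightarrow> 'k) \<Rightarrow> 'u"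
  where "free_lift K U \<beta> f = (\<Oplus>\<^bsub>U\<^esub> p \<in> {p. f p \<noteq> \<zero>\<^bsub>K\<^esub>}. f p \<odot>\<^bsub>U\<^esub> \<beta> p)"

lemma free_lift_superset:
  assumes "module K U" "\<beta> \<in> X \<rightarrow> carrier U" "f \<in> carrier (free_module K X)"
    "finite B" "{p. f p \<noteq> \<zero>\<^bsub>K\<^esub>} \<subseteq> B" "B \<subseteq> X"
  shows "free_lift K U \<beta> f = (\<Oplus>\<^bsub>U\<^esub> p \<in> B. f p \<odot>\<^bsub>U\<^esub> \<beta> p)"
proof -
  interpret U: module K U by fact
  have fK: "f p \<in> carrier K" for p using assms(3) by (auto simp: free_module_def)
  show ?thesis unfolding free_lift_def
    by (rule U.add.finprod_mono_neutral_cong_left)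
       (use assms fK in \<open>auto simp: Pi_def subset_iff\<close>)
qed

lemma free_lift_linear:
  assumes "module K U" "\<beta> \<in> X \<rightarrow> carrier U"
  shows "linear_map K (free_module K X) U (free_lift K U \<beta>)"
proof -
  interpret U: module K U by fact
  have cr: "cring K" using assms(1) by (simp add: module_def)
  interpret F: module K "free_module K X" by (rule free_module_module[OF cr])
  have fK: "f p \<in> carrier K" if "f \<in> carrier (free_module K X)" for f p
    using that by (auto simp: free_module_def)
  have supp: "finite {p. f p \<noteq> \<zero>\<^bsub>K\<^esub>}" "{p. f p \<noteq> \<zero>\<^bsub>K\<^esub>} \<subseteq> X"
    if "f \<in> carrier (free_module K X)" for f
    using that by (auto simp: free_module_def)
  have term_cl: "(\<lambda>p. f p \<odot>\<^bsub>U\<^esub> \<beta> p) \<in> B \<rightarrow> carrier U"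
    if "f \<in> carrier (free_module K X)" "B \<subseteq> X" for f B
    using fK[OF that(1)] that(2) assms(2) by (auto simp: Pi_def subset_iff)
  show ?thesis unfolding linear_map_def
  proof (intro conjI ballI)
    show "free_lift K U \<beta> \<in> carrier (free_module K X) \<rightarrow> carrier U"
      unfolding free_lift_def using term_cl supp by (auto intro!: U.finsum_closed)
  next
    fix f g assume f: "f \<in> carrier (free_module K X)" and g: "g \<in> carrier (free_module K X)"
    let ?B = "{p. f p \<noteq> \<zero>\<^bsub>K\<^esub>} \<union> {p. g p \<noteq> \<zero>\<^bsub>K\<^esub>}"
    have B: "finite ?B" "?B \<subseteq> X" using supp[OF f] supp[OF g] by auto
    have fg: "f \<oplus>\<^bsub>free_module K X\<^esub> g \<in> carrier (free_module K X)" using f g by simp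
    have fgp: "(f \<oplus>\<^bsub>free_module K X\<^esub> g) p = f p \<oplus>\<^bsub>K\<^esub> g p" for p by (simp add: free_module_def)
    have "free_lift K U \<beta> (f \<oplus>\<^bsub>free_module K X\<^esub> g)
        = (\<Oplus>\<^bsub>U\<^esub> p \<in> ?B. (f p \<oplus>\<^bsub>K\<^esub> g p) \<odot>\<^bsub>U\<^esub> \<beta> p)"
      by (subst free_lift_superset[OF assms fg B(1) _ B(2)]) (auto simp: fgp)
    also have "\<dots> = (\<Oplus>\<^bsub>U\<^esub> p \<in> ?B. f p \<odot>\<^bsub>U\<^esub> \<beta> p \<oplus>\<^bsub>U\<^esub> g p \<odot>\<^bsub>U\<^esub> \<beta> p)"
      by (rule U.finsum_cong')
         (use B(2) assms(2) fK[OF f] fK[OF g] in \<open>auto simp: Pi_def subset_iff U.smult_l_distr\<close>)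
    also have "\<dots> = (\<Oplus>\<^bsub>U\<^esub> p \<in> ?B. f p \<odot>\<^bsub>U\<^esub> \<beta> p) \<oplus>\<^bsub>U\<^esub> (\<Oplus>\<^bsub>U\<^esub> p \<in> ?B. g p \<odot>\<^bsub>U\<^esub> \<beta> p)"
      by (rule U.finsum_addf) (use term_cl[OF f B(2)] term_cl[OF g B(2)] in auto)
    also have "\<dots> = free_lift K U \<beta> f \<oplus>\<^bsub>U\<^esub> free_lift K U \<beta> g"
      by (simp add: free_lift_superset[OF assms f B(1) _ B(2)] free_lift_superset[OF assms g B(1) _ B(2)])
    finally show "free_lift K U \<beta> (f \<oplus>\<^bsub>free_module K X\<^esub> g)
      = free_lift K U \<beta> f \<oplus>\<^bsub>U\<^esub> free_lift K U \<beta> g" .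
  next
    fix c f assume c: "c \<in> carrier K" and f: "f \<in> carrier (free_module K X)"
    let ?B = "{p. f p \<noteq> \<zero>\<^bsub>K\<^esub>}"
    note B = supp[OF f]
    have cf: "c \<odot>\<^bsub>free_module K X\<^esub> f \<in> carrier (free_module K X)" using c f by simp
    have cfp: "(c \<odot>\<^bsub>free_module K X\<^esub> f) p = c \<otimes>\<^bsub>K\<^esub> f p" for p by (simp add: free_module_def)
    have "free_lift K U \<beta> (c \<odot>\<^bsub>free_module K X\<^esub> f) = (\<Oplus>\<^bsub>U\<^esub> p \<in> ?B. (c \<otimes>\<^bsub>K\<^esub> f p) \<odot>\<^bsub>U\<^esub> \<beta> p)"
      by (subst free_lift_superset[OF assms cf B(1) _ B(2)]) (use c in \<open>auto simp: cfp\<close>)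
    also have "\<dots> = (\<Oplus>\<^bsub>U\<^esub> p \<in> ?B. c \<odot>\<^bsub>U\<^esub> (f p \<odot>\<^bsub>U\<^esub> \<beta> p))"
      by (rule U.finsum_cong')
         (use B(2) c assms(2) fK[OF f] in \<open>auto simp: Pi_def subset_iff U.smult_assoc1\<close>)
    also have "\<dots> = c \<odot>\<^bsub>U\<^esub> free_lift K U \<beta> f"
      unfolding free_lift_def by (rule U.finsum_smult_ldistr[symmetric]) (use B c term_cl[OF f B(2)] in auto)
    finally show "free_lift K U \<beta> (c \<odot>\<^bsub>free_module K X\<^esub> f) = c \<odot>\<^bsub>U\<^esub> free_lift K U \<beta> f" .
  qed
qed

lemma free_lift_basis:
  assumes "module K U" "\<beta> \<in> X \<rightarrow> carrier U" "x \<in> X"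
  shows "free_lift K U \<beta> (free_basis K x) = \<beta> x"
proof -
  interpret U: module K U by fact
  have cr: "cring K" using assms(1) by (simp add: module_def)
  have "\<beta> x \<in> carrier U" using assms by auto
  then show ?thesis
    by (subst free_lift_superset[OF assms(1,2) free_basis_closed[OF cr assms(3)], of "{x}"])
       (use assms(3) in \<open>auto simp: free_basis_def split: if_splits\<close>)
qed

lemma tensor_relators_closed:
  assumes "module K V" "module K W"
  shows "tensor_relators K V W \<subseteq> carrier (free_module K (carrier V \<times> carrier W))"
proof -
  interpret V: module K V by fact
  interpret W: module K W by fact
  have cr: "cring K" using assms(1) by (simp add: module_def)
  interpret F: module K "free_module K (carrier V \<times> carrier W)" by (rule free_module_module[OF cr])
  show ?thesis
    unfolding tensor_relators_def Let_def by (auto intro!: F.minus_closed free_basis_closed[OF cr])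
qed

lemma tensor_kernel_submodule:
  assumes "module K V" "module K W"
  shows "submodule (tensor_kernel K V W) K (free_module K (carrier V \<times> carrier W))"
  unfolding tensor_kernel_def
  by (rule submodule_span_submodule[OF free_module_module tensor_relators_closed])
     (use assms in \<open>auto simp: module_def\<close>)

lemma bilinear_map_closed:
  "bilinear_map K V W U \<beta> \<Longrightarrow> v \<in> carrier V \<Longrightarrow> w \<in> carrier W \<Longrightarrow> \<beta> v w \<in> carrier U"
  by (auto simp: bilinear_map_def linear_map_def)

lemma tensor_kernel_free_lift:
  assumes "module K V" "module K W" "module K U" "bilinear_map K V W U \<beta>"
    "f \<in> tensor_kernel K V W"
  shows "free_lift K U (case_prod \<beta>) f = \<zero>\<^bsub>U\<^esub>"
proof -
  interpret V: module K V by fact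
  interpret W: module K W by fact
  interpret U: module K U by fact
  let ?X = "carrier V \<times> carrier W"
  have cr: "cring K" using assms(1) by (simp add: module_def)
  interpret F: module K "free_module K ?X" by (rule free_module_module[OF cr])
  have b: "case_prod \<beta> \<in> ?X \<rightarrow> carrier U" using bilinear_map_closed[OF assms(4)] by auto
  note lin = free_lift_linear[OF assms(3) b]
  have diff: "free_lift K U (case_prod \<beta>) (f \<ominus>\<^bsub>free_module K ?X\<^esub> g) = \<zero>\<^bsub>U\<^esub>"
    if "f \<in> carrier (free_module K ?X)" "g \<in> carrier (free_module K ?X)"
       "free_lift K U (case_prod \<beta>) f = free_lift K U (case_prod \<beta>) g" for f g
  proof -
    have "f = (f \<ominus>\<^bsub>free_module K ?X\<^esub> g) \<oplus>\<^bsub>free_module K ?X\<^esub> g"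
      using that by (simp add: F.minus_eq F.a_assoc F.l_neg)
    then have "free_lift K U (case_prod \<beta>) f =
        free_lift K U (case_prod \<beta>) (f \<ominus>\<^bsub>free_module K ?X\<^esub> g) \<oplus>\<^bsub>U\<^esub> free_lift K U (case_prod \<beta>) g"
      using that by (metis F.minus_closed linear_map_add[OF lin])
    then show ?thesis
      using that linear_map_closed[OF lin] by (metis F.minus_closed U.add.r_cancel_one')
  qed
  have bas: "free_basis K (v, w) \<in> carrier (free_module K ?X)"
    if "v \<in> carrier V" "w \<in> carrier W" for v w
    by (rule free_basis_closed[OF cr]) (use that in auto)
  have ev: "free_lift K U (case_prod \<beta>) (free_basis K (v, w)) = \<beta> v w"
    if "v \<in> carrier V" "w \<in> carrier W" for v w
    using free_lift_basis[OF assms(3) b, of "(v, w)"] that by simp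
  have bl: "linear_map K W U (\<beta> v)" "linear_map K V U (\<lambda>v. \<beta> v w)"
    if "v \<in> carrier V" "w \<in> carrier W" for v w using assms(4) that by (auto simp: bilinear_map_def)
  have rel: "tensor_relators K V W \<subseteq>
      {f \<in> carrier (free_module K ?X). free_lift K U (case_prod \<beta>) f \<in> {\<zero>\<^bsub>U\<^esub>}}"
  proof
    fix r assume r: "r \<in> tensor_relators K V W"
    have "free_lift K U (case_prod \<beta>) r = \<zero>\<^bsub>U\<^esub>"
      using r unfolding tensor_relators_def Let_def
      by (auto intro!: diff simp: bas ev linear_map_add[OF lin] linear_map_smult[OF lin]
          linear_map_add[OF bl(1)] linear_map_add[OF bl(2)]
          linear_map_smult[OF bl(1)] linear_map_smult[OF bl(2)])
    with r tensor_relators_closed[OF assms(1,2)]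
    show "r \<in> {f \<in> carrier (free_module K ?X). free_lift K U (case_prod \<beta>) f \<in> {\<zero>\<^bsub>U\<^esub>}}" by auto
  qed
  have "tensor_kernel K V W \<subseteq>
      {f \<in> carrier (free_module K ?X). free_lift K U (case_prod \<beta>) f \<in> {\<zero>\<^bsub>U\<^esub>}}"
    unfolding tensor_kernel_def
    by (rule submodule_span_least[OF linear_map_vimage_submodule[OF F.module_axioms assms(3) lin
          submodule_zero[OF assms(3)]] rel])
  with assms(5) show ?thesis by auto
qed

lemma tensor_product_carrier:
  "carrier (tensor_product K V W) =
    {tensor_kernel K V W +>\<^bsub>free_module K (carrier V \<times> carrier W)\<^esub> f | f.
      f \<in> carrier (free_module K (carrier V \<times> carrier W))}"
  by (auto simp: tensor_product_def quotient_module_def FactRing_def A_RCOSETS_def')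

lemma tensor_lift_coset:
  assumes "module K V" "module K W" "module K U" "bilinear_map K V W U \<beta>"
    "f \<in> carrier (free_module K (carrier V \<times> carrier W))"
  shows "tensor_lift K U \<beta> (tensor_kernel K V W +>\<^bsub>free_module K (carrier V \<times> carrier W)\<^esub> f)
    = free_lift K U (case_prod \<beta>) f"
proof -
  interpret V: module K V by fact
  interpret W: module K W by fact
  interpret U: module K U by fact
  let ?X = "carrier V \<times> carrier W"
  let ?t = "tensor_kernel K V W +>\<^bsub>free_module K ?X\<^esub> f"
  have cr: "cring K" using assms(1) by (simp add: module_def)
  interpret F: module K "free_module K ?X" by (rule free_module_module[OF cr])
  have b: "case_prod \<beta> \<in> ?X \<rightarrow> carrier U" using bilinear_map_closed[OF assms(4)] by auto
  note lin = free_lift_linear[OF assms(3) b]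
  note N = F.submoduleE[OF tensor_kernel_submodule[OF assms(1,2)]]
  obtain n0 where "n0 \<in> tensor_kernel K V W" using N(2) by auto
  then have "\<exists>g. g \<in> ?t" by (auto simp: a_r_coset_def')
  then have "(SOME g. g \<in> ?t) \<in> ?t" by (rule someI_ex)
  then obtain n where n: "n \<in> tensor_kernel K V W" "(SOME g. g \<in> ?t) = n \<oplus>\<^bsub>free_module K ?X\<^esub> f"
    by (auto simp: a_r_coset_def')
  have "tensor_lift K U \<beta> ?t = free_lift K U (case_prod \<beta>) (n \<oplus>\<^bsub>free_module K ?X\<^esub> f)"
    unfolding tensor_lift_def n(2) by (simp add: free_lift_def case_prod_beta' Let_def)
  also have "\<dots> = free_lift K U (case_prod \<beta>) f"
    using n(1) N(1) assms(5) linear_map_closed[OF lin]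
    by (subst linear_map_add[OF lin]) (auto simp: tensor_kernel_free_lift[OF assms(1-4)])
  finally show ?thesis .
qed

theorem tensor_lift_pure_tensor:
  assumes "module K V" "module K W" "module K U" "bilinear_map K V W U \<beta>"
    "v \<in> carrier V" "w \<in> carrier W"
  shows "tensor_lift K U \<beta> (pure_tensor K V W v w) = \<beta> v w"
proof -
  interpret V: module K V by fact
  have cr: "cring K" using assms(1) by (simp add: module_def)
  have b: "case_prod \<beta> \<in> carrier V \<times> carrier W \<rightarrow> carrier U"
    using bilinear_map_closed[OF assms(4)] by auto
  show ?thesis
    using assms(5,6) free_lift_basis[OF assms(3) b, of "(v, w)"]
    by (simp add: pure_tensor_def tensor_lift_coset[OF assms(1-4)] free_basis_closed[OF cr])
qed

lemma quotient_module_smult_coset: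
  assumes "module K V" "submodule N K V" "c \<in> carrier K" "x \<in> carrier V"
  shows "c \<odot>\<^bsub>quotient_module V N\<^esub> (N +>\<^bsub>V\<^esub> x) = N +>\<^bsub>V\<^esub> (c \<odot>\<^bsub>V\<^esub> x)"
proof -
  interpret V: module K V by fact
  interpret N: subgroup N "add_monoid V" using assms(2) by (rule submodule.axioms)
  have sub: "N \<subseteq> carrier V" using N.subset by simp
  have const: "N +>\<^bsub>V\<^esub> (c \<odot>\<^bsub>V\<^esub> y) = N +>\<^bsub>V\<^esub> (c \<odot>\<^bsub>V\<^esub> x)" if "y \<in> N +>\<^bsub>V\<^esub> x" for y
  proof -
    from that obtain n where n: "n \<in> N" "y = n \<oplus>\<^bsub>V\<^esub> x" by (auto simp: a_r_coset_def')
    have cn: "c \<odot>\<^bsub>V\<^esub> n \<in> N" using submodule.smult_closed[OF assms(2,3) n(1)] .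
    have "c \<odot>\<^bsub>V\<^esub> y = c \<odot>\<^bsub>V\<^esub> n \<oplus>\<^bsub>V\<^esub> c \<odot>\<^bsub>V\<^esub> x"
      using n sub assms by (auto simp: V.smult_r_distr)
    then have "c \<odot>\<^bsub>V\<^esub> y \<in> N +>\<^bsub>V\<^esub> (c \<odot>\<^bsub>V\<^esub> x)" using cn by (auto simp: a_r_coset_def')
    then show ?thesis
      using V.add.repr_independence[of "c \<odot>\<^bsub>V\<^esub> y" N "c \<odot>\<^bsub>V\<^esub> x"] assms(3,4) N.subgroup_axioms
      by (simp add: a_r_coset_def)
  qed
  have mem: "x \<in> N +>\<^bsub>V\<^esub> x"
    using N.one_closed assms(4) by (auto simp: a_r_coset_def' intro!: bexI[of _ "\<zero>\<^bsub>V\<^esub>"])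
  have "c \<odot>\<^bsub>quotient_module V N\<^esub> (N +>\<^bsub>V\<^esub> x) =
      (\<Union>y\<in>N +>\<^bsub>V\<^esub> x. N +>\<^bsub>V\<^esub> (c \<odot>\<^bsub>V\<^esub> y))" by (simp add: quotient_module_def)
  also have "\<dots> = (\<Union>y\<in>N +>\<^bsub>V\<^esub> x. N +>\<^bsub>V\<^esub> (c \<odot>\<^bsub>V\<^esub> x))"
    by (rule SUP_cong[OF refl const])
  also have "\<dots> = N +>\<^bsub>V\<^esub> (c \<odot>\<^bsub>V\<^esub> x)" using mem by blast
  finally show ?thesis .
qed

lemma quotient_module_add_coset:
  assumes "module K V" "submodule N K V" "x \<in> carrier V" "y \<in> carrier V"
  shows "(N +>\<^bsub>V\<^esub> x) \<oplus>\<^bsub>quotient_module V N\<^esub> (N +>\<^bsub>V\<^esub> y) = N +>\<^bsub>V\<^esub> (x \<oplus>\<^bsub>V\<^esub> y)"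
proof -
  interpret V: module K V by fact
  interpret N: abelian_subgroup N V
    by (rule abelian_subgroupI3)
       (use submodule.axioms(1)[OF assms(2)] V.abelian_group_axioms in
         \<open>auto simp: additive_subgroup_def\<close>)
  show ?thesis using N.a_rcos_sum[OF assms(3,4)]
    by (simp add: quotient_module_def FactRing_def)
qed

theorem tensor_lift_linear:
  assumes "module K V" "module K W" "module K U" "bilinear_map K V W U \<beta>"
  shows "linear_map K (tensor_product K V W) U (tensor_lift K U \<beta>)"
proof -
  interpret V: module K V by fact
  let ?X = "carrier V \<times> carrier W"
  have cr: "cring K" using assms(1) by (simp add: module_def)
  interpret F: module K "free_module K ?X" by (rule free_module_module[OF cr])
  have b: "case_prod \<beta> \<in> ?X \<rightarrow> carrier U" using bilinear_map_closed[OF assms(4)] by auto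
  note lin = free_lift_linear[OF assms(3) b]
  note sub = tensor_kernel_submodule[OF assms(1,2)]
  show ?thesis
    unfolding linear_map_def
    by (auto simp: tensor_product_carrier tensor_lift_coset[OF assms] linear_map_closed[OF lin])
       (auto simp: tensor_product_def tensor_lift_coset[OF assms]
         quotient_module_add_coset[OF F.module_axioms sub]
         quotient_module_smult_coset[OF F.module_axioms sub]
         linear_map_add[OF lin] linear_map_smult[OF lin])
qed


lemma tensor_product_rep:
  assumes "module K V" "module K W" "t \<in> carrier (tensor_product K V W)"
  shows "(SOME f. f \<in> t) \<in> carrier (free_module K (carrier V \<times> carrier W))"
proof -
  let ?F = "free_module K (carrier V \<times> carrier W)"
  have cr: "cring K" using assms(1) by (simp add: module_def)
  interpret F: module K ?F by (rule free_module_module[OF cr])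
  note N = F.submoduleE[OF tensor_kernel_submodule[OF assms(1,2)]]
  obtain f where f: "f \<in> carrier ?F" "t = tensor_kernel K V W +>\<^bsub>?F\<^esub> f"
    using assms(3) by (auto simp: tensor_product_carrier)
  obtain n0 where "n0 \<in> tensor_kernel K V W" using N(2) by auto
  then have "\<exists>g. g \<in> t" using f(2) by (auto simp: a_r_coset_def')
  then have "(SOME g. g \<in> t) \<in> t" by (rule someI_ex)
  then obtain n where "n \<in> tensor_kernel K V W" "(SOME g. g \<in> t) = n \<oplus>\<^bsub>?F\<^esub> f"
    using f(2) by (auto simp: a_r_coset_def')
  then show ?thesis using N(1) f(1) by auto
qed

lemma tensor_lift_free_lift:
  "tensor_lift K U \<beta> t = free_lift K U (case_prod \<beta>) (SOME f. f \<in> t)"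
  by (simp add: tensor_lift_def free_lift_def case_prod_beta' Let_def)

lemma free_lift_in_image:
  assumes "module K U" "submodule N K U" "\<beta> \<in> X \<rightarrow> N" "f \<in> carrier (free_module K X)"
  shows "free_lift K U \<beta> f \<in> N"
proof -
  interpret U: module K U by fact
  note N = U.submoduleE[OF assms(2)]
  have N0: "\<zero>\<^bsub>U\<^esub> \<in> N"
    using assms(2) by (metis submodule.axioms(1) subgroup.one_closed monoid.simps(2))
  have mem: "f p \<odot>\<^bsub>U\<^esub> \<beta> p \<in> N" if "p \<in> X" for p
    using assms(3,4) that by (intro N(4)) (auto simp: free_module_carrier_iff)
  have "(\<Oplus>\<^bsub>U\<^esub> p \<in> B. f p \<odot>\<^bsub>U\<^esub> \<beta> p) \<in> N" if "finite B" "B \<subseteq> X" for B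
    using that
  proof (induction rule: finite_induct)
    case empty
    then show ?case using N0 by simp
  next
    case (insert x F)
    have "(\<lambda>p. f p \<odot>\<^bsub>U\<^esub> \<beta> p) \<in> F \<rightarrow> carrier U" "f x \<odot>\<^bsub>U\<^esub> \<beta> x \<in> carrier U"
      using mem N(1) insert.prems by auto
    then show ?case
      using insert.hyps insert.IH insert.prems mem[of x] by (simp add: N(5))
  qed
  then show ?thesis
    using assms(4) unfolding free_lift_def by (auto simp: free_module_carrier_iff)
qed

lemma tensor_lift_in_submodule:
  assumes "module K V" "module K W" "module K U" "submodule N K U"
    "t \<in> carrier (tensor_product K V W)"
    "\<And>v w. v \<in> carrier V \<Longrightarrow> w \<in> carrier W \<Longrightarrow> \<beta> v w \<in> N"
  shows "tensor_lift K U \<beta> t \<in> N"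
  unfolding tensor_lift_free_lift
  by (rule free_lift_in_image[OF assms(3,4) _ tensor_product_rep[OF assms(1,2,5)]])
     (use assms(6) in auto)

lemma tensor_lift_comp:
  assumes "module K V" "module K W" "module K U" "module K U'" "linear_map K U U' \<phi>"
    "t \<in> carrier (tensor_product K V W)"
    "\<And>v w. v \<in> carrier V \<Longrightarrow> w \<in> carrier W \<Longrightarrow> \<beta> v w \<in> carrier U"
    "\<And>v w. v \<in> carrier V \<Longrightarrow> w \<in> carrier W \<Longrightarrow> \<beta>' v w = \<phi> (\<beta> v w)"
  shows "tensor_lift K U' \<beta>' t = \<phi> (tensor_lift K U \<beta> t)"
proof -
  interpret U: module K U by fact
  interpret U': module K U' by fact
  let ?f = "SOME f. f \<in> t"
  let ?B = "{p. ?f p \<noteq> \<zero>\<^bsub>K\<^esub>}"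
  have f: "?f \<in> carrier (free_module K (carrier V \<times> carrier W))"
    by (rule tensor_product_rep[OF assms(1,2,6)])
  then have B: "finite ?B" "?B \<subseteq> carrier V \<times> carrier W" and fK: "\<And>p. ?f p \<in> carrier K"
    by (auto simp: free_module_carrier_iff)
  have cl: "?f p \<odot>\<^bsub>U\<^esub> \<beta> (fst p) (snd p) \<in> carrier U" if "p \<in> ?B" for p
    using that B(2) fK assms(7) by (intro U.smult_closed) auto
  have "\<phi> (tensor_lift K U \<beta> t) = (\<Oplus>\<^bsub>U'\<^esub> p \<in> ?B. \<phi> (?f p \<odot>\<^bsub>U\<^esub> \<beta> (fst p) (snd p)))"
    unfolding tensor_lift_def Let_def
    by (rule linear_map_finsum[OF assms(3-5) B(1)]) (use cl in auto)
  also have "\<dots> = tensor_lift K U' \<beta>' t"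
    unfolding tensor_lift_def Let_def
  proof (rule U'.finsum_cong'[OF refl])
    show "(\<lambda>p. ?f p \<odot>\<^bsub>U'\<^esub> \<beta>' (fst p) (snd p)) \<in> ?B \<rightarrow> carrier U'"
    proof
      fix p assume "p \<in> ?B"
      then have "fst p \<in> carrier V" "snd p \<in> carrier W" using B(2) by auto
      then show "?f p \<odot>\<^bsub>U'\<^esub> \<beta>' (fst p) (snd p) \<in> carrier U'"
        using fK assms(7) linear_map_closed[OF assms(5)] by (simp add: assms(8))
    qed
  next
    fix p assume "p \<in> ?B"
    then have "fst p \<in> carrier V" "snd p \<in> carrier W" using B(2) by auto
    then show "\<phi> (?f p \<odot>\<^bsub>U\<^esub> \<beta> (fst p) (snd p)) = ?f p \<odot>\<^bsub>U'\<^esub> \<beta>' (fst p) (snd p)"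
      using fK assms(7) by (simp add: assms(8) linear_map_smult[OF assms(5)])
  qed
  finally show ?thesis by simp
qed

text \<open>Transport of a vector space along an injection.\<close>

definition transport :: "('m \<Rightarrow> 'n) \<Rightarrow> ('k, 'm) module \<Rightarrow> ('k, 'n) module"
  where "transport j M =
    (let i = inv_into (carrier M) j in
      \<lparr>carrier = j ` carrier M, mult = undefined, one = undefined, zero = j \<zero>\<^bsub>M\<^esub>,
       add = (\<lambda>x y. j (i x \<oplus>\<^bsub>M\<^esub> i y)), smult = (\<lambda>c x. j (c \<odot>\<^bsub>M\<^esub> i x))\<rparr>)"

lemma transport_simps:
  "carrier (transport j M) = j ` carrier M"
  "\<zero>\<^bsub>transport j M\<^esub> = j \<zero>\<^bsub>M\<^esub>"
  "inj_on j (carrier M) \<Longrightarrow> x \<in> carrier M \<Longrightarrow> y \<in> carrier M \<Longrightarrow>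
    j x \<oplus>\<^bsub>transport j M\<^esub> j y = j (x \<oplus>\<^bsub>M\<^esub> y)"
  "inj_on j (carrier M) \<Longrightarrow> x \<in> carrier M \<Longrightarrow> c \<odot>\<^bsub>transport j M\<^esub> j x = j (c \<odot>\<^bsub>M\<^esub> x)"
  by (simp_all add: transport_def Let_def)

lemma transport_module:
  assumes "module K M" "inj_on j (carrier M)"
  shows "module K (transport j M)"
proof -
  interpret M: module K M by fact
  note [simp] = transport_simps(1,2) transport_simps(3,4)[OF assms(2)]
  have "abelian_group (transport j M)"
  proof (rule abelian_groupI)
    fix x assume "x \<in> carrier (transport j M)"
    then obtain m where m: "m \<in> carrier M" "x = j m" by auto
    then have "j (\<ominus>\<^bsub>M\<^esub> m) \<oplus>\<^bsub>transport j M\<^esub> x = \<zero>\<^bsub>transport j M\<^esub>" by (simp add: M.l_neg)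
    with m show "\<exists>y\<in>carrier (transport j M). y \<oplus>\<^bsub>transport j M\<^esub> x = \<zero>\<^bsub>transport j M\<^esub>" by auto
  qed (auto simp: M.a_ac)
  then show ?thesis
    by (intro moduleI)
       (auto simp: M.smult_l_distr M.smult_r_distr M.smult_assoc1 M.R.is_cring)
qed

lemma transport_linear:
  "inj_on j (carrier M) \<Longrightarrow> linear_map K M (transport j M) j"
  by (auto simp: linear_map_def transport_simps)

lemma transport_bilinear:
  assumes "module K M" "inj_on j (carrier M)" "bilinear_map K M A M \<beta>"
    "\<And>m a. m \<in> carrier M \<Longrightarrow> \<beta>' (j m) a = j (\<beta> m a)"
  shows "bilinear_map K (transport j M) A (transport j M) \<beta>'"
proof -
  interpret M: module K M by fact
  have *: "\<beta> m a \<in> carrier M" if "m \<in> carrier M" "a \<in> carrier A" for m a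
    using bilinear_map_closed[OF assms(3) that] .
  show ?thesis
    using assms(3) * unfolding bilinear_map_def linear_map_def
    by (auto simp: transport_simps(1) transport_simps(3,4)[OF assms(2)] assms(4))
qed

lemma transport_bilinear_left:
  assumes "module K M" "inj_on j (carrier M)" "bilinear_map K A M M \<beta>"
    "\<And>m a. m \<in> carrier M \<Longrightarrow> \<beta>' a (j m) = j (\<beta> a m)"
  shows "bilinear_map K A (transport j M) (transport j M) \<beta>'"
proof -
  interpret M: module K M by fact
  have *: "\<beta> a m \<in> carrier M" if "m \<in> carrier M" "a \<in> carrier A" for m a
    using bilinear_map_closed[OF assms(3) that(2,1)] .
  show ?thesis
    using assms(3) * unfolding bilinear_map_def linear_map_def
    by (auto simp: transport_simps(1) transport_simps(3,4)[OF assms(2)] assms(4))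
qed

lemma transport_submodule:
  fixes K :: "'k ring"
  assumes "module K M" "inj_on j (carrier M)" "submodule N' K (transport j M)"
  obtains N where "submodule N K M" "N' = j ` N" "N = {m \<in> carrier M. j m \<in> N'}"
proof -
  let ?N = "{m \<in> carrier M. j m \<in> N'}"
  have m': "module K (transport j M)" by (rule transport_module[OF assms(1,2)])
  have "submodule ?N K M"
    by (rule linear_map_vimage_submodule[OF assms(1) m' transport_linear[OF assms(2)] assms(3)])
  moreover have "N' = j ` ?N"
    using module.submoduleE(1)[OF m' assms(3)] by (auto simp: transport_simps(1))
  ultimately show ?thesis using that[of ?N] by blast
qed

lemma fibre_inj_on: "Y \<subseteq> \<phi> ` X \<Longrightarrow> inj_on (\<lambda>y. {x \<in> X. \<phi> x = y}) Y"
  by (rule inj_onI) blast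

lemma module_nonzero_element:
  assumes "module K M" "carrier M \<noteq> {\<zero>\<^bsub>M\<^esub>}"
  obtains m where "m \<in> carrier M" "m \<noteq> \<zero>\<^bsub>M\<^esub>"
proof -
  interpret module K M by fact
  show ?thesis using assms(2) that M.zero_closed by blast
qed

theorem irreducible_right_module_universe:
  fixes A :: "('k, 'a) module" and M :: "('k, 'm) module"
  assumes "unital_algebra K A" "irreducible_right_module K A M rmul"
  shows "\<exists>(M' :: ('k, 'a set) module) rmul' j.
    irreducible_right_module K A M' rmul' \<and>
    bij_betw j (carrier M) (carrier M') \<and> linear_map K M M' j \<and>
    (\<forall>m\<in>carrier M. \<forall>a\<in>carrier A. j (rmul m a) = rmul' (j m) a)"
proof -
  interpret A: unital_algebra K A by fact
  interpret M: right_module K M A rmul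
    using assms(2) by (simp add: irreducible_right_module_def)
  have mA: "module K A" and mM: "module K M" ..
  note bil = M.rmul_bilinear
  have irr: "N = {\<zero>\<^bsub>M\<^esub>} \<or> N = carrier M"
    if "submodule N K M" "\<And>n a. n \<in> N \<Longrightarrow> a \<in> carrier A \<Longrightarrow> rmul n a \<in> N" for N
    using assms(2) that by (auto simp: irreducible_right_module_def)
  have nz: "carrier M \<noteq> {\<zero>\<^bsub>M\<^esub>}" using assms(2) by (simp add: irreducible_right_module_def)
  then obtain m0 where m0: "m0 \<in> carrier M" "m0 \<noteq> \<zero>\<^bsub>M\<^esub>" using mM module_nonzero_element by metis
  have lin: "linear_map K A M (rmul m0)" using bil m0 by (auto simp: bilinear_map_def)
  have "rmul m0 ` carrier A = {\<zero>\<^bsub>M\<^esub>} \<or> rmul m0 ` carrier A = carrier M"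
    by (rule irr[OF linear_map_image_submodule[OF mA mM lin]])
       (use m0 M.rmul_mult in auto)
  moreover have "m0 \<in> rmul m0 ` carrier A"
    using M.rmul_one[OF m0(1)] by (metis A.A.one_closed image_eqI)
  ultimately have gen: "carrier M \<subseteq> rmul m0 ` carrier A" using m0(2) by auto
  define j where "j = (\<lambda>m. {a \<in> carrier A. rmul m0 a = m})"
  have inj: "inj_on j (carrier M)" unfolding j_def by (rule fibre_inj_on[OF gen])
  define rmul' where "rmul' = (\<lambda>x a. j (rmul (inv_into (carrier M) j x) a))"
  have r': "rmul' (j m) a = j (rmul m a)" if "m \<in> carrier M" for m a
    using inj that by (simp add: rmul'_def)
  let ?M' = "transport j M"
  have mM': "module K ?M'" by (rule transport_module[OF mM inj])
  have rm': "right_module K ?M' A rmul'"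
  proof (intro right_module.intro right_module_axioms.intro mM')
    show "bilinear_map K ?M' A ?M' rmul'" 
      by (rule transport_bilinear[OF mM inj bil, where \<beta>' = rmul'])
         (rule r')
  qed (auto simp: transport_simps(1) r' M.rmul_one M.rmul_mult bilinear_map_closed[OF bil])
  have "irreducible_right_module K A ?M' rmul'"
    unfolding irreducible_right_module_def
  proof (intro conjI allI impI)
    show "carrier ?M' \<noteq> {\<zero>\<^bsub>?M'\<^esub>}"
      using m0 inj M.M.zero_closed by (auto simp: transport_simps(1,2) dest: inj_onD)
  next
    fix N' assume N': "submodule N' K ?M' \<and> (\<forall>n\<in>N'. \<forall>a\<in>carrier A. rmul' n a \<in> N')"
    obtain N where N: "submodule N K M" "N' = j ` N" "N = {m \<in> carrier M. j m \<in> N'}"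
      by (rule transport_submodule[OF mM inj conjunct1[OF N']])
    have "N = {\<zero>\<^bsub>M\<^esub>} \<or> N = carrier M"
    proof (rule irr[OF N(1)])
      fix n a assume n: "n \<in> N" and a: "a \<in> carrier A"
      then have "n \<in> carrier M" "j n \<in> N'" using N(3) by auto
      moreover have "j (rmul n a) \<in> N'" using N' a calculation r' by metis
      ultimately show "rmul n a \<in> N" using a bilinear_map_closed[OF bil] N(3) by blast
    qed
    then show "N' = {\<zero>\<^bsub>?M'\<^esub>} \<or> N' = carrier ?M'"
      by (auto simp: N(2) transport_simps(1,2))
  qed (rule rm')
  moreover have "bij_betw j (carrier M) (carrier ?M')"
    using inj by (simp add: bij_betw_def transport_simps(1))
  ultimately show ?thesis using transport_linear[OF inj] r'
    by (intro exI[of _ ?M'] exI[of _ rmul'] exI[of _ j]) auto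
qed

theorem irreducible_left_module_universe:
  fixes A :: "('k, 'a) module" and M :: "('k, 'm) module"
  assumes "unital_algebra K A" "irreducible_left_module K A M lmul"
  shows "\<exists>(M' :: ('k, 'a set) module) lmul' j.
    irreducible_left_module K A M' lmul' \<and>
    bij_betw j (carrier M) (carrier M') \<and> linear_map K M M' j \<and>
    (\<forall>m\<in>carrier M. \<forall>a\<in>carrier A. j (lmul a m) = lmul' a (j m))"
proof -
  interpret A: unital_algebra K A by fact
  interpret M: left_module K M A lmul
    using assms(2) by (simp add: irreducible_left_module_def)
  have mA: "module K A" and mM: "module K M" ..
  note bil = M.lmul_bilinear
  have irr: "N = {\<zero>\<^bsub>M\<^esub>} \<or> N = carrier M"
    if "submodule N K M" "\<And>n a. n \<in> N \<Longrightarrow> a \<in> carrier A \<Longrightarrow> lmul a n \<in> N" for N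
    using assms(2) that by (auto simp: irreducible_left_module_def)
  have nz: "carrier M \<noteq> {\<zero>\<^bsub>M\<^esub>}" using assms(2) by (simp add: irreducible_left_module_def)
  then obtain m0 where m0: "m0 \<in> carrier M" "m0 \<noteq> \<zero>\<^bsub>M\<^esub>" using mM module_nonzero_element by metis
  let ?\<phi> = "\<lambda>a. lmul a m0"
  have lin: "linear_map K A M ?\<phi>" using bil m0 by (auto simp: bilinear_map_def)
  have "?\<phi> ` carrier A = {\<zero>\<^bsub>M\<^esub>} \<or> ?\<phi> ` carrier A = carrier M"
    by (rule irr[OF linear_map_image_submodule[OF mA mM lin]])
       (use m0 M.lmul_mult in auto)
  moreover have "m0 \<in> ?\<phi> ` carrier A"
    using M.lmul_one[OF m0(1)] by (metis A.A.one_closed image_eqI)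
  ultimately have gen: "carrier M \<subseteq> ?\<phi> ` carrier A" using m0(2) by auto
  define j where "j = (\<lambda>m. {a \<in> carrier A. lmul a m0 = m})"
  have inj: "inj_on j (carrier M)" unfolding j_def by (rule fibre_inj_on[OF gen])
  define lmul' where "lmul' = (\<lambda>a x. j (lmul a (inv_into (carrier M) j x)))"
  have r': "lmul' a (j m) = j (lmul a m)" if "m \<in> carrier M" for m a
    using inj that by (simp add: lmul'_def)
  let ?M' = "transport j M"
  have mM': "module K ?M'" by (rule transport_module[OF mM inj])
  have rm': "left_module K ?M' A lmul'"
  proof (intro left_module.intro left_module_axioms.intro mM')
    show "bilinear_map K A ?M' ?M' lmul'" 
      by (rule transport_bilinear_left[OF mM inj bil, where \<beta>' = lmul'])
         (rule r')
  qed (auto simp: transport_simps(1) r' M.lmul_one M.lmul_mult bilinear_map_closed[OF bil])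
  have "irreducible_left_module K A ?M' lmul'"
    unfolding irreducible_left_module_def
  proof (intro conjI allI impI)
    show "carrier ?M' \<noteq> {\<zero>\<^bsub>?M'\<^esub>}"
      using m0 inj M.M.zero_closed by (auto simp: transport_simps(1,2) dest: inj_onD)
  next
    fix N' assume N': "submodule N' K ?M' \<and> (\<forall>n\<in>N'. \<forall>a\<in>carrier A. lmul' a n \<in> N')"
    obtain N where N: "submodule N K M" "N' = j ` N" "N = {m \<in> carrier M. j m \<in> N'}"
      by (rule transport_submodule[OF mM inj conjunct1[OF N']])
    have "N = {\<zero>\<^bsub>M\<^esub>} \<or> N = carrier M"
    proof (rule irr[OF N(1)])
      fix n a assume n: "n \<in> N" and a: "a \<in> carrier A"
      then have "n \<in> carrier M" "j n \<in> N'" using N(3) by auto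
      moreover have "j (lmul a n) \<in> N'" using N' a calculation r' by metis
      ultimately show "lmul a n \<in> N" using a bilinear_map_closed[OF bil] N(3) by blast
    qed
    then show "N' = {\<zero>\<^bsub>?M'\<^esub>} \<or> N' = carrier ?M'"
      by (auto simp: N(2) transport_simps(1,2))
  qed (rule rm')
  moreover have "bij_betw j (carrier M) (carrier ?M')"
    using inj by (simp add: bij_betw_def transport_simps(1))
  ultimately show ?thesis using transport_linear[OF inj] r'
    by (intro exI[of _ ?M'] exI[of _ lmul'] exI[of _ j]) auto
qed

theorem irreducible_right_partial_module_universe:
  fixes H :: "('k, 'h) module" and A :: "('k, 'a) module" and M :: "('k, 'm) module"
  assumes "hopf_algebra K H \<Delta> \<epsilon> S" "partial_module_algebra K A H \<Delta> act"
    "irreducible_right_partial_module K H \<Delta> A act M rmul pact"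
  shows "\<exists>(M' :: ('k, ('a \<times> 'h \<Rightarrow> 'k) set) module) rmul' pact' j.
    irreducible_right_partial_module K H \<Delta> A act M' rmul' pact' \<and>
    bij_betw j (carrier M) (carrier M') \<and> linear_map K M M' j \<and>
    (\<forall>m\<in>carrier M. \<forall>a\<in>carrier A. j (rmul m a) = rmul' (j m) a) \<and>
    (\<forall>m\<in>carrier M. \<forall>h\<in>carrier H. j (pact m h) = pact' (j m) h)"
proof -
  interpret H: hopf_algebra K H \<Delta> \<epsilon> S by fact
  interpret A: partial_module_algebra K A H \<Delta> act by fact
  interpret M: right_partial_module K M A rmul H \<Delta> act pact
    using assms(3) by (simp add: irreducible_right_partial_module_def)
  have mA: "module K A" using A.module_axioms .
  have mM: "module K M" using M.module_axioms .
  have mH: "module K H" using H.module_axioms .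
  have cr: "cring K" using mA by (simp add: module_def)
  note bil = M.rmul_bilinear and pbil = M.pact_bilinear
  note rcl = bilinear_map_closed[OF bil] and pcl = bilinear_map_closed[OF pbil]
    and acl = bilinear_map_closed[OF A.act_bilinear]
  have dcl: "\<Delta> h \<in> carrier (tensor_product K H H)" if "h \<in> carrier H" for h
    using linear_map_closed[OF H.comult_linear that] .
  have irr: "N = {\<zero>\<^bsub>M\<^esub>} \<or> N = carrier M"
    if "submodule N K M" "\<And>n a. n \<in> N \<Longrightarrow> a \<in> carrier A \<Longrightarrow> rmul n a \<in> N"
      "\<And>n h. n \<in> N \<Longrightarrow> h \<in> carrier H \<Longrightarrow> pact n h \<in> N" for N
    using assms(3) that by (auto simp: irreducible_right_partial_module_def)
  have nz: "carrier M \<noteq> {\<zero>\<^bsub>M\<^esub>}" using assms(3) by (simp add: irreducible_right_partial_module_def)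
  then obtain m0 where m0: "m0 \<in> carrier M" "m0 \<noteq> \<zero>\<^bsub>M\<^esub>" using mM module_nonzero_element by metis
  let ?X = "carrier A \<times> carrier H"
  let ?F = "free_module K ?X"
  define \<gamma> where "\<gamma> = (\<lambda>(a, h). pact (rmul m0 a) h)"
  have gcl: "\<gamma> \<in> ?X \<rightarrow> carrier M" using m0 rcl pcl by (auto simp: \<gamma>_def)
  let ?\<phi> = "free_lift K M \<gamma>"
  let ?N = "?\<phi> ` carrier ?F"
  have mF: "module K ?F" by (rule free_module_module[OF cr])
  have lin: "linear_map K ?F M ?\<phi>" by (rule free_lift_linear[OF mM gcl])
  have subN: "submodule ?N K M" by (rule linear_map_image_submodule[OF mF mM lin])
  have gN: "pact (rmul m0 a) h \<in> ?N" if "a \<in> carrier A" "h \<in> carrier H" for a h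
    using free_lift_basis[OF mM gcl, of "(a, h)"] free_basis_closed[OF cr, of "(a, h)" ?X] that
    by (intro image_eqI[of _ _ "free_basis K (a, h)"]) (auto simp: \<gamma>_def)
  have stab: "\<psi> n \<in> ?N"
    if "linear_map K M M \<psi>" "\<And>a h. a \<in> carrier A \<Longrightarrow> h \<in> carrier H \<Longrightarrow> \<psi> (pact (rmul m0 a) h) \<in> ?N"
      "n \<in> ?N" for \<psi> n
  proof -
    from that(3) obtain f where f: "f \<in> carrier ?F" "n = ?\<phi> f" by auto
    have "submodule {m \<in> carrier M. \<psi> m \<in> ?N} K M"
      by (rule linear_map_vimage_submodule[OF mM mM that(1) subN])
    moreover have "\<gamma> \<in> ?X \<rightarrow> {m \<in> carrier M. \<psi> m \<in> ?N}"
      using that(2) m0 rcl pcl by (auto simp: \<gamma>_def)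
    ultimately have "?\<phi> f \<in> {m \<in> carrier M. \<psi> m \<in> ?N}"
      using free_lift_in_image[OF mM _ _ f(1)] by blast
    then show ?thesis using f(2) by simp
  qed
  have key: "pact (rmul (pact (rmul m0 a) h) b) g \<in> ?N"
    if "a \<in> carrier A" "h \<in> carrier H" "b \<in> carrier A" "g \<in> carrier H" for a h b g
  proof -
    have "pact (rmul (rmul m0 a) (act h1 b)) (h2 \<otimes>\<^bsub>H\<^esub> g) \<in> ?N"
      if "h1 \<in> carrier H" "h2 \<in> carrier H" for h1 h2
      using gN[of "a \<otimes>\<^bsub>A\<^esub> act h1 b" "h2 \<otimes>\<^bsub>H\<^esub> g"] that \<open>a \<in> _\<close> \<open>b \<in> _\<close> \<open>g \<in> _\<close> acl m0
      by (simp add: M.rmul_mult)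
    then have "tensor_lift K M (\<lambda>h1 h2. pact (rmul (rmul m0 a) (act h1 b)) (h2 \<otimes>\<^bsub>H\<^esub> g)) (\<Delta> h) \<in> ?N"
      by (intro tensor_lift_in_submodule[OF mH mH mM subN dcl]) (use that in auto)
    then show ?thesis using M.pact_rmul_pact[of "rmul m0 a" b h g] that rcl m0 by simp
  qed
  have "?N = {\<zero>\<^bsub>M\<^esub>} \<or> ?N = carrier M"
  proof (rule irr[OF subN])
    fix n a assume n: "n \<in> ?N" and a: "a \<in> carrier A"
    show "rmul n a \<in> ?N"
    proof (rule stab[OF _ _ n])
      show "linear_map K M M (\<lambda>n. rmul n a)" using bil a by (auto simp: bilinear_map_def)
      fix b h assume b: "b \<in> carrier A" and h: "h \<in> carrier H"
      have "rmul (pact (rmul m0 b) h) a \<in> carrier M" using a b h m0 rcl pcl by simp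
      then show "rmul (pact (rmul m0 b) h) a \<in> ?N"
        using key[OF b h a H.A.one_closed] by (simp add: M.pact_one)
    qed
  next
    fix n g assume n: "n \<in> ?N" and g: "g \<in> carrier H"
    show "pact n g \<in> ?N"
    proof (rule stab[OF _ _ n])
      show "linear_map K M M (\<lambda>n. pact n g)" using pbil g by (auto simp: bilinear_map_def)
      fix b h assume b: "b \<in> carrier A" and h: "h \<in> carrier H"
      have "pact (rmul m0 b) h \<in> carrier M" using b h m0 rcl pcl by simp
      then show "pact (pact (rmul m0 b) h) g \<in> ?N"
        using key[OF b h A.A.one_closed g] by (simp add: M.rmul_one)
    qed
  qed
  moreover have "m0 \<in> ?N"
    using gN[OF A.A.one_closed H.A.one_closed] m0 by (simp add: M.rmul_one M.pact_one)
  ultimately have gen: "carrier M \<subseteq> ?N" using m0(2) by auto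
  define j where "j = (\<lambda>m. {f \<in> carrier ?F. ?\<phi> f = m})"
  have inj: "inj_on j (carrier M)" unfolding j_def by (rule fibre_inj_on[OF gen])
  define rmul' where "rmul' = (\<lambda>x a. j (rmul (inv_into (carrier M) j x) a))"
  define pact' where "pact' = (\<lambda>x h. j (pact (inv_into (carrier M) j x) h))"
  have r': "rmul' (j m) a = j (rmul m a)" if "m \<in> carrier M" for m a
    using inj that by (simp add: rmul'_def)
  have p': "pact' (j m) h = j (pact m h)" if "m \<in> carrier M" for m h
    using inj that by (simp add: pact'_def)
  let ?M' = "transport j M"
  have mM': "module K ?M'" by (rule transport_module[OF mM inj])
  have rm': "right_partial_module K ?M' A rmul' H \<Delta> act pact'"
  proof (intro right_partial_module.intro right_partial_module_axioms.intro
      right_module.intro right_module_axioms.intro mM')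
    show "bilinear_map K ?M' A ?M' rmul'" 
      by (rule transport_bilinear[OF mM inj bil, where \<beta>' = rmul'])
         (rule r')
    show "bilinear_map K ?M' H ?M' pact'" 
      by (rule transport_bilinear[OF mM inj pbil, where \<beta>' = pact'])
         (rule p')
  next
    fix x a h g assume x: "x \<in> carrier ?M'" and a: "a \<in> carrier A"
      and h: "h \<in> carrier H" and g: "g \<in> carrier H"
    then obtain m where m: "m \<in> carrier M" "x = j m" by (auto simp: transport_simps(1))
    have "pact' (rmul' (pact' x h) a) g = j (pact (rmul (pact m h) a) g)"
      using m a h g rcl pcl by (simp add: r' p')
    also have "\<dots> = j (tensor_lift K M (\<lambda>h1 h2. pact (rmul m (act h1 a)) (h2 \<otimes>\<^bsub>H\<^esub> g)) (\<Delta> h))"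
      by (simp add: M.pact_rmul_pact[OF m(1) a h g])
    also have "\<dots> = tensor_lift K ?M' (\<lambda>h1 h2. pact' (rmul' x (act h1 a)) (h2 \<otimes>\<^bsub>H\<^esub> g)) (\<Delta> h)"
      by (rule tensor_lift_comp[OF mH mH mM mM' transport_linear[OF inj] dcl[OF h], symmetric])
         (use m a g rcl pcl acl in \<open>simp_all add: r' p'\<close>)
    finally show "pact' (rmul' (pact' x h) a) g =
      tensor_lift K ?M' (\<lambda>h1 h2. pact' (rmul' x (act h1 a)) (h2 \<otimes>\<^bsub>H\<^esub> g)) (\<Delta> h)" .
  qed (auto simp: transport_simps(1) r' p' M.rmul_one M.rmul_mult M.pact_one rcl)
  have "irreducible_right_partial_module K H \<Delta> A act ?M' rmul' pact'"
    unfolding irreducible_right_partial_module_def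
  proof (intro conjI allI impI)
    show "carrier ?M' \<noteq> {\<zero>\<^bsub>?M'\<^esub>}"
      using m0 inj M.M.zero_closed by (auto simp: transport_simps(1,2) dest: inj_onD)
  next
    fix N' assume N': "submodule N' K ?M' \<and> (\<forall>n\<in>N'. \<forall>a\<in>carrier A. rmul' n a \<in> N') \<and>
      (\<forall>n\<in>N'. \<forall>h\<in>carrier H. pact' n h \<in> N')"
    obtain N where N: "submodule N K M" "N' = j ` N" "N = {m \<in> carrier M. j m \<in> N'}"
      by (rule transport_submodule[OF mM inj conjunct1[OF N']])
    have "N = {\<zero>\<^bsub>M\<^esub>} \<or> N = carrier M"
    proof (rule irr[OF N(1)])
      fix n a assume n: "n \<in> N" and a: "a \<in> carrier A"
      then have "n \<in> carrier M" "j n \<in> N'" using N(3) by auto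
      moreover have "j (rmul n a) \<in> N'" using N' a calculation r' by metis
      ultimately show "rmul n a \<in> N" using a rcl N(3) by blast
    next
      fix n h assume n: "n \<in> N" and h: "h \<in> carrier H"
      then have "n \<in> carrier M" "j n \<in> N'" using N(3) by auto
      moreover have "j (pact n h) \<in> N'" using N' h calculation p' by metis
      ultimately show "pact n h \<in> N" using h pcl N(3) by blast
    qed
    then show "N' = {\<zero>\<^bsub>?M'\<^esub>} \<or> N' = carrier ?M'"
      by (auto simp: N(2) transport_simps(1,2))
  qed (rule rm')
  moreover have "bij_betw j (carrier M) (carrier ?M')"
    using inj by (simp add: bij_betw_def transport_simps(1))
  ultimately show ?thesis using transport_linear[OF inj] r' p'
    by (intro exI[of _ ?M'] exI[of _ rmul'] exI[of _ pact'] exI[of _ j]) auto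
qed

end

theory Submission
  imports Defs
begin

text \<open>
  The argument avoids globalization and works with finite-dimensional left partial modules \<open>X\<close> and the
  partial modules \<open>Hom(H, X)\<close>. For a set \<open>L\<close> of elements of \<open>A # H\<close> let \<open>d(X)\<close> be the dimension of the space
  of those \<open>\<phi>\<close> in \<open>Hom(H, X)\<close> that \<open>L\<close> annihilates. Twisting by the antipode gives
  \<open>d(Hom(H, X)) \<ge> dim H \<cdot> d(X)\<close>, while \<open>d\<close> is subadditive along filtrations. If \<open>X\<close> maximizes \<open>d(X) / dim X\<close>
  among the irreducible modules with a given annihilator, then \<open>Hom(H, X)\<close> attains equality throughout, and
  evaluation at an integral of \<open>H\<close> turns equality into a splitting: if \<open>L w \<subseteq> U\<close> for a stable subspace \<open>U\<close>,
  then \<open>w = y + u\<close> with \<open>L y = 0\<close> and \<open>u \<in> U\<close>. For the set \<open>J\<close> of all elements that annihilate every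
  finite-dimensional irreducible partial module this yields \<open>J Hom(H, X) = 0\<close>, so that the coefficients in \<open>A\<close>
  of an element of \<open>J\<close> lie in the intersection \<open>I\<close> of the annihilators of these modules.

  Coinducing finite-dimensional \<open>A\<close>-modules to partial modules shows that \<open>1 - i\<close> is invertible for \<open>i\<close> in \<open>I\<close>.
  As the partial smash product is finitely generated over \<open>A\<close>, a Nakayama argument shows that \<open>I\<close> annihilates
  every irreducible right partial module, whence \<open>I = 0\<close>. Finally \<open>J\<close> contains the Jacobson radical.
\<close>

section \<open>Dimension of subspaces\<close>

text \<open>The reason for aiming at \<open>J Hom(H, X) = 0\<close> is
  \<open>slice_annihilates\<close>: an element of the partial smash product that kills
  \<open>Hom(H, X)\<close>, and not merely \<open>X\<close>, has all its coefficients in the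
  annihilator of \<open>X\<close>. The obstacle is that \<open>Hom(H, X)\<close> is not known to be
  completely reducible, so \<open>J\<close> may act on it nontrivially although it kills every
  simple factor. The ratio \<open>d(X) / dim X\<close> replaces complete reducibility: the twist
  keeps it from dropping under \<open>Hom(H, -)\<close>, and subadditivity keeps it from exceeding
  the maximum over the simple factors. A maximum exists because irreducible modules whose
  annihilators contain a fixed ideal of finite codimension have bounded dimension. To control
  \<open>Hom(H, X)\<close>, the class over which the maximum is taken must contain the simple
  factors of \<open>Hom(H, X)\<close>; that these have the same annihilator as \<open>X\<close> is
  itself proved by a ratio argument, with \<open>L\<close> the annihilator of a vector.
  Semisimplicity of \<open>H\<close> enters through an integral \<open>\<Lambda>\<close> with
  \<open>\<epsilon> \<Lambda> = 1\<close>, which makes \<open>H\<close> finite-dimensional and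
  splits the embedding of \<open>X\<close> into \<open>Hom(H, X)\<close>.\<close>

locale vector_space = K: field K + module K V for K :: "'k ring" and V :: "('k, 'v) module" (structure)
begin

lemma subspaceD:
  assumes "submodule U K V"
  shows "U \<subseteq> carrier V" "\<And>x. x \<in> U \<Longrightarrow> x \<in> carrier V" "\<zero> \<in> U"
    "\<And>x y. x \<in> U \<Longrightarrow> y \<in> U \<Longrightarrow> x \<oplus> y \<in> U"
    "\<And>x. x \<in> U \<Longrightarrow> \<ominus> x \<in> U"
    "\<And>x y. x \<in> U \<Longrightarrow> y \<in> U \<Longrightarrow> x \<ominus> y \<in> U"
    "\<And>c x. c \<in> carrier K \<Longrightarrow> x \<in> U \<Longrightarrow> c \<odot> x \<in> U"
proof -
  note E = submoduleE[OF assms]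
  show "U \<subseteq> carrier V" "\<And>x. x \<in> U \<Longrightarrow> x \<in> carrier V" using E(1) by auto
  show "\<And>x y. x \<in> U \<Longrightarrow> y \<in> U \<Longrightarrow> x \<oplus> y \<in> U" using E(5) .
  show n: "\<And>x. x \<in> U \<Longrightarrow> \<ominus> x \<in> U" using E(3) .
  show "\<And>x y. x \<in> U \<Longrightarrow> y \<in> U \<Longrightarrow> x \<ominus> y \<in> U" using E(5) n by (simp add: M.minus_eq)
  show "\<And>c x. c \<in> carrier K \<Longrightarrow> x \<in> U \<Longrightarrow> c \<odot> x \<in> U" using E(4) .
  obtain x where x: "x \<in> U" using E(2) by auto
  then have "x \<oplus> \<ominus> x \<in> U" using E(5) n by blast
  then show "\<zero> \<in> U" using x E(1) by (auto simp: M.r_neg)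
qed

lemma subspaceI:
  assumes "U \<subseteq> carrier V" "\<zero> \<in> U" "\<And>x y. x \<in> U \<Longrightarrow> y \<in> U \<Longrightarrow> x \<oplus> y \<in> U"
    "\<And>c x. c \<in> carrier K \<Longrightarrow> x \<in> U \<Longrightarrow> c \<odot> x \<in> U"
  shows "submodule U K V"
proof (rule submoduleI[OF assms(1,2) _ assms(3,4)])
  fix x assume x: "x \<in> U"
  have "(\<ominus>\<^bsub>K\<^esub> \<one>\<^bsub>K\<^esub>) \<odot> x \<in> U" using x by (intro assms(4)) auto
  then show "\<ominus> x \<in> U" using x assms(1) by (auto simp: smult_l_minus)
qed

lemma subspace_Int:
  assumes "submodule X K V" "submodule Y K V"
  shows "submodule (X \<inter> Y) K V"
  by (rule subspaceI) (use subspaceD(1,3,4,7)[OF assms(1)] subspaceD(1,3,4,7)[OF assms(2)] in auto)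

lemma add_minus_cancel:
  assumes "x \<in> carrier V" "y \<in> carrier V"
  shows "(x \<oplus> y) \<ominus> x = y" "(x \<oplus> y) \<ominus> y = x" "(x \<ominus> y) \<oplus> y = x"
proof -
  show r: "(x \<oplus> y) \<ominus> y = x" using assms by (simp add: M.minus_eq M.a_assoc M.r_neg)
  show "(x \<oplus> y) \<ominus> x = y" using assms
    by (subst M.a_comm[OF assms]) (simp add: M.minus_eq M.a_assoc M.r_neg)
  show "(x \<ominus> y) \<oplus> y = x" using assms by (simp add: M.minus_eq M.a_assoc M.l_neg)
qed

lemma minus_add_minus:
  assumes "x \<in> carrier V" "y \<in> carrier V" "z \<in> carrier V"
  shows "(z \<ominus> x) \<oplus> (x \<ominus> y) = z \<ominus> y"
    and "(z \<ominus> y) \<ominus> (z \<ominus> x) = x \<ominus> y"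
    and "(z \<ominus> y) \<ominus> (x \<ominus> y) = z \<ominus> x"
proof -
  show *: "(z \<ominus> x) \<oplus> (x \<ominus> y) = z \<ominus> y"
    using assms by (simp add: M.minus_eq M.a_assoc M.r_neg1)
  show "(z \<ominus> y) \<ominus> (z \<ominus> x) = x \<ominus> y"
    "(z \<ominus> y) \<ominus> (x \<ominus> y) = z \<ominus> x"
    using assms unfolding *[symmetric] by (simp_all add: add_minus_cancel)
qed

lemma minus_eq_zero_iff:
  assumes "x \<in> carrier V" "y \<in> carrier V"
  shows "x \<ominus> y = \<zero> \<longleftrightarrow> x = y"
  using add_minus_cancel(3)[OF assms] assms by (auto simp: M.minus_eq M.r_neg)

lemma set_addI: "x \<in> X \<Longrightarrow> y \<in> Y \<Longrightarrow> x \<oplus> y \<in> X <+>\<^bsub>V\<^esub> Y"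
  unfolding set_add_def' by blast

lemma subspace_sum:
  assumes "submodule X K V" "submodule Y K V"
  shows "submodule (X <+>\<^bsub>V\<^esub> Y) K V" "X \<subseteq> X <+>\<^bsub>V\<^esub> Y" "Y \<subseteq> X <+>\<^bsub>V\<^esub> Y"
proof -
  note X = subspaceD[OF assms(1)] and Y = subspaceD[OF assms(2)]
  show "X \<subseteq> X <+>\<^bsub>V\<^esub> Y"
  proof
    fix x assume x: "x \<in> X"
    then have "x = x \<oplus> \<zero>" using X(2) by simp
    then show "x \<in> X <+>\<^bsub>V\<^esub> Y" using x Y(3) unfolding set_add_def' by blast
  qed
  show "Y \<subseteq> X <+>\<^bsub>V\<^esub> Y"
  proof
    fix x assume x: "x \<in> Y"
    then have "x = \<zero> \<oplus> x" using Y(2) by simp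
    then show "x \<in> X <+>\<^bsub>V\<^esub> Y" using x X(3) unfolding set_add_def' by blast
  qed
  show "submodule (X <+>\<^bsub>V\<^esub> Y) K V"
  proof (rule subspaceI)
    show "X <+>\<^bsub>V\<^esub> Y \<subseteq> carrier V" using X(2) Y(2) by (auto simp: set_add_def')
    show "\<zero> \<in> X <+>\<^bsub>V\<^esub> Y" using X(3) \<open>X \<subseteq> X <+>\<^bsub>V\<^esub> Y\<close> by auto
  next
    fix a b assume "a \<in> X <+>\<^bsub>V\<^esub> Y" "b \<in> X <+>\<^bsub>V\<^esub> Y"
    then obtain x y x' y' where *: "x \<in> X" "y \<in> Y" "a = x \<oplus> y" "x' \<in> X" "y' \<in> Y" "b = x' \<oplus> y'"
      by (auto simp: set_add_def')
    then have "a \<oplus> b = (x \<oplus> x') \<oplus> (y \<oplus> y')" using X(2) Y(2) by (simp add: M.a_ac)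
    then show "a \<oplus> b \<in> X <+>\<^bsub>V\<^esub> Y" using set_addI[OF X(4)[OF *(1,4)] Y(4)[OF *(2,5)]] by simp
  next
    fix c a assume c: "c \<in> carrier K" and "a \<in> X <+>\<^bsub>V\<^esub> Y"
    then obtain x y where *: "x \<in> X" "y \<in> Y" "a = x \<oplus> y" by (auto simp: set_add_def')
    then have "c \<odot> a = c \<odot> x \<oplus> c \<odot> y" using c X(2) Y(2) by (simp add: smult_r_distr)
    then show "c \<odot> a \<in> X <+>\<^bsub>V\<^esub> Y" using set_addI[OF X(7)[OF c *(1)] Y(7)[OF c *(2)]] by simp
  qed
qed

lemma subspace_sum_least:
  assumes "submodule Z K V" "X \<subseteq> Z" "Y \<subseteq> Z"
  shows "X <+>\<^bsub>V\<^esub> Y \<subseteq> Z"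
  using subspaceD(4)[OF assms(1)] assms(2,3) by (auto simp: set_add_def')

definition adjoin :: "'v set \<Rightarrow> 'v \<Rightarrow> 'v set"
  where "adjoin U v = {u \<oplus> c \<odot> v | u c. u \<in> U \<and> c \<in> carrier K}"

lemma adjoinI: "u \<in> U \<Longrightarrow> c \<in> carrier K \<Longrightarrow> u \<oplus> c \<odot> v \<in> adjoin U v"
  unfolding adjoin_def by blast

lemma adjoin_mem:
  assumes "submodule U K V" "v \<in> carrier V"
  shows "U \<subseteq> adjoin U v" "v \<in> adjoin U v"
proof -
  note U = subspaceD[OF assms(1)]
  show "U \<subseteq> adjoin U v"
  proof
    fix u assume u: "u \<in> U"
    then have "u = u \<oplus> \<zero>\<^bsub>K\<^esub> \<odot> v" using U(2) assms(2) by simp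
    then show "u \<in> adjoin U v" using adjoinI[OF u, of "\<zero>\<^bsub>K\<^esub>" v] by simp
  qed
  have "v = \<zero> \<oplus> \<one>\<^bsub>K\<^esub> \<odot> v" using assms(2) by simp
  then show "v \<in> adjoin U v" using adjoinI[OF U(3), of "\<one>\<^bsub>K\<^esub>" v] by simp
qed

lemma adjoin_subspace:
  assumes "submodule U K V" "v \<in> carrier V"
  shows "submodule (adjoin U v) K V"
proof -
  note U = subspaceD[OF assms(1)]
  show ?thesis
  proof (rule subspaceI)
    show "adjoin U v \<subseteq> carrier V" using U(2) assms(2) by (auto simp: adjoin_def)
    show "\<zero> \<in> adjoin U v" using U(3) adjoin_mem[OF assms] by auto
  next
    fix x y assume "x \<in> adjoin U v" "y \<in> adjoin U v"
    then obtain u c u' c' where *: "u \<in> U" "c \<in> carrier K" "x = u \<oplus> c \<odot> v"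
      "u' \<in> U" "c' \<in> carrier K" "y = u' \<oplus> c' \<odot> v" by (auto simp: adjoin_def)
    then have "x \<oplus> y = (u \<oplus> u') \<oplus> (c \<oplus>\<^bsub>K\<^esub> c') \<odot> v"
      using U(2) assms(2) by (simp add: smult_l_distr M.a_ac)
    then show "x \<oplus> y \<in> adjoin U v" using adjoinI[OF U(4)[OF *(1,4)], of "c \<oplus>\<^bsub>K\<^esub> c'" v] *(2,5) by simp
  next
    fix d x assume d: "d \<in> carrier K" and "x \<in> adjoin U v"
    then obtain u c where *: "u \<in> U" "c \<in> carrier K" "x = u \<oplus> c \<odot> v" by (auto simp: adjoin_def)
    then have "d \<odot> x = d \<odot> u \<oplus> (d \<otimes>\<^bsub>K\<^esub> c) \<odot> v"
      using U(2) d assms(2) by (simp add: smult_r_distr smult_assoc1)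
    then show "d \<odot> x \<in> adjoin U v" using adjoinI[OF U(7)[OF d *(1)], of "d \<otimes>\<^bsub>K\<^esub> c" v] d *(2) by simp
  qed
qed

lemma adjoin_least:
  assumes "submodule X K V" "U \<subseteq> X" "v \<in> X"
  shows "adjoin U v \<subseteq> X"
  using subspaceD(4,7)[OF assms(1)] assms(2,3) by (auto simp: adjoin_def)

text \<open>Exchange of a single vector: \<open>x\<close> outside \<open>U\<close> has a nonzero
  coefficient at \<open>v\<close>, and dividing by it expresses \<open>v\<close> through
  \<open>U\<close> and \<open>x\<close>.\<close>

lemma adjoin_exchange:
  assumes "submodule U K V" "v \<in> carrier V" "x \<in> adjoin U v" "x \<notin> U"
  shows "adjoin U x = adjoin U v"
proof -
  note U = subspaceD[OF assms(1)] and A = subspaceD[OF adjoin_subspace[OF assms(1,2)]]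
  have x: "x \<in> carrier V" using A(1) assms(3) by auto
  obtain u c where uc: "u \<in> U" "c \<in> carrier K" "x = u \<oplus> c \<odot> v"
    using assms(3) by (auto simp: adjoin_def)
  then have c: "c \<noteq> \<zero>\<^bsub>K\<^esub>" using assms(2,4) U(2) by auto
  then have i: "inv\<^bsub>K\<^esub> c \<in> carrier K" "inv\<^bsub>K\<^esub> c \<otimes>\<^bsub>K\<^esub> c = \<one>\<^bsub>K\<^esub>" using uc(2) K.field_Units by auto
  have "x \<ominus> u = c \<odot> v"
    using uc(2) assms(2) U(2)[OF uc(1)] unfolding uc(3) by (simp add: add_minus_cancel)
  then have "v = inv\<^bsub>K\<^esub> c \<odot> (x \<ominus> u)"
    using i uc(2) assms(2) by (simp flip: smult_assoc1)
  moreover have "inv\<^bsub>K\<^esub> c \<odot> (x \<ominus> u) \<in> adjoin U x"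
    by (intro subspaceD(6,7)[OF adjoin_subspace[OF assms(1) x]] i(1))
       (use adjoin_mem[OF assms(1) x] uc(1) in auto)
  ultimately have "v \<in> adjoin U x" by simp
  then show ?thesis
    using adjoin_least[OF adjoin_subspace[OF assms(1) x] adjoin_mem(1)[OF assms(1) x], of v]
      adjoin_least[OF adjoin_subspace[OF assms(1,2)] adjoin_mem(1)[OF assms(1,2)] assms(3)] by blast
qed

text \<open>\<open>X\<close> modulo \<open>X \<inter> U\<close> embeds into the line
  \<open>adjoin U v\<close> modulo \<open>U\<close>, so any one vector of \<open>X\<close> outside
  \<open>U\<close> spans it.\<close>

lemma adjoin_meet:
  assumes "submodule U K V" "v \<in> carrier V" "submodule X K V" "X \<subseteq> adjoin U v" "x \<in> X" "x \<notin> U"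
  shows "X = adjoin (X \<inter> U) x"
proof
  note U = subspaceD[OF assms(1)] and X = subspaceD[OF assms(3)]
  have e: "adjoin U x = adjoin U v" using adjoin_exchange[OF assms(1,2)] assms(4,5,6) by auto
  show "adjoin (X \<inter> U) x \<subseteq> X" by (rule adjoin_least[OF assms(3)]) (use assms(5) in auto)
  show "X \<subseteq> adjoin (X \<inter> U) x"
  proof
    fix y assume y: "y \<in> X"
    then have "y \<in> adjoin U x" using assms(4) e by auto
    then obtain u c where uc: "u \<in> U" "c \<in> carrier K" "y = u \<oplus> c \<odot> x"
      by (auto simp: adjoin_def)
    then have "u = y \<ominus> c \<odot> x" using X(2)[OF assms(5)] U(2)[OF uc(1)] by (simp add: add_minus_cancel)
    also have "\<dots> \<in> X" by (rule X(6)[OF y X(7)[OF uc(2) assms(5)]])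
    finally show "y \<in> adjoin (X \<inter> U) x" using uc adjoinI[of u "X \<inter> U" c x] by simp
  qed
qed

text \<open>A complete flag that grows by one vector per step. Taking its length as the dimension
  avoids linearly independent families: dimension counts become inductions in which one vector is
  added.\<close>

inductive flag :: "nat \<Rightarrow> 'v set \<Rightarrow> bool" where
  flag_zero: "flag 0 {\<zero>}"
| flag_step: "flag m U \<Longrightarrow> v \<in> carrier V \<Longrightarrow> v \<notin> U \<Longrightarrow> flag (Suc m) (adjoin U v)"

lemma flag_subspace: "flag m U \<Longrightarrow> submodule U K V"
proof (induction rule: flag.induct)
  case flag_zero
  show ?case by (rule subspaceI) auto
qed (rule adjoin_subspace)

text \<open>Intersecting a flag with \<open>X\<close> turns each step into a step or into an
  equality, by \<open>adjoin_meet\<close>. The clause for \<open>k = m\<close> records that no step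
  was lost; it later gives equality of nested subspaces of equal dimension.\<close>

lemma flag_mono:
  assumes "flag m U" "submodule X K V" "X \<subseteq> U"
  shows "\<exists>k\<le>m. flag k X \<and> (k = m \<longrightarrow> X = U)"
  using assms
proof (induction arbitrary: X rule: flag.induct)
  case flag_zero
  then have "X = {\<zero>}" using subspaceD(3) by blast
  then show ?case using flag.flag_zero by blast
next
  case (flag_step m U v)
  note U = flag_subspace[OF flag_step.hyps(1)]
  show ?case
  proof (cases "X \<subseteq> U")
    case True
    then obtain k where "k \<le> m" "flag k X" using flag_step.IH[OF flag_step.prems(1)] by blast
    then show ?thesis by (intro exI[of _ k]) auto
  next
    case False
    then obtain x where x: "x \<in> X" "x \<notin> U" by auto
    have Xe: "X = adjoin (X \<inter> U) x"
      by (rule adjoin_meet[OF U flag_step.hyps(2) flag_step.prems x])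
    obtain k where k: "k \<le> m" "flag k (X \<inter> U)" "k = m \<longrightarrow> X \<inter> U = U"
      using flag_step.IH[OF subspace_Int[OF flag_step.prems(1) U]] by auto
    have "flag (Suc k) X"
      by (subst Xe, rule flag.flag_step[OF k(2)]) (use x subspaceD(2)[OF flag_step.prems(1)] in auto)
    moreover have "X = adjoin U v" if "k = m"
    proof -
      have "X \<inter> U = U" using k(3) that by simp
      then show ?thesis using Xe adjoin_exchange[OF U flag_step.hyps(2), of x] x flag_step.prems(2) by auto
    qed
    ultimately show ?thesis using k(1) by (intro exI[of _ "Suc k"]) auto
  qed
qed

text \<open>The argument of Jordan and Hoelder: two different last hyperplanes \<open>U1\<close> and
  \<open>U2\<close> both extend \<open>U1 \<inter> U2\<close> by one vector, so a flag of length
  \<open>j\<close> of the intersection gives both of them flags of length \<open>Suc j\<close>, and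
  the induction hypothesis compares these with the given flags.\<close>

lemma flag_unique: "flag m U \<Longrightarrow> flag k U \<Longrightarrow> m = k"
proof (induction m arbitrary: U k)
  case 0
  then have U: "U = {\<zero>}" by (cases rule: flag.cases) auto
  from 0(2) show ?case
  proof (cases rule: flag.cases)
    case (flag_step m' U' v)
    have "v \<in> U" using adjoin_mem[OF flag_subspace[OF flag_step(3)] flag_step(4)] flag_step(2) by auto
    moreover have "\<zero> \<in> U'" using subspaceD[OF flag_subspace[OF flag_step(3)]] by auto
    ultimately show ?thesis using flag_step(5) U by auto
  qed auto
next
  case (Suc m)
  from Suc(2) obtain U1 v1 where 1: "U = adjoin U1 v1" "flag m U1" "v1 \<in> carrier V" "v1 \<notin> U1"
    by (cases rule: flag.cases) auto
  note s1 = flag_subspace[OF 1(2)]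
  from Suc(3) show ?case
  proof (cases rule: flag.cases)
    case flag_zero
    then have "U1 \<subseteq> {\<zero>}" "v1 = \<zero>" using 1 adjoin_mem[OF s1 1(3)] by auto
    then show ?thesis using subspaceD(3)[OF s1] 1(4) by auto
  next
    case (flag_step k' U2 v2)
    note s2 = flag_subspace[OF flag_step(3)]
    show ?thesis
    proof (cases "U1 \<subseteq> U2")
      case True
      have "U2 \<subseteq> U1"
      proof (rule ccontr)
        assume "\<not> U2 \<subseteq> U1"
        then obtain x where x: "x \<in> U2" "x \<notin> U1" by auto
        then have "adjoin U1 x = U" using adjoin_exchange[OF s1 1(3), of x]
          adjoin_mem[OF s2 flag_step(4)] flag_step(2) 1(1) by auto
        then have "U \<subseteq> U2" using adjoin_least[OF s2 True x(1)] by simp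
        then show False using adjoin_mem[OF s2 flag_step(4)] flag_step by auto
      qed
      then have "U1 = U2" using True by simp
      then show ?thesis using Suc.IH[OF 1(2)] flag_step by auto
    next
      case False
      then obtain x1 where x1: "x1 \<in> U1" "x1 \<notin> U2" by auto
      have "\<not> U2 \<subseteq> U1"
      proof
        assume a: "U2 \<subseteq> U1"
        have "adjoin U2 x1 = U" using adjoin_exchange[OF s2 flag_step(4), of x1]
          adjoin_mem[OF s1 1(3)] flag_step(2) 1(1) x1 by auto
        then have "U \<subseteq> U1" using adjoin_least[OF s1 a x1(1)] by simp
        then show False using adjoin_mem[OF s1 1(3)] 1 by auto
      qed
      then obtain x2 where x2: "x2 \<in> U2" "x2 \<notin> U1" by auto
      have e1: "U1 = adjoin (U1 \<inter> U2) x1"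
        by (rule adjoin_meet[OF s2 flag_step(4) s1 _ x1]) (use 1 flag_step adjoin_mem[OF s1 1(3)] in auto)
      have e2: "U2 = adjoin (U1 \<inter> U2) x2"
        using adjoin_meet[OF s1 1(3) s2 _ x2] 1 flag_step adjoin_mem[OF s2 flag_step(4)] by (auto simp: Int_commute)
      obtain j where j: "flag j (U1 \<inter> U2)" using flag_mono[OF 1(2) subspace_Int[OF s1 s2]] by auto
      have f1: "flag (Suc j) U1"
        by (subst e1, rule flag.flag_step[OF j]) (use x1 subspaceD[OF s1] in auto)
      have f2: "flag (Suc j) U2"
        by (subst e2, rule flag.flag_step[OF j]) (use x2 subspaceD[OF s2] in auto)
      have "m = Suc j" using Suc.IH[OF 1(2) f1] .
      then have "m = k'" using Suc.IH[of U2 k'] f2 flag_step by auto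
      then show ?thesis using flag_step by simp
    qed
  qed
qed

definition fin_subspace :: "'v set \<Rightarrow> bool"
  where "fin_subspace U \<longleftrightarrow> (\<exists>m. flag m U)"

definition vdim :: "'v set \<Rightarrow> nat"
  where "vdim U = (THE m. flag m U)"

lemma vdim_flag: "fin_subspace U \<Longrightarrow> flag (vdim U) U"
  unfolding fin_subspace_def vdim_def by (metis flag_unique theI)

lemma flag_vdim: "flag m U \<Longrightarrow> fin_subspace U \<and> vdim U = m"
  using vdim_flag[of U] flag_unique fin_subspace_def by blast

lemma fin_subspace_subspace: "fin_subspace U \<Longrightarrow> submodule U K V"
  using vdim_flag flag_subspace by blast

lemma vdim_mono:
  assumes "fin_subspace U" "submodule X K V" "X \<subseteq> U"
  shows "fin_subspace X" "vdim X \<le> vdim U" "vdim X = vdim U \<Longrightarrow> X = U"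
  using flag_mono[OF vdim_flag[OF assms(1)] assms(2,3)] flag_vdim by blast+

lemma vdim_zero: "fin_subspace {\<zero>}" "vdim {\<zero>} = 0"
  using flag_vdim[OF flag_zero] by auto

lemma vdim_eq_0: "fin_subspace U \<Longrightarrow> vdim U = 0 \<longleftrightarrow> U = {\<zero>}"
  using vdim_flag[of U] vdim_zero by (auto elim: flag.cases)

lemma vdim_adjoin:
  assumes "fin_subspace U" "v \<in> carrier V" "v \<notin> U"
  shows "fin_subspace (adjoin U v)" "vdim (adjoin U v) = Suc (vdim U)"
  using flag_vdim[OF flag_step[OF vdim_flag[OF assms(1)] assms(2,3)]] by auto

lemma fin_subspace_adjoin:
  assumes "fin_subspace U" "v \<in> carrier V"
  shows "fin_subspace (adjoin U v)"
proof (cases "v \<in> U")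
  case True
  have "adjoin U v = U"
    using adjoin_least[OF fin_subspace_subspace[OF assms(1)] _ True]
      adjoin_mem[OF fin_subspace_subspace[OF assms(1)] assms(2)] by auto
  then show ?thesis using assms by simp
qed (use vdim_adjoin assms in auto)

lemma fin_subspace_induct [consumes 1, case_names zero adjoin]:
  assumes "fin_subspace U" "P {\<zero>}"
    "\<And>U v. fin_subspace U \<Longrightarrow> v \<in> carrier V \<Longrightarrow> v \<notin> U \<Longrightarrow> P U \<Longrightarrow> P (adjoin U v)"
  shows "P U"
  using vdim_flag[OF assms(1)]
proof (induction rule: flag.induct)
  case (flag_step m U v)
  then show ?case using assms(3) flag_vdim by blast
qed (rule assms(2))

lemma fin_subspace_cover:
  assumes "finite B" "B \<subseteq> carrier V"
  shows "\<exists>U. fin_subspace U \<and> B \<subseteq> U"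
  using assms
proof (induction rule: finite_induct)
  case empty
  then show ?case using vdim_zero by blast
next
  case (insert x F)
  then obtain U where U: "fin_subspace U" "F \<subseteq> U" by auto
  show ?case
    using fin_subspace_adjoin[OF U(1), of x] adjoin_mem[OF fin_subspace_subspace[OF U(1)], of x] U insert
    by (intro exI[of _ "adjoin U x"]) auto
qed

lemma finite_dimensional_fin_subspace: "finite_dimensional K V \<Longrightarrow> fin_subspace (carrier V)"
  unfolding finite_dimensional_def
  using fin_subspace_cover submodule_span_least fin_subspace_subspace subspaceD(1)
  by (metis subset_antisym)

text \<open>Induction on \<open>Y\<close> alone. When a vector \<open>y\<close> is added, exactly
  one of the sum and the intersection grows, according to whether \<open>y\<close> already lies in
  the sum of \<open>X\<close> and the old \<open>Y\<close>.\<close>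

lemma vdim_sum:
  assumes "fin_subspace Y" "fin_subspace X"
  shows "fin_subspace (X <+>\<^bsub>V\<^esub> Y)" "vdim (X <+>\<^bsub>V\<^esub> Y) + vdim (X \<inter> Y) = vdim X + vdim Y"
proof -
  note X = fin_subspace_subspace[OF assms(2)]
  have "fin_subspace (X <+>\<^bsub>V\<^esub> Y) \<and> vdim (X <+>\<^bsub>V\<^esub> Y) + vdim (X \<inter> Y) = vdim X + vdim Y"
    using assms(1)
  proof (induction rule: fin_subspace_induct)
    case zero
    have "X <+>\<^bsub>V\<^esub> {\<zero>} = X" "X \<inter> {\<zero>} = {\<zero>}" using subspaceD[OF X] by (auto simp: set_add_def')
    then show ?case using assms(2) vdim_zero by simp
  next
    case (adjoin Y y)
    note Y = fin_subspace_subspace[OF adjoin(1)]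
    note S = subspace_sum[OF X Y] and Y' = adjoin_subspace[OF Y adjoin(2)]
    note m = adjoin_mem[OF Y adjoin(2)] and S' = subspace_sum[OF X Y']
    have sum: "X <+>\<^bsub>V\<^esub> adjoin Y y = adjoin (X <+>\<^bsub>V\<^esub> Y) y"
    proof
      show "X <+>\<^bsub>V\<^esub> adjoin Y y \<subseteq> adjoin (X <+>\<^bsub>V\<^esub> Y) y"
        using adjoin_mem[OF S(1) adjoin(2)] S
        by (intro subspace_sum_least adjoin_subspace adjoin_least adjoin(2)) auto
      show "adjoin (X <+>\<^bsub>V\<^esub> Y) y \<subseteq> X <+>\<^bsub>V\<^esub> adjoin Y y"
        by (rule adjoin_least[OF S'(1) subspace_sum_least[OF S'(1)]]) (use m S' in auto)
    qed
    show ?case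
    proof (cases "y \<in> X <+>\<^bsub>V\<^esub> Y")
      case True
      have e: "X <+>\<^bsub>V\<^esub> adjoin Y y = X <+>\<^bsub>V\<^esub> Y"
        unfolding sum using adjoin_least[OF S(1) _ True] adjoin_mem[OF S(1) adjoin(2)] by auto
      \<comment> \<open>The summand of \<open>y\<close> in \<open>X\<close> is the vector by which
        the intersection grows.\<close>
      from True obtain x z where xz: "x \<in> X" "z \<in> Y" "y = x \<oplus> z" by (auto simp: set_add_def')
      then have x: "x = y \<ominus> z"
        using subspaceD(2)[OF X xz(1)] subspaceD(2)[OF Y xz(2)] by (simp add: add_minus_cancel)
      have "x \<in> adjoin Y y" unfolding x by (rule subspaceD(6)[OF Y']) (use m xz in auto)
      moreover have "x \<notin> Y" using xz adjoin(3) subspaceD(4)[OF Y, of x z] by auto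
      ultimately have "X \<inter> adjoin Y y = adjoin ((X \<inter> adjoin Y y) \<inter> Y) x"
        using xz by (intro adjoin_meet[OF Y adjoin(2) subspace_Int[OF X Y']]) auto
      moreover have "(X \<inter> adjoin Y y) \<inter> Y = X \<inter> Y" using m by auto
      moreover have "fin_subspace (X \<inter> Y)" using vdim_mono(1)[OF adjoin(1) subspace_Int[OF X Y]] by auto
      ultimately have "vdim (X \<inter> adjoin Y y) = Suc (vdim (X \<inter> Y))"
        using vdim_adjoin(2)[of "X \<inter> Y" x] \<open>x \<notin> Y\<close> xz subspaceD(2)[OF X] by auto
      then show ?thesis using adjoin e vdim_adjoin[OF adjoin(1-3)] by simp
    next
      case False
      have "X \<inter> adjoin Y y = X \<inter> Y"
      proof (rule ccontr)
        assume "X \<inter> adjoin Y y \<noteq> X \<inter> Y"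
        then obtain x where x: "x \<in> X" "x \<in> adjoin Y y" "x \<notin> Y" using m by auto
        then have "y \<in> adjoin Y x" using adjoin_exchange[OF Y adjoin(2)] m by auto
        also have "adjoin Y x \<subseteq> X <+>\<^bsub>V\<^esub> Y" by (rule adjoin_least[OF S(1)]) (use S x in auto)
        finally show False using False by simp
      qed
      then show ?thesis using adjoin vdim_adjoin[OF adjoin(1-3)] vdim_adjoin[of "X <+>\<^bsub>V\<^esub> Y" y] False sum by simp
    qed
  qed
  then show "fin_subspace (X <+>\<^bsub>V\<^esub> Y)" "vdim (X <+>\<^bsub>V\<^esub> Y) + vdim (X \<inter> Y) = vdim X + vdim Y" by auto
qed

end

text \<open>Linearity is asked for on \<open>U\<close> alone, since several of the maps it serves
  are linear just on a stable subspace. In the induction a new vector \<open>v\<close> either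
  enlarges the image, or \<open>f v = f u\<close> for an old vector \<open>u\<close> and then
  \<open>v - u\<close> enlarges the kernel.\<close>

lemma rank_nullity:
  assumes V: "vector_space K V" and W: "vector_space K W" and U: "vector_space.fin_subspace K V U"
    and cl: "\<And>x. x \<in> U \<Longrightarrow> f x \<in> carrier W"
    and ad: "\<And>x y. x \<in> U \<Longrightarrow> y \<in> U \<Longrightarrow> f (x \<oplus>\<^bsub>V\<^esub> y) = f x \<oplus>\<^bsub>W\<^esub> f y"
    and sm: "\<And>c x. c \<in> carrier K \<Longrightarrow> x \<in> U \<Longrightarrow> f (c \<odot>\<^bsub>V\<^esub> x) = c \<odot>\<^bsub>W\<^esub> f x"
  shows "vector_space.fin_subspace K W (f ` U)"
    and "vector_space.vdim K V {x \<in> U. f x = \<zero>\<^bsub>W\<^esub>} + vector_space.vdim K W (f ` U) = vector_space.vdim K V U"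
proof -
  interpret V: vector_space K V by fact
  interpret W: vector_space K W by fact
  have "X \<subseteq> U \<Longrightarrow> W.fin_subspace (f ` X) \<and> V.vdim {x \<in> X. f x = \<zero>\<^bsub>W\<^esub>} + W.vdim (f ` X) = V.vdim X"
    if "V.fin_subspace X" for X
    using that
  proof (induction rule: V.fin_subspace_induct)
    case zero
    then have z: "\<zero>\<^bsub>V\<^esub> \<in> U" by simp
    have "f \<zero>\<^bsub>V\<^esub> = \<zero>\<^bsub>K\<^esub> \<odot>\<^bsub>W\<^esub> f \<zero>\<^bsub>V\<^esub>" using sm[OF _ z, of "\<zero>\<^bsub>K\<^esub>"] by simp
    then have f0: "f \<zero>\<^bsub>V\<^esub> = \<zero>\<^bsub>W\<^esub>" using cl[OF z] by simp
    then have "{x \<in> {\<zero>\<^bsub>V\<^esub>}. f x = \<zero>\<^bsub>W\<^esub>} = {\<zero>\<^bsub>V\<^esub>}" "f ` {\<zero>\<^bsub>V\<^esub>} = {\<zero>\<^bsub>W\<^esub>}" by auto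
    then show ?case using W.vdim_zero V.vdim_zero by simp
  next
    case (adjoin X v)
    note X = V.fin_subspace_subspace[OF adjoin(1)]
    note X' = V.adjoin_subspace[OF X adjoin(2)] and m = V.adjoin_mem[OF X adjoin(2)]
    note IH = adjoin.IH[OF subset_trans[OF m(1) adjoin.prems]]
    have U': "x \<in> U" if "x \<in> V.adjoin X v" for x using that adjoin.prems by auto
    note subU = V.fin_subspace_subspace[OF U]
    have fm: "f (x \<ominus>\<^bsub>V\<^esub> y) = f x \<ominus>\<^bsub>W\<^esub> f y" if "x \<in> U" "y \<in> U" for x y
    proof -
      have "f (\<ominus>\<^bsub>V\<^esub> y) = f ((\<ominus>\<^bsub>K\<^esub> \<one>\<^bsub>K\<^esub>) \<odot>\<^bsub>V\<^esub> y)"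
        using that V.subspaceD(2)[OF subU] by (simp add: V.smult_l_minus)
      also have "\<dots> = \<ominus>\<^bsub>W\<^esub> f y" using that cl by (subst sm) (auto simp: W.smult_l_minus)
      finally show ?thesis using that ad V.subspaceD(5)[OF subU] by (simp add: V.M.minus_eq W.M.minus_eq)
    qed
    have img: "f ` V.adjoin X v = W.adjoin (f ` X) (f v)"
    proof
      show "f ` V.adjoin X v \<subseteq> W.adjoin (f ` X) (f v)"
      proof
        fix y assume "y \<in> f ` V.adjoin X v"
        then obtain u c where uc: "u \<in> X" "c \<in> carrier K" "y = f (u \<oplus>\<^bsub>V\<^esub> c \<odot>\<^bsub>V\<^esub> v)"
          by (auto simp: V.adjoin_def)
        then have "y = f u \<oplus>\<^bsub>W\<^esub> c \<odot>\<^bsub>W\<^esub> f v"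
          using m U' V.subspaceD(7)[OF X'] by (subst uc(3), subst ad) (auto simp: sm)
        then show "y \<in> W.adjoin (f ` X) (f v)" using uc W.adjoinI by blast
      qed
      show "W.adjoin (f ` X) (f v) \<subseteq> f ` V.adjoin X v"
      proof
        fix y assume "y \<in> W.adjoin (f ` X) (f v)"
        then obtain u c where uc: "u \<in> X" "c \<in> carrier K" "y = f u \<oplus>\<^bsub>W\<^esub> c \<odot>\<^bsub>W\<^esub> f v"
          by (auto simp: W.adjoin_def)
        then have "y = f (u \<oplus>\<^bsub>V\<^esub> c \<odot>\<^bsub>V\<^esub> v)"
          using m U' V.subspaceD(7)[OF X'] by (subst ad) (auto simp: sm)
        then show "y \<in> f ` V.adjoin X v" using uc unfolding V.adjoin_def by blast
      qed
    qed
    have kerX: "submodule {x \<in> V.adjoin X v. f x = \<zero>\<^bsub>W\<^esub>} K V"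
    proof (rule V.subspaceI)
      have "f \<zero>\<^bsub>V\<^esub> = \<zero>\<^bsub>K\<^esub> \<odot>\<^bsub>W\<^esub> f \<zero>\<^bsub>V\<^esub>"
        using sm[OF _ V.subspaceD(3)[OF subU], of "\<zero>\<^bsub>K\<^esub>"] by simp
      then have "f \<zero>\<^bsub>V\<^esub> = \<zero>\<^bsub>W\<^esub>" using cl[OF V.subspaceD(3)[OF subU]] by simp
      then show "\<zero>\<^bsub>V\<^esub> \<in> {x \<in> V.adjoin X v. f x = \<zero>\<^bsub>W\<^esub>}" using V.subspaceD(3)[OF X'] by simp
    qed (use V.subspaceD[OF X'] U' ad sm in auto)
    have finX: "W.fin_subspace (f ` X)" using IH by simp
    have fv: "f v \<in> carrier W" using cl U' m by auto
    show ?case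
    proof (cases "f v \<in> f ` X")
      case True
      then obtain u where u: "u \<in> X" "f v = f u" by auto
      define w where "w = v \<ominus>\<^bsub>V\<^esub> u"
      have w: "w \<in> V.adjoin X v" "w \<notin> X" "f w = \<zero>\<^bsub>W\<^esub>"
      proof -
        show "w \<in> V.adjoin X v" unfolding w_def by (rule V.subspaceD(6)[OF X']) (use m u in auto)
        have "v = w \<oplus>\<^bsub>V\<^esub> u" using adjoin(2) V.subspaceD(2)[OF X u(1)] by (simp add: w_def V.add_minus_cancel)
        then show "w \<notin> X" using adjoin(3) V.subspaceD(4)[OF X, of w u] u(1) by auto
        show "f w = \<zero>\<^bsub>W\<^esub>" using u m U' cl by (simp add: w_def fm W.M.minus_eq W.M.r_neg subset_iff)
      qed
      have "{x \<in> V.adjoin X v. f x = \<zero>\<^bsub>W\<^esub>} = V.adjoin ({x \<in> V.adjoin X v. f x = \<zero>\<^bsub>W\<^esub>} \<inter> X) w"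
        by (rule V.adjoin_meet[OF X adjoin(2) kerX]) (use w in auto)
      moreover have "{x \<in> V.adjoin X v. f x = \<zero>\<^bsub>W\<^esub>} \<inter> X = {x \<in> X. f x = \<zero>\<^bsub>W\<^esub>}" using m by auto
      ultimately have k: "{x \<in> V.adjoin X v. f x = \<zero>\<^bsub>W\<^esub>} = V.adjoin {x \<in> X. f x = \<zero>\<^bsub>W\<^esub>} w" by simp
      have "V.fin_subspace {x \<in> X. f x = \<zero>\<^bsub>W\<^esub>}"
        using V.vdim_mono(1)[OF adjoin(1) V.subspace_Int[OF kerX X]] \<open>_ \<inter> X = _\<close> by auto
      then have "V.vdim {x \<in> V.adjoin X v. f x = \<zero>\<^bsub>W\<^esub>} = Suc (V.vdim {x \<in> X. f x = \<zero>\<^bsub>W\<^esub>})"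
        unfolding k using w(2) V.subspaceD(2)[OF X' w(1)] by (intro V.vdim_adjoin(2)) auto
      moreover have "f ` V.adjoin X v = f ` X"
        unfolding img using W.adjoin_least[OF W.fin_subspace_subspace[OF finX] subset_refl True]
          W.adjoin_mem[OF W.fin_subspace_subspace[OF finX] fv] by auto
      ultimately show ?thesis using IH V.vdim_adjoin[OF adjoin(1-3)] by simp
    next
      case False
      have "{x \<in> V.adjoin X v. f x = \<zero>\<^bsub>W\<^esub>} = {x \<in> X. f x = \<zero>\<^bsub>W\<^esub>}"
      proof (rule ccontr)
        assume "\<not> ?thesis"
        then obtain x where x: "x \<in> V.adjoin X v" "f x = \<zero>\<^bsub>W\<^esub>" "x \<notin> X" using m by auto
        then have "v \<in> V.adjoin X x" using V.adjoin_exchange[OF X adjoin(2)] m by auto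
        then obtain u c where uc: "u \<in> X" "c \<in> carrier K" "v = u \<oplus>\<^bsub>V\<^esub> c \<odot>\<^bsub>V\<^esub> x" by (auto simp: V.adjoin_def)
        then have "f v = f u \<oplus>\<^bsub>W\<^esub> c \<odot>\<^bsub>W\<^esub> f x"
          using m U' x V.subspaceD(7)[OF X'] by (subst uc(3), subst ad) (auto simp: sm)
        then have "f v = f u" using x(2) uc cl U' m by auto
        then show False using False uc by auto
      qed
      then show ?thesis using IH V.vdim_adjoin[OF adjoin(1-3)] W.vdim_adjoin[OF finX fv False] img by simp
    qed
  qed
  from this[OF U] show "W.fin_subspace (f ` U)" "V.vdim {x \<in> U. f x = \<zero>\<^bsub>W\<^esub>} + W.vdim (f ` U) = V.vdim U"
    by auto
qed

section \<open>Functionals, dual bases and spaces of linear maps\<close>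

lemma scalar_module_module: "field K \<Longrightarrow> module K (scalar_module K)"
proof -
  assume "field K"
  then interpret K: field K .
  have "abelian_group (scalar_module K)"
    by (rule abelian_groupI) (auto simp: scalar_module_def K.a_ac intro: bexI[of _ "\<ominus>\<^bsub>K\<^esub> _"] K.l_neg)
  then show ?thesis
    by (intro moduleI K.is_cring)
       (auto simp: scalar_module_def K.l_distr K.r_distr K.m_assoc)
qed

lemma linear_mapI:
  assumes "\<And>x. x \<in> carrier V \<Longrightarrow> f x \<in> carrier W"
    "\<And>x y. x \<in> carrier V \<Longrightarrow> y \<in> carrier V \<Longrightarrow> f (x \<oplus>\<^bsub>V\<^esub> y) = f x \<oplus>\<^bsub>W\<^esub> f y"
    "\<And>c x. c \<in> carrier K \<Longrightarrow> x \<in> carrier V \<Longrightarrow> f (c \<odot>\<^bsub>V\<^esub> x) = c \<odot>\<^bsub>W\<^esub> f x"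
  shows "linear_map K V W f"
  using assms by (auto simp: linear_map_def)

lemma linear_map_cong:
  assumes "module K V" "linear_map K V W f" "\<And>x. x \<in> carrier V \<Longrightarrow> g x = f x"
  shows "linear_map K V W g"
proof -
  interpret module K V by fact
  show ?thesis using assms(2,3) by (auto simp: linear_map_def)
qed

lemma linear_map_minus:
  assumes "module K V" "module K W" "linear_map K V W f" "x \<in> carrier V" "y \<in> carrier V"
  shows "f (x \<ominus>\<^bsub>V\<^esub> y) = f x \<ominus>\<^bsub>W\<^esub> f y"
proof -
  interpret V: module K V by fact
  interpret W: module K W by fact
  note cl = linear_map_closed[OF assms(3)]
  have "f (\<ominus>\<^bsub>V\<^esub> y) = f ((\<ominus>\<^bsub>K\<^esub> \<one>\<^bsub>K\<^esub>) \<odot>\<^bsub>V\<^esub> y)" using assms(5) by (simp add: V.smult_l_minus)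
  also have "\<dots> = \<ominus>\<^bsub>W\<^esub> f y" using assms(5) cl by (subst linear_map_smult[OF assms(3)]) (auto simp: W.smult_l_minus)
  finally show ?thesis using assms(4,5) by (simp add: V.minus_eq W.minus_eq linear_map_add[OF assms(3)])
qed

abbreviation functional :: "'k ring \<Rightarrow> ('k, 'v) module \<Rightarrow> ('v \<Rightarrow> 'k) \<Rightarrow> bool"
  where "functional K V f \<equiv> linear_map K V (scalar_module K) f"

lemma functional_smult_linear:
  assumes "module K V" "module K W" "functional K V f" "w \<in> carrier W"
  shows "linear_map K V W (\<lambda>x. f x \<odot>\<^bsub>W\<^esub> w)"
proof -
  interpret V: module K V by fact
  interpret W: module K W by fact
  have "f x \<in> carrier K" if "x \<in> carrier V" for x
    using linear_map_closed[OF assms(3) that] by (simp add: scalar_module_def)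
  then show ?thesis
    using assms(4)
    by (intro linear_mapI)
       (simp_all add: linear_map_add[OF assms(3)] linear_map_smult[OF assms(3)],
        simp_all add: scalar_module_def W.smult_l_distr W.smult_assoc1)
qed

lemma finsum_linear_map:
  assumes "module K V" "module K W" "finite I" "\<And>i. i \<in> I \<Longrightarrow> linear_map K V W (f i)"
  shows "linear_map K V W (\<lambda>x. \<Oplus>\<^bsub>W\<^esub>i\<in>I. f i x)"
proof -
  interpret V: module K V by fact
  interpret W: module K W by fact
  have c: "(\<lambda>i. f i x) \<in> I \<rightarrow> carrier W" if "x \<in> carrier V" for x
    using linear_map_closed[OF assms(4)] that by blast
  show ?thesis
  proof (rule linear_mapI)
    fix x y assume x: "x \<in> carrier V" and y: "y \<in> carrier V"
    have "(\<Oplus>\<^bsub>W\<^esub>i\<in>I. f i (x \<oplus>\<^bsub>V\<^esub> y)) = (\<Oplus>\<^bsub>W\<^esub>i\<in>I. f i x \<oplus>\<^bsub>W\<^esub> f i y)"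
      using x y c by (intro W.finsum_cong') (auto simp: linear_map_add[OF assms(4)])
    then show "(\<Oplus>\<^bsub>W\<^esub>i\<in>I. f i (x \<oplus>\<^bsub>V\<^esub> y)) = (\<Oplus>\<^bsub>W\<^esub>i\<in>I. f i x) \<oplus>\<^bsub>W\<^esub> (\<Oplus>\<^bsub>W\<^esub>i\<in>I. f i y)"
      using W.finsum_addf[OF c[OF x] c[OF y]] by simp
  next
    fix d x assume d: "d \<in> carrier K" and x: "x \<in> carrier V"
    have "(\<Oplus>\<^bsub>W\<^esub>i\<in>I. f i (d \<odot>\<^bsub>V\<^esub> x)) = (\<Oplus>\<^bsub>W\<^esub>i\<in>I. d \<odot>\<^bsub>W\<^esub> f i x)"
      using d x c[OF x] by (intro W.finsum_cong') (auto simp: linear_map_smult[OF assms(4)])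
    then show "(\<Oplus>\<^bsub>W\<^esub>i\<in>I. f i (d \<odot>\<^bsub>V\<^esub> x)) = d \<odot>\<^bsub>W\<^esub> (\<Oplus>\<^bsub>W\<^esub>i\<in>I. f i x)"
      using W.finsum_smult_ldistr[OF assms(3) d c[OF x]] by simp
  qed (use c in \<open>auto intro!: W.finsum_closed\<close>)
qed

section \<open>Zorn's lemma, separating functionals and dual bases\<close>

context vector_space
begin

lemma a_inv_zero: "\<ominus> \<zero> = \<zero>"
  by (rule M.minus_equality) auto

lemma finsum_in_subspace:
  assumes "submodule U K V" "finite I" "\<And>i. i \<in> I \<Longrightarrow> f i \<in> U"
  shows "(\<Oplus>i\<in>I. f i) \<in> U"
  using assms(2,3)
proof (induction rule: finite_induct)
  case (insert i I)
  then have "f \<in> I \<rightarrow> carrier V" "f i \<in> carrier V" using subspaceD(2)[OF assms(1)] by blast+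
  then show ?case using insert subspaceD(4)[OF assms(1)] by simp
qed (simp add: subspaceD(3)[OF assms(1)])

text \<open>Zorn's lemma in one form for all later uses: with \<open>F\<close> empty it yields a
  complement of the line through \<open>z\<close>, with multiplications in \<open>F\<close> and the
  identity as \<open>z\<close> it yields maximal left or right ideals.\<close>

lemma maximal_stable_subspace:
  assumes "submodule N K V" "\<And>f x. f \<in> F \<Longrightarrow> x \<in> N \<Longrightarrow> f x \<in> N" "z \<notin> N"
  obtains M where "submodule M K V" "\<And>f x. f \<in> F \<Longrightarrow> x \<in> M \<Longrightarrow> f x \<in> M" "N \<subseteq> M" "z \<notin> M"
    "\<And>M'. submodule M' K V \<Longrightarrow> (\<And>f x. f \<in> F \<Longrightarrow> x \<in> M' \<Longrightarrow> f x \<in> M') \<Longrightarrow> M \<subseteq> M' \<Longrightarrow> z \<notin> M' \<Longrightarrow> M' = M"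
proof -
  define \<A> where "\<A> = {M. submodule M K V \<and> (\<forall>f\<in>F. \<forall>x\<in>M. f x \<in> M) \<and> N \<subseteq> M \<and> z \<notin> M}"
  have "N \<in> \<A>" using assms by (auto simp: \<A>_def)
  have "\<exists>M\<in>\<A>. \<forall>X\<in>\<A>. M \<subseteq> X \<longrightarrow> X = M"
  proof (rule subset_Zorn_nonempty)
    show "\<A> \<noteq> {}" using \<open>N \<in> \<A>\<close> by auto
    fix \<C> assume ne: "\<C> \<noteq> {}" and ch: "subset.chain \<A> \<C>"
    have A: "submodule M K V" "\<And>f x. f \<in> F \<Longrightarrow> x \<in> M \<Longrightarrow> f x \<in> M" "N \<subseteq> M" "z \<notin> M" if "M \<in> \<C>" for M
      using ch that by (auto simp: \<A>_def subset_chain_def)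
    have "submodule (\<Union>\<C>) K V"
    proof (rule subspaceI)
      show "\<Union>\<C> \<subseteq> carrier V" using A(1) subspaceD(1) by blast
      show "\<zero> \<in> \<Union>\<C>" using ne A(1) subspaceD(3) by blast
      fix x y assume "x \<in> \<Union>\<C>" "y \<in> \<Union>\<C>"
      then obtain X Y where XY: "x \<in> X" "X \<in> \<C>" "y \<in> Y" "Y \<in> \<C>" by auto
      moreover have "X \<subseteq> Y \<or> Y \<subseteq> X" using ch XY by (simp add: subset_chain_def)
      ultimately obtain Z where Z: "Z \<in> \<C>" "x \<in> Z" "y \<in> Z" by auto
      then have "x \<oplus> y \<in> Z" using subspaceD(4)[OF A(1)[OF Z(1)]] by simp
      then show "x \<oplus> y \<in> \<Union>\<C>" using Z(1) by auto
    next
      fix c x assume c: "c \<in> carrier K" and "x \<in> \<Union>\<C>"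
      then obtain Z where Z: "Z \<in> \<C>" "x \<in> Z" by auto
      then have "c \<odot> x \<in> Z" using subspaceD(7)[OF A(1)[OF Z(1)] c] by simp
      then show "c \<odot> x \<in> \<Union>\<C>" using Z(1) by auto
    qed
    then show "\<Union>\<C> \<in> \<A>" using A(2-4) ne unfolding \<A>_def by blast
  qed
  then obtain M where M: "M \<in> \<A>" "\<And>X. X \<in> \<A> \<Longrightarrow> M \<subseteq> X \<Longrightarrow> X = M" by auto
  show thesis
  proof (rule that[of M])
    fix M' assume "submodule M' K V" "\<And>f x. f \<in> F \<Longrightarrow> x \<in> M' \<Longrightarrow> f x \<in> M'" "M \<subseteq> M'" "z \<notin> M'"
    then show "M' = M" using M unfolding \<A>_def by (intro M(2)) (auto simp: \<A>_def)
  qed (use M(1) in \<open>auto simp: \<A>_def\<close>)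
qed

text \<open>A subspace \<open>M\<close> that is maximal among those that contain \<open>N\<close>
  and miss \<open>z\<close> is a complement of the line through \<open>z\<close>. The functional is
  the coefficient at \<open>z\<close>, unique because \<open>z\<close> is not in
  \<open>M\<close>.\<close>

lemma functional_separates:
  assumes "submodule N K V" "z \<in> carrier V" "z \<notin> N"
  obtains f where "functional K V f" "f z = \<one>\<^bsub>K\<^esub>" "\<And>x. x \<in> N \<Longrightarrow> f x = \<zero>\<^bsub>K\<^esub>"
proof -
  obtain M where M: "submodule M K V" "N \<subseteq> M" "z \<notin> M"
    "\<And>M'. submodule M' K V \<Longrightarrow> M \<subseteq> M' \<Longrightarrow> z \<notin> M' \<Longrightarrow> M' = M"
    using maximal_stable_subspace[OF assms(1) _ assms(3), of "{}"] by auto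
  have ex: "\<exists>c. c \<in> carrier K \<and> x \<ominus> c \<odot> z \<in> M" if x: "x \<in> carrier V" for x
  proof (cases "x \<in> M")
    case True
    then show ?thesis using assms(2) x by (intro exI[of _ "\<zero>\<^bsub>K\<^esub>"]) (auto simp: M.minus_eq a_inv_zero)
  next
    case False
    \<comment> \<open>By maximality \<open>x\<close> cannot be adjoined to \<open>M\<close> without
      bringing in \<open>z\<close>; exchanging the two writes \<open>x\<close> as a vector of
      \<open>M\<close> plus a multiple of \<open>z\<close>.\<close>
    have "z \<in> adjoin M x"
      using M(4)[OF adjoin_subspace[OF M(1) x] adjoin_mem(1)[OF M(1) x]] adjoin_mem(2)[OF M(1) x] False by blast
    then have "x \<in> adjoin M z" using adjoin_exchange[OF M(1) x _ M(3)] adjoin_mem(2)[OF M(1) x] by auto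
    then obtain u c where uc: "u \<in> M" "c \<in> carrier K" "x = u \<oplus> c \<odot> z" by (auto simp: adjoin_def)
    then have "x \<ominus> c \<odot> z = u" using subspaceD(2)[OF M(1) uc(1)] assms(2) by (simp add: add_minus_cancel)
    then show ?thesis using uc by auto
  qed
  have un: "c = d" if "c \<in> carrier K" "d \<in> carrier K" "x \<in> carrier V"
    "x \<ominus> c \<odot> z \<in> M" "x \<ominus> d \<odot> z \<in> M" for c d x
  proof (rule ccontr)
    assume ne: "c \<noteq> d"
    have "(x \<ominus> c \<odot> z) \<ominus> (x \<ominus> d \<odot> z) \<in> M" using subspaceD(6)[OF M(1)] that by blast
    also have "(x \<ominus> c \<odot> z) \<ominus> (x \<ominus> d \<odot> z) = (d \<ominus>\<^bsub>K\<^esub> c) \<odot> z"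
      using minus_add_minus(2)[of "d \<odot> z" "c \<odot> z" x] that assms(2)
      by (simp add: smult_l_distr M.minus_eq K.minus_eq smult_l_minus)
    finally have *: "(d \<ominus>\<^bsub>K\<^esub> c) \<odot> z \<in> M" .
    have "d = (d \<ominus>\<^bsub>K\<^esub> c) \<oplus>\<^bsub>K\<^esub> c" using that by (simp add: K.minus_eq K.a_assoc K.l_neg)
    then have "d \<ominus>\<^bsub>K\<^esub> c \<noteq> \<zero>\<^bsub>K\<^esub>" using that ne by (metis K.l_zero)
    then have i: "inv\<^bsub>K\<^esub> (d \<ominus>\<^bsub>K\<^esub> c) \<in> carrier K" "inv\<^bsub>K\<^esub> (d \<ominus>\<^bsub>K\<^esub> c) \<otimes>\<^bsub>K\<^esub> (d \<ominus>\<^bsub>K\<^esub> c) = \<one>\<^bsub>K\<^esub>"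
      using that K.field_Units by auto
    have "inv\<^bsub>K\<^esub> (d \<ominus>\<^bsub>K\<^esub> c) \<odot> ((d \<ominus>\<^bsub>K\<^esub> c) \<odot> z) \<in> M" using subspaceD(7)[OF M(1) i(1) *] .
    then show False using i that assms(2) M(3) by (simp flip: smult_assoc1)
  qed
  define f where "f = (\<lambda>x. THE c. c \<in> carrier K \<and> x \<ominus> c \<odot> z \<in> M)"
  have fI: "f x = c" if "c \<in> carrier K" "x \<in> carrier V" "x \<ominus> c \<odot> z \<in> M" for x c
    unfolding f_def using that un by (intro the_equality) auto
  have f: "f x \<in> carrier K" "x \<ominus> f x \<odot> z \<in> M" if "x \<in> carrier V" for x
    using ex[OF that] fI that by auto
  show thesis
  proof (rule that[of f])
    show "functional K V f"
    proof (rule linear_mapI)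
      fix x y assume x: "x \<in> carrier V" and y: "y \<in> carrier V"
      have "(x \<ominus> f x \<odot> z) \<oplus> (y \<ominus> f y \<odot> z) \<in> M" using subspaceD(4)[OF M(1)] f x y by blast
      also have "(x \<ominus> f x \<odot> z) \<oplus> (y \<ominus> f y \<odot> z)
        = (x \<oplus> y) \<ominus> (f x \<oplus>\<^bsub>K\<^esub> f y) \<odot> z"
        using f x y assms(2) by (simp add: smult_l_distr M.minus_eq M.minus_add M.a_ac)
      finally show "f (x \<oplus> y) = f x \<oplus>\<^bsub>scalar_module K\<^esub> f y"
        using f x y by (intro fI) (auto simp: scalar_module_def)
    next
      fix c x assume c: "c \<in> carrier K" and x: "x \<in> carrier V"
      have "c \<odot> (x \<ominus> f x \<odot> z) \<in> M" using subspaceD(7)[OF M(1)] f x c by blast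
      also have "c \<odot> (x \<ominus> f x \<odot> z) = c \<odot> x \<ominus> (c \<otimes>\<^bsub>K\<^esub> f x) \<odot> z"
        using f x c assms(2) by (simp add: smult_r_distr smult_assoc1 M.minus_eq smult_r_minus)
      finally show "f (c \<odot> x) = c \<odot>\<^bsub>scalar_module K\<^esub> f x"
        using f x c by (intro fI) (auto simp: scalar_module_def)
    qed (use f in \<open>simp add: scalar_module_def\<close>)
    show "f z = \<one>\<^bsub>K\<^esub>" using assms(2) subspaceD(3)[OF M(1)] by (intro fI) (auto simp: M.minus_eq M.r_neg)
    fix x assume x: "x \<in> N"
    then show "f x = \<zero>\<^bsub>K\<^esub>" using assms(2) M(2) subspaceD(2)[OF assms(1) x]
      by (intro fI) (auto simp: M.minus_eq a_inv_zero)
  qed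
qed

lemma vector_space_scalar: "vector_space K (scalar_module K)"
  by (simp add: vector_space_def K.field_axioms scalar_module_module)

text \<open>The functionals live on all of \<open>V\<close>, which may have infinite dimension; this
  is used for subspaces of \<open>H\<close> before \<open>H\<close> is known to be
  finite-dimensional.\<close>

lemma dual_basis:
  assumes "fin_subspace U"
  obtains g f where "\<And>i. i < vdim U \<Longrightarrow> g i \<in> U" "\<And>i. i < vdim U \<Longrightarrow> functional K V (f i)"
    "\<And>i j. i < vdim U \<Longrightarrow> j < vdim U \<Longrightarrow> f i (g j) = (if i = j then \<one>\<^bsub>K\<^esub> else \<zero>\<^bsub>K\<^esub>)"
    "\<And>x. x \<in> U \<Longrightarrow> x = (\<Oplus>i\<in>{..<vdim U}. f i x \<odot> g i)"
proof -
  have "\<exists>g f. (\<forall>i<vdim U. g i \<in> U) \<and> (\<forall>i<vdim U. functional K V (f i)) \<and>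
    (\<forall>i<vdim U. \<forall>j<vdim U. f i (g j) = (if i = j then \<one>\<^bsub>K\<^esub> else \<zero>\<^bsub>K\<^esub>)) \<and>
    (\<forall>x\<in>U. x = (\<Oplus>i\<in>{..<vdim U}. f i x \<odot> g i))"
    using assms
  proof (induction rule: fin_subspace_induct)
    case zero
    then show ?case by (simp add: vdim_zero)
  next
    case (adjoin U v)
    let ?m = "vdim U"
    note U = fin_subspace_subspace[OF adjoin(1)]
    obtain g f where g: "\<And>i. i < ?m \<Longrightarrow> g i \<in> U" and f: "\<And>i. i < ?m \<Longrightarrow> functional K V (f i)"
      and d: "\<And>i j. i < ?m \<Longrightarrow> j < ?m \<Longrightarrow> f i (g j) = (if i = j then \<one>\<^bsub>K\<^esub> else \<zero>\<^bsub>K\<^esub>)"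
      and e: "\<And>x. x \<in> U \<Longrightarrow> x = (\<Oplus>i\<in>{..<?m}. f i x \<odot> g i)"
      using adjoin.IH by blast
    have fK: "f i x \<in> carrier K" if "i < ?m" "x \<in> carrier V" for i x
      using linear_map_closed[OF f[OF that(1)] that(2)] by (simp add: scalar_module_def)
    have gV: "g i \<in> carrier V" if "i < ?m" for i using g[OF that] subspaceD(2)[OF U] by auto
    define p where "p = (\<lambda>x. \<Oplus>i\<in>{..<?m}. f i x \<odot> g i)"
    have p: "linear_map K V V p" unfolding p_def
      by (rule finsum_linear_map) (auto intro!: functional_smult_linear f gV module_axioms)
    have pU: "p x \<in> U" if "x \<in> carrier V" for x
      unfolding p_def by (rule finsum_in_subspace[OF U]) (use subspaceD(7)[OF U fK[OF _ that] g] in auto)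
    \<comment> \<open>\<open>p\<close> is the projection onto \<open>U\<close> given by the dual
      basis found so far. Subtracting \<open>p v\<close> makes the new basis vector vanish under all
      old functionals, so these stay unchanged and a single functional that is zero on
      \<open>U\<close> completes the dual basis.\<close>
    define w where "w = v \<ominus> p v"
    have pv: "p v \<in> carrier V" using pU[OF adjoin(2)] subspaceD(2)[OF U] by auto
    have w: "w \<in> carrier V" using adjoin(2) pv by (simp add: w_def)
    have v: "v = w \<oplus> p v" using adjoin(2) pv by (simp add: w_def add_minus_cancel)
    have wU: "w \<notin> U" using adjoin(3) v subspaceD(4)[OF U _ pU[OF adjoin(2)], of w] by auto
    have "w \<in> adjoin U v" unfolding w_def
      by (rule subspaceD(6)[OF adjoin_subspace[OF U adjoin(2)]])
         (use adjoin_mem[OF U adjoin(2)] pU[OF adjoin(2)] in auto)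
    then have aw: "adjoin U v = adjoin U w" using adjoin_exchange[OF U adjoin(2) _ wU] by simp
    have fw: "f i w = \<zero>\<^bsub>K\<^esub>" if i: "i < ?m" for i
    proof -
      have "f i (p v) = (\<Oplus>\<^bsub>scalar_module K\<^esub>j\<in>{..<?m}. f i (f j v \<odot> g j))"
        unfolding p_def
        by (rule linear_map_finsum[OF module_axioms _ f[OF i]])
           (use fK gV adjoin(2) in \<open>auto simp: scalar_module_module[OF K.field_axioms]\<close>)
      also have "\<dots> = (\<Oplus>\<^bsub>scalar_module K\<^esub>j\<in>{..<?m}. if i = j then f i v else \<zero>\<^bsub>K\<^esub>)"
      proof (rule abelian_monoid.finsum_cong')
        show "abelian_monoid (scalar_module K)"
          using scalar_module_module[OF K.field_axioms] by (simp add: module_def abelian_group_def)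
      qed (use fK gV adjoin(2) i in \<open>auto simp: linear_map_smult[OF f] d scalar_module_def\<close>)
      also have "\<dots> = f i v"
      proof -
        interpret S: module K "scalar_module K" by (rule scalar_module_module[OF K.field_axioms])
        have "(\<Oplus>\<^bsub>scalar_module K\<^esub>j\<in>{..<?m}. if i = j then f i v else \<zero>\<^bsub>scalar_module K\<^esub>) = f i v"
          by (rule S.add.finprod_singleton) (use i fK adjoin(2) in \<open>auto simp: scalar_module_def\<close>)
        moreover have "\<zero>\<^bsub>K\<^esub> = \<zero>\<^bsub>scalar_module K\<^esub>" by (simp add: scalar_module_def)
        ultimately show ?thesis by metis
      qed
      finally have "f i (p v) = f i v" .
      then have "f i w = f i v \<ominus>\<^bsub>scalar_module K\<^esub> f i v"
        using linear_map_minus[OF module_axioms scalar_module_module[OF K.field_axioms] f[OF i] adjoin(2) pv]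
        by (simp add: w_def)
      also have "\<dots> = \<zero>\<^bsub>scalar_module K\<^esub>"
        using linear_map_closed[OF f[OF i] adjoin(2)]
          module.axioms(2)[OF scalar_module_module[OF K.field_axioms]] abelian_group.minus_eq abelian_group.r_neg
        by (metis)
      finally show ?thesis by (simp add: scalar_module_def)
    qed
    obtain h where h: "functional K V h" "h w = \<one>\<^bsub>K\<^esub>" "\<And>x. x \<in> U \<Longrightarrow> h x = \<zero>\<^bsub>K\<^esub>"
      using functional_separates[OF U w wU] by auto
    have m: "vdim (adjoin U v) = Suc ?m" using vdim_adjoin[OF adjoin(1-3)] by simp
    let ?g = "g(?m := w)" and ?f = "f(?m := h)"
    have "x = (\<Oplus>i\<in>{..<Suc ?m}. ?f i x \<odot> ?g i)" if x: "x \<in> adjoin U v" for x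
    proof -
      obtain u c where uc: "u \<in> U" "c \<in> carrier K" "x = u \<oplus> c \<odot> w"
        using x unfolding aw by (auto simp: adjoin_def)
      have uV: "u \<in> carrier V" using subspaceD(2)[OF U uc(1)] .
      have fx: "f i x = f i u" if "i < ?m" for i
        using fK[OF that uV] uV uc(2) w fw[OF that]
        by (simp add: uc(3) linear_map_add[OF f[OF that]] linear_map_smult[OF f[OF that]]) (simp add: scalar_module_def)
      have hx: "h x = c" using uV uc w h
        by (simp add: linear_map_add[OF h(1)] linear_map_smult[OF h(1)]) (simp add: scalar_module_def)
      have "(\<Oplus>i\<in>{..<Suc ?m}. ?f i x \<odot> ?g i) = (\<Oplus>i\<in>insert ?m {..<?m}. ?f i x \<odot> ?g i)"
        by (simp add: lessThan_Suc)
      also have "\<dots> = h x \<odot> w \<oplus> (\<Oplus>i\<in>{..<?m}. ?f i x \<odot> ?g i)"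
        by (subst M.finsum_insert) (use hx uc w fx fK uV gV in auto)
      also have "(\<Oplus>i\<in>{..<?m}. ?f i x \<odot> ?g i) = (\<Oplus>i\<in>{..<?m}. f i u \<odot> g i)"
        by (rule M.finsum_cong') (use fx fK gV uV in auto)
      also have "\<dots> = u" using e[OF uc(1)] by simp
      finally show ?thesis using uc hx w uV by (simp add: M.a_comm)
    qed
    moreover have "?g i \<in> adjoin U v" if "i < Suc ?m" for i
      using that g adjoin_mem[OF U adjoin(2)] \<open>w \<in> adjoin U v\<close> by (auto simp: less_Suc_eq)
    moreover have "functional K V (?f i)" if "i < Suc ?m" for i using that f h(1) by (auto simp: less_Suc_eq)
    moreover have "?f i (?g j) = (if i = j then \<one>\<^bsub>K\<^esub> else \<zero>\<^bsub>K\<^esub>)" if "i < Suc ?m" "j < Suc ?m" for i j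
      using that d fw h g by (auto simp: less_Suc_eq)
    ultimately show ?case unfolding m by blast
  qed
  then obtain g f where "\<forall>i<vdim U. g i \<in> U" "\<forall>i<vdim U. functional K V (f i)"
    "\<forall>i<vdim U. \<forall>j<vdim U. f i (g j) = (if i = j then \<one>\<^bsub>K\<^esub> else \<zero>\<^bsub>K\<^esub>)"
    "\<forall>x\<in>U. x = (\<Oplus>i\<in>{..<vdim U}. f i x \<odot> g i)"
    by (elim exE conjE)
  then show thesis by (intro that[of g f]) blast+
qed

end


section \<open>Spaces of linear maps and their dimension\<close>

definition hom_module :: "'k ring \<Rightarrow> ('k, 'v) module \<Rightarrow> ('k, 'w) module \<Rightarrow> ('k, 'v \<Rightarrow> 'w) module"
  where "hom_module K V W =
    \<lparr>carrier = {\<phi> \<in> extensional (carrier V). linear_map K V W \<phi>}, mult = undefined, one = undefined,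
     zero = (\<lambda>x\<in>carrier V. \<zero>\<^bsub>W\<^esub>), add = (\<lambda>\<phi> \<psi>. \<lambda>x\<in>carrier V. \<phi> x \<oplus>\<^bsub>W\<^esub> \<psi> x),
     smult = (\<lambda>c \<phi>. \<lambda>x\<in>carrier V. c \<odot>\<^bsub>W\<^esub> \<phi> x)\<rparr>"

lemma hom_module_simps:
  "\<phi> \<in> carrier (hom_module K V W) \<longleftrightarrow> \<phi> \<in> extensional (carrier V) \<and> linear_map K V W \<phi>"
  "\<zero>\<^bsub>hom_module K V W\<^esub> = (\<lambda>x\<in>carrier V. \<zero>\<^bsub>W\<^esub>)"
  "\<phi> \<oplus>\<^bsub>hom_module K V W\<^esub> \<psi> = (\<lambda>x\<in>carrier V. \<phi> x \<oplus>\<^bsub>W\<^esub> \<psi> x)"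
  "c \<odot>\<^bsub>hom_module K V W\<^esub> \<phi> = (\<lambda>x\<in>carrier V. c \<odot>\<^bsub>W\<^esub> \<phi> x)"
  by (auto simp: hom_module_def)

lemma hom_module_ev:
  assumes "x \<in> carrier V"
  shows "\<zero>\<^bsub>hom_module K V W\<^esub> x = \<zero>\<^bsub>W\<^esub>"
    "(\<phi> \<oplus>\<^bsub>hom_module K V W\<^esub> \<psi>) x = \<phi> x \<oplus>\<^bsub>W\<^esub> \<psi> x"
    "(c \<odot>\<^bsub>hom_module K V W\<^esub> \<phi>) x = c \<odot>\<^bsub>W\<^esub> \<phi> x"
  using assms by (simp_all add: hom_module_simps)

lemma hom_module_app:
  "\<phi> \<in> carrier (hom_module K V W) \<Longrightarrow> x \<in> carrier V \<Longrightarrow> \<phi> x \<in> carrier W"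
  by (auto simp: hom_module_simps dest: linear_map_closed)

text \<open>The point of admitting only \<open>extensional\<close> functions as elements: linear
  maps that agree on \<open>carrier V\<close> are equal, so module identities can be checked
  pointwise.\<close>

lemma hom_module_eqI:
  "\<phi> \<in> carrier (hom_module K V W) \<Longrightarrow> \<psi> \<in> carrier (hom_module K V W) \<Longrightarrow>
    (\<And>x. x \<in> carrier V \<Longrightarrow> \<phi> x = \<psi> x) \<Longrightarrow> \<phi> = \<psi>"
  unfolding hom_module_simps by (rule extensionalityI) auto

lemma hom_moduleI:
  assumes "module K V" "linear_map K V W f"
  shows "(\<lambda>x\<in>carrier V. f x) \<in> carrier (hom_module K V W)"
  using linear_map_cong[OF assms, of "\<lambda>x\<in>carrier V. f x"] by (simp add: hom_module_simps(1))

lemma linear_map_zero_map: "module K W \<Longrightarrow> linear_map K V W (\<lambda>x. \<zero>\<^bsub>W\<^esub>)"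
proof -
  assume "module K W"
  then interpret W: module K W .
  show ?thesis by (rule linear_mapI) auto
qed

lemma linear_map_plus:
  assumes "module K V" "module K W" "linear_map K V W f" "linear_map K V W g"
  shows "linear_map K V W (\<lambda>x. f x \<oplus>\<^bsub>W\<^esub> g x)"
proof -
  interpret V: module K V by fact
  interpret W: module K W by fact
  note cl = linear_map_closed[OF assms(3)] linear_map_closed[OF assms(4)]
  show ?thesis
    by (rule linear_mapI)
       (simp_all add: linear_map_add[OF assms(3)] linear_map_add[OF assms(4)] linear_map_smult[OF assms(3)]
         linear_map_smult[OF assms(4)] cl W.a_ac W.smult_r_distr)
qed

lemma linear_map_scale:
  assumes "module K V" "module K W" "linear_map K V W f" "c \<in> carrier K"
  shows "linear_map K V W (\<lambda>x. c \<odot>\<^bsub>W\<^esub> f x)"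
proof -
  interpret V: module K V by fact
  interpret W: module K W by fact
  note cl = linear_map_closed[OF assms(3)]
  have "c \<odot>\<^bsub>W\<^esub> (d \<odot>\<^bsub>W\<^esub> w) = d \<odot>\<^bsub>W\<^esub> (c \<odot>\<^bsub>W\<^esub> w)" if "d \<in> carrier K" "w \<in> carrier W" for d w
    using that assms(4) by (simp add: V.R.m_comm flip: W.smult_assoc1)
  then show ?thesis
    using assms(4)
    by (intro linear_mapI)
       (simp_all add: linear_map_add[OF assms(3)] linear_map_smult[OF assms(3)] cl W.smult_r_distr)
qed

lemma hom_module_module:
  assumes "module K V" "module K W"
  shows "module K (hom_module K V W)"
proof -
  interpret V: module K V by fact
  interpret W: module K W by fact
  let ?H = "hom_module K V W"
  have lin: "linear_map K V W \<phi>" if "\<phi> \<in> carrier ?H" for \<phi> using that by (simp add: hom_module_simps)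
  have add: "\<phi> \<oplus>\<^bsub>?H\<^esub> \<psi> \<in> carrier ?H" if "\<phi> \<in> carrier ?H" "\<psi> \<in> carrier ?H" for \<phi> \<psi>
    unfolding hom_module_simps(3)
    by (rule hom_moduleI[OF assms(1) linear_map_plus[OF assms lin[OF that(1)] lin[OF that(2)]]])
  have smult: "c \<odot>\<^bsub>?H\<^esub> \<phi> \<in> carrier ?H" if "c \<in> carrier K" "\<phi> \<in> carrier ?H" for c \<phi>
    unfolding hom_module_simps(4)
    by (rule hom_moduleI[OF assms(1) linear_map_scale[OF assms lin[OF that(2)] that(1)]])
  have zero: "\<zero>\<^bsub>?H\<^esub> \<in> carrier ?H"
    unfolding hom_module_simps(2) by (rule hom_moduleI[OF assms(1) linear_map_zero_map[OF assms(2)]])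
  have ev: "(\<phi> \<oplus>\<^bsub>?H\<^esub> \<psi>) x = \<phi> x \<oplus>\<^bsub>W\<^esub> \<psi> x" "(c \<odot>\<^bsub>?H\<^esub> \<phi>) x = c \<odot>\<^bsub>W\<^esub> \<phi> x" "\<zero>\<^bsub>?H\<^esub> x = \<zero>\<^bsub>W\<^esub>"
    if "x \<in> carrier V" for c \<phi> \<psi> x using that by (simp_all add: hom_module_simps)
  note ap = hom_module_app
  have "abelian_group ?H"
  proof (rule abelian_groupI[OF add zero])
    fix \<phi> \<psi> \<chi> assume *: "\<phi> \<in> carrier ?H" "\<psi> \<in> carrier ?H" "\<chi> \<in> carrier ?H"
    show "\<phi> \<oplus>\<^bsub>?H\<^esub> \<psi> \<oplus>\<^bsub>?H\<^esub> \<chi> = \<phi> \<oplus>\<^bsub>?H\<^esub> (\<psi> \<oplus>\<^bsub>?H\<^esub> \<chi>)"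
      by (rule hom_module_eqI) (use * in \<open>auto intro: add simp: ev ap W.a_ac\<close>)
  next
    fix \<phi> \<psi> assume *: "\<phi> \<in> carrier ?H" "\<psi> \<in> carrier ?H"
    show "\<phi> \<oplus>\<^bsub>?H\<^esub> \<psi> = \<psi> \<oplus>\<^bsub>?H\<^esub> \<phi>"
      by (rule hom_module_eqI) (use * in \<open>auto intro: add simp: ev ap W.a_ac\<close>)
  next
    fix \<phi> assume *: "\<phi> \<in> carrier ?H"
    show "\<zero>\<^bsub>?H\<^esub> \<oplus>\<^bsub>?H\<^esub> \<phi> = \<phi>"
      by (rule hom_module_eqI) (use * in \<open>auto intro: add zero simp: ev ap\<close>)
    have "(\<ominus>\<^bsub>K\<^esub> \<one>\<^bsub>K\<^esub>) \<odot>\<^bsub>?H\<^esub> \<phi> \<oplus>\<^bsub>?H\<^esub> \<phi> = \<zero>\<^bsub>?H\<^esub>"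
      by (rule hom_module_eqI) (use * in \<open>auto intro: add smult zero simp: ev ap W.smult_l_minus W.l_neg\<close>)
    then show "\<exists>\<psi>\<in>carrier ?H. \<psi> \<oplus>\<^bsub>?H\<^esub> \<phi> = \<zero>\<^bsub>?H\<^esub>" using smult[OF _ *, of "\<ominus>\<^bsub>K\<^esub> \<one>\<^bsub>K\<^esub>"] by auto
  qed
  then show ?thesis
  proof (intro moduleI V.R.is_cring)
    fix a b \<phi> assume ab: "a \<in> carrier K" "b \<in> carrier K" and *: "\<phi> \<in> carrier ?H"
    show "(a \<oplus>\<^bsub>K\<^esub> b) \<odot>\<^bsub>?H\<^esub> \<phi> = a \<odot>\<^bsub>?H\<^esub> \<phi> \<oplus>\<^bsub>?H\<^esub> b \<odot>\<^bsub>?H\<^esub> \<phi>"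
      by (rule hom_module_eqI) (use ab * in \<open>auto intro: add smult simp: ev ap W.smult_l_distr\<close>)
    show "(a \<otimes>\<^bsub>K\<^esub> b) \<odot>\<^bsub>?H\<^esub> \<phi> = a \<odot>\<^bsub>?H\<^esub> (b \<odot>\<^bsub>?H\<^esub> \<phi>)"
      by (rule hom_module_eqI) (use ab * in \<open>auto intro: add smult simp: ev ap W.smult_assoc1\<close>)
  next
    fix a \<phi> \<psi> assume ab: "a \<in> carrier K" and *: "\<phi> \<in> carrier ?H" "\<psi> \<in> carrier ?H"
    show "a \<odot>\<^bsub>?H\<^esub> (\<phi> \<oplus>\<^bsub>?H\<^esub> \<psi>) = a \<odot>\<^bsub>?H\<^esub> \<phi> \<oplus>\<^bsub>?H\<^esub> a \<odot>\<^bsub>?H\<^esub> \<psi>"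
      by (rule hom_module_eqI) (use ab * in \<open>auto intro: add smult simp: ev ap W.smult_r_distr\<close>)
  next
    fix \<phi> assume *: "\<phi> \<in> carrier ?H"
    show "\<one>\<^bsub>K\<^esub> \<odot>\<^bsub>?H\<^esub> \<phi> = \<phi>"
      by (rule hom_module_eqI) (use * in \<open>auto intro: add smult simp: ev ap\<close>)
  qed (auto intro: smult)
qed

lemma hom_into_subspace:
  assumes "module K V" "vector_space K W" "submodule U K W"
  shows "submodule {\<phi> \<in> carrier (hom_module K V W). \<forall>x\<in>carrier V. \<phi> x \<in> U} K (hom_module K V W)"
proof -
  interpret W: vector_space K W by fact
  interpret H: vector_space K "hom_module K V W"
    by (simp add: vector_space_def W.K.field_axioms hom_module_module[OF assms(1) W.module_axioms])
  note U = W.subspaceD[OF assms(3)]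
  show ?thesis
    by (rule H.subspaceI) (auto simp: hom_module_ev U)
qed

text \<open>The maps are filtered by the basis vectors at which they may be nonzero: those in
  \<open>F k\<close> vanish at \<open>g i\<close> for all \<open>i\<close> from \<open>k\<close> on.
  Evaluation at \<open>g k\<close> maps \<open>F (Suc k)\<close> onto \<open>U\<close> with kernel
  \<open>F k\<close>, so each basis vector contributes the dimension of \<open>U\<close>.\<close>

lemma vdim_hom:
  assumes V: "vector_space K V" and W: "vector_space K W" and fV: "vector_space.fin_subspace K V (carrier V)"
    and U: "vector_space.fin_subspace K W U"
  shows "vector_space.fin_subspace K (hom_module K V W) {\<phi> \<in> carrier (hom_module K V W). \<forall>x\<in>carrier V. \<phi> x \<in> U}"
    and "vector_space.vdim K (hom_module K V W) {\<phi> \<in> carrier (hom_module K V W). \<forall>x\<in>carrier V. \<phi> x \<in> U}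
      = vector_space.vdim K V (carrier V) * vector_space.vdim K W U"
proof -
  interpret V: vector_space K V by fact
  interpret W: vector_space K W by fact
  let ?H = "hom_module K V W"
  interpret H: vector_space K ?H
    by (simp add: vector_space_def V.K.field_axioms hom_module_module[OF V.module_axioms W.module_axioms])
  let ?n = "V.vdim (carrier V)"
  note sU = W.fin_subspace_subspace[OF U]
  obtain g f where g: "\<And>i. i < ?n \<Longrightarrow> g i \<in> carrier V" and f: "\<And>i. i < ?n \<Longrightarrow> functional K V (f i)"
    and d: "\<And>i j. i < ?n \<Longrightarrow> j < ?n \<Longrightarrow> f i (g j) = (if i = j then \<one>\<^bsub>K\<^esub> else \<zero>\<^bsub>K\<^esub>)"
    and e: "\<And>x. x \<in> carrier V \<Longrightarrow> x = (\<Oplus>\<^bsub>V\<^esub>i\<in>{..<?n}. f i x \<odot>\<^bsub>V\<^esub> g i)"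
    using V.dual_basis[OF fV] by auto
  define L where "L = {\<phi> \<in> carrier ?H. \<forall>x\<in>carrier V. \<phi> x \<in> U}"
  define F where "F = (\<lambda>k. {\<phi> \<in> L. \<forall>i. k \<le> i \<and> i < ?n \<longrightarrow> \<phi> (g i) = \<zero>\<^bsub>W\<^esub>})"
  have sL: "submodule L K ?H" unfolding L_def by (rule hom_into_subspace[OF V.module_axioms W sU])
  have L: "\<phi> \<in> carrier ?H" "linear_map K V W \<phi>" "\<And>x. x \<in> carrier V \<Longrightarrow> \<phi> x \<in> U" if "\<phi> \<in> L" for \<phi>
    using that by (auto simp: L_def hom_module_simps)
  have fK: "f i x \<in> carrier K" if "i < ?n" "x \<in> carrier V" for i x
    using linear_map_closed[OF f[OF that(1)] that(2)] by (simp add: scalar_module_def)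
  have ker0: "F 0 = {\<zero>\<^bsub>?H\<^esub>}"
  proof
    show "F 0 \<subseteq> {\<zero>\<^bsub>?H\<^esub>}"
    proof
      fix \<phi> assume \<phi>: "\<phi> \<in> F 0"
      then have p: "\<phi> \<in> L" "\<And>i. i < ?n \<Longrightarrow> \<phi> (g i) = \<zero>\<^bsub>W\<^esub>" by (auto simp: F_def)
      have "\<phi> = \<zero>\<^bsub>?H\<^esub>"
      proof (rule hom_module_eqI[OF L(1)[OF p(1)] H.M.zero_closed])
        fix x assume x: "x \<in> carrier V"
        have "\<phi> x = \<phi> (\<Oplus>\<^bsub>V\<^esub>i\<in>{..<?n}. f i x \<odot>\<^bsub>V\<^esub> g i)" using e[OF x] by simp
        also have "\<dots> = (\<Oplus>\<^bsub>W\<^esub>i\<in>{..<?n}. \<phi> (f i x \<odot>\<^bsub>V\<^esub> g i))"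
          by (rule linear_map_finsum[OF V.module_axioms W.module_axioms L(2)[OF p(1)]]) (use fK g x in auto)
        also have "\<dots> = (\<Oplus>\<^bsub>W\<^esub>i\<in>{..<?n}. \<zero>\<^bsub>W\<^esub>)"
          by (rule W.M.finsum_cong') (use fK g x p(2) in \<open>auto simp: linear_map_smult[OF L(2)[OF p(1)]]\<close>)
        finally show "\<phi> x = \<zero>\<^bsub>?H\<^esub> x" using x by (simp add: hom_module_simps(2))
      qed
      then show "\<phi> \<in> {\<zero>\<^bsub>?H\<^esub>}" by simp
    qed
    show "{\<zero>\<^bsub>?H\<^esub>} \<subseteq> F 0" using H.subspaceD(3)[OF sL] g by (auto simp: F_def hom_module_simps(2))
  qed
  have sF: "submodule (F k) K ?H" for k
    unfolding F_def using g
    by (intro H.subspaceI)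
       (auto simp: H.subspaceD(3,4,7)[OF sL] hom_module_ev intro: L(1))
  have img: "(\<lambda>\<phi>. \<phi> (g k)) ` F (Suc k) = U" if k: "k < ?n" for k
  proof
    show "(\<lambda>\<phi>. \<phi> (g k)) ` F (Suc k) \<subseteq> U" using L(3) g k by (auto simp: F_def)
    show "U \<subseteq> (\<lambda>\<phi>. \<phi> (g k)) ` F (Suc k)"
    proof
      fix u assume u: "u \<in> U"
      let ?\<phi> = "\<lambda>x\<in>carrier V. f k x \<odot>\<^bsub>W\<^esub> u"
      have "?\<phi> \<in> carrier ?H"
        by (rule hom_moduleI[OF V.module_axioms functional_smult_linear[OF V.module_axioms W.module_axioms f[OF k]]])
           (use W.subspaceD(2)[OF sU u] in simp)
      then have "?\<phi> \<in> F (Suc k)"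
        using u k g d fK W.subspaceD(2,7)[OF sU] by (auto simp: F_def L_def)
      moreover have "u = ?\<phi> (g k)" using k g d W.subspaceD(2)[OF sU u] by simp
      ultimately show "u \<in> (\<lambda>\<phi>. \<phi> (g k)) ` F (Suc k)" by (rule rev_image_eqI[where f = "\<lambda>\<phi>. \<phi> (g k)"])
    qed
  qed
  have k0: "{\<phi> \<in> F (Suc k). \<phi> (g k) = \<zero>\<^bsub>W\<^esub>} = F k" if "k < ?n" for k
    using that by (auto simp: F_def) (metis Suc_leI le_neq_implies_less)
  have "k \<le> ?n \<Longrightarrow> H.fin_subspace (F k) \<and> H.vdim (F k) = k * W.vdim U" for k
  proof (induction k)
    case 0
    then show ?case using ker0 H.vdim_zero by simp
  next
    case (Suc k)
    then have k: "k < ?n" and IH: "H.fin_subspace (F k)" "H.vdim (F k) = k * W.vdim U" by auto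
    have ev: "(\<phi> \<oplus>\<^bsub>?H\<^esub> \<psi>) (g k) = \<phi> (g k) \<oplus>\<^bsub>W\<^esub> \<psi> (g k)" "(c \<odot>\<^bsub>?H\<^esub> \<phi>) (g k) = c \<odot>\<^bsub>W\<^esub> \<phi> (g k)" for \<phi> \<psi> c
      using g[OF k] by (simp_all add: hom_module_simps)
    \<comment> \<open>\<open>rank_nullity\<close> presupposes a finite-dimensional domain. This is
      obtained by covering \<open>F (Suc k)\<close> with the sum of \<open>F k\<close> and a copy of
      \<open>U\<close>, formed by the maps \<open>f k\<close> times \<open>u\<close>.\<close>
    have "H.fin_subspace (F (Suc k))"
    proof -
      have "F (Suc k) \<subseteq> F k <+>\<^bsub>?H\<^esub> ((\<lambda>u. \<lambda>x\<in>carrier V. f k x \<odot>\<^bsub>W\<^esub> u) ` U)"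
      proof
        fix \<phi> assume \<phi>: "\<phi> \<in> F (Suc k)"
        then have pU: "\<phi> (g k) \<in> U" using img[OF k] by auto
        let ?\<psi> = "\<lambda>x\<in>carrier V. f k x \<odot>\<^bsub>W\<^esub> \<phi> (g k)"
        have uW: "\<phi> (g k) \<in> carrier W" using W.subspaceD(2)[OF sU pU] .
        have \<psi>: "?\<psi> \<in> carrier ?H"
          by (rule hom_moduleI[OF V.module_axioms functional_smult_linear[OF V.module_axioms W.module_axioms f[OF k] uW]])
        then have "?\<psi> \<in> F (Suc k)"
          using pU k g d fK uW W.subspaceD(7)[OF sU] by (auto simp: F_def L_def)
        then have "\<phi> \<ominus>\<^bsub>?H\<^esub> ?\<psi> \<in> F (Suc k)" using H.subspaceD(6)[OF sF \<phi>] by simp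
        moreover have "(\<phi> \<ominus>\<^bsub>?H\<^esub> ?\<psi>) (g k) = \<zero>\<^bsub>W\<^esub>"
        proof -
          have pc: "\<phi> \<in> carrier ?H" using H.subspaceD(2)[OF sF \<phi>] .
          have "\<phi> (g k) = ((\<phi> \<ominus>\<^bsub>?H\<^esub> ?\<psi>) \<oplus>\<^bsub>?H\<^esub> ?\<psi>) (g k)" using H.add_minus_cancel(3)[OF pc \<psi>] by simp
          also have "\<dots> = (\<phi> \<ominus>\<^bsub>?H\<^esub> ?\<psi>) (g k) \<oplus>\<^bsub>W\<^esub> \<phi> (g k)" using g[OF k] k d uW by (simp add: ev)
          finally show ?thesis
            using hom_module_app[OF H.M.minus_closed[OF pc \<psi>] g[OF k]] uW by (metis W.M.add.r_cancel_one')
        qed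
        ultimately have "\<phi> \<ominus>\<^bsub>?H\<^esub> ?\<psi> \<in> F k" using k0[OF k] by auto
        moreover have "\<phi> = (\<phi> \<ominus>\<^bsub>?H\<^esub> ?\<psi>) \<oplus>\<^bsub>?H\<^esub> ?\<psi>"
          using H.add_minus_cancel(3)[OF H.subspaceD(2)[OF sF \<phi>] \<psi>] by simp
        ultimately show "\<phi> \<in> F k <+>\<^bsub>?H\<^esub> ((\<lambda>u. \<lambda>x\<in>carrier V. f k x \<odot>\<^bsub>W\<^esub> u) ` U)"
          using H.set_addI[of "\<phi> \<ominus>\<^bsub>?H\<^esub> ?\<psi>" "F k" ?\<psi>] pU by auto
      qed
      moreover have "H.fin_subspace (F k <+>\<^bsub>?H\<^esub> ((\<lambda>u. \<lambda>x\<in>carrier V. f k x \<odot>\<^bsub>W\<^esub> u) ` U))"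
      proof (rule H.vdim_sum(1)[OF _ IH(1)])
        show "H.fin_subspace ((\<lambda>u. \<lambda>x\<in>carrier V. f k x \<odot>\<^bsub>W\<^esub> u) ` U)"
        proof (rule rank_nullity(1)[OF W H.vector_space_axioms U])
          show "(\<lambda>x\<in>carrier V. f k x \<odot>\<^bsub>W\<^esub> u) \<in> carrier ?H" if "u \<in> U" for u
            by (rule hom_moduleI[OF V.module_axioms functional_smult_linear[OF V.module_axioms W.module_axioms f[OF k]]])
               (use W.subspaceD(2)[OF sU that] in simp)
        qed (use fK[OF k] W.subspaceD(2)[OF sU] in
            \<open>auto simp: hom_module_simps(3,4) fun_eq_iff W.smult_r_distr V.K.m_comm simp flip: W.smult_assoc1\<close>)
      qed
      ultimately show ?thesis using H.vdim_mono(1) sF by blast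
    qed
    then show ?case
      using rank_nullity(2)[OF H.vector_space_axioms W, of "F (Suc k)" "\<lambda>\<phi>. \<phi> (g k)"] k0[OF k] img[OF k] IH
        hom_module_app[OF H.subspaceD(2)[OF sF] g[OF k]] ev by auto
  qed
  from this[of ?n] have "H.fin_subspace (F ?n)" "H.vdim (F ?n) = ?n * W.vdim U" by auto
  moreover have "F ?n = L" by (auto simp: F_def)
  ultimately show "H.fin_subspace {\<phi> \<in> carrier ?H. \<forall>x\<in>carrier V. \<phi> x \<in> U}"
    "H.vdim {\<phi> \<in> carrier ?H. \<forall>x\<in>carrier V. \<phi> x \<in> U} = ?n * W.vdim U"
    by (simp_all add: L_def)
qed

text \<open>
  \<open>transport\<close> along a map that is not injective: if \<open>j\<close> identifies exactly the elements that agree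
  modulo a subspace, it realises the quotient space.
\<close>

lemma transport_quotient:
  assumes "vector_space K X" "submodule U K X"
    and j: "\<And>x y. x \<in> carrier X \<Longrightarrow> y \<in> carrier X \<Longrightarrow> j x = j y \<longleftrightarrow> x \<ominus>\<^bsub>X\<^esub> y \<in> U"
  shows "module K (transport j X)" "linear_map K X (transport j X) j"
proof -
  interpret X: vector_space K X by fact
  note U = X.subspaceD[OF assms(2)]
  let ?i = "inv_into (carrier X) j"
  have i: "?i (j x) \<in> carrier X" "j (?i (j x)) = j x" "?i (j x) \<ominus>\<^bsub>X\<^esub> x \<in> U" if "x \<in> carrier X" for x
  proof -
    show *: "?i (j x) \<in> carrier X" "j (?i (j x)) = j x" using that by (simp_all add: inv_into_into f_inv_into_f)
    show "?i (j x) \<ominus>\<^bsub>X\<^esub> x \<in> U" using j[OF *(1) that] *(2) by simp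
  qed
  have add: "j x \<oplus>\<^bsub>transport j X\<^esub> j y = j (x \<oplus>\<^bsub>X\<^esub> y)" if "x \<in> carrier X" "y \<in> carrier X" for x y
  proof -
    have "(?i (j x) \<oplus>\<^bsub>X\<^esub> ?i (j y)) \<ominus>\<^bsub>X\<^esub> (x \<oplus>\<^bsub>X\<^esub> y) = (?i (j x) \<ominus>\<^bsub>X\<^esub> x) \<oplus>\<^bsub>X\<^esub> (?i (j y) \<ominus>\<^bsub>X\<^esub> y)"
      using i(1) that by (simp add: X.M.minus_eq X.M.minus_add X.M.a_ac)
    also have "\<dots> \<in> U" using U(4) i(3) that by blast
    finally have "j (?i (j x) \<oplus>\<^bsub>X\<^esub> ?i (j y)) = j (x \<oplus>\<^bsub>X\<^esub> y)"
      using j[of "?i (j x) \<oplus>\<^bsub>X\<^esub> ?i (j y)" "x \<oplus>\<^bsub>X\<^esub> y"] i(1) that by simp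
    then show ?thesis by (simp add: transport_def Let_def)
  qed
  have smult: "c \<odot>\<^bsub>transport j X\<^esub> j x = j (c \<odot>\<^bsub>X\<^esub> x)" if "c \<in> carrier K" "x \<in> carrier X" for c x
  proof -
    have "c \<odot>\<^bsub>X\<^esub> ?i (j x) \<ominus>\<^bsub>X\<^esub> c \<odot>\<^bsub>X\<^esub> x = c \<odot>\<^bsub>X\<^esub> (?i (j x) \<ominus>\<^bsub>X\<^esub> x)"
      using i(1) that by (simp add: X.M.minus_eq X.smult_r_distr X.smult_r_minus)
    also have "\<dots> \<in> U" using U(7) i(3) that by blast
    finally have "j (c \<odot>\<^bsub>X\<^esub> ?i (j x)) = j (c \<odot>\<^bsub>X\<^esub> x)"
      using j[of "c \<odot>\<^bsub>X\<^esub> ?i (j x)" "c \<odot>\<^bsub>X\<^esub> x"] i(1) that by simp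
    then show ?thesis by (simp add: transport_def Let_def)
  qed
  note [simp] = add smult transport_simps(1,2)
  have "abelian_group (transport j X)"
  proof (rule abelian_groupI)
    fix x assume "x \<in> carrier (transport j X)"
    then obtain m where m: "m \<in> carrier X" "x = j m" by auto
    then have "j (\<ominus>\<^bsub>X\<^esub> m) \<oplus>\<^bsub>transport j X\<^esub> x = \<zero>\<^bsub>transport j X\<^esub>" by (simp add: X.M.l_neg)
    with m show "\<exists>y\<in>carrier (transport j X). y \<oplus>\<^bsub>transport j X\<^esub> x = \<zero>\<^bsub>transport j X\<^esub>" by auto
  qed (auto simp: X.M.a_ac)
  then show "module K (transport j X)"
    by (intro moduleI)
       (auto simp: X.smult_l_distr X.smult_r_distr X.smult_assoc1 X.K.is_cring)
  show "linear_map K X (transport j X) j" by (rule linear_mapI) auto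
qed

section \<open>Tensor products\<close>

lemma submodule_abelian_subgroup:
  assumes "module K V" "submodule N K V"
  shows "abelian_subgroup N V"
proof -
  interpret V: module K V by fact
  show ?thesis
    by (rule abelian_subgroupI3)
       (use submodule.axioms(1)[OF assms(2)] V.abelian_group_axioms in \<open>auto simp: additive_subgroup_def\<close>)
qed

lemma coset_eq_iff:
  assumes "module K V" "submodule N K V" "x \<in> carrier V" "y \<in> carrier V"
  shows "N +>\<^bsub>V\<^esub> x = N +>\<^bsub>V\<^esub> y \<longleftrightarrow> x \<ominus>\<^bsub>V\<^esub> y \<in> N"
proof -
  interpret V: module K V by fact
  interpret N: abelian_subgroup N V by (rule submodule_abelian_subgroup[OF assms(1,2)])
  note N = V.submoduleE[OF assms(2)]
  show ?thesis
  proof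
    assume "N +>\<^bsub>V\<^esub> x = N +>\<^bsub>V\<^esub> y"
    then have "x \<in> N +>\<^bsub>V\<^esub> y" using N.a_rcos_self[OF assms(3)] by simp
    then obtain n where n: "n \<in> N" "x = n \<oplus>\<^bsub>V\<^esub> y" by (auto simp: a_r_coset_def')
    then have "x \<ominus>\<^bsub>V\<^esub> y = n" using N(1) assms(4) by (auto simp: V.minus_eq V.a_assoc V.r_neg)
    then show "x \<ominus>\<^bsub>V\<^esub> y \<in> N" using n by simp
  next
    assume a: "x \<ominus>\<^bsub>V\<^esub> y \<in> N"
    have "x = (x \<ominus>\<^bsub>V\<^esub> y) \<oplus>\<^bsub>V\<^esub> y" using assms by (simp add: V.minus_eq V.a_assoc V.l_neg)
    then have "x \<in> N +>\<^bsub>V\<^esub> y" using a unfolding a_r_coset_def' by blast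
    then show "N +>\<^bsub>V\<^esub> x = N +>\<^bsub>V\<^esub> y"
      using N.a_repr_independence'[OF _ assms(4)] by simp
  qed
qed

lemma quotient_module_carrier: "carrier (quotient_module V N) = (\<lambda>x. N +>\<^bsub>V\<^esub> x) ` carrier V"
  by (auto simp: quotient_module_def FactRing_def A_RCOSETS_def')

lemma quotient_module_module:
  assumes "module K V" "submodule N K V"
  shows "module K (quotient_module V N)"
    and "linear_map K V (quotient_module V N) (\<lambda>x. N +>\<^bsub>V\<^esub> x)"
proof -
  interpret V: module K V by fact
  note [simp] = quotient_module_add_coset[OF assms] quotient_module_smult_coset[OF assms]
  have z: "\<zero>\<^bsub>quotient_module V N\<^esub> = N +>\<^bsub>V\<^esub> \<zero>\<^bsub>V\<^esub>"
  proof -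
    have "N +>\<^bsub>V\<^esub> \<zero>\<^bsub>V\<^esub> = N" using V.submoduleE(1)[OF assms(2)] by (force simp: a_r_coset_def')
    then show ?thesis by (simp add: quotient_module_def FactRing_def)
  qed
  have "abelian_group (quotient_module V N)"
  proof (rule abelian_groupI)
    fix X assume "X \<in> carrier (quotient_module V N)"
    then obtain x where x: "x \<in> carrier V" "X = N +>\<^bsub>V\<^esub> x" by (auto simp: quotient_module_carrier)
    then have "(N +>\<^bsub>V\<^esub> (\<ominus>\<^bsub>V\<^esub> x)) \<oplus>\<^bsub>quotient_module V N\<^esub> X = \<zero>\<^bsub>quotient_module V N\<^esub>" by (simp add: V.l_neg z)
    with x show "\<exists>Y\<in>carrier (quotient_module V N). Y \<oplus>\<^bsub>quotient_module V N\<^esub> X = \<zero>\<^bsub>quotient_module V N\<^esub>"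
      by (auto simp: quotient_module_carrier)
  qed (auto simp: quotient_module_carrier z V.a_ac)
  then show "module K (quotient_module V N)"
    by (intro moduleI)
       (auto simp: quotient_module_carrier V.smult_l_distr V.smult_r_distr V.smult_assoc1 V.R.is_cring)
  show "linear_map K V (quotient_module V N) (\<lambda>x. N +>\<^bsub>V\<^esub> x)"
    by (rule linear_mapI) (auto simp: quotient_module_carrier)
qed

lemma bilinear_mapI:
  assumes "\<And>v. v \<in> carrier V \<Longrightarrow> linear_map K W U (\<lambda>w. \<beta> v w)"
    "\<And>w. w \<in> carrier W \<Longrightarrow> linear_map K V U (\<lambda>v. \<beta> v w)"
  shows "bilinear_map K V W U \<beta>"
  using assms by (auto simp: bilinear_map_def)

lemma linear_map_id: "linear_map K V V (\<lambda>x. x)"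
  by (auto simp: linear_map_def)

lemma linear_map_compose:
  assumes "linear_map K V W f" "linear_map K W U g"
  shows "linear_map K V U (\<lambda>x. g (f x))"
  by (rule linear_mapI)
     (simp_all add: linear_map_closed[OF assms(1)] linear_map_closed[OF assms(2)] linear_map_add[OF assms(1)]
       linear_map_add[OF assms(2)] linear_map_smult[OF assms(1)] linear_map_smult[OF assms(2)])

lemma bilinear_map_left:
  "bilinear_map K V W U \<beta> \<Longrightarrow> linear_map K X V f \<Longrightarrow> w \<in> carrier W \<Longrightarrow> linear_map K X U (\<lambda>x. \<beta> (f x) w)"
  using linear_map_compose[of K X V f U "\<lambda>v. \<beta> v w"] by (simp add: bilinear_map_def)

lemma bilinear_map_right:
  "bilinear_map K V W U \<beta> \<Longrightarrow> linear_map K X W f \<Longrightarrow> v \<in> carrier V \<Longrightarrow> linear_map K X U (\<lambda>x. \<beta> v (f x))"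
  using linear_map_compose[of K X W f U "\<beta> v"] by (simp add: bilinear_map_def)

section \<open>The tensor product of two vector spaces and its generation by pure tensors\<close>

locale vector_space_pair = K: field K + V: module K V + W: module K W
  for K :: "'k ring" and V :: "('k, 'v) module" and W :: "('k, 'w) module"
begin

abbreviation F where "F \<equiv> free_module K (carrier V \<times> carrier W)"
abbreviation T where "T \<equiv> tensor_product K V W"

lemma F_module: "module K F"
  by (rule free_module_module[OF K.is_cring])

lemma T_module: "module K T"
  unfolding tensor_product_def
  by (rule quotient_module_module(1)[OF F_module tensor_kernel_submodule[OF V.module_axioms W.module_axioms]])

lemma free_basis_pair: "v \<in> carrier V \<Longrightarrow> w \<in> carrier W \<Longrightarrow> free_basis K (v, w) \<in> carrier F"
  by (rule free_basis_closed[OF K.is_cring]) auto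

lemma pure_tensor_closed: "v \<in> carrier V \<Longrightarrow> w \<in> carrier W \<Longrightarrow> pure_tensor K V W v w \<in> carrier T"
  using free_basis_pair by (auto simp: tensor_product_carrier pure_tensor_def)

lemma tensor_relation:
  assumes "f \<in> carrier F" "g \<in> carrier F" "f \<ominus>\<^bsub>F\<^esub> g \<in> tensor_relators K V W"
  shows "tensor_kernel K V W +>\<^bsub>F\<^esub> f = tensor_kernel K V W +>\<^bsub>F\<^esub> g"
  using assms submodule_span_subset[of "tensor_relators K V W" K F]
  by (subst coset_eq_iff[OF F_module tensor_kernel_submodule[OF V.module_axioms W.module_axioms]])
     (auto simp: tensor_kernel_def)

lemma pure_tensor_bilinear: "bilinear_map K V W T (pure_tensor K V W)"
proof -
  interpret F: module K F by (rule F_module)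
  note sub = tensor_kernel_submodule[OF V.module_axioms W.module_axioms]
  note ac = quotient_module_add_coset[OF F_module sub, folded tensor_product_def]
    and sc = quotient_module_smult_coset[OF F_module sub, folded tensor_product_def]
  note b = free_basis_pair
  show ?thesis
  proof (rule bilinear_mapI)
    fix v assume v: "v \<in> carrier V"
    show "linear_map K W T (\<lambda>w. pure_tensor K V W v w)"
    proof (rule linear_mapI)
      fix x y assume xy: "x \<in> carrier W" "y \<in> carrier W"
      show "pure_tensor K V W v (x \<oplus>\<^bsub>W\<^esub> y) = pure_tensor K V W v x \<oplus>\<^bsub>T\<^esub> pure_tensor K V W v y"
        unfolding pure_tensor_def ac[OF b[OF v xy(1)] b[OF v xy(2)]]
        by (rule tensor_relation)
           (use v xy b in \<open>auto simp: tensor_relators_def Let_def\<close>)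
    next
      fix c x assume cx: "c \<in> carrier K" "x \<in> carrier W"
      show "pure_tensor K V W v (c \<odot>\<^bsub>W\<^esub> x) = c \<odot>\<^bsub>T\<^esub> pure_tensor K V W v x"
        unfolding pure_tensor_def sc[OF cx(1) b[OF v cx(2)]]
        by (rule tensor_relation)
           (use v cx b in \<open>auto simp: tensor_relators_def Let_def\<close>)
    qed (use v pure_tensor_closed in auto)
  next
    fix w assume w: "w \<in> carrier W"
    show "linear_map K V T (\<lambda>v. pure_tensor K V W v w)"
    proof (rule linear_mapI)
      fix x y assume xy: "x \<in> carrier V" "y \<in> carrier V"
      show "pure_tensor K V W (x \<oplus>\<^bsub>V\<^esub> y) w = pure_tensor K V W x w \<oplus>\<^bsub>T\<^esub> pure_tensor K V W y w"
        unfolding pure_tensor_def ac[OF b[OF xy(1) w] b[OF xy(2) w]]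
        by (rule tensor_relation)
           (use w xy b in \<open>auto simp: tensor_relators_def Let_def\<close>)
    next
      fix c x assume cx: "c \<in> carrier K" "x \<in> carrier V"
      show "pure_tensor K V W (c \<odot>\<^bsub>V\<^esub> x) w = c \<odot>\<^bsub>T\<^esub> pure_tensor K V W x w"
        unfolding pure_tensor_def sc[OF cx(1) b[OF cx(2) w]]
        by (rule tensor_relation)
           (use w cx b in \<open>auto simp: tensor_relators_def Let_def\<close>)
    qed (use w pure_tensor_closed in auto)
  qed
qed

text \<open>Pulled back to the free module, the claim follows by induction on a finite set that
  contains the support: subtracting \<open>f x\<close> times the basis element at \<open>x\<close>
  clears one point.\<close>

lemma tensor_span:
  assumes N: "submodule N K T" and p: "\<And>v w. v \<in> carrier V \<Longrightarrow> w \<in> carrier W \<Longrightarrow> pure_tensor K V W v w \<in> N"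
  shows "carrier T \<subseteq> N"
proof -
  interpret F: vector_space K F by (simp add: vector_space_def K.field_axioms F_module)
  note sub = tensor_kernel_submodule[OF V.module_axioms W.module_axioms]
  let ?q = "\<lambda>f. tensor_kernel K V W +>\<^bsub>F\<^esub> f"
  have q: "linear_map K F T ?q" using quotient_module_module(2)[OF F_module sub] by (simp add: tensor_product_def)
  define N' where "N' = {f \<in> carrier F. ?q f \<in> N}"
  have N': "submodule N' K F" unfolding N'_def
    by (rule linear_map_vimage_submodule[OF F_module T_module q N])
  have bN: "free_basis K (v, w) \<in> N'" if "v \<in> carrier V" "w \<in> carrier W" for v w
    using p[OF that] free_basis_pair[OF that] by (simp add: N'_def pure_tensor_def)
  have "f \<in> N'" if "finite B" "f \<in> carrier F" "{x. f x \<noteq> \<zero>\<^bsub>K\<^esub>} \<subseteq> B" for f B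
    using that
  proof (induction arbitrary: f rule: finite_induct)
    case empty
    then have "f = \<zero>\<^bsub>F\<^esub>" by (auto simp: free_module_def fun_eq_iff)
    then show ?case using F.subspaceD(3)[OF N'] by simp
  next
    case (insert x B)
    show ?case
    proof (cases "x \<in> carrier V \<times> carrier W")
      case True
      then have fx: "f x \<in> carrier K" using insert.prems(1) by (auto simp: free_module_carrier_iff)
      have e: "f x \<odot>\<^bsub>F\<^esub> free_basis K x \<in> N'"
        using bN True by (intro F.subspaceD(7)[OF N' fx]) auto
      define g where "g = f \<ominus>\<^bsub>F\<^esub> f x \<odot>\<^bsub>F\<^esub> free_basis K x"
      have g: "g \<in> carrier F" using insert.prems(1) F.subspaceD(2)[OF N' e] by (simp add: g_def)
      have fg: "f = g \<oplus>\<^bsub>F\<^esub> f x \<odot>\<^bsub>F\<^esub> free_basis K x"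
        using F.add_minus_cancel(3)[OF insert.prems(1) F.subspaceD(2)[OF N' e]] by (simp add: g_def)
      have gy: "f y = g y \<oplus>\<^bsub>K\<^esub> f x \<otimes>\<^bsub>K\<^esub> free_basis K x y" for y
        by (subst fg) (simp add: free_module_def)
      have gK: "g y \<in> carrier K" for y using g unfolding free_module_carrier_iff by blast
      have "g y = \<zero>\<^bsub>K\<^esub>" if "y \<notin> B" for y
      proof (cases "y = x")
        case True
        have "f x = g x \<oplus>\<^bsub>K\<^esub> f x" using gy[of x] fx by (simp add: free_basis_def)
        then show ?thesis using True fx gK by (metis K.add.r_cancel_one')
      next
        case False
        then have "f y = g y" using gy[of y] fx gK[of y] by (simp add: free_basis_def)
        moreover have "f y = \<zero>\<^bsub>K\<^esub>" using insert.prems(2) that False by blast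
        ultimately show ?thesis by simp
      qed
      then have "g \<in> N'" by (intro insert.IH[OF g]) blast
      then show ?thesis using fg e F.subspaceD(4)[OF N'] by metis
    next
      case False
      then have "f x = \<zero>\<^bsub>K\<^esub>" using insert.prems(1) unfolding free_module_carrier_iff by blast
      then show ?thesis using insert.IH[OF insert.prems(1)] insert.prems(2) by blast
    qed
  qed
  then have "f \<in> N'" if "f \<in> carrier F" for f
    using that by (auto simp: free_module_carrier_iff)
  then show ?thesis by (auto simp: tensor_product_carrier N'_def)
qed

lemma tensor_linear_eqI:
  assumes "module K U" "linear_map K T U f" "linear_map K T U g" "t \<in> carrier T"
    "\<And>v w. v \<in> carrier V \<Longrightarrow> w \<in> carrier W \<Longrightarrow> f (pure_tensor K V W v w) = g (pure_tensor K V W v w)"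
  shows "f t = g t"
proof -
  interpret T: vector_space K T by (simp add: vector_space_def K.field_axioms T_module)
  interpret U: module K U by fact
  have "submodule {t \<in> carrier T. f t = g t} K T"
    by (rule T.subspaceI)
       (auto simp: linear_map_add[OF assms(2)] linear_map_add[OF assms(3)] linear_map_smult[OF assms(2)]
         linear_map_smult[OF assms(3)] linear_map_zero[OF T_module assms(1,2)] linear_map_zero[OF T_module assms(1,3)])
  then have "carrier T \<subseteq> {t \<in> carrier T. f t = g t}"
    by (rule tensor_span) (use assms(5) pure_tensor_closed in auto)
  then show ?thesis using assms(4) by auto
qed

end

section \<open>Rules for lifts from a tensor product\<close>

lemma (in abelian_monoid) finsum_swap:
  assumes "finite I" "finite J" "\<And>i j. i \<in> I \<Longrightarrow> j \<in> J \<Longrightarrow> f i j \<in> carrier G"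
  shows "(\<Oplus>i\<in>I. \<Oplus>j\<in>J. f i j) = (\<Oplus>j\<in>J. \<Oplus>i\<in>I. f i j)"
  using assms(1,3)
proof (induction rule: finite_induct)
  case (insert x F)
  have c: "(\<lambda>i. \<Oplus>j\<in>J. f i j) \<in> F \<rightarrow> carrier G" "(\<Oplus>j\<in>J. f x j) \<in> carrier G"
    "f x \<in> J \<rightarrow> carrier G" "(\<lambda>j. \<Oplus>i\<in>F. f i j) \<in> J \<rightarrow> carrier G"
    using insert.prems by (auto intro!: finsum_closed)
  have "(\<Oplus>i\<in>insert x F. \<Oplus>j\<in>J. f i j) = (\<Oplus>j\<in>J. f x j \<oplus> (\<Oplus>i\<in>F. f i j))"
    using insert c by (simp add: finsum_addf)
  also have "\<dots> = (\<Oplus>j\<in>J. \<Oplus>i\<in>insert x F. f i j)"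
    using insert by (intro finsum_cong') (auto intro!: finsum_closed)
  finally show ?case .
qed simp

lemma tensor_lift_closed:
  assumes "module K V" "module K W" "module K U" "t \<in> carrier (tensor_product K V W)"
    "\<And>v w. v \<in> carrier V \<Longrightarrow> w \<in> carrier W \<Longrightarrow> \<beta> v w \<in> carrier U"
  shows "tensor_lift K U \<beta> t \<in> carrier U"
  by (rule tensor_lift_in_submodule[OF assms(1-3) module.carrier_is_submodule[OF assms(3)] assms(4,5)])

lemma tensor_lift_cong:
  assumes "module K V" "module K W" "module K U" "t \<in> carrier (tensor_product K V W)"
    "\<And>v w. v \<in> carrier V \<Longrightarrow> w \<in> carrier W \<Longrightarrow> \<beta> v w \<in> carrier U"
    "\<And>v w. v \<in> carrier V \<Longrightarrow> w \<in> carrier W \<Longrightarrow> \<beta>' v w = \<beta> v w"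
  shows "tensor_lift K U \<beta>' t = tensor_lift K U \<beta> t"
  using tensor_lift_comp[OF assms(1-3,3) linear_map_id assms(4,5,6)] by simp

text \<open>The representative in \<open>tensor_lift\<close> is chosen from \<open>t\<close> alone,
  whatever map is lifted. The value is thus one fixed finite combination of the
  \<open>\<gamma> x v w\<close>, and linearity in \<open>x\<close> passes through it term by
  term.\<close>

lemma tensor_lift_param_linear:
  assumes "module K V" "module K W" "module K U" "module K X" "t \<in> carrier (tensor_product K V W)"
    "\<And>v w. v \<in> carrier V \<Longrightarrow> w \<in> carrier W \<Longrightarrow> linear_map K X U (\<lambda>x. \<gamma> x v w)"
  shows "linear_map K X U (\<lambda>x. tensor_lift K U (\<lambda>v w. \<gamma> x v w) t)"
proof -
  let ?f = "SOME f. f \<in> t"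
  have f: "?f \<in> carrier (free_module K (carrier V \<times> carrier W))" by (rule tensor_product_rep[OF assms(1,2,5)])
  then have B: "finite {p. ?f p \<noteq> \<zero>\<^bsub>K\<^esub>}" "{p. ?f p \<noteq> \<zero>\<^bsub>K\<^esub>} \<subseteq> carrier V \<times> carrier W" and fK: "\<And>p. ?f p \<in> carrier K"
    by (auto simp: free_module_carrier_iff)
  show ?thesis unfolding tensor_lift_def Let_def
    by (rule finsum_linear_map[OF assms(4,3) B(1)], rule linear_map_scale[OF assms(4,3)])
       (use B fK assms(6) in auto)
qed

lemma tensor_lift_swap:
  assumes "module K V" "module K W" "module K U" "module K V'" "module K W'"
    "t \<in> carrier (tensor_product K V W)" "s \<in> carrier (tensor_product K V' W')"
    "\<And>v w v' w'. v \<in> carrier V \<Longrightarrow> w \<in> carrier W \<Longrightarrow> v' \<in> carrier V' \<Longrightarrow> w' \<in> carrier W' \<Longrightarrow>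
      \<gamma> v w v' w' \<in> carrier U"
  shows "tensor_lift K U (\<lambda>v w. tensor_lift K U (\<lambda>v' w'. \<gamma> v w v' w') s) t =
    tensor_lift K U (\<lambda>v' w'. tensor_lift K U (\<lambda>v w. \<gamma> v w v' w') t) s"
proof -
  interpret U: module K U by fact
  let ?f = "SOME f. f \<in> t" and ?g = "SOME f. f \<in> s"
  let ?B = "{p. ?f p \<noteq> \<zero>\<^bsub>K\<^esub>}" and ?C = "{p. ?g p \<noteq> \<zero>\<^bsub>K\<^esub>}"
  have B: "finite ?B" "?B \<subseteq> carrier V \<times> carrier W" and fK: "\<And>p. ?f p \<in> carrier K"
    using tensor_product_rep[OF assms(1,2,6)] by (auto simp: free_module_carrier_iff)
  have C: "finite ?C" "?C \<subseteq> carrier V' \<times> carrier W'" and gK: "\<And>p. ?g p \<in> carrier K"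
    using tensor_product_rep[OF assms(4,5,7)] by (auto simp: free_module_carrier_iff)
  let ?\<gamma> = "\<lambda>p q. \<gamma> (fst p) (snd p) (fst q) (snd q)"
  have g: "?\<gamma> p q \<in> carrier U" if "p \<in> ?B" "q \<in> ?C" for p q using subsetD[OF B(2) that(1)] subsetD[OF C(2) that(2)] by (simp add: mem_Times_iff assms(8))
  have "tensor_lift K U (\<lambda>v w. tensor_lift K U (\<lambda>v' w'. \<gamma> v w v' w') s) t =
    (\<Oplus>\<^bsub>U\<^esub>p\<in>?B. \<Oplus>\<^bsub>U\<^esub>q\<in>?C. ?f p \<odot>\<^bsub>U\<^esub> (?g q \<odot>\<^bsub>U\<^esub> ?\<gamma> p q))"
    unfolding tensor_lift_def Let_def
    by (rule U.M.finsum_cong')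
       (use fK gK g C in \<open>auto intro!: U.finsum_smult_ldistr U.M.finsum_closed\<close>)
  also have "\<dots> = (\<Oplus>\<^bsub>U\<^esub>q\<in>?C. \<Oplus>\<^bsub>U\<^esub>p\<in>?B. ?f p \<odot>\<^bsub>U\<^esub> (?g q \<odot>\<^bsub>U\<^esub> ?\<gamma> p q))"
    by (rule U.M.finsum_swap) (use B C fK gK g in auto)
  also have "\<dots> = (\<Oplus>\<^bsub>U\<^esub>q\<in>?C. ?g q \<odot>\<^bsub>U\<^esub> (\<Oplus>\<^bsub>U\<^esub>p\<in>?B. ?f p \<odot>\<^bsub>U\<^esub> ?\<gamma> p q))"
  proof (rule U.M.finsum_cong')
    fix q assume q: "q \<in> ?C"
    have "(\<Oplus>\<^bsub>U\<^esub>p\<in>?B. ?f p \<odot>\<^bsub>U\<^esub> (?g q \<odot>\<^bsub>U\<^esub> ?\<gamma> p q)) = (\<Oplus>\<^bsub>U\<^esub>p\<in>?B. ?g q \<odot>\<^bsub>U\<^esub> (?f p \<odot>\<^bsub>U\<^esub> ?\<gamma> p q))"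
      using g[OF _ q] fK gK
      by (intro U.M.finsum_cong') (auto simp: U.R.m_comm simp flip: U.smult_assoc1)
    then show "(\<Oplus>\<^bsub>U\<^esub>p\<in>?B. ?f p \<odot>\<^bsub>U\<^esub> (?g q \<odot>\<^bsub>U\<^esub> ?\<gamma> p q)) = ?g q \<odot>\<^bsub>U\<^esub> (\<Oplus>\<^bsub>U\<^esub>p\<in>?B. ?f p \<odot>\<^bsub>U\<^esub> ?\<gamma> p q)"
      using g[OF _ q] fK gK B by (subst U.finsum_smult_ldistr) auto
  qed (use B C fK gK g in \<open>auto intro!: U.M.finsum_closed\<close>)
  also have "\<dots> = tensor_lift K U (\<lambda>v' w'. tensor_lift K U (\<lambda>v w. \<gamma> v w v' w') t) s"
    unfolding tensor_lift_def Let_def ..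
  finally show ?thesis .
qed

section \<open>Sweedler calculus\<close>

text \<open>The pairs in the chosen representative of \<open>t\<close>, that is, finitely many legs
  in Sweedler notation. The set depends on the choice, but every lift at \<open>t\<close> is
  computed from these pairs.\<close>

definition tensor_support :: "'k ring \<Rightarrow> ('v \<times> 'w \<Rightarrow> 'k) set \<Rightarrow> ('v \<times> 'w) set"
  where "tensor_support K t = {p. (SOME f. f \<in> t) p \<noteq> \<zero>\<^bsub>K\<^esub>}"

lemma tensor_support:
  assumes "module K V" "module K W" "t \<in> carrier (tensor_product K V W)"
  shows "finite (tensor_support K t)" "tensor_support K t \<subseteq> carrier V \<times> carrier W"
  using tensor_product_rep[OF assms] by (auto simp: free_module_carrier_iff tensor_support_def)

lemma tensor_lift_support_cong:
  assumes "module K V" "module K W" "module K U" "t \<in> carrier (tensor_product K V W)"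
    "\<And>v w. (v, w) \<in> tensor_support K t \<Longrightarrow> \<beta> v w \<in> carrier U"
    "\<And>v w. (v, w) \<in> tensor_support K t \<Longrightarrow> \<beta>' v w = \<beta> v w"
  shows "tensor_lift K U \<beta>' t = tensor_lift K U \<beta> t"
proof -
  interpret U: module K U by fact
  have "(SOME f. f \<in> t) p \<in> carrier K" for p
    using tensor_product_rep[OF assms(1,2,4)] unfolding free_module_carrier_iff by blast
  then show ?thesis
    unfolding tensor_lift_def Let_def
    by (intro U.M.finsum_cong') (use assms(5,6) in \<open>auto simp: tensor_support_def\<close>)
qed

lemma tensor_lift_support_in:
  assumes "module K V" "module K W" "module K U" "t \<in> carrier (tensor_product K V W)" "submodule N K U"
    "\<And>v w. (v, w) \<in> tensor_support K t \<Longrightarrow> \<beta> v w \<in> N"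
  shows "tensor_lift K U \<beta> t \<in> N"
proof -
  interpret U: module K U by fact
  note N = U.submoduleE[OF assms(5)]
  have "tensor_lift K U (\<lambda>v w. if (v, w) \<in> tensor_support K t then \<beta> v w else \<zero>\<^bsub>U\<^esub>) t \<in> N"
  proof (rule tensor_lift_in_submodule[OF assms(1-3,5,4)])
    have "\<zero>\<^bsub>U\<^esub> \<in> N" using assms(5) by (metis submodule.axioms(1) subgroup.one_closed monoid.simps(2))
    then show "(if (v, w) \<in> tensor_support K t then \<beta> v w else \<zero>\<^bsub>U\<^esub>) \<in> N" for v w using assms(6) by simp
  qed
  then show ?thesis
    using tensor_lift_support_cong[OF assms(1-4), of \<beta> "\<lambda>v w. if (v, w) \<in> tensor_support K t then \<beta> v w else \<zero>\<^bsub>U\<^esub>"]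
      assms(6) N(1) by (simp add: subset_iff)
qed

context hopf_algebra
begin

abbreviation hopf_mult (infixl "\<star>" 70)
  where "x \<star> y \<equiv> x \<otimes>\<^bsub>H\<^esub> y"

abbreviation sw :: "('k, 'u) module \<Rightarrow> ('h \<Rightarrow> 'h \<Rightarrow> 'u) \<Rightarrow> 'h \<Rightarrow> 'u"
  where "sw U \<beta> h \<equiv> tensor_lift K U \<beta> (\<Delta> h)"

sublocale HH: vector_space_pair K H H
  by unfold_locales

lemma H_module: "module K H" and H_vector_space: "vector_space K H"
  using module_axioms K.field_axioms by (auto simp: vector_space_def)

lemma comult_closed [simp]: "h \<in> carrier H \<Longrightarrow> \<Delta> h \<in> carrier (tensor_product K H H)"
  using linear_map_closed[OF comult_linear] .

lemma counit_closed [simp]: "h \<in> carrier H \<Longrightarrow> \<epsilon> h \<in> carrier K"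
  using linear_map_closed[OF counit_linear] by (simp add: scalar_module_def)

lemma antipode_closed [simp]: "h \<in> carrier H \<Longrightarrow> S h \<in> carrier H"
  using linear_map_closed[OF antipode_linear] .

lemma mult_bilinear: "bilinear_map K H H H (\<star>)"
  by (rule bilinear_mapI; rule linear_mapI)
     (simp_all add: A.r_distr A.l_distr smult_mult_left smult_mult_right)

lemma linear_counit_smult:
  "module K U \<Longrightarrow> linear_map K X H f \<Longrightarrow> u \<in> carrier U \<Longrightarrow> linear_map K X U (\<lambda>x. \<epsilon> (f x) \<odot>\<^bsub>U\<^esub> u)"
  by (rule linear_map_compose[OF _ functional_smult_linear[OF H_module _ counit_linear]])

lemma linear_sw:
  "module K U \<Longrightarrow> linear_map K X H f \<Longrightarrow> bilinear_map K H H U \<beta> \<Longrightarrow> linear_map K X U (\<lambda>x. sw U \<beta> (f x))"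
  by (rule linear_map_compose[OF linear_map_compose[OF _ comult_linear] tensor_lift_linear[OF H_module H_module]])

lemma linear_sw_param:
  assumes "module K U" "module K X" "h \<in> carrier H"
    "\<And>p q. p \<in> carrier H \<Longrightarrow> q \<in> carrier H \<Longrightarrow> linear_map K X U (\<lambda>x. \<gamma> x p q)"
  shows "linear_map K X U (\<lambda>x. sw U (\<lambda>p q. \<gamma> x p q) h)"
  by (rule tensor_lift_param_linear[OF H_module H_module assms(1,2) comult_closed[OF assms(3)] assms(4)])

text \<open>Introduction rules that follow the structure of a Sweedler expression. They discharge
  the linearity conditions under which coassociativity and the laws of counit and antipode may be
  applied inside such an expression.\<close>

lemmas lin = linear_map_id bilinear_map_left[OF mult_bilinear] bilinear_map_right[OF mult_bilinear]
  linear_map_compose[OF _ antipode_linear] linear_counit_smult linear_sw linear_sw_param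

lemma sw_closed:
  "module K U \<Longrightarrow> h \<in> carrier H \<Longrightarrow>
    (\<And>x y. x \<in> carrier H \<Longrightarrow> y \<in> carrier H \<Longrightarrow> \<beta> x y \<in> carrier U) \<Longrightarrow> sw U \<beta> h \<in> carrier U"
  by (rule tensor_lift_closed[OF H_module H_module]) auto

lemma sw_cong:
  "module K U \<Longrightarrow> h \<in> carrier H \<Longrightarrow>
    (\<And>x y. x \<in> carrier H \<Longrightarrow> y \<in> carrier H \<Longrightarrow> \<beta> x y \<in> carrier U) \<Longrightarrow>
    (\<And>x y. x \<in> carrier H \<Longrightarrow> y \<in> carrier H \<Longrightarrow> \<beta> x y = \<beta>' x y) \<Longrightarrow> sw U \<beta> h = sw U \<beta>' h"
  by (rule tensor_lift_cong[OF H_module H_module, symmetric]) auto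

lemma sw_comp:
  "module K U \<Longrightarrow> module K U' \<Longrightarrow> linear_map K U U' \<phi> \<Longrightarrow> h \<in> carrier H \<Longrightarrow>
    (\<And>x y. x \<in> carrier H \<Longrightarrow> y \<in> carrier H \<Longrightarrow> \<beta> x y \<in> carrier U) \<Longrightarrow>
    \<phi> (sw U \<beta> h) = sw U' (\<lambda>x y. \<phi> (\<beta> x y)) h"
  by (rule tensor_lift_comp[OF H_module H_module, symmetric]) auto

lemma sw_swap:
  assumes "module K U" "h \<in> carrier H" "g \<in> carrier H"
    "\<And>x y u v. x \<in> carrier H \<Longrightarrow> y \<in> carrier H \<Longrightarrow> u \<in> carrier H \<Longrightarrow> v \<in> carrier H \<Longrightarrow> \<gamma> x y u v \<in> carrier U"
  shows "sw U (\<lambda>x y. sw U (\<lambda>u v. \<gamma> x y u v) g) h = sw U (\<lambda>u v. sw U (\<lambda>x y. \<gamma> x y u v) h) g"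
  using assms by (intro tensor_lift_swap[OF H_module H_module _ H_module H_module]) auto

lemma sw_one:
  "module K U \<Longrightarrow> bilinear_map K H H U \<beta> \<Longrightarrow> sw U \<beta> \<one>\<^bsub>H\<^esub> = \<beta> \<one>\<^bsub>H\<^esub> \<one>\<^bsub>H\<^esub>"
  by (simp add: comult_one tensor_lift_pure_tensor[OF H_module H_module])

text \<open>\<open>comult_mult\<close> is an identity in the tensor square of \<open>H\<close>; the
  lift of \<open>\<beta>\<close> is applied to both of its sides and moved inside the two
  sums.\<close>

lemma sw_mult:
  assumes "module K U" "bilinear_map K H H U \<beta>" "h \<in> carrier H" "g \<in> carrier H"
  shows "sw U \<beta> (h \<star> g) =
    sw U (\<lambda>h1 h2. sw U (\<lambda>g1 g2. \<beta> (h1 \<star> g1) (h2 \<star> g2)) g) h"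
proof -
  let ?L = "tensor_lift K U \<beta>"
  have L: "linear_map K HH.T U ?L" by (rule tensor_lift_linear[OF H_module H_module assms(1,2)])
  have "?L (\<Delta> (h \<star> g)) = sw U (\<lambda>h1 h2. ?L (sw HH.T (\<lambda>g1 g2. pure_tensor K H H (h1 \<star> g1) (h2 \<star> g2)) g)) h"
    unfolding comult_mult[OF assms(3,4)]
    by (rule sw_comp[OF HH.T_module assms(1) L assms(3)])
       (auto intro!: sw_closed HH.T_module HH.pure_tensor_closed assms(4))
  also have "\<dots> = sw U (\<lambda>h1 h2. sw U (\<lambda>g1 g2. \<beta> (h1 \<star> g1) (h2 \<star> g2)) g) h"
  proof (rule sw_cong[OF assms(1,3)])
    fix x y assume xy: "x \<in> carrier H" "y \<in> carrier H"
    show "?L (sw HH.T (\<lambda>g1 g2. pure_tensor K H H (x \<star> g1) (y \<star> g2)) g) \<in> carrier U"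
      by (rule linear_map_closed[OF L])
         (auto intro!: sw_closed HH.T_module HH.pure_tensor_closed assms(4) xy)
    have "?L (sw HH.T (\<lambda>g1 g2. pure_tensor K H H (x \<star> g1) (y \<star> g2)) g) =
      sw U (\<lambda>g1 g2. ?L (pure_tensor K H H (x \<star> g1) (y \<star> g2))) g"
      by (rule sw_comp[OF HH.T_module assms(1) L assms(4)])
         (auto intro!: HH.pure_tensor_closed xy)
    also have "\<dots> = sw U (\<lambda>g1 g2. \<beta> (x \<star> g1) (y \<star> g2)) g"
      by (rule sw_cong[OF assms(1,4)])
         (simp_all add: xy tensor_lift_pure_tensor[OF H_module H_module assms(1,2)] bilinear_map_closed[OF assms(2)])
    finally show "?L (sw HH.T (\<lambda>g1 g2. pure_tensor K H H (x \<star> g1) (y \<star> g2)) g) =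
      sw U (\<lambda>g1 g2. \<beta> (x \<star> g1) (y \<star> g2)) g" .
  qed
  finally show ?thesis .
qed

text \<open>\<open>coassoc\<close> is an identity in the triple tensor product. The trilinear
  \<open>\<gamma>\<close> is lifted in two stages, first in its last two arguments and then in the
  first one, and this lift is applied to both sides.\<close>

lemma sw_coassoc:
  assumes U: "module K U" and h: "h \<in> carrier H"
    and 1: "\<And>v y. v \<in> carrier H \<Longrightarrow> y \<in> carrier H \<Longrightarrow> linear_map K H U (\<lambda>u. \<gamma> u v y)"
    and 2: "\<And>u y. u \<in> carrier H \<Longrightarrow> y \<in> carrier H \<Longrightarrow> linear_map K H U (\<lambda>v. \<gamma> u v y)"
    and 3: "\<And>u v. u \<in> carrier H \<Longrightarrow> v \<in> carrier H \<Longrightarrow> linear_map K H U (\<lambda>y. \<gamma> u v y)"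
  shows "sw U (\<lambda>x y. sw U (\<lambda>u v. \<gamma> u v y) x) h = sw U (\<lambda>x y. sw U (\<lambda>u v. \<gamma> x u v) y) h"
proof -
  interpret HHH: vector_space_pair K H HH.T
    by (intro vector_space_pair.intro K.field_axioms H_module HH.T_module)
  let ?G = "\<lambda>u. tensor_lift K U (\<lambda>v y. \<gamma> u v y)"
  let ?p = "\<lambda>u v y. pure_tensor K H HH.T u (pure_tensor K H H v y)"
  have cl: "\<gamma> u v y \<in> carrier U" if "u \<in> carrier H" "v \<in> carrier H" "y \<in> carrier H" for u v y
    using linear_map_closed[OF 1] that by blast
  have pcl: "?p u v y \<in> carrier HHH.T" if "u \<in> carrier H" "v \<in> carrier H" "y \<in> carrier H" for u v y
    using that by (auto intro!: HHH.pure_tensor_closed HH.pure_tensor_closed)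
  have b: "bilinear_map K H H U (\<lambda>v y. \<gamma> u v y)" if "u \<in> carrier H" for u
    using 2 3 that by (intro bilinear_mapI) auto
  have G: "bilinear_map K H HH.T U ?G"
  proof (rule bilinear_mapI)
    fix u assume "u \<in> carrier H"
    then show "linear_map K HH.T U (\<lambda>t. ?G u t)" using tensor_lift_linear[OF H_module H_module U b] by blast
  next
    fix t assume "t \<in> carrier HH.T"
    then show "linear_map K H U (\<lambda>u. ?G u t)"
      by (rule tensor_lift_param_linear[OF H_module H_module U H_module]) (rule 1)
  qed
  let ?L = "tensor_lift K U ?G"
  have L: "linear_map K HHH.T U ?L" by (rule tensor_lift_linear[OF H_module HH.T_module U G])
  have ev: "?L (?p u v y) = \<gamma> u v y" if "u \<in> carrier H" "v \<in> carrier H" "y \<in> carrier H" for u v y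
    using that by (simp add: tensor_lift_pure_tensor[OF H_module HH.T_module U G]
      tensor_lift_pure_tensor[OF H_module H_module U b] HH.pure_tensor_closed)
  have "?L (sw HHH.T (\<lambda>x y. sw HHH.T (\<lambda>u v. ?p u v y) x) h) = sw U (\<lambda>x y. ?L (sw HHH.T (\<lambda>u v. ?p u v y) x)) h"
    by (rule sw_comp[OF HHH.T_module U L h]) (auto intro!: sw_closed HHH.T_module pcl)
  also have "\<dots> = sw U (\<lambda>x y. sw U (\<lambda>u v. \<gamma> u v y) x) h"
  proof (rule sw_cong[OF U h])
    fix x y assume xy: "x \<in> carrier H" "y \<in> carrier H"
    show "?L (sw HHH.T (\<lambda>u v. ?p u v y) x) \<in> carrier U"
      by (rule linear_map_closed[OF L]) (auto intro!: sw_closed HHH.T_module pcl xy)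
    have "?L (sw HHH.T (\<lambda>u v. ?p u v y) x) = sw U (\<lambda>u v. ?L (?p u v y)) x"
      by (rule sw_comp[OF HHH.T_module U L xy(1)]) (auto intro!: pcl xy)
    also have "\<dots> = sw U (\<lambda>u v. \<gamma> u v y) x"
      by (rule sw_cong[OF U xy(1)]) (simp_all add: ev xy cl)
    finally show "?L (sw HHH.T (\<lambda>u v. ?p u v y) x) = sw U (\<lambda>u v. \<gamma> u v y) x" .
  qed
  finally have l: "?L (sw HHH.T (\<lambda>x y. sw HHH.T (\<lambda>u v. ?p u v y) x) h) = sw U (\<lambda>x y. sw U (\<lambda>u v. \<gamma> u v y) x) h" .
  have "?L (sw HHH.T (\<lambda>x y. pure_tensor K H HH.T x (\<Delta> y)) h) = sw U (\<lambda>x y. ?L (pure_tensor K H HH.T x (\<Delta> y))) h"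
    by (rule sw_comp[OF HHH.T_module U L h]) (auto intro!: HHH.pure_tensor_closed)
  also have "\<dots> = sw U (\<lambda>x y. sw U (\<lambda>u v. \<gamma> x u v) y) h"
    by (rule sw_cong[OF U h])
       (simp_all add: tensor_lift_pure_tensor[OF H_module HH.T_module U G] sw_closed[OF U] cl)
  finally show ?thesis using l coassoc[OF h] by simp
qed

lemma sw_counit_right:
  assumes "module K U" "linear_map K H U \<psi>" "h \<in> carrier H"
  shows "sw U (\<lambda>x y. \<epsilon> y \<odot>\<^bsub>U\<^esub> \<psi> x) h = \<psi> h"
proof -
  have "\<psi> (sw H (\<lambda>x y. \<epsilon> y \<odot>\<^bsub>H\<^esub> x) h) = sw U (\<lambda>x y. \<psi> (\<epsilon> y \<odot>\<^bsub>H\<^esub> x)) h"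
    by (rule sw_comp[OF H_module assms]) simp
  also have "\<dots> = sw U (\<lambda>x y. \<epsilon> y \<odot>\<^bsub>U\<^esub> \<psi> x) h"
    by (rule sw_cong[OF assms(1,3)]) (simp_all add: linear_map_smult[OF assms(2)] linear_map_closed[OF assms(2)]
      module.smult_closed[OF assms(1)])
  finally show ?thesis using counit_right[OF assms(3)] by simp
qed

lemma sw_counit_left:
  assumes "module K U" "linear_map K H U \<psi>" "h \<in> carrier H"
  shows "sw U (\<lambda>x y. \<epsilon> x \<odot>\<^bsub>U\<^esub> \<psi> y) h = \<psi> h"
proof -
  have "\<psi> (sw H (\<lambda>x y. \<epsilon> x \<odot>\<^bsub>H\<^esub> y) h) = sw U (\<lambda>x y. \<psi> (\<epsilon> x \<odot>\<^bsub>H\<^esub> y)) h"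
    by (rule sw_comp[OF H_module assms]) simp
  also have "\<dots> = sw U (\<lambda>x y. \<epsilon> x \<odot>\<^bsub>U\<^esub> \<psi> y) h"
    by (rule sw_cong[OF assms(1,3)]) (simp_all add: linear_map_smult[OF assms(2)] linear_map_closed[OF assms(2)]
      module.smult_closed[OF assms(1)])
  finally show ?thesis using counit_left[OF assms(3)] by simp
qed

lemma sw_antipode_right:
  assumes "module K U" "linear_map K H U \<psi>" "h \<in> carrier H"
  shows "sw U (\<lambda>x y. \<psi> (x \<star> S y)) h = \<epsilon> h \<odot>\<^bsub>U\<^esub> \<psi> \<one>\<^bsub>H\<^esub>"
  using sw_comp[OF H_module assms, of "\<lambda>x y. x \<star> S y"] assms(3)
  by (simp add: antipode_right linear_map_smult[OF assms(2)])

lemma sw_antipode_left: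
  assumes "module K U" "linear_map K H U \<psi>" "h \<in> carrier H"
  shows "sw U (\<lambda>x y. \<psi> (S x \<star> y)) h = \<epsilon> h \<odot>\<^bsub>U\<^esub> \<psi> \<one>\<^bsub>H\<^esub>"
  using sw_comp[OF H_module assms, of "\<lambda>x y. S x \<star> y"] assms(3)
  by (simp add: antipode_left linear_map_smult[OF assms(2)])

subsection \<open>Integrals and finite dimensionality\<close>

text \<open>One half of Maschke's theorem for Hopf algebras. The kernel of \<open>\<epsilon>\<close>
  is a right ideal; the component of the identity in a complement \<open>J\<close> is an integral,
  because \<open>\<Lambda> k\<close> lies both in \<open>J\<close> and in the kernel whenever
  \<open>\<epsilon> k = 0\<close>.\<close>

lemma semisimple_integral:
  assumes "semisimple H"
  obtains \<Lambda> where "\<Lambda> \<in> carrier H" "\<epsilon> \<Lambda> = \<one>\<^bsub>K\<^esub>" "\<And>h. h \<in> carrier H \<Longrightarrow> \<Lambda> \<star> h = \<epsilon> h \<odot>\<^bsub>H\<^esub> \<Lambda>"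
proof -
  interpret vector_space K H by (rule H_vector_space)
  have eadd: "\<epsilon> (x \<oplus>\<^bsub>H\<^esub> y) = \<epsilon> x \<oplus>\<^bsub>K\<^esub> \<epsilon> y" if "x \<in> carrier H" "y \<in> carrier H" for x y
    using linear_map_add[OF counit_linear that] by (simp add: scalar_module_def)
  have esm: "\<epsilon> (c \<odot>\<^bsub>H\<^esub> x) = c \<otimes>\<^bsub>K\<^esub> \<epsilon> x" if "c \<in> carrier K" "x \<in> carrier H" for c x
    using linear_map_smult[OF counit_linear that] by (simp add: scalar_module_def)
  let ?I = "{x \<in> carrier H. \<epsilon> x = \<zero>\<^bsub>K\<^esub>}"
  have I: "submodule ?I K H"
  proof (rule subspaceI)
    have "\<epsilon> (\<zero>\<^bsub>K\<^esub> \<odot>\<^bsub>H\<^esub> \<zero>\<^bsub>H\<^esub>) = \<zero>\<^bsub>K\<^esub>" by (subst esm) auto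
    then show "\<zero>\<^bsub>H\<^esub> \<in> ?I" by simp
  qed (auto simp: eadd esm)
  have "right_ideal ?I H"
    unfolding right_ideal_def additive_subgroup_def
    using submodule.axioms(1)[OF I] by (auto simp: counit_mult)
  then obtain J where J: "right_ideal J H" "?I \<inter> J = {\<zero>\<^bsub>H\<^esub>}" "?I <+>\<^bsub>H\<^esub> J = carrier H"
    using assms unfolding semisimple_def by blast
  then have JH: "J \<subseteq> carrier H" using additive_subgroup.a_subset[of J H] by (auto simp: right_ideal_def)
  have "\<one>\<^bsub>H\<^esub> \<in> ?I <+>\<^bsub>H\<^esub> J" using J(3) by simp
  then obtain u \<Lambda> where u: "u \<in> ?I" and L: "\<Lambda> \<in> J" and one: "\<one>\<^bsub>H\<^esub> = u \<oplus>\<^bsub>H\<^esub> \<Lambda>"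
    by (auto simp: set_add_def')
  have LH: "\<Lambda> \<in> carrier H" using L JH by auto
  have "\<one>\<^bsub>K\<^esub> = \<epsilon> (u \<oplus>\<^bsub>H\<^esub> \<Lambda>)" using counit_one one by simp
  then have e: "\<epsilon> \<Lambda> = \<one>\<^bsub>K\<^esub>" using u LH by (simp add: eadd)
  show thesis
  proof (rule that[OF LH e])
    fix h assume h: "h \<in> carrier H"
    define k where "k = h \<ominus>\<^bsub>H\<^esub> \<epsilon> h \<odot>\<^bsub>H\<^esub> \<one>\<^bsub>H\<^esub>"
    have k: "k \<in> carrier H" using h by (simp add: k_def)
    have hk: "h = k \<oplus>\<^bsub>H\<^esub> \<epsilon> h \<odot>\<^bsub>H\<^esub> \<one>\<^bsub>H\<^esub>" using h by (simp add: k_def add_minus_cancel)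
    have "\<epsilon> h = \<epsilon> (k \<oplus>\<^bsub>H\<^esub> \<epsilon> h \<odot>\<^bsub>H\<^esub> \<one>\<^bsub>H\<^esub>)" by (subst (1) hk) simp
    then have "\<epsilon> h = \<epsilon> k \<oplus>\<^bsub>K\<^esub> \<epsilon> h" using k h by (simp add: eadd esm counit_one)
    then have "\<epsilon> k = \<zero>\<^bsub>K\<^esub>" using k h by (metis K.add.r_cancel_one' counit_closed)
    then have "\<Lambda> \<star> k \<in> ?I \<inter> J" using J(1) L LH k by (auto simp: right_ideal_def counit_mult)
    then have "\<Lambda> \<star> k = \<zero>\<^bsub>H\<^esub>" using J(2) by auto
    then have "\<Lambda> \<star> (k \<oplus>\<^bsub>H\<^esub> \<epsilon> h \<odot>\<^bsub>H\<^esub> \<one>\<^bsub>H\<^esub>) = \<epsilon> h \<odot>\<^bsub>H\<^esub> \<Lambda>"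
      using k h LH by (simp add: A.r_distr smult_mult_right)
    then show "\<Lambda> \<star> h = \<epsilon> h \<odot>\<^bsub>H\<^esub> \<Lambda>" using hk by simp
  qed
qed

text \<open>Write \<open>h\<close> as \<open>h1 \<epsilon>(h2)\<close> and replace
  \<open>\<epsilon>(h2)\<close> by \<open>h2 S(h3)\<close> behind the second leg of
  \<open>\<Lambda>\<close>. The factors \<open>h1\<close> and \<open>h2\<close> behind the two legs
  then form the coproduct of \<open>\<Lambda> h1\<close>, which is \<open>\<epsilon>(h1)\<close>
  times the coproduct of \<open>\<Lambda>\<close>, and just \<open>S(h)\<close> remains on the
  right.\<close>

lemma integral_shift:
  assumes "\<Lambda> \<in> carrier H" "\<And>h. h \<in> carrier H \<Longrightarrow> \<Lambda> \<star> h = \<epsilon> h \<odot>\<^bsub>H\<^esub> \<Lambda>"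
    and U: "module K U" and b: "bilinear_map K H H U \<beta>" and h: "h \<in> carrier H"
  shows "sw U (\<lambda>x y. \<beta> (x \<star> h) y) \<Lambda> = sw U (\<lambda>x y. \<beta> x (y \<star> S h)) \<Lambda>"
proof -
  note L = assms(1) and bl = bilinear_map_left[OF b] bilinear_map_right[OF b] and bc = bilinear_map_closed[OF b]
  note U' = module.smult_closed[OF U]
  let ?\<gamma> = "\<lambda>p r s. sw U (\<lambda>x y. \<beta> (x \<star> p) (y \<star> (r \<star> S s))) \<Lambda>"
  have "sw U (\<lambda>x y. \<beta> (x \<star> h) y) \<Lambda> = sw U (\<lambda>p q. \<epsilon> q \<odot>\<^bsub>U\<^esub> sw U (\<lambda>x y. \<beta> (x \<star> p) y) \<Lambda>) h"
    by (rule sw_counit_right[OF U _ h, symmetric]) (intro lin bl U H_module L; simp)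
  also have "\<dots> = sw U (\<lambda>p q. sw U (\<lambda>r s. ?\<gamma> p r s) q) h"
  proof (rule sw_cong[OF U h])
    fix p q assume pq: "p \<in> carrier H" "q \<in> carrier H"
    show "\<epsilon> q \<odot>\<^bsub>U\<^esub> sw U (\<lambda>x y. \<beta> (x \<star> p) y) \<Lambda> \<in> carrier U"
      using pq L by (intro U' sw_closed U bc) auto
    have "sw U (\<lambda>r s. ?\<gamma> p r s) q = \<epsilon> q \<odot>\<^bsub>U\<^esub> sw U (\<lambda>x y. \<beta> (x \<star> p) (y \<star> \<one>\<^bsub>H\<^esub>)) \<Lambda>"
      by (rule sw_antipode_right[OF U _ pq(2), of "\<lambda>z. sw U (\<lambda>x y. \<beta> (x \<star> p) (y \<star> z)) \<Lambda>"])
         (intro lin bl U H_module L; simp add: pq)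
    also have "sw U (\<lambda>x y. \<beta> (x \<star> p) (y \<star> \<one>\<^bsub>H\<^esub>)) \<Lambda> = sw U (\<lambda>x y. \<beta> (x \<star> p) y) \<Lambda>"
      by (rule sw_cong[OF U L]) (simp_all add: bc pq)
    finally show "\<epsilon> q \<odot>\<^bsub>U\<^esub> sw U (\<lambda>x y. \<beta> (x \<star> p) y) \<Lambda> = sw U (\<lambda>r s. ?\<gamma> p r s) q" by simp
  qed
  also have "\<dots> = sw U (\<lambda>p q. sw U (\<lambda>r s. ?\<gamma> r s q) p) h"
    by (rule sw_coassoc[OF U h, symmetric]) (intro lin bl U H_module L; simp)+
  also have "\<dots> = sw U (\<lambda>p q. \<epsilon> p \<odot>\<^bsub>U\<^esub> sw U (\<lambda>x y. \<beta> x (y \<star> S q)) \<Lambda>) h"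
  proof (rule sw_cong[OF U h])
    fix p q assume pq: "p \<in> carrier H" "q \<in> carrier H"
    show "sw U (\<lambda>r s. ?\<gamma> r s q) p \<in> carrier U" using pq L by (intro sw_closed U bc) auto
    have bq: "bilinear_map K H H U (\<lambda>x y. \<beta> x (y \<star> S q))"
      by (intro bilinear_mapI lin bl; simp add: pq)
    have "sw U (\<lambda>r s. ?\<gamma> r s q) p = sw U (\<lambda>x y. sw U (\<lambda>r s. \<beta> (x \<star> r) (y \<star> (s \<star> S q))) p) \<Lambda>"
      using pq L by (intro sw_swap U bc) auto
    also have "\<dots> = sw U (\<lambda>x y. sw U (\<lambda>r s. \<beta> (x \<star> r) ((y \<star> s) \<star> S q)) p) \<Lambda>"
      by (rule sw_cong[OF U L], (rule sw_closed[OF U pq(1)], (simp add: bc pq)),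
          (rule sw_cong[OF U pq(1)], simp_all add: bc pq A.m_assoc))
    also have "\<dots> = sw U (\<lambda>x y. \<beta> x (y \<star> S q)) (\<Lambda> \<star> p)"
      by (rule sw_mult[OF U bq L pq(1), symmetric])
    also have "\<dots> = \<epsilon> p \<odot>\<^bsub>U\<^esub> sw U (\<lambda>x y. \<beta> x (y \<star> S q)) \<Lambda>"
      using linear_map_smult[OF linear_sw[OF U linear_map_id bq] counit_closed[OF pq(1)] L]
      by (simp add: assms(2) pq)
    finally show "sw U (\<lambda>r s. ?\<gamma> r s q) p = \<epsilon> p \<odot>\<^bsub>U\<^esub> sw U (\<lambda>x y. \<beta> x (y \<star> S q)) \<Lambda>" .
  qed
  also have "\<dots> = sw U (\<lambda>x y. \<beta> x (y \<star> S h)) \<Lambda>"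
    by (rule sw_counit_left[OF U _ h]) (intro lin bl U H_module L; simp)
  finally show ?thesis .
qed


text \<open>The first legs of the coproduct of an integral with
  \<open>\<epsilon> \<Lambda> = 1\<close> span \<open>H\<close>. Every \<open>h\<close> is the sum
  of \<open>\<Lambda>1 S(\<Lambda>2) h\<close>, hence of products \<open>x i S(g i) h\<close>, and
  \<open>integral_shift\<close> moves the right factor of such a product to the second leg, so that
  the first leg stays in \<open>W\<close>.\<close>

lemma semisimple_finite_dimensional:
  assumes "semisimple H"
  shows "vector_space.fin_subspace K H (carrier H)"
proof -
  interpret V: vector_space K H by (rule H_vector_space)
  obtain \<Lambda> where L: "\<Lambda> \<in> carrier H" "\<epsilon> \<Lambda> = \<one>\<^bsub>K\<^esub>"
    and shift: "\<And>h. h \<in> carrier H \<Longrightarrow> \<Lambda> \<star> h = \<epsilon> h \<odot>\<^bsub>H\<^esub> \<Lambda>"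
    using semisimple_integral[OF assms] by blast
  let ?B = "tensor_support K (\<Delta> \<Lambda>)"
  note supp = tensor_support[OF H_module H_module comult_closed[OF L(1)]]
  obtain Y where Y: "V.fin_subspace Y" "snd ` ?B \<subseteq> Y"
    using V.fin_subspace_cover[of "snd ` ?B"] supp by fastforce
  obtain W where W: "V.fin_subspace W" "fst ` ?B \<subseteq> W"
    using V.fin_subspace_cover[of "fst ` ?B"] supp by fastforce
  note sW = V.fin_subspace_subspace[OF W(1)]
  let ?m = "V.vdim Y"
  obtain g f where g: "\<And>i. i < ?m \<Longrightarrow> g i \<in> Y" and f: "\<And>i. i < ?m \<Longrightarrow> functional K H (f i)"
    and e: "\<And>x. x \<in> Y \<Longrightarrow> x = (\<Oplus>\<^bsub>H\<^esub>i\<in>{..<?m}. f i x \<odot>\<^bsub>H\<^esub> g i)"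
    using V.dual_basis[OF Y(1)] by metis
  have gH: "g i \<in> carrier H" if "i < ?m" for i
    using g[OF that] V.subspaceD(2)[OF V.fin_subspace_subspace[OF Y(1)]] by auto
  have fK: "f i x \<in> carrier K" if "i < ?m" "x \<in> carrier H" for i x
    using linear_map_closed[OF f[OF that(1)] that(2)] by (simp add: scalar_module_def)
  \<comment> \<open>The coproduct of \<open>\<Lambda>\<close> with its second leg contracted by the
    \<open>i\<close>-th coordinate functional of a space \<open>Y\<close> that contains the second
    legs.\<close>
  define x where "x = (\<lambda>i. sw H (\<lambda>u v. f i v \<odot>\<^bsub>H\<^esub> u) \<Lambda>)"
  have b: "bilinear_map K H H H (\<lambda>u v. f i v \<odot>\<^bsub>H\<^esub> u)" if "i < ?m" for i
    by (intro bilinear_mapI functional_smult_linear[OF H_module H_module f[OF that]]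
        linear_map_scale[OF H_module H_module linear_map_id] fK that)
  have xW: "x i \<star> h \<in> W" if i: "i < ?m" and h: "h \<in> carrier H" for i h
  proof -
    have "x i \<star> h = sw H (\<lambda>u v. (f i v \<odot>\<^bsub>H\<^esub> u) \<star> h) \<Lambda>"
      unfolding x_def
      by (rule sw_comp[OF H_module H_module bilinear_map_left[OF mult_bilinear linear_map_id h] L(1)])
         (simp add: fK i)
    also have "\<dots> = sw H (\<lambda>u v. f i v \<odot>\<^bsub>H\<^esub> (u \<star> h)) \<Lambda>"
      by (rule sw_cong[OF H_module L(1)]) (simp_all add: fK i h smult_mult_left)
    also have "\<dots> = sw H (\<lambda>u v. f i (v \<star> S h) \<odot>\<^bsub>H\<^esub> u) \<Lambda>"
      by (rule integral_shift[OF L(1) shift H_module b[OF i] h])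
    also have "\<dots> \<in> W"
    proof (rule tensor_lift_support_in[OF H_module H_module H_module comult_closed[OF L(1)] sW])
      fix u v assume "(u, v) \<in> ?B"
      then have "u \<in> W" "v \<in> carrier H" using W(2) supp(2) by force+
      then show "f i (v \<star> S h) \<odot>\<^bsub>H\<^esub> u \<in> W" by (intro V.subspaceD(7)[OF sW] fK i) (auto simp: h)
    qed
    finally show ?thesis .
  qed
  have "carrier H \<subseteq> W"
  proof
    fix h assume h: "h \<in> carrier H"
    let ?c = "\<lambda>v. S v \<star> h"
    have c: "linear_map K H H ?c" by (intro lin h)
    have xc: "x i \<in> carrier H" if "i < ?m" for i unfolding x_def by (rule sw_closed[OF H_module L(1)]) (simp add: fK that)
    have "h = \<epsilon> \<Lambda> \<odot>\<^bsub>H\<^esub> (\<one>\<^bsub>H\<^esub> \<star> h)" using h L by simp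
    also have "\<dots> = sw H (\<lambda>u v. (u \<star> S v) \<star> h) \<Lambda>"
      by (rule sw_antipode_right[OF H_module _ L(1), symmetric]) (intro lin h)
    also have "\<dots> = sw H (\<lambda>u v. \<Oplus>\<^bsub>H\<^esub>i\<in>{..<?m}. f i v \<odot>\<^bsub>H\<^esub> (u \<star> ?c (g i))) \<Lambda>"
    proof (rule tensor_lift_support_cong[OF H_module H_module H_module comult_closed[OF L(1)]])
      fix u v assume uv: "(u, v) \<in> ?B"
      then have uH: "u \<in> carrier H" and vH: "v \<in> carrier H" and vY: "v \<in> Y" using supp(2) Y(2) by force+
      show "(\<Oplus>\<^bsub>H\<^esub>i\<in>{..<?m}. f i v \<odot>\<^bsub>H\<^esub> (u \<star> ?c (g i))) \<in> carrier H"
        using uH vH fK gH h by (auto intro!: M.finsum_closed)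
      have l: "linear_map K H H (\<lambda>v. u \<star> ?c v)" by (intro lin h uH)
      have "(u \<star> S v) \<star> h = u \<star> ?c v" using uH vH h by (simp add: A.m_assoc)
      also have "\<dots> = u \<star> ?c (\<Oplus>\<^bsub>H\<^esub>i\<in>{..<?m}. f i v \<odot>\<^bsub>H\<^esub> g i)"
        by (rule arg_cong[OF e[OF vY], of "\<lambda>v. u \<star> ?c v"])
      also have "\<dots> = (\<Oplus>\<^bsub>H\<^esub>i\<in>{..<?m}. u \<star> ?c (f i v \<odot>\<^bsub>H\<^esub> g i))"
        by (rule linear_map_finsum[OF H_module H_module l]) (use fK gH vH in auto)
      also have "\<dots> = (\<Oplus>\<^bsub>H\<^esub>i\<in>{..<?m}. f i v \<odot>\<^bsub>H\<^esub> (u \<star> ?c (g i)))"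
        by (rule M.finsum_cong') (use fK gH vH uH h in \<open>auto simp: linear_map_smult[OF l]\<close>)
      finally show "(u \<star> S v) \<star> h = (\<Oplus>\<^bsub>H\<^esub>i\<in>{..<?m}. f i v \<odot>\<^bsub>H\<^esub> (u \<star> ?c (g i)))" .
    qed
    also have "\<dots> \<in> W"
    proof -
      \<comment> \<open>Additivity of the lift in the form to be lifted is read off from pure
        tensors for two bilinear forms at a time, so the finite sum is pulled out by
        induction.\<close>
      have "sw H (\<lambda>u v. \<Oplus>\<^bsub>H\<^esub>i\<in>I. f i v \<odot>\<^bsub>H\<^esub> (u \<star> ?c (g i))) \<Lambda> \<in> W" if "finite I" "I \<subseteq> {..<?m}" for I
        using that
      proof (induction rule: finite_induct)
        case empty
        have "sw H (\<lambda>u v. \<zero>\<^bsub>H\<^esub>) \<Lambda> \<in> W"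
          by (rule tensor_lift_in_submodule[OF H_module H_module H_module sW comult_closed[OF L(1)]])
             (rule V.subspaceD(3)[OF sW])
        then show ?case by simp
      next
        case (insert i I)
        then have i: "i < ?m" and I: "\<And>j. j \<in> I \<Longrightarrow> j < ?m" by auto
        let ?r = "\<lambda>u v. \<Oplus>\<^bsub>H\<^esub>j\<in>I. f j v \<odot>\<^bsub>H\<^esub> (u \<star> ?c (g j))"
        let ?s = "\<lambda>u v. f i v \<odot>\<^bsub>H\<^esub> (u \<star> ?c (g i))"
        have t: "f j v \<odot>\<^bsub>H\<^esub> (u \<star> ?c (g j)) \<in> carrier H"
          if "j < ?m" "u \<in> carrier H" "v \<in> carrier H" for j u v using that fK gH h by simp
        have bs: "bilinear_map K H H H ?s" and bt: "bilinear_map K H H H ?r"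
          and br: "bilinear_map K H H H (\<lambda>u v. ?s u v \<oplus>\<^bsub>H\<^esub> ?r u v)"
        proof -
          have b1: "bilinear_map K H H H (\<lambda>u v. f j v \<odot>\<^bsub>H\<^esub> (u \<star> ?c (g j)))" if "j < ?m" for j
            by (intro bilinear_mapI functional_smult_linear[OF H_module H_module f[OF that]]
                linear_map_scale[OF H_module H_module] fK that bilinear_map_left[OF mult_bilinear] linear_map_id)
               (use gH that h in auto)
          show "bilinear_map K H H H ?s" by (rule b1[OF i])
          show "bilinear_map K H H H ?r"
            by (intro bilinear_mapI finsum_linear_map H_module insert.hyps(1))
               (use b1 I in \<open>auto simp: bilinear_map_def\<close>)
          then show "bilinear_map K H H H (\<lambda>u v. ?s u v \<oplus>\<^bsub>H\<^esub> ?r u v)"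
            using b1[OF i]
            by (intro bilinear_mapI linear_map_plus H_module) (auto simp: bilinear_map_def)
        qed
        have "sw H (\<lambda>u v. \<Oplus>\<^bsub>H\<^esub>j\<in>insert i I. f j v \<odot>\<^bsub>H\<^esub> (u \<star> ?c (g j))) \<Lambda>
          = sw H (\<lambda>u v. ?s u v \<oplus>\<^bsub>H\<^esub> ?r u v) \<Lambda>"
          by (rule sw_cong[OF H_module L(1)])
             (use insert t I i in \<open>auto intro!: M.finsum_closed M.finsum_insert\<close>)
        also have "\<dots> = sw H ?s \<Lambda> \<oplus>\<^bsub>H\<^esub> sw H ?r \<Lambda>"
          by (rule HH.tensor_linear_eqI[OF H_module tensor_lift_linear[OF H_module H_module H_module br]
                linear_map_plus[OF HH.T_module H_module tensor_lift_linear[OF H_module H_module H_module bs]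
                  tensor_lift_linear[OF H_module H_module H_module bt]] comult_closed[OF L(1)]])
             (simp add: tensor_lift_pure_tensor[OF H_module H_module H_module br]
               tensor_lift_pure_tensor[OF H_module H_module H_module bs]
               tensor_lift_pure_tensor[OF H_module H_module H_module bt])
        also have "sw H ?s \<Lambda> = x i \<star> ?c (g i)"
        proof -
          have "x i \<star> ?c (g i) = sw H (\<lambda>u v. (f i v \<odot>\<^bsub>H\<^esub> u) \<star> ?c (g i)) \<Lambda>"
            unfolding x_def
            by (rule sw_comp[OF H_module H_module bilinear_map_left[OF mult_bilinear linear_map_id] L(1)])
               (simp_all add: fK gH i h)
          also have "\<dots> = sw H ?s \<Lambda>"
            by (rule sw_cong[OF H_module L(1)]) (simp_all add: fK gH i h smult_mult_left)
          finally show ?thesis by simp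
        qed
        also have "x i \<star> ?c (g i) \<oplus>\<^bsub>H\<^esub> sw H ?r \<Lambda> \<in> W"
          by (rule V.subspaceD(4)[OF sW xW[OF i] insert.IH]) (use gH i h insert.prems in auto)
        finally show ?case .
      qed
      then show ?thesis by simp
    qed
    finally show "h \<in> W" .
  qed
  then have "W = carrier H" using V.subspaceD(1)[OF sW] by auto
  then show ?thesis using W(1) by simp
qed

end

section \<open>Left partial modules\<close>

text \<open>The compatibility of \<open>lmul\<close> and \<open>hmul\<close> is what makes
  \<open>(a # h) x = a (h x)\<close> respect the product of the smash product; see
  \<open>ten_mult\<close>. The definition of the \<open>H\<close>-radical speaks of right modules;
  the two sides meet in \<open>fd_annihilator_kills_right\<close>, where invertibility of
  \<open>1 - i\<close> replaces any comparison of modules.\<close>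

locale left_partial_module = left_module K X A lmul
  for K and X :: "('k, 'x) module" and A :: "('k, 'a) module" and lmul +
  fixes H :: "('k, 'h) module"
    and \<Delta> :: "'h \<Rightarrow> ('h \<times> 'h \<Rightarrow> 'k) set"
    and act :: "'h \<Rightarrow> 'a \<Rightarrow> 'a"
    and hmul :: "'h \<Rightarrow> 'x \<Rightarrow> 'x"
  assumes hmul_bilinear: "bilinear_map K H X X hmul"
    and hmul_one: "x \<in> carrier X \<Longrightarrow> hmul \<one>\<^bsub>H\<^esub> x = x"
    and hmul_lmul_hmul: "\<lbrakk>x \<in> carrier X; a \<in> carrier A; h \<in> carrier H; g \<in> carrier H\<rbrakk> \<Longrightarrow>
      hmul h (lmul a (hmul g x)) = tensor_lift K X (\<lambda>h1 h2. lmul (act h1 a) (hmul (h2 \<otimes>\<^bsub>H\<^esub> g) x)) (\<Delta> h)"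

definition stable_subspace ::
  "'k ring \<Rightarrow> ('k, 'h) module \<Rightarrow> ('k, 'a) module \<Rightarrow> ('k, 'x) module \<Rightarrow> ('a \<Rightarrow> 'x \<Rightarrow> 'x) \<Rightarrow> ('h \<Rightarrow> 'x \<Rightarrow> 'x) \<Rightarrow>
   'x set \<Rightarrow> bool"
  where "stable_subspace K H A X lmul hmul N \<longleftrightarrow> submodule N K X \<and>
    (\<forall>n\<in>N. \<forall>a\<in>carrier A. lmul a n \<in> N) \<and> (\<forall>n\<in>N. \<forall>h\<in>carrier H. hmul h n \<in> N)"

section \<open>The smash product of a partial action and its action on partial modules\<close>

locale hopf_partial_action = H: hopf_algebra K H \<Delta> \<epsilon> S + A: partial_module_algebra K A H \<Delta> act
  for K :: "'k ring" and H :: "('k, 'h) module" and \<Delta> \<epsilon> S and A :: "('k, 'a) module" and act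
begin

abbreviation alg_mult (infixl "\<cdot>" 70)
  where "x \<cdot> y \<equiv> x \<otimes>\<^bsub>A\<^esub> y"

lemma A_module: "module K A" and A_vector_space: "vector_space K A"
  using A.module_axioms H.K.field_axioms by (auto simp: vector_space_def)

lemma act_closed [simp]: "h \<in> carrier H \<Longrightarrow> a \<in> carrier A \<Longrightarrow> act h a \<in> carrier A"
  using bilinear_map_closed[OF A.act_bilinear] .

lemma A_mult_bilinear: "bilinear_map K A A A (\<cdot>)"
  by (rule bilinear_mapI; rule linear_mapI)
     (simp_all add: A.A.r_distr A.A.l_distr A.smult_mult_left A.smult_mult_right)

lemma act_mult: 
  assumes "h \<in> carrier H" "a \<in> carrier A" "b \<in> carrier A"
  shows "act h (a \<cdot> b) = H.sw A (\<lambda>h1 h2. act h1 a \<cdot> act h2 b) h"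
proof -
  have "act h (a \<cdot> b) = H.sw A (\<lambda>h1 h2. act h1 a \<cdot> act (h2 \<star> \<one>\<^bsub>H\<^esub>) b) h"
    using A.act_mult_act[of a b h "\<one>\<^bsub>H\<^esub>"] assms by (simp add: A.act_one)
  also have "\<dots> = H.sw A (\<lambda>h1 h2. act h1 a \<cdot> act h2 b) h"
    by (rule H.sw_cong[OF A_module assms(1)]) (simp_all add: assms)
  finally show ?thesis .
qed

sublocale AH: vector_space_pair K A H
  by (intro vector_space_pair.intro A_module H.H_module H.K.field_axioms)

lemmas AH_module = AH.T_module

lemma AH_vector_space: "vector_space K AH.T"
  by (simp add: vector_space_def AH_module H.K.field_axioms)

abbreviation pure :: "'a \<Rightarrow> 'h \<Rightarrow> ('a \<times> 'h \<Rightarrow> 'k) set"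
  where "pure \<equiv> pure_tensor K A H"

lemmas pure_closed [simp] = AH.pure_tensor_closed

lemmas lin = H.lin bilinear_map_left[OF A_mult_bilinear] bilinear_map_right[OF A_mult_bilinear]
  bilinear_map_left[OF A.act_bilinear] bilinear_map_right[OF A.act_bilinear]
  bilinear_map_left[OF AH.pure_tensor_bilinear] bilinear_map_right[OF AH.pure_tensor_bilinear]

abbreviation P where "P \<equiv> smash_product K H \<Delta> A act"

abbreviation smash_mult (infixl "\<bullet>" 70)
  where "s \<bullet> t \<equiv> s \<otimes>\<^bsub>P\<^esub> t"

abbreviation partial_module :: "('k, 'x) module \<Rightarrow> ('a \<Rightarrow> 'x \<Rightarrow> 'x) \<Rightarrow> ('h \<Rightarrow> 'x \<Rightarrow> 'x) \<Rightarrow> bool"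
  where "partial_module X lmul hmul \<equiv> left_partial_module K X A lmul H \<Delta> act hmul"

abbreviation stable :: "('k, 'x) module \<Rightarrow> ('a \<Rightarrow> 'x \<Rightarrow> 'x) \<Rightarrow> ('h \<Rightarrow> 'x \<Rightarrow> 'x) \<Rightarrow> 'x set \<Rightarrow> bool"
  where "stable X lmul hmul \<equiv> stable_subspace K H A X lmul hmul"

definition irreducible_module :: "('k, 'x) module \<Rightarrow> ('a \<Rightarrow> 'x \<Rightarrow> 'x) \<Rightarrow> ('h \<Rightarrow> 'x \<Rightarrow> 'x) \<Rightarrow> bool"
  where "irreducible_module X lmul hmul \<longleftrightarrow> partial_module X lmul hmul \<and> carrier X \<noteq> {\<zero>\<^bsub>X\<^esub>} \<and>
    (\<forall>N. stable X lmul hmul N \<longrightarrow> N = {\<zero>\<^bsub>X\<^esub>} \<or> N = carrier X)"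

definition annihilator :: "('k, 'x) module \<Rightarrow> ('a \<Rightarrow> 'x \<Rightarrow> 'x) \<Rightarrow> 'a set"
  where "annihilator X lmul = {a \<in> carrier A. \<forall>x\<in>carrier X. lmul a x = \<zero>\<^bsub>X\<^esub>}"

definition tact :: "('k, 'x) module \<Rightarrow> ('a \<Rightarrow> 'x \<Rightarrow> 'x) \<Rightarrow> ('h \<Rightarrow> 'x \<Rightarrow> 'x) \<Rightarrow> ('a \<times> 'h \<Rightarrow> 'k) set \<Rightarrow> 'x \<Rightarrow> 'x"
  where "tact X lmul hmul t x = tensor_lift K X (\<lambda>a h. lmul a (hmul h x)) t"

lemma smash_simps:
  "carrier P = carrier AH.T" "\<zero>\<^bsub>P\<^esub> = \<zero>\<^bsub>AH.T\<^esub>" "x \<oplus>\<^bsub>P\<^esub> y = x \<oplus>\<^bsub>AH.T\<^esub> y" "c \<odot>\<^bsub>P\<^esub> x = c \<odot>\<^bsub>AH.T\<^esub> x"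
  "\<one>\<^bsub>P\<^esub> = pure \<one>\<^bsub>A\<^esub> \<one>\<^bsub>H\<^esub>"
  by (simp_all add: smash_product_def)

lemma smash_mult_bilinear: "bilinear_map K AH.T AH.T AH.T (\<bullet>)"
  and smash_pure: "a \<in> carrier A \<Longrightarrow> h \<in> carrier H \<Longrightarrow> b \<in> carrier A \<Longrightarrow> g \<in> carrier H \<Longrightarrow>
    pure a h \<bullet> pure b g = H.sw AH.T (\<lambda>h1 h2. pure (a \<cdot> act h1 b) (h2 \<star> g)) h"
proof -
  note m = AH_module A_module H.H_module
  let ?\<beta> = "\<lambda>a h b g. H.sw AH.T (\<lambda>h1 h2. pure (a \<cdot> act h1 b) (h2 \<star> g)) h"
  have b: "bilinear_map K A H AH.T (?\<beta> a h)" if "a \<in> carrier A" "h \<in> carrier H" for a h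
    by (intro bilinear_mapI lin m that; simp add: that)
  have c: "?\<beta> a h b g \<in> carrier AH.T" if "a \<in> carrier A" "h \<in> carrier H" "b \<in> carrier A" "g \<in> carrier H" for a h b g
    using bilinear_map_closed[OF b] that by blast
  have o: "bilinear_map K A H AH.T (\<lambda>a h. tensor_lift K AH.T (?\<beta> a h) t)" if "t \<in> carrier AH.T" for t
    by (rule bilinear_mapI; rule tensor_lift_param_linear[OF m(2,3,1) _ that]; (rule m)?)
       (intro bilinear_mapI lin m that; simp add: that)+
  show "pure a h \<bullet> pure b g = ?\<beta> a h b g"
    if "a \<in> carrier A" "h \<in> carrier H" "b \<in> carrier A" "g \<in> carrier H"
    using that by (simp add: smash_product_def tensor_lift_pure_tensor[OF m(2,3,1) o]
      tensor_lift_pure_tensor[OF m(2,3,1) b])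
  show "bilinear_map K AH.T AH.T AH.T (\<bullet>)"
  proof (rule bilinear_mapI)
    fix t assume t: "t \<in> carrier AH.T"
    show "linear_map K AH.T AH.T (\<lambda>s. s \<bullet> t)"
      using tensor_lift_linear[OF m(2,3,1) o[OF t]] by (simp add: smash_product_def)
    have "linear_map K AH.T AH.T (\<lambda>s. tensor_lift K AH.T (\<lambda>a h. tensor_lift K AH.T (?\<beta> a h) s) t)"
      by (rule tensor_lift_param_linear[OF m(2,3,1,1) t]) (rule tensor_lift_linear[OF m(2,3,1) b])
    then show "linear_map K AH.T AH.T (\<lambda>s. t \<bullet> s)"
      by (simp add: smash_product_def)
  qed
qed

lemma smash_closed [simp]: "s \<in> carrier AH.T \<Longrightarrow> t \<in> carrier AH.T \<Longrightarrow> s \<bullet> t \<in> carrier AH.T"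
  using bilinear_map_closed[OF smash_mult_bilinear] .

lemma AH_bilinear_eqI:
  assumes "module K U" "bilinear_map K AH.T AH.T U f" "bilinear_map K AH.T AH.T U g" "s \<in> carrier AH.T" "t \<in> carrier AH.T"
    "\<And>a h b k. a \<in> carrier A \<Longrightarrow> h \<in> carrier H \<Longrightarrow> b \<in> carrier A \<Longrightarrow> k \<in> carrier H \<Longrightarrow>
      f (pure a h) (pure b k) = g (pure a h) (pure b k)"
  shows "f s t = g s t"
proof -
  have "f s (pure b k) = g s (pure b k)" if "b \<in> carrier A" "k \<in> carrier H" for b k
    by (rule AH.tensor_linear_eqI[OF assms(1) _ _ assms(4)])
       (use assms(2,3,6) that in \<open>auto simp: bilinear_map_def\<close>)
  then show ?thesis
    by (intro AH.tensor_linear_eqI[OF assms(1) _ _ assms(5), of "f s" "g s"])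
       (use assms(2-4) in \<open>auto simp: bilinear_map_def\<close>)
qed

end

locale partial_module_context = hopf_partial_action K H \<Delta> \<epsilon> S A act + X: left_partial_module K X A lmul H \<Delta> act hmul
  for K :: "'k ring" and H :: "('k, 'h) module" and \<Delta> \<epsilon> S and A :: "('k, 'a) module" and act
    and X :: "('k, 'x) module" (structure) and lmul hmul
begin

lemma X_module: "module K X" and X_vector_space: "vector_space K X"
  using X.module_axioms H.K.field_axioms by (auto simp: vector_space_def)

lemma lmul_closed [simp]: "a \<in> carrier A \<Longrightarrow> x \<in> carrier X \<Longrightarrow> lmul a x \<in> carrier X"
  using bilinear_map_closed[OF X.lmul_bilinear] .

lemma hmul_closed [simp]: "h \<in> carrier H \<Longrightarrow> x \<in> carrier X \<Longrightarrow> hmul h x \<in> carrier X"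
  using bilinear_map_closed[OF X.hmul_bilinear] .

lemmas xlin = lin bilinear_map_left[OF X.lmul_bilinear] bilinear_map_right[OF X.lmul_bilinear]
  bilinear_map_left[OF X.hmul_bilinear] bilinear_map_right[OF X.hmul_bilinear]

abbreviation ten where "ten \<equiv> tact X lmul hmul"

lemma tact_bilinear_aux: "x \<in> carrier X \<Longrightarrow> bilinear_map K A H X (\<lambda>a h. lmul a (hmul h x))"
  by (intro bilinear_mapI xlin X_module; simp)

lemma ten_pure [simp]:
  "a \<in> carrier A \<Longrightarrow> h \<in> carrier H \<Longrightarrow> x \<in> carrier X \<Longrightarrow> ten (pure a h) x = lmul a (hmul h x)"
  unfolding tact_def by (rule tensor_lift_pure_tensor[OF A_module H.H_module X_module tact_bilinear_aux])

lemma ten_bilinear: "bilinear_map K AH.T X X ten"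
  unfolding tact_def
proof (rule bilinear_mapI)
  show "linear_map K AH.T X (\<lambda>t. tensor_lift K X (\<lambda>a h. lmul a (hmul h x)) t)" if "x \<in> carrier X" for x
    by (rule tensor_lift_linear[OF A_module H.H_module X_module tact_bilinear_aux[OF that]])
  show "linear_map K X X (\<lambda>x. tensor_lift K X (\<lambda>a h. lmul a (hmul h x)) t)" if "t \<in> carrier AH.T" for t
    by (rule tensor_lift_param_linear[OF A_module H.H_module X_module X_module that]) (intro xlin; simp)
qed

lemma ten_closed [simp]: "t \<in> carrier AH.T \<Longrightarrow> x \<in> carrier X \<Longrightarrow> ten t x \<in> carrier X"
  using bilinear_map_closed[OF ten_bilinear] .

text \<open>On pure tensors the product formula of the smash product is
  \<open>hmul_lmul_hmul\<close> with \<open>a\<close> applied from outside; both sides are bilinear,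
  so pure tensors suffice.\<close>

lemma ten_mult:
  assumes "s \<in> carrier AH.T" "t \<in> carrier AH.T" "x \<in> carrier X"
  shows "ten (s \<bullet> t) x = ten s (ten t x)"
proof (rule AH_bilinear_eqI[OF X_module _ _ assms(1,2), of "\<lambda>s t. ten (s \<bullet> t) x"])
  note tl = bilinear_map_left[OF ten_bilinear] bilinear_map_right[OF ten_bilinear]
    bilinear_map_left[OF smash_mult_bilinear] bilinear_map_right[OF smash_mult_bilinear] linear_map_id
  show "bilinear_map K AH.T AH.T X (\<lambda>s t. ten (s \<bullet> t) x)"
    by (intro bilinear_mapI tl assms(3))
  show "bilinear_map K AH.T AH.T X (\<lambda>s t. ten s (ten t x))"
    by (intro bilinear_mapI tl assms(3) ten_closed)
  fix a h b k assume *: "a \<in> carrier A" "h \<in> carrier H" "b \<in> carrier A" "k \<in> carrier H"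
  have "ten (pure a h \<bullet> pure b k) x = H.sw X (\<lambda>h1 h2. ten (pure (a \<cdot> act h1 b) (h2 \<star> k)) x) h"
    unfolding smash_pure[OF *]
    by (rule H.sw_comp[OF AH_module X_module tl(1)[OF linear_map_id assms(3)] *(2)]) (simp add: *)
  also have "\<dots> = H.sw X (\<lambda>h1 h2. lmul a (lmul (act h1 b) (hmul (h2 \<star> k) x))) h"
    by (rule H.sw_cong[OF X_module *(2)]) (simp_all add: * assms X.lmul_mult)
  also have "\<dots> = lmul a (H.sw X (\<lambda>h1 h2. lmul (act h1 b) (hmul (h2 \<star> k) x)) h)"
    by (rule H.sw_comp[OF X_module X_module bilinear_map_right[OF X.lmul_bilinear linear_map_id *(1)] *(2), symmetric])
       (simp add: * assms)
  also have "\<dots> = ten (pure a h) (ten (pure b k) x)"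
    using * assms by (simp add: X.hmul_lmul_hmul)
  finally show "ten (pure a h \<bullet> pure b k) x = ten (pure a h) (ten (pure b k) x)" .
qed

lemma ten_one: "x \<in> carrier X \<Longrightarrow> ten (pure \<one>\<^bsub>A\<^esub> \<one>\<^bsub>H\<^esub>) x = x"
  by (simp add: X.hmul_one X.lmul_one)

lemma stableD:
  assumes "stable X lmul hmul N"
  shows "submodule N K X" "\<And>n a. n \<in> N \<Longrightarrow> a \<in> carrier A \<Longrightarrow> lmul a n \<in> N"
    "\<And>n h. n \<in> N \<Longrightarrow> h \<in> carrier H \<Longrightarrow> hmul h n \<in> N" "\<And>n t. n \<in> N \<Longrightarrow> t \<in> carrier AH.T \<Longrightarrow> ten t n \<in> N"
    "N \<subseteq> carrier X"
proof -
  show *: "submodule N K X" "\<And>n a. n \<in> N \<Longrightarrow> a \<in> carrier A \<Longrightarrow> lmul a n \<in> N"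
    "\<And>n h. n \<in> N \<Longrightarrow> h \<in> carrier H \<Longrightarrow> hmul h n \<in> N"
    using assms by (auto simp: stable_subspace_def)
  show "\<And>n t. n \<in> N \<Longrightarrow> t \<in> carrier AH.T \<Longrightarrow> ten t n \<in> N"
    unfolding tact_def by (rule tensor_lift_in_submodule[OF A_module H.H_module X_module *(1)]) (use * in auto)
  show "N \<subseteq> carrier X" using *(1) X.submoduleE(1) by blast
qed

lemma stableI_ten:
  assumes "submodule N K X" "\<And>n t. n \<in> N \<Longrightarrow> t \<in> carrier AH.T \<Longrightarrow> ten t n \<in> N"
  shows "stable X lmul hmul N"
proof -
  have N: "N \<subseteq> carrier X" using assms(1) X.submoduleE(1) by blast
  have "lmul a n \<in> N" if "n \<in> N" "a \<in> carrier A" for n a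
    using assms(2)[OF that(1), of "pure a \<one>\<^bsub>H\<^esub>"] that N by (auto simp: X.hmul_one)
  moreover have "hmul h n \<in> N" if "n \<in> N" "h \<in> carrier H" for n h
    using assms(2)[OF that(1), of "pure \<one>\<^bsub>A\<^esub> h"] that N by (auto simp: X.lmul_one)
  ultimately show ?thesis using assms(1) by (auto simp: stable_subspace_def)
qed

lemma orbit_stable:
  assumes x: "x \<in> carrier X"
  shows "stable X lmul hmul ((\<lambda>t. ten t x) ` carrier AH.T)" "x \<in> (\<lambda>t. ten t x) ` carrier AH.T"
proof -
  show "stable X lmul hmul ((\<lambda>t. ten t x) ` carrier AH.T)"
  proof (rule stableI_ten)
    show "submodule ((\<lambda>t. ten t x) ` carrier AH.T) K X"
      by (rule linear_map_image_submodule[OF AH_module X_module]) 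
         (use ten_bilinear x in \<open>auto simp: bilinear_map_def\<close>)
  qed (use x in \<open>auto simp flip: ten_mult\<close>)
  show "x \<in> (\<lambda>t. ten t x) ` carrier AH.T"
    using ten_one[OF x] by (intro image_eqI[of _ _ "pure \<one>\<^bsub>A\<^esub> \<one>\<^bsub>H\<^esub>"]) auto
qed

end

section \<open>Associativity of the smash product and its left identity\<close>

context hopf_partial_action
begin

lemmas smash_left_linear = bilinear_map_left[OF smash_mult_bilinear linear_map_id]
  and smash_right_linear = bilinear_map_right[OF smash_mult_bilinear linear_map_id]

text \<open>For pure tensors, both bracketings spread \<open>h\<close> over three legs and
  \<open>g\<close> over two. Coassociativity groups the two legs of \<open>h\<close> that act on
  \<open>b\<close> and \<open>c\<close>, and \<open>act_mult_act\<close> folds them into one action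
  on \<open>b (u c)\<close>, where \<open>u\<close> is the first leg of \<open>g\<close>.\<close>

lemma smash_assoc:
  assumes r: "r \<in> carrier AH.T" and s: "s \<in> carrier AH.T" and t: "t \<in> carrier AH.T"
  shows "r \<bullet> s \<bullet> t = r \<bullet> (s \<bullet> t)"
proof (rule AH_bilinear_eqI[OF AH_module _ _ r s, of "\<lambda>r s. r \<bullet> s \<bullet> t"])
  note m = AH_module and sl = bilinear_map_left[OF smash_mult_bilinear] bilinear_map_right[OF smash_mult_bilinear] linear_map_id
  note sc = H.sw_closed[OF m]
  show "bilinear_map K AH.T AH.T AH.T (\<lambda>r s. r \<bullet> s \<bullet> t)"
    "bilinear_map K AH.T AH.T AH.T (\<lambda>r s. r \<bullet> (s \<bullet> t))"
    by (intro bilinear_mapI sl smash_closed t; assumption)+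
  fix a h b g assume a: "a \<in> carrier A" and h: "h \<in> carrier H" and b: "b \<in> carrier A" and g: "g \<in> carrier H"
  show "pure a h \<bullet> pure b g \<bullet> t = pure a h \<bullet> (pure b g \<bullet> t)"
  proof (rule AH.tensor_linear_eqI[OF m _ _ t, of "\<lambda>t. pure a h \<bullet> pure b g \<bullet> t"])
    show "linear_map K AH.T AH.T (\<lambda>t. pure a h \<bullet> pure b g \<bullet> t)"
      "linear_map K AH.T AH.T (\<lambda>t. pure a h \<bullet> (pure b g \<bullet> t))"
      by (intro sl; simp add: a h b g)+
    fix c k assume ck: "c \<in> carrier A" "k \<in> carrier H"
    note car = a b g ck
    let ?\<gamma> = "\<lambda>x p q u v. pure (a \<cdot> act x b \<cdot> act (p \<star> u) c) (q \<star> v \<star> k)"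
    let ?\<delta> = "\<lambda>z q u v. pure (a \<cdot> act z (b \<cdot> act u c)) (q \<star> v \<star> k)"
    have "pure a h \<bullet> pure b g \<bullet> pure c k =
      H.sw AH.T (\<lambda>x y. pure (a \<cdot> act x b) (y \<star> g) \<bullet> pure c k) h"
      unfolding smash_pure[OF a h b g]
      by (rule H.sw_comp[OF m m smash_left_linear h]) (simp_all add: car)
    also have "\<dots> = H.sw AH.T (\<lambda>x y. H.sw AH.T (\<lambda>p q. H.sw AH.T (\<lambda>u v. ?\<gamma> x p q u v) g) y) h"
    proof (rule H.sw_cong[OF m h])
      fix x y assume xy: "x \<in> carrier H" "y \<in> carrier H"
      show "pure (a \<cdot> act x b) (y \<star> g) \<bullet> pure c k \<in> carrier AH.T" by (simp add: xy car)
      have "bilinear_map K H H AH.T (\<lambda>r s. pure (a \<cdot> act x b \<cdot> act r c) (s \<star> k))"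
        by (intro bilinear_mapI lin; simp add: xy car)
      from H.sw_mult[OF m this xy(2) g]
      show "pure (a \<cdot> act x b) (y \<star> g) \<bullet> pure c k =
        H.sw AH.T (\<lambda>p q. H.sw AH.T (\<lambda>u v. ?\<gamma> x p q u v) g) y"
        by (simp add: smash_pure xy car)
    qed
    also have "\<dots> = H.sw AH.T (\<lambda>z q. H.sw AH.T (\<lambda>x p. H.sw AH.T (\<lambda>u v. ?\<gamma> x p q u v) g) z) h"
      by (rule H.sw_coassoc[OF m h, symmetric]) (intro lin m H.H_module; simp add: car g)+
    also have "\<dots> = H.sw AH.T (\<lambda>z q. H.sw AH.T (\<lambda>u v. ?\<delta> z q u v) g) h"
    proof (rule H.sw_cong[OF m h])
      fix z q assume zq: "z \<in> carrier H" "q \<in> carrier H"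
      show "H.sw AH.T (\<lambda>x p. H.sw AH.T (\<lambda>u v. ?\<gamma> x p q u v) g) z \<in> carrier AH.T"
        by (intro sc; simp add: zq car)
      have "H.sw AH.T (\<lambda>x p. H.sw AH.T (\<lambda>u v. ?\<gamma> x p q u v) g) z = H.sw AH.T (\<lambda>u v. H.sw AH.T (\<lambda>x p. ?\<gamma> x p q u v) z) g"
        by (rule H.sw_swap[OF m zq(1) g]) (simp add: zq car)
      also have "\<dots> = H.sw AH.T (\<lambda>u v. ?\<delta> z q u v) g"
      proof (rule H.sw_cong[OF m g])
        fix u v assume uv: "u \<in> carrier H" "v \<in> carrier H"
        show "H.sw AH.T (\<lambda>x p. ?\<gamma> x p q u v) z \<in> carrier AH.T" by (rule sc) (simp_all add: zq uv car)
        have "?\<delta> z q u v = H.sw AH.T (\<lambda>x p. pure (a \<cdot> (act x b \<cdot> act (p \<star> u) c)) (q \<star> v \<star> k)) z"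
          unfolding A.act_mult_act[OF b ck(1) zq(1) uv(1)]
          by (rule H.sw_comp[OF A_module m _ zq(1), of "\<lambda>y. pure (a \<cdot> y) (q \<star> v \<star> k)"])
             (intro lin, simp_all add: zq uv car)
        also have "\<dots> = H.sw AH.T (\<lambda>x p. ?\<gamma> x p q u v) z"
          by (rule H.sw_cong[OF m zq(1)]) (simp_all add: zq uv car A.A.m_assoc)
        finally show "H.sw AH.T (\<lambda>x p. ?\<gamma> x p q u v) z = ?\<delta> z q u v" ..
      qed
      finally show "H.sw AH.T (\<lambda>x p. H.sw AH.T (\<lambda>u v. ?\<gamma> x p q u v) g) z = H.sw AH.T (\<lambda>u v. ?\<delta> z q u v) g" .
    qed
    also have "\<dots> = H.sw AH.T (\<lambda>u v. H.sw AH.T (\<lambda>z q. ?\<delta> z q u v) h) g"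
      by (rule H.sw_swap[OF m h g]) (simp add: car)
    also have "\<dots> = H.sw AH.T (\<lambda>u v. pure a h \<bullet> pure (b \<cdot> act u c) (v \<star> k)) g"
    proof (rule H.sw_cong[OF m g])
      fix u v assume uv: "u \<in> carrier H" "v \<in> carrier H"
      show "H.sw AH.T (\<lambda>z q. ?\<delta> z q u v) h \<in> carrier AH.T" by (rule sc) (simp_all add: h uv car)
      show "H.sw AH.T (\<lambda>z q. ?\<delta> z q u v) h = pure a h \<bullet> pure (b \<cdot> act u c) (v \<star> k)"
        unfolding smash_pure[OF a h A.A.m_closed[OF b act_closed[OF uv(1) ck(1)]] H.A.m_closed[OF uv(2) ck(2)]]
        by (rule H.sw_cong[OF m h]) (simp_all add: uv car H.A.m_assoc)
    qed
    also have "\<dots> = pure a h \<bullet> (pure b g \<bullet> pure c k)"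
      unfolding smash_pure[OF b g ck]
      by (rule H.sw_comp[OF m m smash_right_linear g, symmetric]) (simp_all add: h car)
    finally show "pure a h \<bullet> pure b g \<bullet> pure c k = pure a h \<bullet> (pure b g \<bullet> pure c k)" .
  qed
qed

lemma pure_one_mult:
  assumes "a \<in> carrier A" "b \<in> carrier A" "h \<in> carrier H"
  shows "pure a \<one>\<^bsub>H\<^esub> \<bullet> pure b h = pure (a \<cdot> b) h"
proof -
  have "bilinear_map K H H AH.T (\<lambda>h1 h2. pure (a \<cdot> act h1 b) (h2 \<star> h))"
    by (intro bilinear_mapI lin; simp add: assms)
  then show ?thesis
    unfolding smash_pure[OF assms(1) H.A.one_closed assms(2,3)]
    by (simp add: H.sw_one[OF AH_module] A.act_one assms)
qed

text \<open>\<open>1 # 1\<close> is a left identity, whereas right multiplication by it is in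
  general a proper projection, since \<open>h 1\<close> need not be \<open>\<epsilon>(h) 1\<close>
  in a partial action. This is why elements of the partial smash product appear below as those with
  \<open>t \<bullet> e = t\<close>.\<close>

lemma smash_one_left: "t \<in> carrier AH.T \<Longrightarrow> pure \<one>\<^bsub>A\<^esub> \<one>\<^bsub>H\<^esub> \<bullet> t = t"
  by (rule AH.tensor_linear_eqI[OF AH_module smash_right_linear linear_map_id])
     (simp_all add: pure_one_mult)

end

section \<open>The coinduced module of linear maps from H\<close>

lemma linear_map_into_hom:
  assumes "module K Y" "module K V" "module K W" "\<And>y. y \<in> carrier Y \<Longrightarrow> F y \<in> carrier (hom_module K V W)"
    "\<And>v. v \<in> carrier V \<Longrightarrow> linear_map K Y W (\<lambda>y. F y v)"
  shows "linear_map K Y (hom_module K V W) F"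
proof -
  interpret Y: module K Y by fact
  interpret H: module K "hom_module K V W" by (rule hom_module_module[OF assms(2,3)])
  show ?thesis
  proof (rule linear_mapI[OF assms(4)])
    fix x y assume xy: "x \<in> carrier Y" "y \<in> carrier Y"
    show "F (x \<oplus>\<^bsub>Y\<^esub> y) = F x \<oplus>\<^bsub>hom_module K V W\<^esub> F y"
      by (rule hom_module_eqI) (auto simp: assms(4) xy hom_module_ev linear_map_add[OF assms(5)])
  next
    fix c x assume cx: "c \<in> carrier K" "x \<in> carrier Y"
    show "F (c \<odot>\<^bsub>Y\<^esub> x) = c \<odot>\<^bsub>hom_module K V W\<^esub> F x"
      by (rule hom_module_eqI) (auto simp: assms(4) cx hom_module_ev linear_map_smult[OF assms(5)])
  qed
qed

lemma linear_map_eval: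
  "v \<in> carrier V \<Longrightarrow> linear_map K (hom_module K V W) W (\<lambda>\<phi>. \<phi> v)"
  by (rule linear_mapI) (auto simp: hom_module_ev hom_module_app)

context hopf_partial_action
begin

abbreviation G :: "('k, 'x) module \<Rightarrow> ('k, 'h \<Rightarrow> 'x) module"
  where "G X \<equiv> hom_module K H X"

definition glm :: "('a \<Rightarrow> 'x \<Rightarrow> 'x) \<Rightarrow> 'a \<Rightarrow> ('h \<Rightarrow> 'x) \<Rightarrow> 'h \<Rightarrow> 'x"
  where "glm lmul a \<phi> = (\<lambda>w\<in>carrier H. lmul a (\<phi> w))"

text \<open>For finite-dimensional \<open>H\<close>, \<open>Hom(H, X)\<close> with
  \<open>glm\<close> and \<open>ghm\<close> is the tensor product of \<open>X\<close> with the dual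
  of \<open>H\<close>: \<open>A\<close> acts on \<open>X\<close> alone, while \<open>H\<close> acts
  diagonally, on the dual by right translation of the argument.\<close>

definition ghm :: "('k, 'x) module \<Rightarrow> ('h \<Rightarrow> 'x \<Rightarrow> 'x) \<Rightarrow> 'h \<Rightarrow> ('h \<Rightarrow> 'x) \<Rightarrow> 'h \<Rightarrow> 'x"
  where "ghm X hmul h \<phi> = (\<lambda>w\<in>carrier H. H.sw X (\<lambda>x y. hmul x (\<phi> (w \<star> y))) h)"

lemma G_module: "module K X \<Longrightarrow> module K (G X)"
  by (rule hom_module_module[OF H.H_module])

lemma G_linear: "\<phi> \<in> carrier (G X) \<Longrightarrow> linear_map K H X \<phi>"
  by (simp add: hom_module_simps)

lemma sw_eval:
  assumes "module K X" "h \<in> carrier H" "w \<in> carrier H"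
    "\<And>x y. x \<in> carrier H \<Longrightarrow> y \<in> carrier H \<Longrightarrow> \<beta> x y \<in> carrier (G X)"
  shows "H.sw (G X) \<beta> h w = H.sw X (\<lambda>x y. \<beta> x y w) h"
  by (rule H.sw_comp[OF G_module[OF assms(1)] assms(1) linear_map_eval[OF assms(3)] assms(2,4)])

end

context partial_module_context
begin

lemma ten_equivariant:
  assumes "module K Y" "linear_map K X Y f" "partial_module Y lmul' hmul'"
    "\<And>a x. a \<in> carrier A \<Longrightarrow> x \<in> carrier X \<Longrightarrow> f (lmul a x) = lmul' a (f x)"
    "\<And>h x. h \<in> carrier H \<Longrightarrow> x \<in> carrier X \<Longrightarrow> f (hmul h x) = hmul' h (f x)"
    "t \<in> carrier AH.T" "x \<in> carrier X"
  shows "f (ten t x) = tact Y lmul' hmul' t (f x)"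
  unfolding tact_def
  by (rule tensor_lift_comp[OF A_module H.H_module X_module assms(1,2,6), symmetric])
     (simp_all add: assms(4,5,7))

lemma ghm_app: "w \<in> carrier H \<Longrightarrow> ghm X hmul h \<phi> w = H.sw X (\<lambda>x y. hmul x (\<phi> (w \<star> y))) h"
  and glm_app: "w \<in> carrier H \<Longrightarrow> glm lmul a \<phi> w = lmul a (\<phi> w)"
  by (simp_all add: ghm_def glm_def)

text \<open>The first leg of \<open>h\<close> acts on values, the second one translates the
  argument. The compatibility thus reduces to that of \<open>X\<close> for the first leg;
  coassociativity then regroups the other legs so that they form the coproduct of
  \<open>h2 g\<close>.\<close>

lemma G_partial_module: "partial_module (G X) (glm lmul) (ghm X hmul)"
proof -
  note m = H.H_module X_module G_module[OF X_module] A_module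
  note ap' = hom_module_app[where K = K and V = H and W = X]
  have lc: "glm lmul a \<phi> \<in> carrier (G X)" if "a \<in> carrier A" "\<phi> \<in> carrier (G X)" for a \<phi>
    unfolding glm_def by (rule hom_moduleI[OF m(1)]) (intro xlin linear_map_compose[OF _ G_linear[OF that(2)]]; simp add: that)
  have hc: "ghm X hmul h \<phi> \<in> carrier (G X)" if "h \<in> carrier H" "\<phi> \<in> carrier (G X)" for h \<phi>
    unfolding ghm_def by (rule hom_moduleI[OF m(1)]) (intro xlin m linear_map_compose[OF _ G_linear[OF that(2)]]; simp add: that)
  have hb: "bilinear_map K H H X (\<lambda>x y. hmul x (\<phi> (w \<star> y)))" if "\<phi> \<in> carrier (G X)" "w \<in> carrier H" for \<phi> w
    by (intro bilinear_mapI xlin linear_map_compose[OF _ G_linear[OF that(1)]]; simp add: that ap'[OF that(1)])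
  have lb: "bilinear_map K A (G X) (G X) (glm lmul)"
    by (intro bilinear_mapI linear_map_into_hom m lc; (assumption | simp add: glm_app))
       (intro xlin linear_map_eval; simp add: ap')+
  have hbl: "bilinear_map K H (G X) (G X) (ghm X hmul)"
    by (intro bilinear_mapI linear_map_into_hom m hc; (assumption | simp add: ghm_app))
       (intro xlin m hb linear_map_eval; simp add: ap')+
  show ?thesis
  proof (intro left_partial_module.intro left_module.intro left_module_axioms.intro left_partial_module_axioms.intro m lb hbl)
    fix \<phi> assume \<phi>: "\<phi> \<in> carrier (G X)"
    note ap = ap'[OF \<phi>]
    show "glm lmul \<one>\<^bsub>A\<^esub> \<phi> = \<phi>"
      by (rule hom_module_eqI[OF lc \<phi>]) (simp_all add: \<phi> glm_app ap X.lmul_one)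
    show "ghm X hmul \<one>\<^bsub>H\<^esub> \<phi> = \<phi>"
      by (rule hom_module_eqI[OF hc \<phi>]) (simp_all add: \<phi> ghm_app ap H.sw_one[OF X_module hb] X.hmul_one)
    fix a b assume ab: "a \<in> carrier A" "b \<in> carrier A"
    show "glm lmul a (glm lmul b \<phi>) = glm lmul (a \<cdot> b) \<phi>"
      by (rule hom_module_eqI[OF lc lc]) (simp_all add: \<phi> ab lc glm_app ap X.lmul_mult)
  next
    fix \<phi> a h g assume \<phi>: "\<phi> \<in> carrier (G X)" and a: "a \<in> carrier A" and h: "h \<in> carrier H" and g: "g \<in> carrier H"
    note c = \<phi> a h g lc hc ap'[OF \<phi>] and pl = linear_map_compose[OF _ G_linear[OF \<phi>]]
    show "ghm X hmul h (glm lmul a (ghm X hmul g \<phi>)) =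
      H.sw (G X) (\<lambda>h1 h2. glm lmul (act h1 a) (ghm X hmul (h2 \<star> g) \<phi>)) h"
    proof (rule hom_module_eqI)
      show "ghm X hmul h (glm lmul a (ghm X hmul g \<phi>)) \<in> carrier (G X)" by (simp add: c)
      show "H.sw (G X) (\<lambda>h1 h2. glm lmul (act h1 a) (ghm X hmul (h2 \<star> g) \<phi>)) h \<in> carrier (G X)"
        by (rule H.sw_closed[OF m(3) h]) (simp add: c)
      fix w assume w: "w \<in> carrier H"
      let ?\<gamma> = "\<lambda>p q y. H.sw X (\<lambda>u v. lmul (act p a) (hmul (q \<star> u) (\<phi> (w \<star> (y \<star> v))))) g"
      have "ghm X hmul h (glm lmul a (ghm X hmul g \<phi>)) w =
        H.sw X (\<lambda>x y. hmul x (lmul a (H.sw X (\<lambda>u v. hmul u (\<phi> (w \<star> y \<star> v))) g))) h"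
        unfolding ghm_app[OF w]
        by (rule H.sw_cong[OF m(2) h]) (simp_all add: c w ghm_app glm_app H.sw_closed[OF m(2)])
      also have "\<dots> = H.sw X (\<lambda>x y. H.sw X (\<lambda>p q. ?\<gamma> p q y) x) h"
      proof (rule H.sw_cong[OF m(2) h])
        fix x y assume xy: "x \<in> carrier H" "y \<in> carrier H"
        show "hmul x (lmul a (H.sw X (\<lambda>u v. hmul u (\<phi> (w \<star> y \<star> v))) g)) \<in> carrier X"
          by (intro hmul_closed lmul_closed H.sw_closed[OF m(2)]; simp add: c w xy)
        have "hmul x (lmul a (H.sw X (\<lambda>u v. hmul u (\<phi> (w \<star> y \<star> v))) g)) =
          H.sw X (\<lambda>u v. hmul x (lmul a (hmul u (\<phi> (w \<star> y \<star> v))))) g"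
          by (rule H.sw_comp[OF m(2,2) _ g, of "\<lambda>z. hmul x (lmul a z)"]) (intro xlin, simp_all add: c w xy)
        also have "\<dots> = H.sw X (\<lambda>u v. H.sw X (\<lambda>p q. lmul (act p a) (hmul (q \<star> u) (\<phi> (w \<star> (y \<star> v))))) x) g"
          by (rule H.sw_cong[OF m(2) g]) (simp_all add: c w xy X.hmul_lmul_hmul H.A.m_assoc H.sw_closed[OF m(2)])
        also have "\<dots> = H.sw X (\<lambda>p q. ?\<gamma> p q y) x"
          by (rule H.sw_swap[OF m(2) g xy(1)]) (simp add: c w xy)
        finally show "hmul x (lmul a (H.sw X (\<lambda>u v. hmul u (\<phi> (w \<star> y \<star> v))) g)) = H.sw X (\<lambda>p q. ?\<gamma> p q y) x" .
      qed
      also have "\<dots> = H.sw X (\<lambda>x y. H.sw X (\<lambda>p q. ?\<gamma> x p q) y) h"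
        by (rule H.sw_coassoc[OF m(2) h]) (intro xlin m pl; simp add: c w)+
      also have "\<dots> = H.sw X (\<lambda>x y. glm lmul (act x a) (ghm X hmul (y \<star> g) \<phi>) w) h"
      proof (rule H.sw_cong[OF m(2) h])
        fix x y assume xy: "x \<in> carrier H" "y \<in> carrier H"
        show "H.sw X (\<lambda>p q. ?\<gamma> x p q) y \<in> carrier X" by (intro H.sw_closed[OF m(2)]; simp add: c w xy)
        have "bilinear_map K H H X (\<lambda>p q. lmul (act x a) (hmul p (\<phi> (w \<star> q))))"
          by (intro bilinear_mapI xlin pl; simp add: c w xy)
        note e = H.sw_mult[OF m(2) this xy(2) g]
        have "glm lmul (act x a) (ghm X hmul (y \<star> g) \<phi>) w =
          lmul (act x a) (H.sw X (\<lambda>p q. hmul p (\<phi> (w \<star> q))) (y \<star> g))"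
          using w by (simp add: glm_app ghm_app)
        also have "\<dots> = H.sw X (\<lambda>p q. lmul (act x a) (hmul p (\<phi> (w \<star> q)))) (y \<star> g)"
          by (rule H.sw_comp[OF m(2,2)]) (intro xlin, simp_all add: c w xy)
        also have "\<dots> = H.sw X (\<lambda>p q. ?\<gamma> x p q) y" by (rule e)
        finally show "H.sw X (\<lambda>p q. ?\<gamma> x p q) y = glm lmul (act x a) (ghm X hmul (y \<star> g) \<phi>) w" by simp
      qed
      also have "\<dots> = H.sw (G X) (\<lambda>h1 h2. glm lmul (act h1 a) (ghm X hmul (h2 \<star> g) \<phi>)) h w"
        by (rule sw_eval[OF m(2) h w, symmetric]) (simp add: c)
      finally show "ghm X hmul h (glm lmul a (ghm X hmul g \<phi>)) w =
        H.sw (G X) (\<lambda>h1 h2. glm lmul (act h1 a) (ghm X hmul (h2 \<star> g) \<phi>)) h w" .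
    qed
  qed
qed

lemma G_context: "partial_module_context K H \<Delta> \<epsilon> S A act (G X) (glm lmul) (ghm X hmul)"
  using G_partial_module by (simp add: partial_module_context_def hopf_partial_action_axioms)

interpretation G: partial_module_context K H \<Delta> \<epsilon> S A act "G X" "glm lmul" "ghm X hmul"
  by (rule G_context)

text \<open>Since \<open>\<epsilon>\<close> is multiplicative, translation by the second leg of
  \<open>h\<close> becomes a counit factor and disappears. So the functions
  \<open>w \<mapsto> \<epsilon>(w) x\<close> form a copy of \<open>X\<close> inside
  \<open>Hom(H, X)\<close>.\<close>

lemma ten_G_const:
  assumes t: "t \<in> carrier AH.T" and x: "x \<in> carrier X"
  shows "(\<lambda>w\<in>carrier H. \<epsilon> w \<odot> x) \<in> carrier (G X)"
    and "G.ten t (\<lambda>w\<in>carrier H. \<epsilon> w \<odot> x) = (\<lambda>w\<in>carrier H. \<epsilon> w \<odot> ten t x)"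
proof -
  let ?c = "\<lambda>x. \<lambda>w\<in>carrier H. \<epsilon> w \<odot> x"
  have c: "?c x \<in> carrier (G X)" if "x \<in> carrier X" for x
    by (rule hom_moduleI[OF H.H_module]) (intro xlin X_module that)
  show "?c x \<in> carrier (G X)" by (rule c[OF x])
  have "?c (ten t x) = tact (G X) (glm lmul) (ghm X hmul) t (?c x)"
  proof (rule ten_equivariant[OF G.X_module _ G_partial_module _ _ t x, of ?c])
    show "linear_map K X (G X) ?c"
      by (rule linear_map_into_hom[OF X_module H.H_module X_module c])
         (simp_all add: linear_map_scale[OF X_module X_module linear_map_id])
    fix a x assume ax: "a \<in> carrier A" "x \<in> carrier X"
    show "?c (lmul a x) = glm lmul a (?c x)"
      by (rule hom_module_eqI[OF c G.lmul_closed])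
         (simp_all add: ax c glm_app linear_map_smult[OF bilinear_map_right[OF X.lmul_bilinear linear_map_id]])
  next
    fix h x assume hx: "h \<in> carrier H" "x \<in> carrier X"
    show "?c (hmul h x) = ghm X hmul h (?c x)"
    proof (rule hom_module_eqI[OF c G.hmul_closed])
      fix w assume w: "w \<in> carrier H"
      have "ghm X hmul h (?c x) w = H.sw X (\<lambda>u v. hmul u (\<epsilon> (w \<star> v) \<odot> x)) h"
        unfolding ghm_app[OF w] by (rule H.sw_cong[OF X_module hx(1)]) (simp_all add: w hx)
      also have "\<dots> = H.sw X (\<lambda>u v. \<epsilon> v \<odot> (\<epsilon> w \<odot> hmul u x)) h"
        by (rule H.sw_cong[OF X_module hx(1)])
           (simp_all add: w hx H.counit_mult linear_map_smult[OF bilinear_map_right[OF X.hmul_bilinear linear_map_id]]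
             H.K.m_comm flip: X.smult_assoc1)
      also have "\<dots> = \<epsilon> w \<odot> hmul h x"
        by (rule H.sw_counit_right[OF X_module _ hx(1), of "\<lambda>u. \<epsilon> w \<odot> hmul u x"])
           (intro linear_map_scale[OF H.H_module X_module] xlin, simp_all add: w hx)
      finally show "?c (hmul h x) w = ghm X hmul h (?c x) w" using w by simp
    qed (use hx c in auto)
  qed
  then show "G.ten t (?c x) = ?c (ten t x)" by simp
qed

text \<open>Translation by \<open>h2\<close> changes the value at \<open>\<Lambda>\<close> by the
  factor \<open>\<epsilon>(h2)\<close>, so evaluation at \<open>\<Lambda>\<close> is a homomorphism
  from \<open>Hom(H, X)\<close> to \<open>X\<close>. If \<open>\<epsilon> \<Lambda> = 1\<close>, it
  splits the embedding in \<open>ten_G_const\<close>.\<close>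

lemma ten_G_integral:
  assumes L: "\<Lambda> \<in> carrier H" "\<And>h. h \<in> carrier H \<Longrightarrow> \<Lambda> \<star> h = \<epsilon> h \<odot>\<^bsub>H\<^esub> \<Lambda>"
    and t: "t \<in> carrier AH.T" and \<phi>: "\<phi> \<in> carrier (G X)"
  shows "G.ten t \<phi> \<Lambda> = ten t (\<phi> \<Lambda>)"
proof (rule G.ten_equivariant[OF X_module linear_map_eval[OF L(1)] _ _ _ t \<phi>])
  show "partial_module X lmul hmul" by (rule X.left_partial_module_axioms)
  fix h \<phi> assume h: "h \<in> carrier H" and \<phi>: "\<phi> \<in> carrier (G X)"
  note ap = hom_module_app[OF \<phi>]
  have "ghm X hmul h \<phi> \<Lambda> = H.sw X (\<lambda>x y. \<epsilon> y \<odot> hmul x (\<phi> \<Lambda>)) h"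
    unfolding ghm_app[OF L(1)]
    by (rule H.sw_cong[OF X_module h])
       (simp_all add: L ap linear_map_smult[OF G_linear[OF \<phi>]]
         linear_map_smult[OF bilinear_map_right[OF X.hmul_bilinear linear_map_id]])
  also have "\<dots> = hmul h (\<phi> \<Lambda>)"
    by (rule H.sw_counit_right[OF X_module _ h, of "\<lambda>x. hmul x (\<phi> \<Lambda>)"]) (intro xlin, simp add: L ap)
  finally show "ghm X hmul h \<phi> \<Lambda> = hmul h (\<phi> \<Lambda>)" .
qed (use L glm_app in auto)

text \<open>By the compatibility axiom the left-hand side is the sum of
  \<open>(h1 a) (h2 S(h3)) x\<close>, and the antipode removes the last two legs. It is the partial
  form of the rule that in a smash product the action of \<open>h\<close> on \<open>a\<close> is the
  conjugation \<open>h1 a S(h2)\<close>.\<close>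

lemma hmul_lmul_antipode:
  assumes h: "h \<in> carrier H" and a: "a \<in> carrier A" and x: "x \<in> carrier X"
  shows "H.sw X (\<lambda>p u. hmul p (lmul a (hmul (S u) x))) h = lmul (act h a) x"
proof -
  note m = X_module H.H_module
  let ?\<gamma> = "\<lambda>c d u. lmul (act c a) (hmul (d \<star> S u) x)"
  have "H.sw X (\<lambda>p u. hmul p (lmul a (hmul (S u) x))) h = H.sw X (\<lambda>p u. H.sw X (\<lambda>c d. ?\<gamma> c d u) p) h"
    by (rule H.sw_cong[OF m(1) h]) (simp_all add: a x X.hmul_lmul_hmul H.sw_closed[OF m(1)])
  also have "\<dots> = H.sw X (\<lambda>c z. H.sw X (\<lambda>d u. ?\<gamma> c d u) z) h"
    by (rule H.sw_coassoc[OF m(1) h]) (intro xlin m; simp add: a x)+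
  also have "\<dots> = H.sw X (\<lambda>c z. \<epsilon> z \<odot> lmul (act c a) x) h"
  proof (rule H.sw_cong[OF m(1) h])
    fix c z assume cz: "c \<in> carrier H" "z \<in> carrier H"
    show "H.sw X (\<lambda>d u. ?\<gamma> c d u) z \<in> carrier X" by (rule H.sw_closed[OF m(1)]; simp add: cz a x)
    have "H.sw X (\<lambda>d u. ?\<gamma> c d u) z = \<epsilon> z \<odot> lmul (act c a) (hmul \<one>\<^bsub>H\<^esub> x)"
      by (rule H.sw_antipode_right[OF m(1) _ cz(2), of "\<lambda>y. lmul (act c a) (hmul y x)"]) (intro xlin; simp add: cz a x)
    then show "H.sw X (\<lambda>d u. ?\<gamma> c d u) z = \<epsilon> z \<odot> lmul (act c a) x" using x by (simp add: X.hmul_one)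
  qed
  also have "\<dots> = lmul (act h a) x"
    by (rule H.sw_counit_right[OF m(1) _ h, of "\<lambda>c. lmul (act c a) x"]) (intro xlin; simp add: a x)
  finally show ?thesis .
qed

text \<open>\<open>hmul_lmul_antipode\<close> writes \<open>(h a) x\<close> as a sum of terms in
  which \<open>a\<close> is applied to some vector of \<open>X\<close>.\<close>

lemma annihilator_act:
  assumes "a \<in> annihilator X lmul" "h \<in> carrier H"
  shows "act h a \<in> annihilator X lmul"
proof -
  have a: "a \<in> carrier A" and z: "\<And>x. x \<in> carrier X \<Longrightarrow> lmul a x = \<zero>" using assms(1) by (auto simp: annihilator_def)
  have "lmul (act h a) x = \<zero>" if x: "x \<in> carrier X" for x
  proof -
    have "lmul (act h a) x = H.sw X (\<lambda>p u. hmul p (lmul a (hmul (S u) x))) h"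
      by (rule hmul_lmul_antipode[OF assms(2) a x, symmetric])
    also have "\<dots> \<in> {\<zero>}"
      by (rule tensor_lift_in_submodule[OF H.H_module H.H_module X_module submodule_zero[OF X_module] H.comult_closed[OF assms(2)]])
         (simp add: z x linear_map_zero[OF X_module X_module bilinear_map_right[OF X.hmul_bilinear linear_map_id]])
    finally show ?thesis by simp
  qed
  then show ?thesis using a assms(2) by (simp add: annihilator_def)
qed

end

section \<open>Coefficients in \<open>A\<close> of elements of the smash product\<close>

context hopf_partial_action
begin

text \<open>The map \<open>id\<close> tensor \<open>f\<close>. For the functionals of a dual basis
  of \<open>H\<close> the slices of \<open>t\<close> are its coefficients in \<open>A\<close>;
  speaking of all functionals avoids fixing a basis.\<close>

definition slice :: "('h \<Rightarrow> 'k) \<Rightarrow> ('a \<times> 'h \<Rightarrow> 'k) set \<Rightarrow> 'a"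
  where "slice f t = tensor_lift K A (\<lambda>a h. f h \<odot>\<^bsub>A\<^esub> a) t"

lemma slice_linear: "functional K H f \<Longrightarrow> linear_map K AH.T A (slice f)"
  and slice_pure: "functional K H f \<Longrightarrow> a \<in> carrier A \<Longrightarrow> h \<in> carrier H \<Longrightarrow> slice f (pure a h) = f h \<odot>\<^bsub>A\<^esub> a"
proof -
  assume f: "functional K H f"
  have fK: "f h \<in> carrier K" if "h \<in> carrier H" for h
    using linear_map_closed[OF f that] by (simp add: scalar_module_def)
  have b: "bilinear_map K A H A (\<lambda>a h. f h \<odot>\<^bsub>A\<^esub> a)"
    by (intro bilinear_mapI linear_map_scale[OF A_module A_module linear_map_id]
        functional_smult_linear[OF H.H_module A_module f])
       (simp_all add: fK)
  show "linear_map K AH.T A (slice f)" unfolding slice_def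
    by (rule tensor_lift_linear[OF A_module H.H_module A_module b])
  show "a \<in> carrier A \<Longrightarrow> h \<in> carrier H \<Longrightarrow> slice f (pure a h) = f h \<odot>\<^bsub>A\<^esub> a"
    unfolding slice_def by (rule tensor_lift_pure_tensor[OF A_module H.H_module A_module b])
qed

end

context partial_module_context
begin

interpretation G: partial_module_context K H \<Delta> \<epsilon> S A act "G X" "glm lmul" "ghm X hmul"
  by (rule G_context)

text \<open>The test function \<open>w \<mapsto> f(w2) S(w1) x\<close> is built so that acting with
  \<open>a # h\<close> and evaluating at \<open>1\<close> gives the sum of
  \<open>f(h3) a h1 S(h2) x\<close>. By \<open>hmul_lmul_antipode\<close> this is the sum of
  \<open>f(h2) a (h1 1) x\<close>, the action on \<open>x\<close> of the slice of
  \<open>(a # h) (1 # 1)\<close>. The assumption that \<open>1 # 1\<close> fixes \<open>t\<close>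
  from the right turns this into the slice of \<open>t\<close>.\<close>

lemma slice_annihilates:
  assumes t: "t \<in> carrier AH.T" "t \<bullet> pure \<one>\<^bsub>A\<^esub> \<one>\<^bsub>H\<^esub> = t"
    and k: "\<And>\<phi>. \<phi> \<in> carrier (G X) \<Longrightarrow> G.ten t \<phi> = \<zero>\<^bsub>G X\<^esub>" and f: "functional K H f"
  shows "slice f t \<in> annihilator X lmul"
proof -
  note m = X_module H.H_module A_module
  have fK: "f h \<in> carrier K" if "h \<in> carrier H" for h
    using linear_map_closed[OF f that] by (simp add: scalar_module_def)
  have sA: "slice f t \<in> carrier A" using linear_map_closed[OF slice_linear[OF f] t(1)] .
  have "lmul (slice f t) x = \<zero>" if x: "x \<in> carrier X" for x
  proof -
    note fl = functional_smult_linear[OF H.H_module _ f] linear_map_scale[OF H.H_module X_module]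
    let ?\<phi> = "\<lambda>w\<in>carrier H. H.sw X (\<lambda>u v. f v \<odot> hmul (S u) x) w"
    have b: "bilinear_map K H H X (\<lambda>u v. f v \<odot> hmul (S u) x)"
      by (intro bilinear_mapI fl xlin m; simp add: x fK)
    have \<phi>: "?\<phi> \<in> carrier (G X)"
      by (rule hom_moduleI[OF m(2)]) (intro xlin m b)
    have "lmul (slice f (t \<bullet> pure \<one>\<^bsub>A\<^esub> \<one>\<^bsub>H\<^esub>)) x = G.ten t ?\<phi> \<one>\<^bsub>H\<^esub>"
    proof (rule AH.tensor_linear_eqI[OF m(1) _ _ t(1), of "\<lambda>t. lmul (slice f (t \<bullet> pure \<one>\<^bsub>A\<^esub> \<one>\<^bsub>H\<^esub>)) x"])
      show "linear_map K AH.T X (\<lambda>t. lmul (slice f (t \<bullet> pure \<one>\<^bsub>A\<^esub> \<one>\<^bsub>H\<^esub>)) x)"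
        by (intro bilinear_map_left[OF X.lmul_bilinear] linear_map_compose[OF _ slice_linear[OF f]]
            bilinear_map_left[OF smash_mult_bilinear] linear_map_id) (simp_all add: x)
      show "linear_map K AH.T X (\<lambda>t. G.ten t ?\<phi> \<one>\<^bsub>H\<^esub>)"
        by (rule linear_map_compose[OF bilinear_map_left[OF G.ten_bilinear linear_map_id \<phi>] linear_map_eval]) simp
      fix a h assume a: "a \<in> carrier A" and h: "h \<in> carrier H"
      have "slice f (pure a h \<bullet> pure \<one>\<^bsub>A\<^esub> \<one>\<^bsub>H\<^esub>) = H.sw A (\<lambda>p q. slice f (pure (a \<cdot> act p \<one>\<^bsub>A\<^esub>) (q \<star> \<one>\<^bsub>H\<^esub>))) h"
        unfolding smash_pure[OF a h A.A.one_closed H.A.one_closed]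
        by (rule H.sw_comp[OF AH_module m(3) slice_linear[OF f] h]) (simp add: a)
      also have "\<dots> = H.sw A (\<lambda>p q. f q \<odot>\<^bsub>A\<^esub> (a \<cdot> act p \<one>\<^bsub>A\<^esub>)) h"
        by (rule H.sw_cong[OF m(3) h]) (simp_all add: a slice_pure[OF f] fK)
      also have "lmul \<dots> x = H.sw X (\<lambda>p q. lmul (f q \<odot>\<^bsub>A\<^esub> (a \<cdot> act p \<one>\<^bsub>A\<^esub>)) x) h"
        by (rule H.sw_comp[OF m(3,1) _ h, of "\<lambda>b. lmul b x"]) (intro xlin, simp_all add: x a fK)
      also have "\<dots> = H.sw X (\<lambda>p q. f q \<odot> lmul a (lmul (act p \<one>\<^bsub>A\<^esub>) x)) h"
        by (rule H.sw_cong[OF m(1) h])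
           (simp_all add: a x fK linear_map_smult[OF bilinear_map_left[OF X.lmul_bilinear linear_map_id]] X.lmul_mult)
      also have "\<dots> = H.sw X (\<lambda>p q. H.sw X (\<lambda>c u. f q \<odot> lmul a (hmul c (hmul (S u) x))) p) h"
      proof (rule H.sw_cong[OF m(1) h])
        fix p q assume pq: "p \<in> carrier H" "q \<in> carrier H"
        have "lmul (act p \<one>\<^bsub>A\<^esub>) x = H.sw X (\<lambda>c u. hmul c (lmul \<one>\<^bsub>A\<^esub> (hmul (S u) x))) p"
          by (rule hmul_lmul_antipode[symmetric]) (simp_all add: pq x)
        also have "\<dots> = H.sw X (\<lambda>c u. hmul c (hmul (S u) x)) p"
          by (rule H.sw_cong[OF m(1) pq(1)]) (simp_all add: x X.lmul_one)
        finally have "f q \<odot> lmul a (lmul (act p \<one>\<^bsub>A\<^esub>) x) = f q \<odot> lmul a (H.sw X (\<lambda>c u. hmul c (hmul (S u) x)) p)"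
          by simp
        also have "\<dots> = H.sw X (\<lambda>c u. f q \<odot> lmul a (hmul c (hmul (S u) x))) p"
          by (rule H.sw_comp[OF m(1,1) _ pq(1), of "\<lambda>z. f q \<odot> lmul a z"])
             (intro linear_map_scale[OF m(1,1)] xlin, simp_all add: pq a x fK)
        finally show "f q \<odot> lmul a (lmul (act p \<one>\<^bsub>A\<^esub>) x) =
          H.sw X (\<lambda>c u. f q \<odot> lmul a (hmul c (hmul (S u) x))) p" .
      qed (simp add: a x fK)
      also have "\<dots> = H.sw X (\<lambda>c z. H.sw X (\<lambda>u q. f q \<odot> lmul a (hmul c (hmul (S u) x))) z) h"
        by (rule H.sw_coassoc[OF m(1) h]) (intro fl xlin m; simp add: a x fK)+
      also have "\<dots> = H.sw X (\<lambda>c z. lmul a (hmul c (?\<phi> (\<one>\<^bsub>H\<^esub> \<star> z)))) h"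
      proof (rule H.sw_cong[OF m(1) h])
        fix c z assume cz: "c \<in> carrier H" "z \<in> carrier H"
        show "H.sw X (\<lambda>u q. f q \<odot> lmul a (hmul c (hmul (S u) x))) z \<in> carrier X"
          by (rule H.sw_closed[OF m(1)]; simp add: cz a x fK)
        have "lmul a (hmul c (H.sw X (\<lambda>u v. f v \<odot> hmul (S u) x) z)) =
          H.sw X (\<lambda>u v. lmul a (hmul c (f v \<odot> hmul (S u) x))) z"
          by (rule H.sw_comp[OF m(1,1) _ cz(2), of "\<lambda>y. lmul a (hmul c y)"]) (intro xlin, simp_all add: cz a x fK)
        also have "\<dots> = H.sw X (\<lambda>u q. f q \<odot> lmul a (hmul c (hmul (S u) x))) z"
          by (rule H.sw_cong[OF m(1) cz(2)])
             (simp_all add: cz a x fK linear_map_smult[OF bilinear_map_right[OF X.lmul_bilinear linear_map_id]]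
               linear_map_smult[OF bilinear_map_right[OF X.hmul_bilinear linear_map_id]])
        finally show "H.sw X (\<lambda>u q. f q \<odot> lmul a (hmul c (hmul (S u) x))) z = lmul a (hmul c (?\<phi> (\<one>\<^bsub>H\<^esub> \<star> z)))"
          using cz by simp
      qed
      also have "\<dots> = lmul a (H.sw X (\<lambda>c z. hmul c (?\<phi> (\<one>\<^bsub>H\<^esub> \<star> z))) h)"
        by (rule H.sw_comp[OF m(1,1) _ h, of "lmul a", symmetric])
           (intro bilinear_map_right[OF X.lmul_bilinear linear_map_id a], 
            simp del: restrict_apply add: hom_module_app[OF \<phi>])
      also have "\<dots> = G.ten (pure a h) ?\<phi> \<one>\<^bsub>H\<^esub>"
        using a h \<phi> by (simp add: glm_app ghm_app del: restrict_apply)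
      finally show "lmul (slice f (pure a h \<bullet> pure \<one>\<^bsub>A\<^esub> \<one>\<^bsub>H\<^esub>)) x = G.ten (pure a h) ?\<phi> \<one>\<^bsub>H\<^esub>" .
    qed
    then show ?thesis using k[OF \<phi>] t(2) by (simp add: hom_module_ev)
  qed
  then show ?thesis using sA by (simp add: annihilator_def)
qed

end

section \<open>Twisting by the antipode\<close>

context partial_module_context
begin

interpretation G: partial_module_context K H \<Delta> \<epsilon> S A act "G X" "glm lmul" "ghm X hmul"
  by (rule G_context)

interpretation GG: partial_module_context K H \<Delta> \<epsilon> S A act "G (G X)" "glm (glm lmul)" "ghm (G X) (ghm X hmul)"
  by (rule G.G_context)

text \<open>
  Each \<open>untwist u\<close> is a homomorphism of partial modules, and \<open>twist\<close> is a section of the family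
  \<open>\<lambda>\<Phi> u. untwist u \<Phi>\<close>. Neither of the two is equivariant jointly in \<open>u\<close>, nor needs to be.
\<close>

definition untwist :: "'h \<Rightarrow> ('h \<Rightarrow> 'h \<Rightarrow> 'x) \<Rightarrow> 'h \<Rightarrow> 'x"
  where "untwist u \<Phi> = (\<lambda>w\<in>carrier H. H.sw X (\<lambda>p q. \<Phi> q (u \<star> p)) w)"

definition twist :: "('h \<Rightarrow> 'h \<Rightarrow> 'x) \<Rightarrow> 'h \<Rightarrow> 'h \<Rightarrow> 'x"
  where "twist \<Psi> = (\<lambda>w\<in>carrier H. \<lambda>v\<in>carrier H. H.sw X (\<lambda>p q. \<Psi> (v \<star> S p) q) w)"

lemma GG_linear:
  assumes "\<Phi> \<in> carrier (G (G X))"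
  shows "u \<in> carrier H \<Longrightarrow> \<Phi> u \<in> carrier (G X)"
    and "u \<in> carrier H \<Longrightarrow> v \<in> carrier H \<Longrightarrow> \<Phi> u v \<in> carrier X"
    and "u \<in> carrier H \<Longrightarrow> linear_map K Y H f \<Longrightarrow> linear_map K Y X (\<lambda>y. \<Phi> u (f y))"
    and "v \<in> carrier H \<Longrightarrow> linear_map K Y H f \<Longrightarrow> linear_map K Y X (\<lambda>y. \<Phi> (f y) v)"
proof -
  show *: "\<Phi> u \<in> carrier (G X)" if "u \<in> carrier H" for u
    using hom_module_app[OF assms that] .
  show "\<Phi> u v \<in> carrier X" if "u \<in> carrier H" "v \<in> carrier H"
    using hom_module_app[OF *[OF that(1)] that(2)] .
  show "linear_map K Y X (\<lambda>y. \<Phi> u (f y))" if "u \<in> carrier H" "linear_map K Y H f"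
    by (rule linear_map_compose[OF that(2) G_linear[OF *[OF that(1)]]])
  show "linear_map K Y X (\<lambda>y. \<Phi> (f y) v)" if "v \<in> carrier H" "linear_map K Y H f"
    by (rule linear_map_compose[OF linear_map_compose[OF that(2) G_linear[OF assms]] linear_map_eval[OF that(1)]])
qed

lemma untwist_closed:
  assumes "u \<in> carrier H" "\<Phi> \<in> carrier (G (G X))"
  shows "untwist u \<Phi> \<in> carrier (G X)"
  unfolding untwist_def
  by (rule hom_moduleI[OF H.H_module])
     (intro lin GG_linear(3,4)[OF assms(2)] X_module bilinear_mapI; simp add: assms)

lemma untwist_linear:
  assumes u: "u \<in> carrier H"
  shows "linear_map K (G (G X)) (G X) (untwist u)"
proof (rule linear_map_into_hom[OF GG.X_module H.H_module X_module untwist_closed[OF u]])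
  fix w assume w: "w \<in> carrier H"
  show "linear_map K (G (G X)) X (\<lambda>\<Phi>. untwist u \<Phi> w)"
    unfolding untwist_def using w
    by (simp, intro H.linear_sw_param[OF X_module GG.X_module] linear_map_compose[OF linear_map_eval linear_map_eval])
       (simp_all add: u)
qed

lemma untwist_lmul:
  assumes "u \<in> carrier H" "\<Phi> \<in> carrier (G (G X))" "a \<in> carrier A"
  shows "untwist u (glm (glm lmul) a \<Phi>) = glm lmul a (untwist u \<Phi>)"
proof (rule hom_module_eqI)
  show "untwist u (glm (glm lmul) a \<Phi>) \<in> carrier (G X)" "glm lmul a (untwist u \<Phi>) \<in> carrier (G X)"
    using assms by (simp_all add: untwist_closed)
  fix w assume w: "w \<in> carrier H"
  have "untwist u (glm (glm lmul) a \<Phi>) w = H.sw X (\<lambda>p q. lmul a (\<Phi> q (u \<star> p))) w"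
    using w by (simp add: untwist_def, intro H.sw_cong[OF X_module w])
      (simp_all add: assms G.glm_app glm_app GG_linear[OF assms(2)])
  also have "\<dots> = lmul a (H.sw X (\<lambda>p q. \<Phi> q (u \<star> p)) w)"
    by (rule H.sw_comp[OF X_module X_module bilinear_map_right[OF X.lmul_bilinear linear_map_id assms(3)] w, symmetric])
       (simp add: assms GG_linear[OF assms(2)])
  finally show "untwist u (glm (glm lmul) a \<Phi>) w = glm lmul a (untwist u \<Phi>) w"
    using w by (simp add: untwist_def glm_app)
qed

text \<open>In the two layers of \<open>Hom\<close>, \<open>h1\<close> acts on values, while the
  legs \<open>p\<close> and \<open>q\<close> of \<open>w\<close> become \<open>p h2\<close> and
  \<open>q h3\<close>. Together these are the legs of the product of \<open>w\<close> with the
  second leg of \<open>h\<close>, so the untwisted function is translated exactly as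
  \<open>ghm\<close> demands.\<close>

lemma untwist_hmul:
  assumes u: "u \<in> carrier H" and \<Phi>: "\<Phi> \<in> carrier (G (G X))" and h: "h \<in> carrier H"
  shows "untwist u (ghm (G X) (ghm X hmul) h \<Phi>) = ghm X hmul h (untwist u \<Phi>)"
proof (rule hom_module_eqI)
  note c = u h GG_linear(1,2)[OF \<Phi>] and pl = GG_linear(3,4)[OF \<Phi>]
  note m = X_module H.H_module and sc = H.sw_closed[OF X_module]
  show "untwist u (ghm (G X) (ghm X hmul) h \<Phi>) \<in> carrier (G X)" "ghm X hmul h (untwist u \<Phi>) \<in> carrier (G X)"
    using assms by (simp_all add: untwist_closed)
  fix w assume w: "w \<in> carrier H"
  let ?\<gamma> = "\<lambda>r s y. H.sw X (\<lambda>p q. hmul r (\<Phi> (q \<star> y) (u \<star> (p \<star> s)))) w"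
  have e: "ghm (G X) (ghm X hmul) h \<Phi> q (u \<star> p) =
    H.sw X (\<lambda>x y. H.sw X (\<lambda>r s. hmul r (\<Phi> (q \<star> y) (u \<star> (p \<star> s)))) x) h" (is "_ = ?R")
    if q: "q \<in> carrier H" and p: "p \<in> carrier H" for q p
  proof -
    have "ghm (G X) (ghm X hmul) h \<Phi> q (u \<star> p) =
      H.sw X (\<lambda>x y. ghm X hmul x (\<Phi> (q \<star> y)) (u \<star> p)) h"
      unfolding G.ghm_app[OF q] by (rule sw_eval[OF m(1) h]) (simp_all add: c p q)
    also have "\<dots> = ?R"
    proof (rule H.sw_cong[OF m(1) h])
      fix x y assume xy: "x \<in> carrier H" "y \<in> carrier H"
      show "ghm X hmul x (\<Phi> (q \<star> y)) (u \<star> p) \<in> carrier X"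
        by (rule hom_module_app[OF G.hmul_closed]) (simp_all add: c p q xy)
      show "ghm X hmul x (\<Phi> (q \<star> y)) (u \<star> p) =
        H.sw X (\<lambda>r s. hmul r (\<Phi> (q \<star> y) (u \<star> (p \<star> s)))) x"
        unfolding ghm_app[OF H.A.m_closed[OF u p]]
        by (rule H.sw_cong[OF m(1) xy(1)]) (simp_all add: c p q xy H.A.m_assoc)
    qed
    finally show ?thesis .
  qed
  have "untwist u (ghm (G X) (ghm X hmul) h \<Phi>) w =
    H.sw X (\<lambda>p q. H.sw X (\<lambda>x y. H.sw X (\<lambda>r s. hmul r (\<Phi> (q \<star> y) (u \<star> (p \<star> s)))) x) h) w"
    using w by (simp add: untwist_def, intro H.sw_cong[OF m(1) w])
      (simp_all add: c e sc)
  also have "\<dots> = H.sw X (\<lambda>x y. H.sw X (\<lambda>p q. H.sw X (\<lambda>r s. hmul r (\<Phi> (q \<star> y) (u \<star> (p \<star> s)))) x) w) h"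
    by (rule H.sw_swap[OF m(1) w h]) (simp add: c sc)
  also have "\<dots> = H.sw X (\<lambda>x y. H.sw X (\<lambda>r s. ?\<gamma> r s y) x) h"
    by (rule H.sw_cong[OF m(1) h], simp add: c sc w, rule H.sw_swap[OF m(1) w]) (simp_all add: c)
  also have "\<dots> = H.sw X (\<lambda>x y. H.sw X (\<lambda>s y. ?\<gamma> x s y) y) h"
    by (rule H.sw_coassoc[OF m(1) h]) (intro xlin pl m; simp add: c w)+
  also have "\<dots> = H.sw X (\<lambda>x y. hmul x (untwist u \<Phi> (w \<star> y))) h"
  proof (rule H.sw_cong[OF m(1) h])
    fix x y assume xy: "x \<in> carrier H" "y \<in> carrier H"
    show "H.sw X (\<lambda>s y. ?\<gamma> x s y) y \<in> carrier X" by (simp add: c sc w xy)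
    have b: "bilinear_map K H H X (\<lambda>p q. hmul x (\<Phi> q (u \<star> p)))"
      by (intro bilinear_mapI xlin pl; simp add: c xy)
    have "hmul x (untwist u \<Phi> (w \<star> y)) = H.sw X (\<lambda>p q. hmul x (\<Phi> q (u \<star> p))) (w \<star> y)"
      unfolding untwist_def using w xy
      by (simp, intro H.sw_comp[OF m(1,1) bilinear_map_right[OF X.hmul_bilinear linear_map_id]]) (simp_all add: c)
    also have "\<dots> = H.sw X (\<lambda>p q. H.sw X (\<lambda>s y. hmul x (\<Phi> (q \<star> y) (u \<star> (p \<star> s)))) y) w"
      by (rule H.sw_mult[OF m(1) b w xy(2)])
    also have "\<dots> = H.sw X (\<lambda>s y. ?\<gamma> x s y) y"
      by (rule H.sw_swap[OF m(1) w xy(2)]) (simp add: c xy)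
    finally show "H.sw X (\<lambda>s y. ?\<gamma> x s y) y = hmul x (untwist u \<Phi> (w \<star> y))" by simp
  qed
  finally show "untwist u (ghm (G X) (ghm X hmul) h \<Phi>) w = ghm X hmul h (untwist u \<Phi>) w"
    using w by (simp add: ghm_app)
qed

lemma untwist_ten:
  assumes "u \<in> carrier H" "\<Phi> \<in> carrier (G (G X))" "t \<in> carrier AH.T"
  shows "untwist u (GG.ten t \<Phi>) = G.ten t (untwist u \<Phi>)"
  by (rule GG.ten_equivariant[OF G.X_module untwist_linear[OF assms(1)] G_partial_module _ _ assms(3,2)])
     (simp_all add: assms(1) untwist_lmul untwist_hmul)

text \<open>\<open>\<Phi>\<close> can be recovered from its untwists: by the antipode,
  \<open>\<Phi>(w)(v)\<close> is the sum of \<open>\<Phi>(w3)(v S(w1) w2)\<close>, and this is the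
  sum of the values of \<open>untwist (v S(w1)) \<Phi>\<close> at \<open>w2\<close>, with
  \<open>w2\<close> and \<open>w3\<close> merged into one leg.\<close>

lemma untwist_zero:
  assumes \<Phi>: "\<Phi> \<in> carrier (G (G X))" and z: "\<And>u. u \<in> carrier H \<Longrightarrow> untwist u \<Phi> = \<zero>\<^bsub>G X\<^esub>"
  shows "\<Phi> = \<zero>\<^bsub>G (G X)\<^esub>"
proof -
  note c = GG_linear(1,2)[OF \<Phi>] and pl = GG_linear(3,4)[OF \<Phi>]
  note m = X_module H.H_module and sc = H.sw_closed[OF X_module]
  interpret X': module K X by (rule X_module)
  have "\<Phi> w v = \<zero>" if w: "w \<in> carrier H" and v: "v \<in> carrier H" for w v
  proof -
    let ?\<gamma> = "\<lambda>p r s. \<Phi> s (v \<star> (S p \<star> r))"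
    have "\<Phi> w v = H.sw X (\<lambda>x s. \<epsilon> x \<odot> \<Phi> s v) w"
      by (rule H.sw_counit_left[OF m(1) _ w, symmetric]) (intro pl linear_map_id v)
    also have "\<dots> = H.sw X (\<lambda>x s. H.sw X (\<lambda>p r. ?\<gamma> p r s) x) w"
    proof (rule H.sw_cong[OF m(1) w])
      fix x s assume xs: "x \<in> carrier H" "s \<in> carrier H"
      have "H.sw X (\<lambda>p r. ?\<gamma> p r s) x = \<epsilon> x \<odot> \<Phi> s (v \<star> \<one>\<^bsub>H\<^esub>)"
        by (rule H.sw_antipode_left[OF m(1) _ xs(1), of "\<lambda>z. \<Phi> s (v \<star> z)"]) (intro lin pl; simp add: xs v)
      then show "\<epsilon> x \<odot> \<Phi> s v = H.sw X (\<lambda>p r. ?\<gamma> p r s) x" using v by simp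
    qed (simp add: c v)
    also have "\<dots> = H.sw X (\<lambda>p q. H.sw X (\<lambda>r s. ?\<gamma> p r s) q) w"
      by (rule H.sw_coassoc[OF m(1) w]) (intro lin pl; simp add: v)+
    also have "\<dots> = H.sw X (\<lambda>p q. \<zero>) w"
    proof (rule H.sw_cong[OF m(1) w])
      fix p q assume pq: "p \<in> carrier H" "q \<in> carrier H"
      show "H.sw X (\<lambda>r s. ?\<gamma> p r s) q \<in> carrier X" by (rule sc) (simp_all add: c v pq)
      have "H.sw X (\<lambda>r s. ?\<gamma> p r s) q = untwist (v \<star> S p) \<Phi> q"
        using pq by (simp add: untwist_def, intro H.sw_cong[OF m(1)]) (simp_all add: c v H.A.m_assoc)
      then show "H.sw X (\<lambda>r s. ?\<gamma> p r s) q = \<zero>" using z v pq by (simp add: hom_module_ev)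
    qed
    also have "\<dots> \<in> {\<zero>}"
      by (rule tensor_lift_in_submodule[OF m(2,2,1) submodule_zero[OF m(1)] H.comult_closed[OF w]]) simp
    finally show ?thesis by simp
  qed
  then show ?thesis
    by (intro hom_module_eqI[OF \<Phi> GG.X.zero_closed] hom_module_eqI[where V = H and W = X and K = K])
       (simp_all add: c hom_module_ev)
qed

lemma twist_closed:
  assumes "\<Psi> \<in> carrier (G (G X))"
  shows "twist \<Psi> \<in> carrier (G (G X))"
proof -
  note c = GG_linear(1,2)[OF assms] and pl = GG_linear(3,4)[OF assms]
  have b: "bilinear_map K H H X (\<lambda>p q. \<Psi> (v \<star> S p) q)" if "v \<in> carrier H" for v
    by (intro bilinear_mapI lin pl; simp add: that)
  have 1: "(\<lambda>v\<in>carrier H. H.sw X (\<lambda>p q. \<Psi> (v \<star> S p) q) w) \<in> carrier (G X)" if "w \<in> carrier H" for w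
    by (rule hom_moduleI[OF H.H_module], rule H.linear_sw_param[OF X_module H.H_module that, of "\<lambda>v p q. \<Psi> (v \<star> S p) q"])
       (intro lin pl; simp)
  show ?thesis
    unfolding twist_def
  proof (rule hom_moduleI[OF H.H_module], rule linear_map_into_hom[OF H.H_module H.H_module X_module 1])
    fix v assume v: "v \<in> carrier H"
    then show "linear_map K H X (\<lambda>w. (\<lambda>v\<in>carrier H. H.sw X (\<lambda>p q. \<Psi> (v \<star> S p) q) w) v)"
      by (simp, intro H.linear_sw[OF X_module linear_map_id b])
  qed
qed

lemma twist_linear: "linear_map K (G (G X)) (G (G X)) twist"
proof (rule linear_map_into_hom[OF GG.X_module H.H_module G.X_module])
  fix w assume w: "w \<in> carrier H"
  have "linear_map K (G (G X)) (G X) (\<lambda>\<Psi>. \<lambda>v\<in>carrier H. H.sw X (\<lambda>p q. \<Psi> (v \<star> S p) q) w)"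
  proof (rule linear_map_into_hom[OF GG.X_module H.H_module X_module])
    fix \<Psi> assume P: "\<Psi> \<in> carrier (G (G X))"
    show "(\<lambda>v\<in>carrier H. H.sw X (\<lambda>p q. \<Psi> (v \<star> S p) q) w) \<in> carrier (G X)"
      using hom_module_app[OF twist_closed[OF P] w] w by (simp add: twist_def)
  next
    fix v assume v: "v \<in> carrier H"
    then show "linear_map K (G (G X)) X (\<lambda>\<Psi>. (\<lambda>v\<in>carrier H. H.sw X (\<lambda>p q. \<Psi> (v \<star> S p) q) w) v)"
      by (simp, intro H.linear_sw_param[OF X_module GG.X_module w] linear_map_compose[OF linear_map_eval linear_map_eval])
         simp_all
  qed
  then show "linear_map K (G (G X)) (G X) (\<lambda>\<Psi>. twist \<Psi> w)" using w by (simp add: twist_def)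
qed (rule twist_closed)

text \<open>In the sum of \<open>\<Psi>(u w1 S(w2))(w3)\<close> the antipode cancels the first two
  legs.\<close>

lemma untwist_twist:
  assumes \<Psi>: "\<Psi> \<in> carrier (G (G X))" and u: "u \<in> carrier H"
  shows "untwist u (twist \<Psi>) = \<Psi> u"
proof (rule hom_module_eqI[OF untwist_closed[OF u twist_closed[OF \<Psi>]] GG_linear(1)[OF \<Psi> u]])
  note c = GG_linear(1,2)[OF \<Psi>] and pl = GG_linear(3,4)[OF \<Psi>]
  note m = X_module H.H_module and sc = H.sw_closed[OF X_module]
  fix w assume w: "w \<in> carrier H"
  let ?\<gamma> = "\<lambda>p r s. \<Psi> (u \<star> (p \<star> S r)) s"
  have "untwist u (twist \<Psi>) w = H.sw X (\<lambda>p q. H.sw X (\<lambda>r s. ?\<gamma> p r s) q) w"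
  proof -
    have "twist \<Psi> q (u \<star> p) = H.sw X (\<lambda>r s. ?\<gamma> p r s) q" if pq: "p \<in> carrier H" "q \<in> carrier H" for p q
      using pq u by (simp add: twist_def, intro H.sw_cong[OF m(1)]) (simp_all add: c H.A.m_assoc)
    then show ?thesis
      using w by (simp add: untwist_def, intro H.sw_cong[OF m(1) w]) (simp_all add: c u sc)
  qed
  also have "\<dots> = H.sw X (\<lambda>x s. H.sw X (\<lambda>p r. ?\<gamma> p r s) x) w"
    by (rule H.sw_coassoc[OF m(1) w, symmetric]) (intro lin pl; simp add: u)+
  also have "\<dots> = H.sw X (\<lambda>x s. \<epsilon> x \<odot> \<Psi> u s) w"
  proof (rule H.sw_cong[OF m(1) w])
    fix x s assume xs: "x \<in> carrier H" "s \<in> carrier H"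
    show "H.sw X (\<lambda>p r. ?\<gamma> p r s) x \<in> carrier X" by (rule sc) (simp_all add: c u xs)
    have "H.sw X (\<lambda>p r. ?\<gamma> p r s) x = \<epsilon> x \<odot> \<Psi> (u \<star> \<one>\<^bsub>H\<^esub>) s"
      by (rule H.sw_antipode_right[OF m(1) _ xs(1), of "\<lambda>z. \<Psi> (u \<star> z) s"]) (intro lin pl; simp add: xs u)
    then show "H.sw X (\<lambda>p r. ?\<gamma> p r s) x = \<epsilon> x \<odot> \<Psi> u s" using u by simp
  qed
  also have "\<dots> = \<Psi> u w"
    by (rule H.sw_counit_left[OF m(1) _ w]) (intro pl linear_map_id u)
  finally show "untwist u (twist \<Psi>) w = \<Psi> u w" .
qed

end

section \<open>Homomorphisms, submodules and quotients of partial modules\<close>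

context hopf_partial_action
begin

definition partial_hom ::
  "('k, 'x) module \<Rightarrow> ('a \<Rightarrow> 'x \<Rightarrow> 'x) \<Rightarrow> ('h \<Rightarrow> 'x \<Rightarrow> 'x) \<Rightarrow>
   ('k, 'y) module \<Rightarrow> ('a \<Rightarrow> 'y \<Rightarrow> 'y) \<Rightarrow> ('h \<Rightarrow> 'y \<Rightarrow> 'y) \<Rightarrow> ('x \<Rightarrow> 'y) \<Rightarrow> bool"
  where "partial_hom X lmul hmul Y lmul' hmul' f \<longleftrightarrow>
    partial_module X lmul hmul \<and> partial_module Y lmul' hmul' \<and> linear_map K X Y f \<and>
    (\<forall>a\<in>carrier A. \<forall>x\<in>carrier X. f (lmul a x) = lmul' a (f x)) \<and>
    (\<forall>h\<in>carrier H. \<forall>x\<in>carrier X. f (hmul h x) = hmul' h (f x))"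

lemma partial_contextI:
  "partial_module X lmul hmul \<Longrightarrow> partial_module_context K H \<Delta> \<epsilon> S A act X lmul hmul"
  by (simp add: partial_module_context_def hopf_partial_action_axioms)

lemma partial_hom_ten:
  assumes "partial_hom X lmul hmul Y lmul' hmul' f" "t \<in> carrier AH.T" "x \<in> carrier X"
  shows "f (tact X lmul hmul t x) = tact Y lmul' hmul' t (f x)"
proof -
  interpret X: partial_module_context K H \<Delta> \<epsilon> S A act X lmul hmul
    using assms(1) by (simp add: partial_hom_def partial_contextI)
  interpret Y: partial_module_context K H \<Delta> \<epsilon> S A act Y lmul' hmul'
    using assms(1) by (simp add: partial_hom_def partial_contextI)
  show ?thesis
    using assms by (intro X.ten_equivariant[OF Y.X_module]) (auto simp: partial_hom_def)
qed

lemma partial_hom_G: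
  assumes "partial_hom X lmul hmul Y lmul' hmul' f"
  shows "partial_hom (G X) (glm lmul) (ghm X hmul) (G Y) (glm lmul') (ghm Y hmul') (\<lambda>\<phi>. \<lambda>h\<in>carrier H. f (\<phi> h))"
proof -
  interpret X: partial_module_context K H \<Delta> \<epsilon> S A act X lmul hmul
    using assms(1) by (simp add: partial_hom_def partial_contextI)
  interpret Y: partial_module_context K H \<Delta> \<epsilon> S A act Y lmul' hmul'
    using assms(1) by (simp add: partial_hom_def partial_contextI)
  interpret GX: partial_module_context K H \<Delta> \<epsilon> S A act "G X" "glm lmul" "ghm X hmul"
    by (rule X.G_context)
  interpret GY: partial_module_context K H \<Delta> \<epsilon> S A act "G Y" "glm lmul'" "ghm Y hmul'"
    by (rule Y.G_context)
  have f: "linear_map K X Y f" "\<And>a x. a \<in> carrier A \<Longrightarrow> x \<in> carrier X \<Longrightarrow> f (lmul a x) = lmul' a (f x)"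
    "\<And>h x. h \<in> carrier H \<Longrightarrow> x \<in> carrier X \<Longrightarrow> f (hmul h x) = hmul' h (f x)"
    using assms by (auto simp: partial_hom_def)
  let ?F = "\<lambda>\<phi>. \<lambda>h\<in>carrier H. f (\<phi> h)"
  have F: "?F \<phi> \<in> carrier (G Y)" if "\<phi> \<in> carrier (G X)" for \<phi>
    by (rule hom_moduleI[OF H.H_module linear_map_compose[OF G_linear[OF that] f(1)]])
  have "linear_map K (G X) (G Y) ?F"
    by (rule linear_map_into_hom[OF GX.X_module H.H_module Y.X_module F])
       (simp_all add: linear_map_compose[OF linear_map_eval f(1)])
  moreover have "?F (glm lmul a \<phi>) = glm lmul' a (?F \<phi>)" if "a \<in> carrier A" "\<phi> \<in> carrier (G X)" for a \<phi>
    by (rule hom_module_eqI[OF F GY.lmul_closed])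
       (simp_all add: that F X.glm_app Y.glm_app f hom_module_app[OF that(2)])
  moreover have "?F (ghm X hmul h \<phi>) = ghm Y hmul' h (?F \<phi>)" if h: "h \<in> carrier H" and \<phi>: "\<phi> \<in> carrier (G X)" for h \<phi>
  proof (rule hom_module_eqI[OF F GY.hmul_closed])
    fix w assume w: "w \<in> carrier H"
    have "f (ghm X hmul h \<phi> w) = H.sw Y (\<lambda>x y. f (hmul x (\<phi> (w \<star> y)))) h"
      unfolding X.ghm_app[OF w]
      by (rule H.sw_comp[OF X.X_module Y.X_module f(1) h]) (simp add: w hom_module_app[OF \<phi>])
    also have "\<dots> = ghm Y hmul' h (?F \<phi>) w"
      unfolding Y.ghm_app[OF w]
      by (rule H.sw_cong[OF Y.X_module h]) (simp_all add: w f hom_module_app[OF \<phi>] linear_map_closed[OF f(1)])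
    finally show "?F (ghm X hmul h \<phi>) w = ghm Y hmul' h (?F \<phi>) w" using w by simp
  qed (use h \<phi> F in simp_all)
  ultimately show ?thesis
    using X.G_partial_module Y.G_partial_module by (simp add: partial_hom_def)
qed

lemma submodule_partial_module:
  assumes "partial_module X lmul hmul" "stable X lmul hmul V"
  shows "partial_module (X\<lparr>carrier := V\<rparr>) lmul hmul"
    and "partial_hom (X\<lparr>carrier := V\<rparr>) lmul hmul X lmul hmul (\<lambda>x. x)"
proof -
  interpret X: partial_module_context K H \<Delta> \<epsilon> S A act X lmul hmul
    by (rule partial_contextI[OF assms(1)])
  note V = X.stableD[OF assms(2)]
  let ?V = "X\<lparr>carrier := V\<rparr>"
  have m: "module K ?V" by (rule submodule.submodule_is_module[OF V(1) X.X_module])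
  have i: "linear_map K ?V X (\<lambda>x. x)" using V(5) by (intro linear_mapI) auto
  have into: "linear_map K Y ?V f" if "linear_map K Y X f" "\<And>y. y \<in> carrier Y \<Longrightarrow> f y \<in> V" for f and Y :: "('k, 'y) module"
    by (rule linear_mapI) (simp_all add: that(2) linear_map_add[OF that(1)] linear_map_smult[OF that(1)])
  have Vx: "x \<in> carrier X" if "x \<in> V" for x using that V(5) by auto
  have lb: "bilinear_map K A ?V ?V lmul"
    by (intro bilinear_mapI into linear_map_compose[OF i] X.xlin) (simp_all add: V(2) Vx)
  have hb: "bilinear_map K H ?V ?V hmul"
    by (intro bilinear_mapI into linear_map_compose[OF i] X.xlin) (simp_all add: V(3) Vx)
  show pm: "partial_module ?V lmul hmul"
  proof (intro left_partial_module.intro left_module.intro left_module_axioms.intro left_partial_module_axioms.intro m lb hb)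
    fix x a h g assume x: "x \<in> carrier ?V" and a: "a \<in> carrier A" and h: "h \<in> carrier H" and g: "g \<in> carrier H"
    have "H.sw ?V (\<lambda>h1 h2. lmul (act h1 a) (hmul (h2 \<star> g) x)) h = H.sw X (\<lambda>h1 h2. lmul (act h1 a) (hmul (h2 \<star> g) x)) h"
      by (rule H.sw_comp[OF m X.X_module i h]) (use x a g V in simp)
    then show "hmul h (lmul a (hmul g x)) = H.sw ?V (\<lambda>h1 h2. lmul (act h1 a) (hmul (h2 \<star> g) x)) h"
      using X.X.hmul_lmul_hmul[of x a h g] x a h g Vx by simp
  qed (simp_all add: Vx X.X.lmul_one X.X.lmul_mult X.X.hmul_one)
  show "partial_hom ?V lmul hmul X lmul hmul (\<lambda>x. x)"
    using pm assms(1) i by (simp add: partial_hom_def)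
qed

text \<open>The quotient is taken along any map \<open>j\<close> that separates the cosets of
  \<open>U\<close>, so the caller decides in which type its elements live;
  \<open>simple_factor_exists\<close> uses this freedom to reach \<open>umodule\<close>.\<close>

lemma quotient_partial_module:
  assumes "partial_module X lmul hmul" "stable X lmul hmul U"
    and j: "\<And>x y. x \<in> carrier X \<Longrightarrow> y \<in> carrier X \<Longrightarrow> j x = j y \<longleftrightarrow> x \<ominus>\<^bsub>X\<^esub> y \<in> U"
  obtains lmul' hmul' where "partial_hom X lmul hmul (transport j X) lmul' hmul' j"
proof -
  interpret X: partial_module_context K H \<Delta> \<epsilon> S A act X lmul hmul
    by (rule partial_contextI[OF assms(1)])
  note U = X.stableD[OF assms(2)]
  let ?Y = "transport j X" and ?i = "inv_into (carrier X) j"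
  have Y: "module K ?Y" "linear_map K X ?Y j"
    by (rule transport_quotient[OF X.X_vector_space U(1)], erule (1) j)+
  note ml = linear_map_minus[OF X.X_module X.X_module]
  have i: "?i (j x) \<in> carrier X" "?i (j x) \<ominus>\<^bsub>X\<^esub> x \<in> U" if "x \<in> carrier X" for x
  proof -
    show *: "?i (j x) \<in> carrier X" using that by (simp add: inv_into_into)
    show "?i (j x) \<ominus>\<^bsub>X\<^esub> x \<in> U" using j[OF * that] that by (simp add: f_inv_into_f)
  qed
  define lmul' where "lmul' = (\<lambda>a y. j (lmul a (?i y)))"
  define hmul' where "hmul' = (\<lambda>h y. j (hmul h (?i y)))"
  have l: "lmul' a (j x) = j (lmul a x)" if "a \<in> carrier A" "x \<in> carrier X" for a x
  proof -
    have "lmul a (?i (j x)) \<ominus>\<^bsub>X\<^esub> lmul a x = lmul a (?i (j x) \<ominus>\<^bsub>X\<^esub> x)"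
      using i that by (simp add: ml[OF bilinear_map_right[OF X.X.lmul_bilinear linear_map_id]])
    also have "\<dots> \<in> U" using U(2) i that by simp
    finally show ?thesis using j[of "lmul a (?i (j x))" "lmul a x"] i that by (simp add: lmul'_def)
  qed
  have h: "hmul' a (j x) = j (hmul a x)" if "a \<in> carrier H" "x \<in> carrier X" for a x
  proof -
    have "hmul a (?i (j x)) \<ominus>\<^bsub>X\<^esub> hmul a x = hmul a (?i (j x) \<ominus>\<^bsub>X\<^esub> x)"
      using i that by (simp add: ml[OF bilinear_map_right[OF X.X.hmul_bilinear linear_map_id]])
    also have "\<dots> \<in> U" using U(3) i that by simp
    finally show ?thesis using j[of "hmul a (?i (j x))" "hmul a x"] i that by (simp add: hmul'_def)
  qed
  have c: "carrier ?Y = j ` carrier X" by (simp add: transport_simps)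
  have ops: "j x \<oplus>\<^bsub>?Y\<^esub> j y = j (x \<oplus>\<^bsub>X\<^esub> y)" "k \<in> carrier K \<Longrightarrow> k \<odot>\<^bsub>?Y\<^esub> j x = j (k \<odot>\<^bsub>X\<^esub> x)"
    if "x \<in> carrier X" "y \<in> carrier X" for x y k
    using linear_map_add[OF Y(2)] linear_map_smult[OF Y(2)] that by simp_all
  note bl = X.X.lmul_bilinear and bh = X.X.hmul_bilinear
  have lb: "bilinear_map K A ?Y ?Y lmul'"
    using bl unfolding bilinear_map_def linear_map_def by (auto simp: c l ops)
  have hb: "bilinear_map K H ?Y ?Y hmul'"
    using bh unfolding bilinear_map_def linear_map_def by (auto simp: c h ops)
  have "partial_module ?Y lmul' hmul'"
  proof (intro left_partial_module.intro left_module.intro left_module_axioms.intro left_partial_module_axioms.intro Y(1) lb hb)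
    fix y a g k assume y: "y \<in> carrier ?Y" and a: "a \<in> carrier A" and g: "g \<in> carrier H" and k: "k \<in> carrier H"
    then obtain x where x: "x \<in> carrier X" "y = j x" by (auto simp: c)
    have "hmul' g (lmul' a (hmul' k y)) = j (H.sw X (\<lambda>h1 h2. lmul (act h1 a) (hmul (h2 \<star> k) x)) g)"
      using x a g k by (simp add: l h X.X.hmul_lmul_hmul)
    also have "\<dots> = H.sw ?Y (\<lambda>h1 h2. j (lmul (act h1 a) (hmul (h2 \<star> k) x))) g"
      by (rule H.sw_comp[OF X.X_module Y(1) Y(2) g, of "\<lambda>h1 h2. lmul (act h1 a) (hmul (h2 \<star> k) x)"])
         (simp add: x a k)
    also have "\<dots> = H.sw ?Y (\<lambda>h1 h2. lmul' (act h1 a) (hmul' (h2 \<star> k) y)) g"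
      by (rule H.sw_cong[OF Y(1) g]) (use x a k in \<open>simp_all add: l h c\<close>)
    finally show "hmul' g (lmul' a (hmul' k y)) = H.sw ?Y (\<lambda>h1 h2. lmul' (act h1 a) (hmul' (h2 \<star> k) y)) g" .
  qed (auto simp: c l h X.X.lmul_one X.X.lmul_mult X.X.hmul_one)
  then have "partial_hom X lmul hmul ?Y lmul' hmul' j"
    using assms(1) Y(2) by (simp add: partial_hom_def l h)
  then show thesis by (rule that)
qed

end

section \<open>Dimensions of annihilated families\<close>

context hopf_partial_action
begin

lemma linear_map_into_submodule:
  assumes "linear_map K Y X f" "\<And>y. y \<in> carrier Y \<Longrightarrow> f y \<in> V"
  shows "linear_map K Y (X\<lparr>carrier := V\<rparr>) f"
  using assms by (intro linear_mapI) (auto simp: linear_map_add linear_map_smult)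

text \<open>With \<open>V = carrier X\<close> and \<open>U\<close> zero this is the space whose
  dimension is the \<open>d(X)\<close> of the overview. In general, for stable \<open>U\<close>
  inside a stable finite-dimensional \<open>V\<close>, its dimension is \<open>d(V/U)\<close> plus
  that of \<open>Hom(H, U)\<close>, so \<open>d\<close> of a subquotient can be studied inside
  \<open>X\<close>.\<close>

definition Dset ::
  "('k, 'x) module \<Rightarrow> ('a \<Rightarrow> 'x \<Rightarrow> 'x) \<Rightarrow> ('h \<Rightarrow> 'x \<Rightarrow> 'x) \<Rightarrow> ('a \<times> 'h \<Rightarrow> 'k) set set \<Rightarrow> 'x set \<Rightarrow> 'x set \<Rightarrow> ('h \<Rightarrow> 'x) set"
  where "Dset X lmul hmul L V U = {\<phi> \<in> carrier (G X). (\<forall>h\<in>carrier H. \<phi> h \<in> V) \<and>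
    (\<forall>t\<in>L. \<forall>h\<in>carrier H. tact (G X) (glm lmul) (ghm X hmul) t \<phi> h \<in> U)}"

lemma partial_hom_vimage_stable:
  assumes "partial_hom X lmul hmul Y lmul' hmul' f" "stable Y lmul' hmul' N"
  shows "stable X lmul hmul {x \<in> carrier X. f x \<in> N}"
proof -
  interpret X: partial_module_context K H \<Delta> \<epsilon> S A act X lmul hmul
    using assms(1) by (simp add: partial_hom_def partial_contextI)
  interpret Y: partial_module_context K H \<Delta> \<epsilon> S A act Y lmul' hmul'
    using assms(1) by (simp add: partial_hom_def partial_contextI)
  note N = Y.stableD[OF assms(2)]
  have f: "linear_map K X Y f" "\<And>a x. a \<in> carrier A \<Longrightarrow> x \<in> carrier X \<Longrightarrow> f (lmul a x) = lmul' a (f x)"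
    "\<And>h x. h \<in> carrier H \<Longrightarrow> x \<in> carrier X \<Longrightarrow> f (hmul h x) = hmul' h (f x)"
    using assms by (auto simp: partial_hom_def)
  show ?thesis
    unfolding stable_subspace_def
    using linear_map_vimage_submodule[OF X.X_module Y.X_module f(1) N(1)] f(2,3) N(2,3) by auto
qed

end

context partial_module_context
begin

interpretation G: partial_module_context K H \<Delta> \<epsilon> S A act "G X" "glm lmul" "ghm X hmul"
  by (rule G_context)

interpretation GG: partial_module_context K H \<Delta> \<epsilon> S A act "G (G X)" "glm (glm lmul)" "ghm (G X) (ghm X hmul)"
  by (rule G.G_context)

interpretation VX: vector_space K X by (rule X_vector_space)
interpretation VG: vector_space K "G X" by (rule G.X_vector_space)
interpretation VGG: vector_space K "G (G X)" by (rule GG.X_vector_space)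
interpretation VH: vector_space K H by (rule H.H_vector_space)

abbreviation D where "D \<equiv> Dset X lmul hmul"

abbreviation HomS where "HomS V \<equiv> {\<phi> \<in> carrier (G X). \<forall>h\<in>carrier H. \<phi> h \<in> V}"

lemma G_ten_linear: "t \<in> carrier AH.T \<Longrightarrow> linear_map K (G X) (G X) (G.ten t)"
  using bilinear_map_right[OF G.ten_bilinear linear_map_id] by simp

lemma Dset_subspace:
  assumes "submodule V K X" "submodule U K X" "L \<subseteq> carrier AH.T"
  shows "submodule (D L V U) K (G X)"
proof -
  note V = VX.subspaceD[OF assms(1)] and U = VX.subspaceD[OF assms(2)]
  have t: "t \<in> carrier AH.T" if "t \<in> L" for t using assms(3) that by auto
  show ?thesis
  proof (rule VG.subspaceI)
    show "\<zero>\<^bsub>G X\<^esub> \<in> D L V U"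
      using V(3) U(3) t by (auto simp: Dset_def hom_module_ev linear_map_zero[OF G.X_module G.X_module G_ten_linear])
    show "x \<oplus>\<^bsub>G X\<^esub> y \<in> D L V U" if "x \<in> D L V U" "y \<in> D L V U" for x y
      using that V(4) U(4) t by (auto simp: Dset_def hom_module_ev linear_map_add[OF G_ten_linear])
    show "c \<odot>\<^bsub>G X\<^esub> x \<in> D L V U" if "c \<in> carrier K" "x \<in> D L V U" for c x
      using that V(7) U(7) t by (auto simp: Dset_def hom_module_ev linear_map_smult[OF G_ten_linear])
  qed (auto simp: Dset_def)
qed

lemma Dset_fin:
  assumes "VH.fin_subspace (carrier H)" "VX.fin_subspace V" "submodule U K X" "L \<subseteq> carrier AH.T"
  shows "VG.fin_subspace (D L V U)"
  by (rule VG.vdim_mono(1)[OF vdim_hom(1)[OF H.H_vector_space X_vector_space assms(1,2)]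
        Dset_subspace[OF VX.fin_subspace_subspace[OF assms(2)] assms(3,4)]])
     (auto simp: Dset_def)

lemma Dset_zero_iff:
  assumes "L \<subseteq> carrier AH.T"
  shows "\<phi> \<in> D L (carrier X) {\<zero>} \<longleftrightarrow> \<phi> \<in> carrier (G X) \<and> (\<forall>t\<in>L. G.ten t \<phi> = \<zero>\<^bsub>G X\<^esub>)"
proof -
  have "(\<forall>h\<in>carrier H. G.ten t \<phi> h \<in> {\<zero>}) \<longleftrightarrow> G.ten t \<phi> = \<zero>\<^bsub>G X\<^esub>" if "t \<in> L" "\<phi> \<in> carrier (G X)" for t
  proof
    assume "\<forall>h\<in>carrier H. G.ten t \<phi> h \<in> {\<zero>}"
    then show "G.ten t \<phi> = \<zero>\<^bsub>G X\<^esub>"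
      using that assms by (intro hom_module_eqI[OF G.ten_closed G.X.zero_closed]) (auto simp: hom_module_ev)
  qed (simp add: hom_module_ev)
  then show ?thesis by (auto simp: Dset_def hom_module_app)
qed

end

context partial_module_context
begin

interpretation G: partial_module_context K H \<Delta> \<epsilon> S A act "G X" "glm lmul" "ghm X hmul"
  by (rule G_context)

interpretation GG: partial_module_context K H \<Delta> \<epsilon> S A act "G (G X)" "glm (glm lmul)" "ghm (G X) (ghm X hmul)"
  by (rule G.G_context)

interpretation VX: vector_space K X by (rule X_vector_space)
interpretation VG: vector_space K "G X" by (rule G.X_vector_space)
interpretation VGG: vector_space K "G (G X)" by (rule GG.X_vector_space)
interpretation VH: vector_space K H by (rule H.H_vector_space)

text \<open>The left-hand side is the dimension of the space of all linear maps
  \<open>\<Psi>\<close> from \<open>H\<close> into the part of \<open>Hom(H, X)\<close> killed by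
  \<open>L\<close>. \<open>twist\<close> embeds this space; each \<open>untwist u\<close> is
  equivariant and takes \<open>twist \<Psi>\<close> to \<open>\<Psi> u\<close>, which
  \<open>L\<close> kills, so \<open>L\<close> kills \<open>twist \<Psi>\<close> by
  \<open>untwist_zero\<close>.\<close>

lemma vdim_Dset_G:
  assumes fH: "VH.fin_subspace (carrier H)" and fX: "VX.fin_subspace (carrier X)" and L: "L \<subseteq> carrier AH.T"
  shows "VH.vdim (carrier H) * VG.vdim (D L (carrier X) {\<zero>})
    \<le> VGG.vdim (Dset (G X) (glm lmul) (ghm X hmul) L (carrier (G X)) {\<zero>\<^bsub>G X\<^esub>})"
proof -
  let ?D = "D L (carrier X) {\<zero>}" and ?DG = "Dset (G X) (glm lmul) (ghm X hmul) L (carrier (G X)) {\<zero>\<^bsub>G X\<^esub>}"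
  let ?S = "{\<Psi> \<in> carrier (G (G X)). \<forall>u\<in>carrier H. \<Psi> u \<in> ?D}"
  have fD: "VG.fin_subspace ?D" by (rule Dset_fin[OF fH fX submodule_zero[OF X_module] L])
  note S = vdim_hom[OF H.H_vector_space G.X_vector_space fH fD]
  have fGX: "VG.fin_subspace (carrier (G X))"
  proof -
    have "HomS (carrier X) = carrier (G X)" by (auto simp: hom_module_app)
    then show ?thesis using vdim_hom(1)[OF H.H_vector_space X_vector_space fH fX] by simp
  qed
  have fDG: "VGG.fin_subspace ?DG" by (rule G.Dset_fin[OF fH fGX submodule_zero[OF G.X_module] L])
  have tw: "twist \<Psi> \<in> carrier (G (G X))" if "\<Psi> \<in> ?S" for \<Psi> using that twist_closed by blast
  note rn = rank_nullity[OF GG.X_vector_space GG.X_vector_space S(1), of twist]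
  have "{\<Psi> \<in> ?S. twist \<Psi> = \<zero>\<^bsub>G (G X)\<^esub>} = {\<zero>\<^bsub>G (G X)\<^esub>}"
  proof -
    have "\<Psi> = \<zero>\<^bsub>G (G X)\<^esub>" if \<Psi>: "\<Psi> \<in> ?S" "twist \<Psi> = \<zero>\<^bsub>G (G X)\<^esub>" for \<Psi>
    proof (rule hom_module_eqI[of \<Psi> K H "G X"])
      fix u assume u: "u \<in> carrier H"
      have "\<Psi> u = untwist u (twist \<Psi>)" using untwist_twist[of \<Psi> u] \<Psi> u by auto
      also have "\<dots> = \<zero>\<^bsub>G X\<^esub>"
        unfolding \<Psi>(2) by (rule linear_map_zero[OF GG.X_module G.X_module untwist_linear[OF u]])
      finally show "\<Psi> u = \<zero>\<^bsub>G (G X)\<^esub> u" using u by (simp add: hom_module_ev)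
    qed (use \<Psi> in auto)
    moreover have "\<zero>\<^bsub>G (G X)\<^esub> \<in> ?S"
      using VG.subspaceD(3)[OF VG.fin_subspace_subspace[OF fD]] by (simp add: hom_module_ev)
    moreover have "twist \<zero>\<^bsub>G (G X)\<^esub> = \<zero>\<^bsub>G (G X)\<^esub>" by (rule linear_map_zero[OF GG.X_module GG.X_module twist_linear])
    ultimately show ?thesis by blast
  qed
  then have dim: "VGG.vdim (twist ` ?S) = VGG.vdim ?S" and fin: "VGG.fin_subspace (twist ` ?S)"
    using rn tw linear_map_add[OF twist_linear] linear_map_smult[OF twist_linear]
    by (simp_all add: VGG.vdim_zero)
  have "twist ` ?S \<subseteq> ?DG"
  proof safe
    fix \<Psi> assume \<Psi>: "\<Psi> \<in> carrier (G (G X))" "\<forall>u\<in>carrier H. \<Psi> u \<in> ?D"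
    have "GG.ten t (twist \<Psi>) = \<zero>\<^bsub>G (G X)\<^esub>" if t: "t \<in> L" for t
    proof (rule untwist_zero)
      have tc: "t \<in> carrier AH.T" using t L by auto
      show "GG.ten t (twist \<Psi>) \<in> carrier (G (G X))" using tc \<Psi>(1) twist_closed by simp
      fix u assume u: "u \<in> carrier H"
      have "untwist u (GG.ten t (twist \<Psi>)) = G.ten t (untwist u (twist \<Psi>))"
        by (rule untwist_ten[OF u twist_closed[OF \<Psi>(1)] tc])
      also have "\<dots> = G.ten t (\<Psi> u)" by (simp add: untwist_twist[OF \<Psi>(1) u])
      also have "\<dots> = \<zero>\<^bsub>G X\<^esub>" using \<Psi>(2) u t Dset_zero_iff[OF L] by blast
      finally show "untwist u (GG.ten t (twist \<Psi>)) = \<zero>\<^bsub>G X\<^esub>" .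
    qed
    then show "twist \<Psi> \<in> ?DG" using twist_closed[OF \<Psi>(1)] G.Dset_zero_iff[OF L] by blast
  qed
  from VGG.vdim_mono(2)[OF fDG VGG.fin_subspace_subspace[OF fin] this]
  show ?thesis by (simp add: dim S(2))
qed

text \<open>\<open>Hom(H, B)\<close> is a partial module in its own right, and its inclusion into
  \<open>Hom(H, X)\<close> is a homomorphism by \<open>partial_hom_G\<close>; so the two actions
  agree.\<close>

lemma HomS_ten:
  assumes "stable X lmul hmul B" "\<phi> \<in> HomS B" "t \<in> carrier AH.T"
  shows "G.ten t \<phi> \<in> HomS B"
proof -
  let ?B = "X\<lparr>carrier := B\<rparr>"
  note B = stableD[OF assms(1)]
  note sp = submodule_partial_module[OF X.left_partial_module_axioms assms(1)]
  interpret B: partial_module_context K H \<Delta> \<epsilon> S A act ?B lmul hmul by (rule partial_contextI[OF sp(1)])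
  interpret GB: partial_module_context K H \<Delta> \<epsilon> S A act "G ?B" "glm lmul" "ghm ?B hmul" by (rule B.G_context)
  have \<phi>: "\<phi> \<in> carrier (G ?B)"
    using assms(2) linear_map_into_submodule[of H X \<phi> B] by (auto simp: hom_module_simps)
  have id: "(\<lambda>h\<in>carrier H. \<psi> h) = \<psi>" if "\<psi> \<in> carrier (G ?B)" for \<psi>
    using that by (auto simp: hom_module_simps extensional_restrict)
  have "G.ten t \<phi> = GB.ten t \<phi>"
    using partial_hom_ten[OF partial_hom_G[OF sp(2)] assms(3) \<phi>] id[OF \<phi>] id[OF GB.ten_closed[OF assms(3) \<phi>]] by simp
  moreover have "GB.ten t \<phi> h \<in> B" if "h \<in> carrier H" for h
    using hom_module_app[OF GB.ten_closed[OF assms(3) \<phi>] that] by simp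
  ultimately show ?thesis using assms(2,3) G.ten_closed[of t \<phi>] by (simp del: G.ten_closed)
qed

text \<open>This is the dimension formula for \<open>D L C U\<close> and \<open>Hom(H, B)\<close>:
  their intersection is \<open>D L B U\<close>, and their sum lies in \<open>D L C B\<close>. With
  \<open>d(V/U)\<close> standing for the dimension of \<open>D L V U\<close> minus
  \<open>dim H\<close> times that of \<open>U\<close>, it reads
  \<open>d(C/U) \<le> d(C/B) + d(B/U)\<close>; terms are moved across to avoid subtraction.\<close>

lemma vdim_Dset_triangle:
  assumes fH: "VH.fin_subspace (carrier H)" and fC: "VX.fin_subspace C" and L: "L \<subseteq> carrier AH.T"
    and B: "stable X lmul hmul B" and U: "submodule U K X" and "U \<subseteq> B" "B \<subseteq> C"
  shows "VG.vdim (D L C U) + VH.vdim (carrier H) * VX.vdim B \<le> VG.vdim (D L C B) + VG.vdim (D L B U)"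
proof -
  note sB = stableD(1)[OF B]
  have fB: "VX.fin_subspace B" by (rule VX.vdim_mono(1)[OF fC sB assms(7)])
  note hB = vdim_hom[OF H.H_vector_space X_vector_space fH fB]
  have fD: "VG.fin_subspace (D L C U)" "VG.fin_subspace (D L C B)"
    using Dset_fin fH fC U sB L by auto
  note s = VG.vdim_sum[OF hB(1) fD(1)]
  have "D L C U \<inter> HomS B = D L B U"
    using assms(6,7) by (auto simp: Dset_def)
  moreover have "D L C U <+>\<^bsub>G X\<^esub> HomS B \<subseteq> D L C B"
  proof (rule VG.subspace_sum_least[OF VG.fin_subspace_subspace[OF fD(2)]])
    show "D L C U \<subseteq> D L C B" using assms(6) by (auto simp: Dset_def)
    show "HomS B \<subseteq> D L C B"
    proof
      fix \<phi> assume \<phi>: "\<phi> \<in> HomS B"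
      then show "\<phi> \<in> D L C B" using HomS_ten[OF B \<phi>] assms(7) L by (auto simp: Dset_def)
    qed
  qed
  ultimately show ?thesis
    using s VG.vdim_mono(2)[OF fD(2) VG.fin_subspace_subspace[OF s(1)]] hB(2) by simp
qed

text \<open>Composition with \<open>\<pi>\<close> maps \<open>D L V U\<close> onto the part of
  \<open>Hom(H, Y)\<close> killed by \<open>L\<close>, with kernel \<open>Hom(H, U)\<close>.\<close>

lemma vdim_Dset_quotient:
  assumes fH: "VH.fin_subspace (carrier H)" and fV: "VX.fin_subspace V" and L: "L \<subseteq> carrier AH.T"
    and V: "stable X lmul hmul V" and U: "stable X lmul hmul U" "U \<subseteq> V"
    and \<pi>: "partial_hom (X\<lparr>carrier := V\<rparr>) lmul hmul Y lmul' hmul' \<pi>" "\<pi> ` V = carrier Y" "{v \<in> V. \<pi> v = \<zero>\<^bsub>Y\<^esub>} = U"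
  shows "vector_space.fin_subspace K Y (carrier Y)"
    and "vector_space.vdim K Y (carrier Y) + VX.vdim U = VX.vdim V"
    and "vector_space.vdim K (G Y) (Dset Y lmul' hmul' L (carrier Y) {\<zero>\<^bsub>Y\<^esub>}) + VH.vdim (carrier H) * VX.vdim U = VG.vdim (D L V U)"
proof -
  interpret Y: partial_module_context K H \<Delta> \<epsilon> S A act Y lmul' hmul'
    using \<pi>(1) by (simp add: partial_hom_def partial_contextI)
  let ?V = "X\<lparr>carrier := V\<rparr>"
  note sp = submodule_partial_module[OF X.left_partial_module_axioms V]
  interpret V: partial_module_context K H \<Delta> \<epsilon> S A act ?V lmul hmul by (rule partial_contextI[OF sp(1)])
  interpret GV: partial_module_context K H \<Delta> \<epsilon> S A act "G ?V" "glm lmul" "ghm ?V hmul" by (rule V.G_context)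
  interpret GY: partial_module_context K H \<Delta> \<epsilon> S A act "G Y" "glm lmul'" "ghm Y hmul'" by (rule Y.G_context)
  have pl: "linear_map K ?V Y \<pi>" using \<pi>(1) by (simp add: partial_hom_def)
  have padd: "\<pi> (x \<oplus> y) = \<pi> x \<oplus>\<^bsub>Y\<^esub> \<pi> y" and psm: "c \<in> carrier K \<Longrightarrow> \<pi> (c \<odot> x) = c \<odot>\<^bsub>Y\<^esub> \<pi> x"
    and pcl: "\<pi> x \<in> carrier Y"
    if "x \<in> V" "y \<in> V" for x y c
    using linear_map_add[OF pl] linear_map_smult[OF pl] linear_map_closed[OF pl] that by auto
  note rn = rank_nullity[OF X_vector_space Y.X_vector_space fV, of \<pi>]
  show fY: "vector_space.fin_subspace K Y (carrier Y)" "vector_space.vdim K Y (carrier Y) + VX.vdim U = VX.vdim V"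
    using rn pcl padd psm \<pi>(2,3) by simp_all
  have fU: "VX.fin_subspace U" by (rule VX.vdim_mono(1)[OF fV stableD(1)[OF U(1)] U(2)])
  have fD: "VG.fin_subspace (D L V U)" by (rule Dset_fin[OF fH fV stableD(1)[OF U(1)] L])
  have toV: "\<phi> \<in> carrier (G ?V)" if "\<phi> \<in> HomS V" for \<phi>
    using that linear_map_into_submodule[of H X \<phi> V] by (auto simp: hom_module_simps)
  have id: "(\<lambda>h\<in>carrier H. \<psi> h) = \<psi>" if "\<psi> \<in> carrier (G ?V)" for \<psi>
    using that by (auto simp: hom_module_simps extensional_restrict)
  have ten: "G.ten t \<phi> = GV.ten t \<phi>" if "t \<in> carrier AH.T" "\<phi> \<in> HomS V" for t \<phi>
    using partial_hom_ten[OF partial_hom_G[OF sp(2)] that(1) toV[OF that(2)]] 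
      id[OF toV[OF that(2)]] id[OF GV.ten_closed[OF that(1) toV[OF that(2)]]] by simp
  let ?F = "\<lambda>\<phi>. \<lambda>h\<in>carrier H. \<pi> (\<phi> h)"
  have hF: "partial_hom (G ?V) (glm lmul) (ghm ?V hmul) (G Y) (glm lmul') (ghm Y hmul') ?F"
    by (rule partial_hom_G[OF \<pi>(1)])
  then have Fl: "linear_map K (G ?V) (G Y) ?F" by (simp add: partial_hom_def)
  have Fcl: "?F \<phi> \<in> carrier (G Y)" if "\<phi> \<in> HomS V" for \<phi> by (rule linear_map_closed[OF Fl toV[OF that]])
  have Ften: "GY.ten t (?F \<phi>) = ?F (G.ten t \<phi>)" if "t \<in> carrier AH.T" "\<phi> \<in> HomS V" for t \<phi>
    using partial_hom_ten[OF hF that(1) toV[OF that(2)]] ten[OF that] by simp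
  have DV: "\<phi> \<in> HomS V" if "\<phi> \<in> D L V U" for \<phi> using that by (auto simp: Dset_def)
  have Lc: "t \<in> carrier AH.T" if "t \<in> L" for t using L that by auto
  have kerF: "\<pi> (\<phi> h) = \<zero>\<^bsub>Y\<^esub> \<longleftrightarrow> \<phi> h \<in> U" if "\<phi> \<in> HomS V" "h \<in> carrier H" for \<phi> h
    using that \<pi>(3) by auto
  have im: "?F \<phi> \<in> Dset Y lmul' hmul' L (carrier Y) {\<zero>\<^bsub>Y\<^esub>} \<longleftrightarrow> \<phi> \<in> D L V U" if \<phi>: "\<phi> \<in> HomS V" for \<phi>
  proof -
    have "GY.ten t (?F \<phi>) h \<in> {\<zero>\<^bsub>Y\<^esub>} \<longleftrightarrow> G.ten t \<phi> h \<in> U" if "t \<in> L" "h \<in> carrier H" for t h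
      using Ften[OF Lc[OF that(1)] \<phi>] kerF[OF HomS_ten[OF V \<phi> Lc[OF that(1)]] that(2)] that by simp
    then show ?thesis using \<phi> Fcl[OF \<phi>] pcl by (auto simp: Dset_def)
  qed
  note rF = rank_nullity[OF G.X_vector_space GY.X_vector_space fD, of ?F]
  have 1: "?F ` D L V U = Dset Y lmul' hmul' L (carrier Y) {\<zero>\<^bsub>Y\<^esub>}"
  proof
    show "?F ` D L V U \<subseteq> Dset Y lmul' hmul' L (carrier Y) {\<zero>\<^bsub>Y\<^esub>}" using im DV by blast
    \<comment> \<open>A map into \<open>Y\<close> is lifted to \<open>V\<close> by lifting its
      values on a basis of \<open>H\<close>. The lift belongs to \<open>D L V U\<close> because, by
      \<open>im\<close>, membership can be tested after composition with
      \<open>\<pi>\<close>.\<close>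
    show "Dset Y lmul' hmul' L (carrier Y) {\<zero>\<^bsub>Y\<^esub>} \<subseteq> ?F ` D L V U"
    proof
      fix \<psi> assume \<psi>: "\<psi> \<in> Dset Y lmul' hmul' L (carrier Y) {\<zero>\<^bsub>Y\<^esub>}"
      then have pc: "\<psi> \<in> carrier (G Y)" by (simp add: Dset_def)
      obtain g f where gf: "\<And>i. i < VH.vdim (carrier H) \<Longrightarrow> g i \<in> carrier H"
          "\<And>i. i < VH.vdim (carrier H) \<Longrightarrow> functional K H (f i)"
          "\<And>i j. i < VH.vdim (carrier H) \<Longrightarrow> j < VH.vdim (carrier H) \<Longrightarrow> f i (g j) = (if i = j then \<one>\<^bsub>K\<^esub> else \<zero>\<^bsub>K\<^esub>)"
          "\<And>x. x \<in> carrier H \<Longrightarrow> x = (\<Oplus>\<^bsub>H\<^esub>i\<in>{..<VH.vdim (carrier H)}. f i x \<odot>\<^bsub>H\<^esub> g i)"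
        using VH.dual_basis[OF fH] by blast
      let ?n = "VH.vdim (carrier H)"
      have fK: "f i x \<in> carrier K" if "i < ?n" "x \<in> carrier H" for i x
        using linear_map_closed[OF gf(2)[OF that(1)] that(2)] by (simp add: scalar_module_def)
      have "\<exists>v\<in>V. \<pi> v = \<psi> (g i)" if "i < ?n" for i
      proof -
        have "\<psi> (g i) \<in> carrier Y" by (rule hom_module_app[OF pc gf(1)[OF that]])
        then show ?thesis unfolding \<pi>(2)[symmetric] by (metis imageE)
      qed
      then obtain v where v: "\<And>i. i < ?n \<Longrightarrow> v i \<in> V" "\<And>i. i < ?n \<Longrightarrow> \<pi> (v i) = \<psi> (g i)" by metis
      have sm: "f i x \<odot> v i \<in> V" if "i < ?n" "x \<in> carrier H" for i x
        by (rule VX.subspaceD(7)[OF stableD(1)[OF V] fK[OF that] v(1)[OF that(1)]])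
      let ?\<phi> = "\<lambda>x\<in>carrier H. \<Oplus>\<^bsub>?V\<^esub>i\<in>{..<?n}. f i x \<odot>\<^bsub>?V\<^esub> v i"
      have \<phi>V: "?\<phi> \<in> carrier (G ?V)"
        by (rule hom_moduleI[OF H.H_module finsum_linear_map[OF H.H_module V.X_module]],
            simp, rule functional_smult_linear[OF H.H_module V.X_module gf(2)])
           (simp_all add: v)
      have \<phi>: "?\<phi> \<in> HomS V"
      proof -
        have "linear_map K H X ?\<phi>"
          by (rule linear_map_compose[OF G_linear[OF \<phi>V], of X "\<lambda>x. x"]) (use sp(2) in \<open>simp add: partial_hom_def\<close>)
        then have "?\<phi> \<in> carrier (G X)" unfolding hom_module_simps by (intro conjI restrict_extensional)
        moreover have "\<forall>h\<in>carrier H. ?\<phi> h \<in> V" using hom_module_app[OF \<phi>V] by (simp del: restrict_apply)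
        ultimately show ?thesis by blast
      qed
      have "?F ?\<phi> = \<psi>"
      proof (rule hom_module_eqI[OF Fcl[OF \<phi>] pc])
        fix x assume x: "x \<in> carrier H"
        have "\<pi> (\<Oplus>\<^bsub>?V\<^esub>i\<in>{..<?n}. f i x \<odot>\<^bsub>?V\<^esub> v i) = (\<Oplus>\<^bsub>Y\<^esub>i\<in>{..<?n}. \<pi> (f i x \<odot>\<^bsub>?V\<^esub> v i))"
          by (rule linear_map_finsum[OF V.X_module Y.X_module pl]) (use sm x v in auto)
        also have "\<dots> = (\<Oplus>\<^bsub>Y\<^esub>i\<in>{..<?n}. \<psi> (f i x \<odot>\<^bsub>H\<^esub> g i))"
          by (rule Y.X.finsum_cong')
             (use v gf(1) fK x psm[OF v(1) v(1)] linear_map_smult[OF G_linear[OF pc]] hom_module_app[OF pc] in auto)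
        also have "\<dots> = \<psi> (\<Oplus>\<^bsub>H\<^esub>i\<in>{..<?n}. f i x \<odot>\<^bsub>H\<^esub> g i)"
          by (rule linear_map_finsum[OF H.H_module Y.X_module G_linear[OF pc], symmetric]) (auto simp: gf(1) fK x)
        also have "\<dots> = \<psi> x" by (rule arg_cong[OF gf(4)[OF x], of \<psi>, symmetric])
        finally show "?F ?\<phi> x = \<psi> x" using x by simp
      qed
      then show "\<psi> \<in> ?F ` D L V U" using im[OF \<phi>] \<psi> by (intro image_eqI[of _ _ ?\<phi>]) (simp_all del: restrict_apply)
    qed
  qed
  have 2: "{\<phi> \<in> D L V U. ?F \<phi> = \<zero>\<^bsub>G Y\<^esub>} = HomS U"
  proof (intro equalityI subsetI)
    fix \<phi> assume *: "\<phi> \<in> {\<phi> \<in> D L V U. ?F \<phi> = \<zero>\<^bsub>G Y\<^esub>}"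
    then have \<phi>: "\<phi> \<in> HomS V" "?F \<phi> = \<zero>\<^bsub>G Y\<^esub>" using DV by blast+
    have "\<phi> h \<in> U" if "h \<in> carrier H" for h
      using fun_cong[OF \<phi>(2), of h] kerF[OF \<phi>(1) that] that by (simp add: hom_module_ev)
    then show "\<phi> \<in> HomS U" using \<phi>(1) by blast
  next
    fix \<phi> assume \<phi>: "\<phi> \<in> HomS U"
    then have \<phi>V: "\<phi> \<in> HomS V" using U(2) by blast
    have "\<phi> \<in> D L V U" using \<phi> \<phi>V HomS_ten[OF U(1) \<phi>] Lc by (auto simp: Dset_def)
    moreover have "?F \<phi> = \<zero>\<^bsub>G Y\<^esub>"
      by (rule hom_module_eqI[OF Fcl[OF \<phi>V] GY.X.zero_closed]) (use \<phi> kerF[OF \<phi>V] in \<open>auto simp: hom_module_ev\<close>)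
    ultimately show "\<phi> \<in> {\<phi> \<in> D L V U. ?F \<phi> = \<zero>\<^bsub>G Y\<^esub>}" by blast
  qed
  have "VG.vdim {\<phi> \<in> D L V U. ?F \<phi> = \<zero>\<^bsub>G Y\<^esub>} + vector_space.vdim K (G Y) (?F ` D L V U) = VG.vdim (D L V U)"
  proof (rule rF(2))
    fix x y assume "x \<in> D L V U" "y \<in> D L V U"
    then have *: "x \<in> HomS V" "y \<in> HomS V" using DV by auto
    show "?F (x \<oplus>\<^bsub>G X\<^esub> y) = ?F x \<oplus>\<^bsub>G Y\<^esub> ?F y"
      using * padd by (auto simp: hom_module_simps(3) intro!: restrict_ext)
  next
    fix c x assume "c \<in> carrier K" "x \<in> D L V U"
    moreover from this have "x \<in> HomS V" using DV by auto
    ultimately show "?F (c \<odot>\<^bsub>G X\<^esub> x) = c \<odot>\<^bsub>G Y\<^esub> ?F x"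
      using psm by (auto simp: hom_module_simps(4) intro!: restrict_ext)
  qed (use Fcl DV in auto)
  then show "vector_space.vdim K (G Y) (Dset Y lmul' hmul' L (carrier Y) {\<zero>\<^bsub>Y\<^esub>}) + VH.vdim (carrier H) * VX.vdim U = VG.vdim (D L V U)"
    by (simp add: 1 2 vdim_hom(2)[OF H.H_vector_space X_vector_space fH fU])
qed

end

section \<open>Simple factors\<close>

context hopf_partial_action
begin

abbreviation fin :: "('k, 'x) module \<Rightarrow> bool"
  where "fin X \<equiv> vector_space.fin_subspace K X (carrier X)"

abbreviation dim :: "('k, 'x) module \<Rightarrow> nat"
  where "dim X \<equiv> vector_space.vdim K X (carrier X)"

text \<open>\<open>\<pi>\<close> identifies \<open>Y\<close> with \<open>V/U\<close>. Carrying
  \<open>Y\<close> and \<open>\<pi>\<close> as data lets the type of the factor differ from that of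
  \<open>X\<close>.\<close>

definition simple_factor ::
  "('k, 'x) module \<Rightarrow> ('a \<Rightarrow> 'x \<Rightarrow> 'x) \<Rightarrow> ('h \<Rightarrow> 'x \<Rightarrow> 'x) \<Rightarrow> 'x set \<Rightarrow> 'x set \<Rightarrow>
   ('k, 'y) module \<Rightarrow> ('a \<Rightarrow> 'y \<Rightarrow> 'y) \<Rightarrow> ('h \<Rightarrow> 'y \<Rightarrow> 'y) \<Rightarrow> ('x \<Rightarrow> 'y) \<Rightarrow> bool"
  where "simple_factor X lmul hmul U V Y lmul' hmul' \<pi> \<longleftrightarrow>
    stable X lmul hmul U \<and> stable X lmul hmul V \<and> U \<subseteq> V \<and> irreducible_module Y lmul' hmul' \<and>
    partial_hom (X\<lparr>carrier := V\<rparr>) lmul hmul Y lmul' hmul' \<pi> \<and> \<pi> ` V = carrier Y \<and> {v \<in> V. \<pi> v = \<zero>\<^bsub>Y\<^esub>} = U"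

lemma irreducible_context:
  "irreducible_module X lmul hmul \<Longrightarrow> partial_module_context K H \<Delta> \<epsilon> S A act X lmul hmul"
  by (simp add: irreducible_module_def partial_contextI)

end

context partial_module_context
begin

interpretation VX: vector_space K X by (rule X_vector_space)

lemma stable_sum:
  assumes "stable X lmul hmul U" "stable X lmul hmul V"
  shows "stable X lmul hmul (U <+>\<^bsub>X\<^esub> V)"
proof (rule stableI_ten)
  note U = stableD[OF assms(1)] and V = stableD[OF assms(2)]
  show "submodule (U <+>\<^bsub>X\<^esub> V) K X" by (rule VX.subspace_sum(1)[OF U(1) V(1)])
  fix n t assume n: "n \<in> U <+>\<^bsub>X\<^esub> V" and t: "t \<in> carrier AH.T"
  then obtain u v where uv: "u \<in> U" "v \<in> V" "n = u \<oplus> v" by (auto simp: set_add_def')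
  have "ten t n = ten t u \<oplus> ten t v"
    unfolding uv(3) by (rule linear_map_add[OF bilinear_map_right[OF ten_bilinear linear_map_id t]]) (use uv U(5) V(5) in auto)
  then show "ten t n \<in> U <+>\<^bsub>X\<^esub> V" using VX.set_addI U(4)[OF uv(1) t] V(4)[OF uv(2) t] by simp
qed

lemma stable_zero: "stable X lmul hmul {\<zero>}"
  by (rule stableI_ten[OF submodule_zero[OF X_module]])
     (simp add: linear_map_zero[OF X_module X_module bilinear_map_right[OF ten_bilinear linear_map_id]])

lemma stable_carrier: "stable X lmul hmul (carrier X)"
  by (rule stableI_ten) (auto intro!: VX.subspaceI)

lemma maximal_stable:
  assumes fV: "VX.fin_subspace V" and "stable X lmul hmul U" "stable X lmul hmul V" "U \<subset> V"
  obtains W where "stable X lmul hmul W" "U \<subseteq> W" "W \<subset> V"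
    "\<And>N. stable X lmul hmul N \<Longrightarrow> W \<subseteq> N \<Longrightarrow> N \<subseteq> V \<Longrightarrow> N = W \<or> N = V"
proof -
  let ?Q = "\<lambda>W. stable X lmul hmul W \<and> U \<subseteq> W \<and> W \<subset> V"
  have "VX.vdim W \<le> VX.vdim V" if "?Q W" for W
    using VX.vdim_mono(2)[OF fV stableD(1)] that by auto
  then obtain W where W: "?Q W" "\<And>W'. ?Q W' \<Longrightarrow> VX.vdim W' \<le> VX.vdim W"
    using ex_has_greatest_nat[of ?Q U VX.vdim "Suc (VX.vdim V)"] assms(2-4) by (metis less_Suc_eq_le subset_refl)
  show thesis
  proof (rule that)
    fix N assume N: "stable X lmul hmul N" "W \<subseteq> N" "N \<subseteq> V"
    have "N = W" if "N \<noteq> V"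
    proof -
      have "VX.vdim N \<le> VX.vdim W" using W(2)[of N] N W(1) that by auto
      moreover have f: "VX.fin_subspace N" by (rule VX.vdim_mono(1)[OF fV stableD(1)[OF N(1)] N(3)])
      moreover have "VX.vdim W \<le> VX.vdim N" by (rule VX.vdim_mono(2)[OF f stableD(1) N(2)]) (use W(1) in auto)
      ultimately show ?thesis using VX.vdim_mono(3)[OF f stableD(1) N(2)] W(1) by auto
    qed
    then show "N = W \<or> N = V" by blast
  qed (use W in auto)
qed

text \<open>The type of the elements changes with every application of \<open>Hom\<close>, while
  bounds over all irreducible modules need a single type. A vector \<open>v0\<close> of
  \<open>V\<close> outside \<open>U\<close> generates \<open>V\<close> modulo \<open>U\<close>, so a
  coset \<open>x + U\<close> can be named by the set of all \<open>t\<close> in \<open>A # H\<close>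
  with \<open>t v0\<close> in \<open>x + U\<close>.\<close>

lemma simple_factor_exists:
  assumes U: "stable X lmul hmul U" and V: "stable X lmul hmul V" and "U \<subset> V"
    and max: "\<And>N. stable X lmul hmul N \<Longrightarrow> U \<subseteq> N \<Longrightarrow> N \<subseteq> V \<Longrightarrow> N = U \<or> N = V"
  obtains Y :: "('k, ('a \<times> 'h \<Rightarrow> 'k) set set) module" and lmul' hmul' \<pi>
  where "simple_factor X lmul hmul U V Y lmul' hmul' \<pi>"
proof -
  let ?V = "X\<lparr>carrier := V\<rparr>"
  note sV = stableD[OF V] and sU = stableD[OF U]
  note Us = VX.subspaceD[OF sU(1)] and Vs = VX.subspaceD[OF sV(1)]
  note sp = submodule_partial_module[OF X.left_partial_module_axioms V]
  interpret V: partial_module_context K H \<Delta> \<epsilon> S A act ?V lmul hmul by (rule partial_contextI[OF sp(1)])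
  interpret VV: vector_space K ?V by (rule V.X_vector_space)
  have minus: "x \<ominus>\<^bsub>?V\<^esub> y = x \<ominus> y" if "x \<in> V" "y \<in> V" for x y
    using linear_map_minus[OF V.X_module X_module, of "\<lambda>x. x" x y] sp(2) that by (simp add: partial_hom_def)
  have tV: "V.ten t x = ten t x" if "t \<in> carrier AH.T" "x \<in> V" for t x
    using partial_hom_ten[OF sp(2) that(1), of x] that(2) by simp
  obtain v0 where v0: "v0 \<in> V" "v0 \<notin> U" using assms(3) by blast
  have v0X: "v0 \<in> carrier X" using v0 sV(5) by auto
  define j where "j x = {t \<in> carrier AH.T. ten t v0 \<ominus> x \<in> U}" for x
  \<comment> \<open>Names must be nonempty to tell cosets apart. The sum of \<open>U\<close> and the
    orbit of \<open>v0\<close> is stable and larger than \<open>U\<close>, hence all of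
    \<open>V\<close>.\<close>
  have gen: "\<exists>t. t \<in> j x" if x: "x \<in> V" for x
  proof -
    let ?O = "(\<lambda>t. ten t v0) ` carrier AH.T"
    note O = orbit_stable[OF v0X]
    have "?O <+>\<^bsub>X\<^esub> U = V"
    proof -
      have "?O <+>\<^bsub>X\<^esub> U \<subseteq> V"
        by (rule VX.subspace_sum_least[OF sV(1)]) (use sV(4)[OF v0(1)] assms(3) in auto)
      moreover have "v0 \<in> ?O <+>\<^bsub>X\<^esub> U" "U \<subseteq> ?O <+>\<^bsub>X\<^esub> U"
        using VX.subspace_sum[OF stableD(1)[OF O(1)] sU(1)] O(2) by auto
      ultimately show ?thesis using max[OF stable_sum[OF O(1) U]] v0(2) by blast
    qed
    then obtain t u where t: "t \<in> carrier AH.T" and u: "u \<in> U" and e: "x = ten t v0 \<oplus> u"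
      using x by (auto simp: set_add_def')
    have "x \<ominus> ten t v0 \<in> U"
      using VX.add_minus_cancel(1)[of "ten t v0" u] t u v0X Us(2) by (simp add: e)
    moreover have "\<zero> \<ominus> (x \<ominus> ten t v0) = ten t v0 \<ominus> x"
      using VX.minus_add_minus(2)[of "ten t v0" x x] x Vs(2) t v0X
      by (simp add: X.M.r_neg X.M.minus_eq)
    ultimately show ?thesis using Us(6)[OF Us(3)] t unfolding j_def by fastforce
  qed
  have j: "j x = j y \<longleftrightarrow> x \<ominus>\<^bsub>?V\<^esub> y \<in> U" if x: "x \<in> carrier ?V" and y: "y \<in> carrier ?V" for x y
  proof -
    have xy: "x \<in> V" "y \<in> V" "x \<in> carrier X" "y \<in> carrier X" using x y sV(5) by auto
    have "x \<ominus> y \<in> U" if e: "j x = j y"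
    proof -
      obtain t where t: "t \<in> j x" "t \<in> j y" using gen[OF xy(1)] e by blast
      then have "(ten t v0 \<ominus> y) \<ominus> (ten t v0 \<ominus> x) \<in> U" by (auto simp: j_def intro: Us(6))
      moreover have "(ten t v0 \<ominus> y) \<ominus> (ten t v0 \<ominus> x) = x \<ominus> y"
        by (rule VX.minus_add_minus(2)) (use xy t v0X in \<open>simp_all add: j_def\<close>)
      ultimately show ?thesis by simp
    qed
    moreover have "j x = j y" if d: "x \<ominus> y \<in> U"
    proof -
      have "ten t v0 \<ominus> x \<in> U \<longleftrightarrow> ten t v0 \<ominus> y \<in> U" if t: "t \<in> carrier AH.T" for t
      proof -
        have e: "ten t v0 \<ominus> y = (ten t v0 \<ominus> x) \<oplus> (x \<ominus> y)"
          "ten t v0 \<ominus> x = (ten t v0 \<ominus> y) \<ominus> (x \<ominus> y)"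
          using VX.minus_add_minus[of x y "ten t v0"] xy t v0X by simp_all
        show ?thesis using Us(4)[OF _ d] Us(6)[OF _ d] e by metis
      qed
      then show ?thesis by (auto simp: j_def)
    qed
    ultimately show ?thesis using minus[OF xy(1,2)] by auto
  qed
  have UV: "stable ?V lmul hmul U"
    by (rule V.stableI_ten) (use sU assms(3) tV Us in \<open>auto intro!: VV.subspaceI\<close>)
  obtain lmul' hmul' where h: "partial_hom ?V lmul hmul (transport j ?V) lmul' hmul' j"
    using quotient_partial_module[OF sp(1) UV, of j] j by blast
  let ?Y = "transport j ?V"
  interpret Y: partial_module_context K H \<Delta> \<epsilon> S A act ?Y lmul' hmul'
    using h by (simp add: partial_hom_def partial_contextI)
  have cY: "carrier ?Y = j ` V" and zY: "\<zero>\<^bsub>?Y\<^esub> = j \<zero>" by (simp_all add: transport_simps)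
  have ker: "{v \<in> V. j v = \<zero>\<^bsub>?Y\<^esub>} = U"
    unfolding zY using j[of _ "\<zero>"] minus[of _ "\<zero>"] Vs(2,3) assms(3)
    by (auto simp: X.M.minus_eq VX.a_inv_zero)
  have "irreducible_module ?Y lmul' hmul'"
    unfolding irreducible_module_def
  proof (intro conjI allI impI Y.X.left_partial_module_axioms)
    show "carrier ?Y \<noteq> {\<zero>\<^bsub>?Y\<^esub>}" using ker v0 by (auto simp: cY)
    fix N assume N: "stable ?Y lmul' hmul' N"
    let ?N = "{v \<in> V. j v \<in> N}"
    have Nz: "\<zero>\<^bsub>?Y\<^esub> \<in> N"
      using vector_space.subspaceD(3)[OF Y.X_vector_space Y.stableD(1)[OF N]] .
    have "stable ?V lmul hmul ?N" using partial_hom_vimage_stable[OF h N] by simp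
    note sN = V.stableD[OF this]
    have "stable X lmul hmul ?N"
      by (rule stableI_ten) (use VV.subspaceD[OF sN(1)] sN(4) tV Vs(2) in \<open>auto intro!: VX.subspaceI\<close>)
    moreover have "U \<subseteq> ?N" using ker Nz by auto
    ultimately have "?N = U \<or> ?N = V" using max[of ?N] by blast
    moreover have "N \<subseteq> j ` V" using Y.stableD(5)[OF N] by (simp add: cY)
    ultimately show "N = {\<zero>\<^bsub>?Y\<^esub>} \<or> N = carrier ?Y"
      using ker Nz unfolding cY by blast
  qed
  then have "simple_factor X lmul hmul U V ?Y lmul' hmul' j"
    using U V assms(3) h ker by (auto simp: simple_factor_def cY)
  then show thesis by (rule that)
qed

end

section \<open>Finite-dimensional images and the size of irreducible modules\<close>

lemma fin_subspace_lift:
  assumes V: "vector_space K V" and W: "vector_space K W" and f: "linear_map K V W f"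
    and U: "vector_space.fin_subspace K W U" "U \<subseteq> f ` carrier V"
  shows "\<exists>M. vector_space.fin_subspace K V M \<and> U \<subseteq> f ` M"
proof -
  interpret V: vector_space K V by fact
  interpret W: vector_space K W by fact
  obtain g c where g: "\<And>i. i < W.vdim U \<Longrightarrow> g i \<in> U" and c: "\<And>i. i < W.vdim U \<Longrightarrow> functional K W (c i)"
    and "\<And>i j. i < W.vdim U \<Longrightarrow> j < W.vdim U \<Longrightarrow> c i (g j) = (if i = j then \<one>\<^bsub>K\<^esub> else \<zero>\<^bsub>K\<^esub>)"
    and gen: "\<And>x. x \<in> U \<Longrightarrow> x = (\<Oplus>\<^bsub>W\<^esub>i\<in>{..<W.vdim U}. c i x \<odot>\<^bsub>W\<^esub> g i)"
    using W.dual_basis[OF U(1)] by blast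
  have UW: "U \<subseteq> carrier W" by (rule W.subspaceD(1)[OF W.fin_subspace_subspace[OF U(1)]])
  let ?v = "\<lambda>i. SOME v. v \<in> carrier V \<and> f v = g i"
  obtain v where v: "\<And>i. i < W.vdim U \<Longrightarrow> v i \<in> carrier V" "\<And>i. i < W.vdim U \<Longrightarrow> f (v i) = g i"
  proof (rule that[of ?v])
    fix i assume "i < W.vdim U"
    from g[OF this] U(2) obtain x where "x \<in> carrier V \<and> f x = g i" by (metis imageE subsetD)
    from someI[of "\<lambda>v. v \<in> carrier V \<and> f v = g i", OF this]
    show "?v i \<in> carrier V" "f (?v i) = g i" by simp_all
  qed
  obtain M where M: "V.fin_subspace M" "v ` {..<W.vdim U} \<subseteq> M"
    using V.fin_subspace_cover[of "v ` {..<W.vdim U}"] v(1) by auto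
  note sM = V.fin_subspace_subspace[OF M(1)]
  have mM: "module K (V\<lparr>carrier := M\<rparr>)" by (rule submodule.submodule_is_module[OF sM V.module_axioms])
  have fM: "linear_map K (V\<lparr>carrier := M\<rparr>) W f"
    using linear_map_closed[OF f] linear_map_add[OF f] linear_map_smult[OF f] V.subspaceD(2)[OF sM]
    by (intro linear_mapI) auto
  have sM': "submodule (f ` M) K W"
    using linear_map_image_submodule[OF mM W.module_axioms fM] by simp
  note fMs = W.subspaceD[OF this]
  have "x \<in> f ` M" if x: "x \<in> U" for x
  proof -
    have cg: "c i x \<odot>\<^bsub>W\<^esub> g i \<in> f ` M" if "i < W.vdim U" for i
    proof (rule fMs(7))
      show "c i x \<in> carrier K" using linear_map_closed[OF c[OF that], of x] x UW by (auto simp: scalar_module_def)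
      show "g i \<in> f ` M" using M(2) that v(2)[OF that, symmetric] by auto
    qed
    have "(\<Oplus>\<^bsub>W\<^esub>i\<in>{..<W.vdim U}. c i x \<odot>\<^bsub>W\<^esub> g i) \<in> f ` M"
      by (rule W.finsum_in_subspace[OF sM']) (use cg in auto)
    then show ?thesis by (subst gen[OF x])
  qed
  then show ?thesis using M(1) by blast
qed

context partial_module_context
begin

interpretation VX: vector_space K X by (rule X_vector_space)
interpretation VA: vector_space K A by (rule A_vector_space)
interpretation VH: vector_space K H by (rule H.H_vector_space)

text \<open>The image of \<open>A\<close> in the endomorphisms of \<open>X\<close> is
  finite-dimensional, hence already the image of a finite-dimensional subspace \<open>M\<close> of
  \<open>A\<close>.\<close>

lemma annihilator_complement:
  assumes "fin X"
  obtains M where "VA.fin_subspace M" "\<And>a. a \<in> carrier A \<Longrightarrow> \<exists>m\<in>M. a \<ominus>\<^bsub>A\<^esub> m \<in> annihilator X lmul"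
proof -
  let ?E = "hom_module K X X"
  have mE: "module K ?E" by (rule hom_module_module[OF X_module X_module])
  then have VE: "vector_space K ?E" by (simp add: vector_space_def H.K.field_axioms)
  interpret VE: vector_space K ?E by (rule VE)
  define \<rho> where "\<rho> a = (\<lambda>x\<in>carrier X. lmul a x)" for a
  have \<rho>: "linear_map K A ?E \<rho>"
  proof (rule linear_map_into_hom[OF A_module X_module X_module])
    show "\<rho> a \<in> carrier ?E" if "a \<in> carrier A" for a
      unfolding \<rho>_def by (rule hom_moduleI[OF X_module bilinear_map_right[OF X.lmul_bilinear linear_map_id that]])
    show "linear_map K A X (\<lambda>a. \<rho> a x)" if "x \<in> carrier X" for x
      using bilinear_map_left[OF X.lmul_bilinear linear_map_id that] that by (simp add: \<rho>_def)
  qed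
  have "{\<phi> \<in> carrier ?E. \<forall>x\<in>carrier X. \<phi> x \<in> carrier X} = carrier ?E" by (auto simp: hom_module_app)
  then have "VE.fin_subspace (carrier ?E)" using vdim_hom(1)[OF X_vector_space X_vector_space assms assms] by simp
  then have "VE.fin_subspace (\<rho> ` carrier A)"
    by (rule VE.vdim_mono(1)[OF _ linear_map_image_submodule[OF A_module mE \<rho>]]) (use linear_map_closed[OF \<rho>] in auto)
  from fin_subspace_lift[OF A_vector_space VE \<rho> this]
  obtain M where M: "VA.fin_subspace M" "\<rho> ` carrier A \<subseteq> \<rho> ` M" by blast
  show thesis
  proof (rule that[OF M(1)])
    fix a assume a: "a \<in> carrier A"
    then obtain m where m: "m \<in> M" "\<rho> a = \<rho> m" using M(2) by blast
    have mA: "m \<in> carrier A" using m(1) VA.subspaceD(2)[OF VA.fin_subspace_subspace[OF M(1)]] by blast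
    have "lmul (a \<ominus>\<^bsub>A\<^esub> m) x = \<zero>" if x: "x \<in> carrier X" for x
    proof -
      have "lmul (a \<ominus>\<^bsub>A\<^esub> m) x = lmul a x \<ominus> lmul m x"
        by (rule linear_map_minus[OF A_module X_module bilinear_map_left[OF X.lmul_bilinear linear_map_id x] a mA])
      also have "lmul a x = lmul m x" using fun_cong[OF m(2), of x] x by (simp add: \<rho>_def)
      finally show ?thesis using x mA by (simp add: X.M.minus_eq X.M.r_neg)
    qed
    then show "\<exists>m\<in>M. a \<ominus>\<^bsub>A\<^esub> m \<in> annihilator X lmul"
      using m(1) a mA by (auto simp: annihilator_def)
  qed
qed

text \<open>\<open>X\<close> is spanned by the \<open>a (h x0)\<close> for one nonzero
  \<open>x0\<close>, and \<open>a\<close> can be taken from \<open>M\<close>, as it matters only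
  modulo the annihilator. The bound depends on \<open>H\<close> and \<open>M\<close> alone and so is
  uniform over all irreducible modules whose annihilator contains a given ideal of finite
  codimension; this uniformity makes a maximal ratio exist.\<close>

lemma irreducible_dim:
  assumes irr: "irreducible_module X lmul hmul" and fH: "VH.fin_subspace (carrier H)"
    and M: "VA.fin_subspace M" "\<And>a. a \<in> carrier A \<Longrightarrow> \<exists>m\<in>M. a \<ominus>\<^bsub>A\<^esub> m \<in> annihilator X lmul"
  shows "fin X" "dim X \<le> VH.vdim (carrier H) * VA.vdim M"
proof -
  let ?n = "VH.vdim (carrier H)" and ?E = "hom_module K H A"
  have VE: "vector_space K ?E" by (simp add: vector_space_def H.K.field_axioms hom_module_module[OF H.H_module A_module])
  interpret VE: vector_space K ?E by (rule VE)
  let ?S = "{\<phi> \<in> carrier ?E. \<forall>h\<in>carrier H. \<phi> h \<in> M}"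
  note S = vdim_hom[OF H.H_vector_space A_vector_space fH M(1)]
  have sM: "m \<in> carrier A" if "m \<in> M" for m using VA.subspaceD(2)[OF VA.fin_subspace_subspace[OF M(1)] that] .
  obtain x0 where x0: "x0 \<in> carrier X" "x0 \<noteq> \<zero>"
    using irr X.M.zero_closed unfolding irreducible_module_def by blast
  obtain g f where g: "\<And>i. i < ?n \<Longrightarrow> g i \<in> carrier H"
    and f: "\<And>i. i < ?n \<Longrightarrow> functional K H (f i)"
    and fg: "\<And>i j. i < ?n \<Longrightarrow> j < ?n \<Longrightarrow> f i (g j) = (if i = j then \<one>\<^bsub>K\<^esub> else \<zero>\<^bsub>K\<^esub>)"
    and gen: "\<And>x. x \<in> carrier H \<Longrightarrow> x = (\<Oplus>\<^bsub>H\<^esub>i\<in>{..<?n}. f i x \<odot>\<^bsub>H\<^esub> g i)"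
    using VH.dual_basis[OF fH] by blast
  have fK: "f i x \<in> carrier K" if "i < ?n" "x \<in> carrier H" for i x
    using linear_map_closed[OF f[OF that(1)] that(2)] by (simp add: scalar_module_def)
  \<comment> \<open>\<open>Hom(H, M)\<close> serves as the direct sum of \<open>dim H\<close> copies
    of \<open>M\<close>, with \<open>\<phi> (g i)\<close> as the \<open>i\<close>-th
    component.\<close>
  let ?F = "\<lambda>\<phi>. \<Oplus>i\<in>{..<?n}. lmul (\<phi> (g i)) (hmul (g i) x0)"
  have F: "linear_map K ?E X ?F"
    by (rule finsum_linear_map[OF VE.module_axioms X_module])
       (auto intro!: bilinear_map_left[OF X.lmul_bilinear] linear_map_eval simp: g x0)
  note rn = rank_nullity[OF VE X_vector_space S(1), of ?F]
  have rn': "VX.fin_subspace (?F ` ?S)" "VX.vdim (?F ` ?S) \<le> ?n * VA.vdim M"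
    using rn linear_map_closed[OF F] linear_map_add[OF F] linear_map_smult[OF F] S(2) by auto
  note N = VX.subspaceD[OF VX.fin_subspace_subspace[OF rn'(1)]]
  have 1: "lmul m (hmul (g i) x0) \<in> ?F ` ?S" if m: "m \<in> M" and i: "i < ?n" for m i
  proof (rule image_eqI)
    let ?\<phi> = "\<lambda>h\<in>carrier H. f i h \<odot>\<^bsub>A\<^esub> m"
    have "?\<phi> \<in> carrier ?E"
      by (rule hom_moduleI[OF H.H_module functional_smult_linear[OF H.H_module A_module f[OF i] sM[OF m]]])
    moreover have "?\<phi> h \<in> M" if "h \<in> carrier H" for h
      using VA.subspaceD(7)[OF VA.fin_subspace_subspace[OF M(1)] fK[OF i that] m] that by simp
    ultimately show "?\<phi> \<in> ?S" by blast
    have "?F ?\<phi> = (\<Oplus>j\<in>{..<?n}. if i = j then lmul m (hmul (g j) x0) else \<zero>)"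
      by (rule X.M.finsum_cong')
         (use g x0 m sM fg[OF i] in \<open>auto simp: linear_map_zero[OF A_module X_module bilinear_map_left[OF X.lmul_bilinear linear_map_id]] A.smult_one\<close>)
    also have "\<dots> = lmul m (hmul (g i) x0)"
      by (rule X.M.finsum_singleton[of i "{..<?n}" "\<lambda>j. lmul m (hmul (g j) x0)"]) (use i g x0 sM m in auto)
    finally show "lmul m (hmul (g i) x0) = ?F ?\<phi>" ..
  qed
  have 2: "lmul a (hmul (g i) x0) \<in> ?F ` ?S" if a: "a \<in> carrier A" and i: "i < ?n" for a i
  proof -
    obtain m where m: "m \<in> M" "a \<ominus>\<^bsub>A\<^esub> m \<in> annihilator X lmul" using M(2)[OF a] by blast
    have y: "hmul (g i) x0 \<in> carrier X" using g i x0 by simp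
    have "lmul (a \<ominus>\<^bsub>A\<^esub> m) (hmul (g i) x0) = lmul a (hmul (g i) x0) \<ominus> lmul m (hmul (g i) x0)"
      by (rule linear_map_minus[OF A_module X_module bilinear_map_left[OF X.lmul_bilinear linear_map_id y] a sM[OF m(1)]])
    moreover have "lmul (a \<ominus>\<^bsub>A\<^esub> m) (hmul (g i) x0) = \<zero>" using m(2) y by (simp add: annihilator_def)
    ultimately have "lmul a (hmul (g i) x0) = lmul m (hmul (g i) x0)"
      using VX.minus_eq_zero_iff[of "lmul a (hmul (g i) x0)" "lmul m (hmul (g i) x0)"] a sM[OF m(1)] y by simp
    then show ?thesis using 1[OF m(1) i] by simp
  qed
  have 3: "lmul a (hmul h x0) \<in> ?F ` ?S" if a: "a \<in> carrier A" and h: "h \<in> carrier H" for a h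
  proof -
    have l: "linear_map K H X (\<lambda>h. lmul a (hmul h x0))" by (intro xlin a x0)
    have "lmul a (hmul h x0) = lmul a (hmul (\<Oplus>\<^bsub>H\<^esub>i\<in>{..<?n}. f i h \<odot>\<^bsub>H\<^esub> g i) x0)"
      by (rule arg_cong[OF gen[OF h]])
    also have "lmul a (hmul (\<Oplus>\<^bsub>H\<^esub>i\<in>{..<?n}. f i h \<odot>\<^bsub>H\<^esub> g i) x0) = (\<Oplus>i\<in>{..<?n}. lmul a (hmul (f i h \<odot>\<^bsub>H\<^esub> g i) x0))"
      by (rule linear_map_finsum[OF H.H_module X_module l]) (use fK g h in auto)
    also have "\<dots> \<in> ?F ` ?S"
    proof -
      have c: "lmul a (hmul (f i h \<odot>\<^bsub>H\<^esub> g i) x0) \<in> ?F ` ?S" if "i < ?n" for i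
        using N(7)[OF fK[OF that h] 2[OF a that]] linear_map_smult[OF l fK[OF that h] g[OF that]] by simp
      show ?thesis by (rule VX.finsum_in_subspace[OF VX.fin_subspace_subspace[OF rn'(1)]]) (use c in auto)
    qed
    finally show ?thesis .
  qed
  have 4: "ten t x0 \<in> ?F ` ?S" if "t \<in> carrier AH.T" for t
    unfolding tact_def
    by (rule tensor_lift_in_submodule[OF A_module H.H_module X_module VX.fin_subspace_subspace[OF rn'(1)] that 3])
  have orb: "(\<lambda>t. ten t x0) ` carrier AH.T = carrier X"
    using orbit_stable[OF x0(1)] irr x0(2) by (auto simp: irreducible_module_def)
  have "?F ` ?S = carrier X"
    by (rule equalityI[OF N(1)], subst orb[symmetric], rule image_subsetI, rule 4)
  then show "fin X" "dim X \<le> ?n * VA.vdim M" using rn' by (simp_all only:)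
qed

lemma simple_factor_annihilator:
  assumes "simple_factor X lmul hmul U V Y lmul' hmul' \<pi>"
  shows "annihilator X lmul \<subseteq> annihilator Y lmul'"
proof
  fix a assume a: "a \<in> annihilator X lmul"
  have \<pi>: "partial_hom (X\<lparr>carrier := V\<rparr>) lmul hmul Y lmul' hmul' \<pi>" "\<pi> ` V = carrier Y" and V: "stable X lmul hmul V"
    using assms by (auto simp: simple_factor_def)
  interpret V: partial_module_context K H \<Delta> \<epsilon> S A act "X\<lparr>carrier := V\<rparr>" lmul hmul
    by (rule partial_contextI) (use \<pi>(1) in \<open>simp add: partial_hom_def\<close>)
  interpret Y: partial_module_context K H \<Delta> \<epsilon> S A act Y lmul' hmul'
    by (rule partial_contextI) (use \<pi>(1) in \<open>simp add: partial_hom_def\<close>)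
  have "lmul' a y = \<zero>\<^bsub>Y\<^esub>" if "y \<in> carrier Y" for y
  proof -
    have "y \<in> \<pi> ` V" using that by (simp only: \<pi>(2))
    then obtain v where v: "v \<in> V" "y = \<pi> v" by (elim imageE)
    then have "lmul' a y = \<pi> (lmul a v)" using \<pi>(1) a by (simp add: partial_hom_def annihilator_def)
    also have "lmul a v = \<zero>" using a v(1) stableD(5)[OF V] by (auto simp: annihilator_def)
    also have "\<pi> \<zero> = \<zero>\<^bsub>Y\<^esub>"
      using linear_map_zero[OF V.X_module Y.X_module] \<pi>(1) by (simp add: partial_hom_def)
    finally show ?thesis .
  qed
  then show "a \<in> annihilator Y lmul'" using a by (simp add: annihilator_def)
qed

lemma annihilator_G: "annihilator X lmul \<subseteq> annihilator (G X) (glm lmul)"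
proof
  fix a assume a: "a \<in> annihilator X lmul"
  interpret G: partial_module_context K H \<Delta> \<epsilon> S A act "G X" "glm lmul" "ghm X hmul"
    by (rule G_context)
  have "glm lmul a \<phi> = \<zero>\<^bsub>G X\<^esub>" if "\<phi> \<in> carrier (G X)" for \<phi>
    using a that by (intro hom_module_eqI[OF G.lmul_closed G.X.zero_closed])
      (auto simp: glm_app hom_module_ev annihilator_def hom_module_app[OF that])
  then show "a \<in> annihilator (G X) (glm lmul)" using a by (simp add: annihilator_def)
qed

lemma annihilator_inj_hom:
  assumes f: "partial_hom X lmul hmul Y lmul' hmul' f" "inj_on f (carrier X)"
  shows "annihilator Y lmul' \<subseteq> annihilator X lmul"
proof
  fix a assume a: "a \<in> annihilator Y lmul'"
  interpret Y: partial_module_context K H \<Delta> \<epsilon> S A act Y lmul' hmul'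
    using f(1) by (simp add: partial_hom_def partial_contextI)
  have fl: "linear_map K X Y f" using f(1) by (simp add: partial_hom_def)
  have "lmul a x = \<zero>" if x: "x \<in> carrier X" for x
  proof -
    have "f (lmul a x) = f \<zero>"
      using f(1) a x linear_map_closed[OF fl x] linear_map_zero[OF X_module Y.X_module fl]
      by (simp add: partial_hom_def annihilator_def)
    then show ?thesis using f(2) x a by (auto simp: inj_on_def annihilator_def)
  qed
  then show "a \<in> annihilator X lmul" using a by (simp add: annihilator_def)
qed

text \<open>\<open>t x0 \<mapsto> t w\<close> is well defined because whatever kills
  \<open>x0\<close> kills \<open>w\<close>. Its kernel is stable and does not contain
  \<open>x0\<close>, hence it is zero.\<close>

lemma irreducible_embeds:
  assumes irr: "irreducible_module X lmul hmul" and x0: "x0 \<in> carrier X"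
    and W: "partial_module W lmul' hmul'" "w \<in> carrier W" "w \<noteq> \<zero>\<^bsub>W\<^esub>"
    and k: "\<And>t. t \<in> carrier AH.T \<Longrightarrow> ten t x0 = \<zero> \<Longrightarrow> tact W lmul' hmul' t w = \<zero>\<^bsub>W\<^esub>"
  obtains \<theta> where "partial_hom X lmul hmul W lmul' hmul' \<theta>" "inj_on \<theta> (carrier X)"
proof -
  interpret W: partial_module_context K H \<Delta> \<epsilon> S A act W lmul' hmul' by (rule partial_contextI[OF W(1)])
  interpret VW: vector_space K W by (rule W.X_vector_space)
  interpret VT: vector_space K AH.T by (rule AH_vector_space)
  note tl = bilinear_map_left[OF ten_bilinear linear_map_id] bilinear_map_left[OF W.ten_bilinear linear_map_id]
  have well: "W.ten s w = W.ten t w" if "s \<in> carrier AH.T" "t \<in> carrier AH.T" "ten s x0 = ten t x0" for s t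
  proof -
    have "ten (s \<ominus>\<^bsub>AH.T\<^esub> t) x0 = ten s x0 \<ominus> ten t x0"
      by (rule linear_map_minus[OF AH_module X_module tl(1)[OF x0] that(1,2)])
    then have "ten (s \<ominus>\<^bsub>AH.T\<^esub> t) x0 = \<zero>"
      using that x0 VX.minus_eq_zero_iff[of "ten t x0" "ten t x0"] by simp
    then have "W.ten (s \<ominus>\<^bsub>AH.T\<^esub> t) w = \<zero>\<^bsub>W\<^esub>" using k that by simp
    moreover have "W.ten (s \<ominus>\<^bsub>AH.T\<^esub> t) w = W.ten s w \<ominus>\<^bsub>W\<^esub> W.ten t w"
      by (rule linear_map_minus[OF AH_module W.X_module tl(2)[OF W(2)] that(1,2)])
    ultimately show ?thesis using VW.minus_eq_zero_iff[of "W.ten s w" "W.ten t w"] that W(2) by simp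
  qed
  have x0nz: "x0 \<noteq> \<zero>"
  proof
    assume "x0 = \<zero>"
    then have "W.ten (pure \<one>\<^bsub>A\<^esub> \<one>\<^bsub>H\<^esub>) w = \<zero>\<^bsub>W\<^esub>" using k[of "pure \<one>\<^bsub>A\<^esub> \<one>\<^bsub>H\<^esub>"] ten_one[OF x0] by simp
    then show False using W.ten_one[OF W(2)] W(3) by simp
  qed
  have orb: "(\<lambda>t. ten t x0) ` carrier AH.T = carrier X"
    using orbit_stable[OF x0] irr x0nz by (auto simp: irreducible_module_def)
  define \<tau> where "\<tau> x = (SOME t. t \<in> carrier AH.T \<and> ten t x0 = x)" for x
  have \<tau>: "\<tau> x \<in> carrier AH.T" "ten (\<tau> x) x0 = x" if "x \<in> carrier X" for x
  proof -
    have "x \<in> (\<lambda>t. ten t x0) ` carrier AH.T" using that by (simp only: orb)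
    then obtain t where "t \<in> carrier AH.T \<and> ten t x0 = x" by auto
    from someI[of "\<lambda>t. t \<in> carrier AH.T \<and> ten t x0 = x", OF this] show "\<tau> x \<in> carrier AH.T" "ten (\<tau> x) x0 = x" by (simp_all add: \<tau>_def)
  qed
  define \<theta> where "\<theta> x = W.ten (\<tau> x) w" for x
  have \<theta>: "\<theta> x = W.ten t w" if "t \<in> carrier AH.T" "ten t x0 = x" for x t
    unfolding \<theta>_def by (rule well) (use \<tau> that x0 in auto)
  have cl: "\<theta> x \<in> carrier W" if "x \<in> carrier X" for x using \<tau>[OF that] W(2) by (simp add: \<theta>_def)
  have lin\<theta>: "linear_map K X W \<theta>"
  proof (rule linear_mapI[OF cl])
    fix x y assume xy: "x \<in> carrier X" "y \<in> carrier X"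
    have "\<theta> (x \<oplus> y) = W.ten (\<tau> x \<oplus>\<^bsub>AH.T\<^esub> \<tau> y) w"
      by (rule \<theta>) (use xy \<tau> linear_map_add[OF tl(1)[OF x0]] in simp_all)
    then show "\<theta> (x \<oplus> y) = \<theta> x \<oplus>\<^bsub>W\<^esub> \<theta> y"
      using linear_map_add[OF tl(2)[OF W(2)]] \<tau>(1) xy by (simp add: \<theta>_def)
  next
    fix c x assume cx: "c \<in> carrier K" "x \<in> carrier X"
    have "\<theta> (c \<odot> x) = W.ten (c \<odot>\<^bsub>AH.T\<^esub> \<tau> x) w"
      by (rule \<theta>) (use cx \<tau> linear_map_smult[OF tl(1)[OF x0]] in simp_all)
    then show "\<theta> (c \<odot> x) = c \<odot>\<^bsub>W\<^esub> \<theta> x"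
      using linear_map_smult[OF tl(2)[OF W(2)]] \<tau>(1) cx by (simp add: \<theta>_def)
  qed
  have ten\<theta>: "\<theta> (ten t x) = W.ten t (\<theta> x)" if "t \<in> carrier AH.T" "x \<in> carrier X" for t x
  proof -
    have "\<theta> (ten t x) = W.ten (t \<bullet> \<tau> x) w"
      by (rule \<theta>) (use that \<tau> x0 ten_mult in simp_all)
    then show ?thesis using W.ten_mult[OF that(1) \<tau>(1) W(2)] that by (simp add: \<theta>_def)
  qed
  have h\<theta>: "partial_hom X lmul hmul W lmul' hmul' \<theta>"
    unfolding partial_hom_def
  proof (intro conjI ballI lin\<theta> W(1) X.left_partial_module_axioms)
    show "\<theta> (lmul a x) = lmul' a (\<theta> x)" if "a \<in> carrier A" "x \<in> carrier X" for a x
      using ten\<theta>[of "pure a \<one>\<^bsub>H\<^esub>" x] that cl by (simp add: X.hmul_one W.X.hmul_one)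
    show "\<theta> (hmul h x) = hmul' h (\<theta> x)" if "h \<in> carrier H" "x \<in> carrier X" for h x
      using ten\<theta>[of "pure \<one>\<^bsub>A\<^esub> h" x] that cl by (simp add: X.lmul_one W.X.lmul_one)
  qed
  have "\<theta> x0 \<noteq> \<zero>\<^bsub>W\<^esub>" using \<theta>[of "pure \<one>\<^bsub>A\<^esub> \<one>\<^bsub>H\<^esub>" x0] ten_one[OF x0] W.ten_one[OF W(2)] W(3) by simp
  then have ker: "{x \<in> carrier X. \<theta> x \<in> {\<zero>\<^bsub>W\<^esub>}} = {\<zero>}"
  proof -
    have "{x \<in> carrier X. \<theta> x \<in> {\<zero>\<^bsub>W\<^esub>}} = {\<zero>} \<or> {x \<in> carrier X. \<theta> x \<in> {\<zero>\<^bsub>W\<^esub>}} = carrier X"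
      using partial_hom_vimage_stable[OF h\<theta> W.stable_zero] irr by (simp add: irreducible_module_def)
    moreover have "x0 \<notin> {x \<in> carrier X. \<theta> x \<in> {\<zero>\<^bsub>W\<^esub>}}" using \<open>\<theta> x0 \<noteq> \<zero>\<^bsub>W\<^esub>\<close> by simp
    ultimately show ?thesis using x0 by metis
  qed
  have "inj_on \<theta> (carrier X)"
  proof (rule inj_onI)
    fix x y assume xy: "x \<in> carrier X" "y \<in> carrier X" "\<theta> x = \<theta> y"
    then have "\<theta> (x \<ominus> y) = \<zero>\<^bsub>W\<^esub>"
      using linear_map_minus[OF X_module W.X_module lin\<theta> xy(1,2)] VW.minus_eq_zero_iff[of "\<theta> y" "\<theta> y"] cl by simp
    then have "x \<ominus> y = \<zero>" using ker xy by auto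
    then show "x = y" using VX.minus_eq_zero_iff[OF xy(1,2)] by simp
  qed
  then show thesis using h\<theta> that by blast
qed

text \<open>The inverse of the embedding, defined on the image, presents \<open>X\<close> as a
  simple factor, so that statements about all simple factors of \<open>W\<close> apply to
  \<open>X\<close>.\<close>

lemma simple_factor_embedding:
  assumes irr: "irreducible_module X lmul hmul"
    and f: "partial_hom X lmul hmul W lmul' hmul' \<theta>" "inj_on \<theta> (carrier X)"
  shows "simple_factor W lmul' hmul' {\<zero>\<^bsub>W\<^esub>} (\<theta> ` carrier X) X lmul hmul (inv_into (carrier X) \<theta>)"
proof -
  interpret W: partial_module_context K H \<Delta> \<epsilon> S A act W lmul' hmul'
    using f(1) by (simp add: partial_hom_def partial_contextI)
  have t: "linear_map K X W \<theta>" "\<And>a x. a \<in> carrier A \<Longrightarrow> x \<in> carrier X \<Longrightarrow> \<theta> (lmul a x) = lmul' a (\<theta> x)"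
    "\<And>h x. h \<in> carrier H \<Longrightarrow> x \<in> carrier X \<Longrightarrow> \<theta> (hmul h x) = hmul' h (\<theta> x)"
    using f(1) by (auto simp: partial_hom_def)
  let ?V = "\<theta> ` carrier X" and ?i = "inv_into (carrier X) \<theta>"
  have z: "\<theta> \<zero> = \<zero>\<^bsub>W\<^esub>" by (rule linear_map_zero[OF X_module W.X_module t(1)])
  have i: "?i (\<theta> x) = x" if "x \<in> carrier X" for x using f(2) that by simp
  have V: "stable W lmul' hmul' ?V"
    unfolding stable_subspace_def
    using linear_map_image_submodule[OF X_module W.X_module t(1)] by (auto simp flip: t(2,3))
  have il: "linear_map K (W\<lparr>carrier := ?V\<rparr>) X ?i"
    by (rule linear_mapI) (auto simp: i simp flip: linear_map_add[OF t(1)] linear_map_smult[OF t(1)])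
  have "partial_hom (W\<lparr>carrier := ?V\<rparr>) lmul' hmul' X lmul hmul ?i"
    using submodule_partial_module(1)[OF W.X.left_partial_module_axioms V] il X.left_partial_module_axioms
    by (auto simp: partial_hom_def i simp flip: t(2,3))
  moreover have "{v \<in> ?V. ?i v = \<zero>} = {\<zero>\<^bsub>W\<^esub>}" using i X.M.zero_closed z by force
  ultimately show ?thesis
    using irr V W.stable_zero i z X.M.zero_closed unfolding simple_factor_def by (auto simp: image_image)
qed

end

section \<open>The dimension ratio argument\<close>

text \<open>Every denominator is positive and at most \<open>N\<close>, and so divides
  \<open>fact N\<close>. Multiplied by \<open>fact N\<close>, the ratios \<open>d x / m x\<close>
  become natural numbers bounded by \<open>n * fact N\<close>, among which there is a
  greatest.\<close>

lemma ratio_maximizer: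
  fixes d m :: "'x \<Rightarrow> nat"
  assumes "C x0" "\<And>x. C x \<Longrightarrow> 0 < m x \<and> m x \<le> N \<and> d x \<le> n * m x"
  obtains x where "C x" "\<And>y. C y \<Longrightarrow> d y * m x \<le> d x * m y"
proof -
  define f where "f x = d x * (fact N div m x)" for x
  have fm: "f x * m x = d x * fact N" if "C x" for x
    using assms(2)[OF that] dvd_fact[of "m x" N] by (simp add: f_def)
  have "f x \<le> n * fact N" if "C x" for x
  proof -
    have "f x * m x \<le> n * m x * fact N" using fm[OF that] assms(2)[OF that] by simp
    then show ?thesis using assms(2)[OF that] by (simp add: mult.commute mult.left_commute)
  qed
  then obtain x where x: "C x" "\<And>y. C y \<Longrightarrow> f y \<le> f x"
    using ex_has_greatest_nat[of C x0 f "Suc (n * fact N)"] assms(1) by (metis less_Suc_eq_le)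
  show thesis
  proof (rule that[OF x(1)])
    fix y assume y: "C y"
    have "f y * m y * m x \<le> f x * m x * m y"
      using mult_right_mono[OF x(2)[OF y], of "m x * m y"] by (simp add: mult.assoc mult.left_commute)
    then show "d y * m x \<le> d x * m y" by (simp add: fm[OF y] fm[OF x(1)] mult.assoc mult.left_commute)
  qed
qed

text \<open>
  An irreducible partial module is a quotient of \<open>A \<otimes> H\<close>, so its elements can be taken to be subsets of
  \<open>A \<otimes> H\<close>; quantifying over all irreducible partial modules means quantifying over this type.
\<close>

type_synonym ('k, 'a, 'h) umodule = "('k, ('a \<times> 'h \<Rightarrow> 'k) set set) module"

context hopf_partial_action
begin

abbreviation ddim :: "('a \<times> 'h \<Rightarrow> 'k) set set \<Rightarrow> ('k, 'x) module \<Rightarrow> ('a \<Rightarrow> 'x \<Rightarrow> 'x) \<Rightarrow> ('h \<Rightarrow> 'x \<Rightarrow> 'x) \<Rightarrow> nat"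
  where "ddim L X lmul hmul \<equiv> vector_space.vdim K (G X) (Dset X lmul hmul L (carrier X) {\<zero>\<^bsub>X\<^esub>})"

end

context partial_module_context
begin

interpretation G: partial_module_context K H \<Delta> \<epsilon> S A act "G X" "glm lmul" "ghm X hmul"
  by (rule G_context)

interpretation VX: vector_space K X by (rule X_vector_space)
interpretation VG: vector_space K "G X" by (rule G.X_vector_space)
interpretation VH: vector_space K H by (rule H.H_vector_space)

lemma dim_G:
  assumes "fin H" "fin X"
  shows "fin (G X)" "dim (G X) = dim H * dim X"
proof -
  have "HomS (carrier X) = carrier (G X)" by (auto simp: hom_module_app)
  then show "fin (G X)" "dim (G X) = dim H * dim X"
    using vdim_hom[OF H.H_vector_space X_vector_space assms] by simp_all
qed

lemma vdim_Dset_le: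
  assumes "fin H" "VX.fin_subspace V" "submodule U K X" "L \<subseteq> carrier AH.T"
  shows "VG.vdim (D L V U) \<le> dim H * VX.vdim V"
proof -
  note h = vdim_hom[OF H.H_vector_space X_vector_space assms(1,2)]
  have "VG.vdim (D L V U) \<le> VG.vdim (HomS V)"
    by (rule VG.vdim_mono(2)[OF h(1) Dset_subspace[OF VX.fin_subspace_subspace[OF assms(2)] assms(3,4)]])
       (auto simp: Dset_def)
  then show ?thesis using h(2) by simp
qed

text \<open>Induction along a filtration from \<open>U\<close> to \<open>V\<close>: a simple factor
  \<open>V/W\<close> is peeled off at the top, \<open>bound\<close> is applied to it, and
  \<open>vdim_Dset_triangle\<close> adds the layers up. Without the terms that avoid subtraction,
  the claim is that the ratio of \<open>V/U\<close> is at most \<open>d / m\<close>.\<close>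

lemma Dset_vdim_upper:
  assumes fH: "fin H" and fX: "fin X" and L: "L \<subseteq> carrier AH.T"
    and bound: "\<And>U V (Y :: ('k, 'a, 'h) umodule) lmul' hmul' \<pi>.
      simple_factor X lmul hmul U V Y lmul' hmul' \<pi> \<Longrightarrow> ddim L Y lmul' hmul' * m \<le> d * dim Y"
    and U: "stable X lmul hmul U" and "stable X lmul hmul V" "U \<subseteq> V"
  shows "VG.vdim (D L V U) * m + d * VX.vdim U \<le> d * VX.vdim V + dim H * VX.vdim U * m"
  using assms(6,7)
proof (induction "VX.vdim V" arbitrary: V rule: less_induct)
  case less
  have fV: "VX.fin_subspace V"
    by (rule VX.vdim_mono(1)[OF fX stableD(1)[OF less.prems(1)] stableD(5)[OF less.prems(1)]])
  show ?case
  proof (cases "U = V")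
    case True
    show ?thesis
      using mult_right_mono[OF vdim_Dset_le[OF fH fV stableD(1)[OF U] L], of m] by (simp add: True)
  next
    case False
    then have "U \<subset> V" using less.prems by blast
    from maximal_stable[OF fV U less.prems(1) this] obtain W where W: "stable X lmul hmul W" "U \<subseteq> W" "W \<subset> V"
      "\<And>N. stable X lmul hmul N \<Longrightarrow> W \<subseteq> N \<Longrightarrow> N \<subseteq> V \<Longrightarrow> N = W \<or> N = V" by blast
    obtain Y :: "('k, 'a, 'h) umodule" and lmul' hmul' \<pi> where Y: "simple_factor X lmul hmul W V Y lmul' hmul' \<pi>"
      using simple_factor_exists[OF W(1) less.prems(1) W(3,4)] by blast
    note q = vdim_Dset_quotient[OF fH fV L less.prems(1) W(1) _, of Y lmul' hmul' \<pi>]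
    have q: "dim Y + VX.vdim W = VX.vdim V" "ddim L Y lmul' hmul' + dim H * VX.vdim W = VG.vdim (D L V W)"
      using q Y by (auto simp: simple_factor_def)
    have t: "VG.vdim (D L V U) + dim H * VX.vdim W \<le> VG.vdim (D L V W) + VG.vdim (D L W U)"
      by (rule vdim_Dset_triangle[OF fH fV L W(1) stableD(1)[OF U] W(2)]) (use W(3) in blast)
    have "VX.vdim W < VX.vdim V"
      using VX.vdim_mono(2,3)[OF fV stableD(1)[OF W(1)]] W(3) by (metis nat_less_le order_less_imp_le order_less_irrefl)
    from less.hyps[OF this W(1,2)]
    have ih: "VG.vdim (D L W U) * m + d * VX.vdim U \<le> d * VX.vdim W + dim H * VX.vdim U * m" .
    have "VG.vdim (D L V U) \<le> ddim L Y lmul' hmul' + VG.vdim (D L W U)" using t q(2) by simp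
    then have "VG.vdim (D L V U) * m \<le> ddim L Y lmul' hmul' * m + VG.vdim (D L W U) * m"
      by (metis add_mult_distrib mult_le_mono1)
    moreover have "ddim L Y lmul' hmul' * m \<le> d * dim Y" by (rule bound[OF Y])
    moreover have "d * VX.vdim V = d * dim Y + d * VX.vdim W" by (simp flip: q(1) add: add_mult_distrib2)
    ultimately show ?thesis using ih by linarith
  qed
qed

text \<open>The layers \<open>X/V\<close>, \<open>V/U\<close> and \<open>U\<close> each satisfy the
  upper bound. By the triangle inequality, used twice, their contributions add up to at least that
  of \<open>X\<close>, which \<open>lower\<close> makes as large as the three bounds together; so
  none of them can be strict.\<close>

lemma Dset_vdim_equal:
  assumes fH: "fin H" and fX: "fin X" and L: "L \<subseteq> carrier AH.T"
    and bound: "\<And>U V (Y :: ('k, 'a, 'h) umodule) lmul' hmul' \<pi>.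
      simple_factor X lmul hmul U V Y lmul' hmul' \<pi> \<Longrightarrow> ddim L Y lmul' hmul' * m \<le> d * dim Y"
    and lower: "d * dim X \<le> ddim L X lmul hmul * m"
    and U: "stable X lmul hmul U" and V: "stable X lmul hmul V" and "U \<subseteq> V"
  shows "VG.vdim (D L V U) * m + d * VX.vdim U = d * VX.vdim V + dim H * VX.vdim U * m"
proof -
  note up = Dset_vdim_upper[OF fH fX L bound]
  have z: "{\<zero>} \<subseteq> U" "{\<zero>} \<subseteq> V" using VX.subspaceD(3) stableD(1) U V by blast+
  have fV: "VX.fin_subspace V" by (rule VX.vdim_mono(1)[OF fX stableD(1,5)[OF V]])
  have "VG.vdim (D L (carrier X) {\<zero>}) + dim H * VX.vdim V \<le> VG.vdim (D L (carrier X) V) + VG.vdim (D L V {\<zero>})"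
    by (rule vdim_Dset_triangle[OF fH fX L V submodule_zero[OF X_module] z(2) stableD(5)[OF V]])
  moreover have "VG.vdim (D L V {\<zero>}) + dim H * VX.vdim U \<le> VG.vdim (D L V U) + VG.vdim (D L U {\<zero>})"
    by (rule vdim_Dset_triangle[OF fH fV L U submodule_zero[OF X_module] z(1) assms(8)])
  ultimately have "VG.vdim (D L (carrier X) {\<zero>}) + dim H * VX.vdim V + dim H * VX.vdim U
    \<le> VG.vdim (D L (carrier X) V) + VG.vdim (D L V U) + VG.vdim (D L U {\<zero>})" by linarith
  from mult_le_mono1[OF this, of m]
  have "ddim L X lmul hmul * m + dim H * VX.vdim V * m + dim H * VX.vdim U * m
    \<le> VG.vdim (D L (carrier X) V) * m + VG.vdim (D L V U) * m + VG.vdim (D L U {\<zero>}) * m"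
    by (simp only: add_mult_distrib)
  moreover have "VG.vdim (D L (carrier X) V) * m + d * VX.vdim V \<le> d * dim X + dim H * VX.vdim V * m"
    by (rule up[OF _ V stable_carrier stableD(5)[OF V]])
  moreover have "VG.vdim (D L V U) * m + d * VX.vdim U \<le> d * VX.vdim V + dim H * VX.vdim U * m"
    by (rule up[OF _ U V assms(8)])
  moreover have "VG.vdim (D L U {\<zero>}) * m + d * VX.vdim {\<zero>} \<le> d * VX.vdim U + dim H * VX.vdim {\<zero>} * m"
    by (rule up[OF _ stable_zero U z(1)])
  ultimately show ?thesis using lower by (simp add: VX.vdim_zero)
qed

lemma simple_factor_ratio:
  assumes fH: "fin H" and fX: "fin X" and L: "L \<subseteq> carrier AH.T"
    and bound: "\<And>U V (Y :: ('k, 'a, 'h) umodule) lmul' hmul' \<pi>.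
      simple_factor X lmul hmul U V Y lmul' hmul' \<pi> \<Longrightarrow> ddim L Y lmul' hmul' * m \<le> d * dim Y"
    and lower: "d * dim X \<le> ddim L X lmul hmul * m"
    and Y: "simple_factor X lmul hmul U V Y lmul' hmul' \<pi>"
  shows "ddim L Y lmul' hmul' * m = d * dim Y"
proof -
  have U: "stable X lmul hmul U" and V: "stable X lmul hmul V" "U \<subseteq> V" using Y by (auto simp: simple_factor_def)
  have fV: "VX.fin_subspace V" by (rule VX.vdim_mono(1)[OF fX stableD(1,5)[OF V(1)]])
  have q: "dim Y + VX.vdim U = VX.vdim V" "ddim L Y lmul' hmul' + dim H * VX.vdim U = VG.vdim (D L V U)"
    using vdim_Dset_quotient[OF fH fV L V(1) U V(2), of Y lmul' hmul' \<pi>] Y by (auto simp: simple_factor_def)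
  have "VG.vdim (D L V U) * m + d * VX.vdim U = d * VX.vdim V + dim H * VX.vdim U * m"
    by (rule Dset_vdim_equal[OF fH fX L bound lower U V])
  then show ?thesis by (simp flip: q add: add_mult_distrib add_mult_distrib2)
qed

text \<open>Equality for \<open>X\<close>, \<open>X/U\<close> and \<open>U\<close> says, by a
  dimension count, that every map in \<open>D L (carrier X) U\<close> is the sum of a map killed by
  \<open>L\<close> and a map into \<open>U\<close>. So the splitting arises one level up, in
  \<open>Hom(H, X)\<close>. It is applied to \<open>w \<mapsto> \<epsilon>(w) x\<close> and brought
  back to \<open>X\<close> by evaluation at \<open>\<Lambda>\<close>, both of which respect the
  action.\<close>

lemma annihilated_modulo_split:
  assumes fH: "fin H" and fX: "fin X" and L: "L \<subseteq> carrier AH.T" and m: "m > 0"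
    and bound: "\<And>U V (Y :: ('k, 'a, 'h) umodule) lmul' hmul' \<pi>.
      simple_factor X lmul hmul U V Y lmul' hmul' \<pi> \<Longrightarrow> ddim L Y lmul' hmul' * m \<le> d * dim Y"
    and lower: "d * dim X \<le> ddim L X lmul hmul * m"
    and int: "\<Lambda> \<in> carrier H" "\<epsilon> \<Lambda> = \<one>\<^bsub>K\<^esub>" "\<And>h. h \<in> carrier H \<Longrightarrow> \<Lambda> \<star> h = \<epsilon> h \<odot>\<^bsub>H\<^esub> \<Lambda>"
    and U: "stable X lmul hmul U" and x: "x \<in> carrier X" "\<And>t. t \<in> L \<Longrightarrow> ten t x \<in> U"
  obtains y u where "y \<in> carrier X" "u \<in> U" "x = y \<oplus> u" "\<And>t. t \<in> L \<Longrightarrow> ten t y = \<zero>"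
proof -
  note eq = Dset_vdim_equal[OF fH fX L bound lower]
  note z = submodule_zero[OF X_module] and sU = stableD[OF U]
  note Us = VX.subspaceD[OF sU(1)]
  have z': "{\<zero>} \<subseteq> U" using Us(3) by blast
  let ?W = "carrier X"
  have fU: "VX.fin_subspace U" by (rule VX.vdim_mono(1)[OF fX sU(1,5)])
  note hU = vdim_hom[OF H.H_vector_space X_vector_space fH fU]
  have fD: "VG.fin_subspace (D L ?W {\<zero>})" "VG.fin_subspace (D L ?W U)"
    by (rule Dset_fin[OF fH fX z L], rule Dset_fin[OF fH fX sU(1) L])
  note s = VG.vdim_sum[OF hU(1) fD(1)]
  have i: "D L ?W {\<zero>} \<inter> HomS U = D L U {\<zero>}"
    using sU(5) by (auto simp: Dset_def)
  have sub: "D L ?W {\<zero>} <+>\<^bsub>G X\<^esub> HomS U \<subseteq> D L ?W U"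
  proof (rule VG.subspace_sum_least[OF VG.fin_subspace_subspace[OF fD(2)]])
    show "D L ?W {\<zero>} \<subseteq> D L ?W U" using z' by (auto simp: Dset_def)
    show "HomS U \<subseteq> D L ?W U"
    proof
      fix \<phi> assume \<phi>: "\<phi> \<in> HomS U"
      then show "\<phi> \<in> D L ?W U" using HomS_ten[OF U \<phi>] sU(5) L by (auto simp: Dset_def)
    qed
  qed
  have "VG.vdim (D L ?W U) * m + d * VX.vdim U = d * dim X + dim H * VX.vdim U * m"
    by (rule eq[OF _ U stable_carrier sU(5)])
  moreover have "VG.vdim (D L U {\<zero>}) * m + d * VX.vdim {\<zero>} = d * VX.vdim U + dim H * VX.vdim {\<zero>} * m"
    by (rule eq[OF _ stable_zero U z'])
  moreover have "VG.vdim (D L ?W {\<zero>}) * m + d * VX.vdim {\<zero>} = d * dim X + dim H * VX.vdim {\<zero>} * m"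
    by (rule eq[OF _ stable_zero stable_carrier]) (simp_all add: X.M.zero_closed)
  ultimately have "(VG.vdim (D L ?W {\<zero>}) + dim H * VX.vdim U) * m = (VG.vdim (D L ?W U) + VG.vdim (D L U {\<zero>})) * m"
    by (simp add: VX.vdim_zero add_mult_distrib)
  then have "VG.vdim (D L ?W {\<zero>} <+>\<^bsub>G X\<^esub> HomS U) = VG.vdim (D L ?W U)"
    using m s(2) hU(2) i by simp
  then have full: "D L ?W {\<zero>} <+>\<^bsub>G X\<^esub> HomS U = D L ?W U"
    by (rule VG.vdim_mono(3)[OF fD(2) VG.fin_subspace_subspace[OF s(1)] sub])
  let ?c = "\<lambda>w\<in>carrier H. \<epsilon> w \<odot> x"
  have "?c \<in> D L ?W U"
  proof -
    have "?c \<in> carrier (G X)" by (rule ten_G_const(1)[OF pure_closed[OF A.A.one_closed H.A.one_closed] x(1)])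
    moreover have "G.ten t ?c h \<in> U" if "t \<in> L" "h \<in> carrier H" for t h
    proof -
      have t: "t \<in> carrier AH.T" using that L by auto
      show ?thesis unfolding ten_G_const(2)[OF t x(1)] using that x(2) Us(7) by simp
    qed
    ultimately show ?thesis using x(1) by (simp add: Dset_def)
  qed
  then obtain \<phi> \<psi> where \<phi>: "\<phi> \<in> D L ?W {\<zero>}" and \<psi>: "\<psi> \<in> HomS U" and sum: "?c = \<phi> \<oplus>\<^bsub>G X\<^esub> \<psi>"
    unfolding full[symmetric] by (auto simp: set_add_def')
  have \<phi>G: "\<phi> \<in> carrier (G X)" using \<phi> by (simp add: Dset_def)
  show thesis
  proof (rule that)
    show "\<phi> \<Lambda> \<in> carrier X" by (rule hom_module_app[OF \<phi>G int(1)])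
    show "\<psi> \<Lambda> \<in> U" using \<psi> int(1) by blast
    show "x = \<phi> \<Lambda> \<oplus> \<psi> \<Lambda>"
      using fun_cong[OF sum, of \<Lambda>] int(1,2) x(1) by (simp add: hom_module_ev)
    fix t assume t: "t \<in> L"
    then have "t \<in> carrier AH.T" using L by auto
    then have "ten t (\<phi> \<Lambda>) = G.ten t \<phi> \<Lambda>"
      by (intro ten_G_integral[symmetric] int \<phi>G)
    then show "ten t (\<phi> \<Lambda>) = \<zero>" using \<phi> t int(1) by (simp add: Dset_def)
  qed
qed

end

section \<open>Modules of maximal ratio\<close>

context partial_module_context
begin

text \<open>Passing from \<open>X\<close> to \<open>Hom(H, X)\<close> multiplies the dimension by
  \<open>dim H\<close> and \<open>d\<close> by at least that factor. This supplies the assumption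
  \<open>lower\<close> for \<open>Hom(H, X)\<close>, with \<open>d\<close> and \<open>m\<close>
  taken from \<open>X\<close>.\<close>

lemma ddim_G_lower:
  assumes "fin H" "fin X" "L \<subseteq> carrier AH.T"
  shows "ddim L X lmul hmul * dim (G X) \<le> ddim L (G X) (glm lmul) (ghm X hmul) * dim X"
  using mult_right_mono[OF vdim_Dset_G[OF assms], of "dim X"] dim_G(2)[OF assms(1,2)]
  by (simp add: mult.commute mult.left_commute)

lemma ddim_pos_element:
  assumes "L \<subseteq> carrier AH.T" "ddim L X lmul hmul > 0"
  obtains \<phi> where "\<phi> \<in> carrier (G X)" "\<phi> \<noteq> \<zero>\<^bsub>G X\<^esub>" "\<And>t. t \<in> L \<Longrightarrow> tact (G X) (glm lmul) (ghm X hmul) t \<phi> = \<zero>\<^bsub>G X\<^esub>"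
proof -
  interpret G: partial_module_context K H \<Delta> \<epsilon> S A act "G X" "glm lmul" "ghm X hmul"
    by (rule G_context)
  interpret VG: vector_space K "G X" by (rule G.X_vector_space)
  let ?D = "Dset X lmul hmul L (carrier X) {\<zero>}"
  have "?D \<noteq> {\<zero>\<^bsub>G X\<^esub>}" using assms(2) VG.vdim_zero(2) by auto
  moreover have "\<zero>\<^bsub>G X\<^esub> \<in> ?D"
    using VG.subspaceD(3)[OF Dset_subspace[OF stableD(1)[OF stable_carrier] submodule_zero[OF X_module] assms(1)]] .
  ultimately obtain \<phi> where "\<phi> \<in> ?D" "\<phi> \<noteq> \<zero>\<^bsub>G X\<^esub>" by blast
  then show thesis using that Dset_zero_iff[OF assms(1)] by blast
qed

lemma dim_pos:
  assumes "irreducible_module X lmul hmul" "fin X"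
  shows "dim X > 0"
proof -
  interpret VX: vector_space K X by (rule X_vector_space)
  show ?thesis using VX.vdim_eq_0[OF assms(2)] assms(1) by (auto simp: irreducible_module_def)
qed

end

context hopf_partial_action
begin

text \<open>The class \<open>C\<close> may be any class of irreducible modules with a common part
  \<open>Q\<close> of their annihilators: finite codimension of \<open>Q\<close> bounds the
  dimensions through \<open>irreducible_dim\<close>, as \<open>ratio_maximizer\<close>
  requires.\<close>

lemma maximal_ratio_module:
  fixes C :: "('k, 'a, 'h) umodule \<Rightarrow> ('a \<Rightarrow> ('a \<times> 'h \<Rightarrow> 'k) set set \<Rightarrow> _) \<Rightarrow> ('h \<Rightarrow> ('a \<times> 'h \<Rightarrow> 'k) set set \<Rightarrow> _) \<Rightarrow> bool"
  assumes fH: "fin H" and L: "L \<subseteq> carrier AH.T" 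
    and M: "vector_space.fin_subspace K A M" "\<And>a. a \<in> carrier A \<Longrightarrow> \<exists>m\<in>M. a \<ominus>\<^bsub>A\<^esub> m \<in> Q"
    and C: "\<And>Z l h. C Z l h \<Longrightarrow> irreducible_module Z l h \<and> Q \<subseteq> annihilator Z l" "C Z0 l0 h0"
  obtains X l h where "C X l h" "fin X" "\<And>Z l' h'. C Z l' h' \<Longrightarrow> ddim L Z l' h' * dim X \<le> ddim L X l h * dim Z"
proof -
  let ?C = "\<lambda>(X, l, h). C X l h" and ?m = "\<lambda>(X, l, h). dim X" and ?d = "\<lambda>(X, l, h). ddim L X l h"
  have fin: "fin Z \<and> 0 < dim Z \<and> dim Z \<le> dim H * vector_space.vdim K A M \<and> ddim L Z l h \<le> dim H * dim Z" if "C Z l h" for Z l h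
  proof -
    note Z = C(1)[OF that]
    interpret Z: partial_module_context K H \<Delta> \<epsilon> S A act Z l h by (rule irreducible_context[OF conjunct1[OF Z]])
    have "fin Z" "dim Z \<le> dim H * vector_space.vdim K A M"
      by (rule Z.irreducible_dim[OF conjunct1[OF Z] fH M(1)], use M(2) Z in blast)+
    then show ?thesis
      using Z.dim_pos[OF conjunct1[OF Z]] Z.vdim_Dset_le[OF fH _ submodule_zero[OF Z.X_module] L] by blast
  qed
  have 1: "?C (Z0, l0, h0)" using C(2) by simp
  have 2: "0 < ?m x \<and> ?m x \<le> dim H * vector_space.vdim K A M \<and> ?d x \<le> dim H * ?m x" if "?C x" for x
    using fin that by (auto split: prod.splits)
  obtain x where "?C x" and x: "\<And>y. ?C y \<Longrightarrow> ?d y * ?m x \<le> ?d x * ?m y"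
    by (rule ratio_maximizer[of ?C _ ?m _ ?d, OF 1], rule 2, assumption, rule that)
  moreover obtain X l h where e: "x = (X, l, h)" by (cases x)
  ultimately have X: "C X l h" by simp
  have "ddim L Z l' h' * dim X \<le> ddim L X l h * dim Z" if "C Z l' h'" for Z l' h'
    using x[of "(Z, l', h')"] that by (simp add: e)
  then show thesis using fin[OF X] X that by blast
qed

lemma embeds_of_ddim_pos:
  assumes irr: "irreducible_module Y ly hy" "y0 \<in> carrier Y"
    and Z: "partial_module Z lz hz" "ddim {t \<in> carrier AH.T. tact Y ly hy t y0 = \<zero>\<^bsub>Y\<^esub>} Z lz hz > 0"
  obtains \<theta> where "partial_hom Y ly hy (G Z) (glm lz) (ghm Z hz) \<theta>" "inj_on \<theta> (carrier Y)"
proof -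
  interpret Y: partial_module_context K H \<Delta> \<epsilon> S A act Y ly hy by (rule irreducible_context[OF irr(1)])
  interpret Z: partial_module_context K H \<Delta> \<epsilon> S A act Z lz hz by (rule partial_contextI[OF Z(1)])
  obtain \<phi> where "\<phi> \<in> carrier (G Z)" "\<phi> \<noteq> \<zero>\<^bsub>G Z\<^esub>"
    "\<And>t. t \<in> {t \<in> carrier AH.T. tact Y ly hy t y0 = \<zero>\<^bsub>Y\<^esub>} \<Longrightarrow> tact (G Z) (glm lz) (ghm Z hz) t \<phi> = \<zero>\<^bsub>G Z\<^esub>"
    using Z.ddim_pos_element[OF _ Z(2)] by blast
  then show thesis
    using Y.irreducible_embeds[OF irr Z.G_partial_module, of \<phi>] that by blast
qed

text \<open>
  Here \<open>L\<close> is the annihilator in \<open>A # H\<close> of a nonzero vector of \<open>Y\<close>: then \<open>d(Z) > 0\<close> means that \<open>Y\<close> embeds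
  into \<open>Hom(H, Z)\<close>, so that \<open>d\<close> vanishes unless the annihilator of \<open>Z\<close> is contained in that of \<open>Y\<close>.
\<close>

lemma simple_factor_G_annihilator:
  fixes Y Z :: "('k, 'a, 'h) umodule"
  assumes fH: "fin H" and Y: "irreducible_module Y ly hy" "fin Y"
    and Z: "simple_factor (G Y) (glm ly) (ghm Y hy) U V Z lz hz \<pi>"
  shows "annihilator Z lz = annihilator Y ly"
proof -
  interpret Y: partial_module_context K H \<Delta> \<epsilon> S A act Y ly hy by (rule irreducible_context[OF Y(1)])
  interpret VY: vector_space K Y by (rule Y.X_vector_space)
  obtain y0 where y0: "y0 \<in> carrier Y" "y0 \<noteq> \<zero>\<^bsub>Y\<^esub>"
    using Y(1) Y.X.M.zero_closed unfolding irreducible_module_def by blast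
  let ?L = "{t \<in> carrier AH.T. Y.ten t y0 = \<zero>\<^bsub>Y\<^esub>}" and ?P = "annihilator Y ly"
  have L: "?L \<subseteq> carrier AH.T" by blast
  define C where "C Z l h \<longleftrightarrow> irreducible_module Z l h \<and> ?P \<subseteq> annihilator Z l" for Z :: "('k, 'a, 'h) umodule" and l h
  have CY: "C Y ly hy" using Y(1) by (simp add: C_def)
  obtain M where M: "vector_space.fin_subspace K A M" "\<And>a. a \<in> carrier A \<Longrightarrow> \<exists>m\<in>M. a \<ominus>\<^bsub>A\<^esub> m \<in> ?P"
    using Y.annihilator_complement[OF Y(2)] by blast
  obtain X l h where X: "C X l h" "fin X" and max: "\<And>Z l' h'. C Z l' h' \<Longrightarrow> ddim ?L Z l' h' * dim X \<le> ddim ?L X l h * dim Z"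
    using maximal_ratio_module[OF fH L M, of C] C_def CY by blast
  have factor: "C Z lz hz" if "C X l h" "simple_factor (G X) (glm l) (ghm X h) U V Z lz hz \<pi>"
    for X l h U V \<pi> and Z :: "('k, 'a, 'h) umodule" and lz hz
  proof -
    interpret X: partial_module_context K H \<Delta> \<epsilon> S A act X l h using that(1) by (simp add: C_def irreducible_context)
    interpret GX: partial_module_context K H \<Delta> \<epsilon> S A act "G X" "glm l" "ghm X h" by (rule X.G_context)
    show ?thesis
      using GX.simple_factor_annihilator[OF that(2)] X.annihilator_G that by (auto simp: C_def simple_factor_def)
  qed
  have ratio: "ddim ?L Z lz hz * dim X = ddim ?L X l h * dim Z"
    if X: "C X l h" "fin X" and max: "\<And>Z l' h'. C Z l' h' \<Longrightarrow> ddim ?L Z l' h' * dim X \<le> ddim ?L X l h * dim Z"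
      and Z: "simple_factor (G X) (glm l) (ghm X h) U V Z lz hz \<pi>"
    for X l h U V \<pi> and Z :: "('k, 'a, 'h) umodule" and lz hz
  proof -
    interpret X: partial_module_context K H \<Delta> \<epsilon> S A act X l h using X(1) by (simp add: C_def irreducible_context)
    interpret GX: partial_module_context K H \<Delta> \<epsilon> S A act "G X" "glm l" "ghm X h" by (rule X.G_context)
    show ?thesis
      by (rule GX.simple_factor_ratio[OF fH X.dim_G(1)[OF fH X(2)] L max[OF factor[OF X(1)]] X.ddim_G_lower[OF fH X(2) L] Z])
  qed
  \<comment> \<open>The map \<open>w \<mapsto> \<epsilon>(w) y0\<close> is killed by everything that
    kills \<open>y0\<close>.\<close>
  have pos: "ddim ?L Y ly hy > 0"
  proof -
    interpret GY: partial_module_context K H \<Delta> \<epsilon> S A act "G Y" "glm ly" "ghm Y hy" by (rule Y.G_context)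
    interpret VG: vector_space K "G Y" by (rule GY.X_vector_space)
    let ?D = "Dset Y ly hy ?L (carrier Y) {\<zero>\<^bsub>Y\<^esub>}"
    let ?c = "\<lambda>w\<in>carrier H. \<epsilon> w \<odot>\<^bsub>Y\<^esub> y0"
    have "?c \<in> carrier (G Y)" by (rule Y.ten_G_const(1)[OF pure_closed[OF A.A.one_closed H.A.one_closed] y0(1)])
    moreover have "GY.ten t ?c = \<zero>\<^bsub>G Y\<^esub>" if "t \<in> ?L" for t
    proof -
      have t: "t \<in> carrier AH.T" "Y.ten t y0 = \<zero>\<^bsub>Y\<^esub>" using that by auto
      show ?thesis unfolding Y.ten_G_const(2)[OF t(1) y0(1)] t(2)
        by (auto simp: hom_module_simps(2) intro!: restrict_ext)
    qed
    ultimately have "?c \<in> ?D" using Y.Dset_zero_iff[OF L] by blast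
    moreover have "?c \<noteq> \<zero>\<^bsub>G Y\<^esub>"
      using y0 by (auto dest!: fun_cong[of _ _ "\<one>\<^bsub>H\<^esub>"] simp: hom_module_ev H.counit_one)
    ultimately have "?D \<noteq> {\<zero>\<^bsub>G Y\<^esub>}" by blast
    then show ?thesis
      using VG.vdim_eq_0[OF Y.Dset_fin[OF fH Y(2) submodule_zero[OF Y.X_module] L]] by blast
  qed
  have dY: "dim Y > 0" by (rule Y.dim_pos[OF Y])
  have dX: "dim X > 0"
  proof -
    interpret X: partial_module_context K H \<Delta> \<epsilon> S A act X l h using X(1) by (simp add: C_def irreducible_context)
    show ?thesis using X.dim_pos X by (simp add: C_def)
  qed
  have "ddim ?L X l h > 0"
  proof (rule ccontr)
    assume "\<not> ddim ?L X l h > 0"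
    then have "ddim ?L Y ly hy * dim X = 0" using max[OF CY] by simp
    then show False using pos dX by simp
  qed
  moreover have "partial_module X l h" using X(1) by (simp add: C_def irreducible_module_def)
  \<comment> \<open>\<open>Y\<close> thus becomes a simple factor of \<open>Hom(H, X)\<close>, all
    of whose simple factors attain the ratio of \<open>X\<close>. Hence \<open>Y\<close> is a
    maximizer as well, and the argument can be repeated with \<open>Y\<close> in place of
    \<open>X\<close>.\<close>
  ultimately obtain \<theta> where "partial_hom Y ly hy (G X) (glm l) (ghm X h) \<theta>" "inj_on \<theta> (carrier Y)"
    using embeds_of_ddim_pos[OF Y(1) y0(1)] by blast
  from ratio[OF X max Y.simple_factor_embedding[OF Y(1) this]]
  have rY: "ddim ?L Y ly hy * dim X = ddim ?L X l h * dim Y" .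
  have maxY: "ddim ?L Z l' h' * dim Y \<le> ddim ?L Y ly hy * dim Z" if "C Z l' h'" for Z l' h'
  proof -
    have "ddim ?L Z l' h' * dim X * dim Y \<le> ddim ?L X l h * dim Z * dim Y"
      by (rule mult_le_mono1[OF max[OF that]])
    also have "\<dots> = ddim ?L Y ly hy * dim X * dim Z" unfolding rY by (simp add: mult.assoc mult.commute)
    finally have "ddim ?L Z l' h' * dim Y * dim X \<le> ddim ?L Y ly hy * dim Z * dim X"
      by (simp only: mult.assoc mult.commute mult.left_commute)
    then show ?thesis using dX by simp
  qed
  have CZ: "C Z lz hz" by (rule factor[OF CY Z])
  then interpret Z: partial_module_context K H \<Delta> \<epsilon> S A act Z lz hz by (simp add: C_def irreducible_context)
  have fZ: "fin Z"
    by (rule Z.irreducible_dim(1)[OF _ fH M(1)]) (use CZ M(2) in \<open>unfold C_def, blast+\<close>)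
  have "dim Z > 0" using Z.dim_pos[OF _ fZ] CZ by (simp add: C_def)
  then have "ddim ?L Y ly hy * dim Z > 0" using pos by simp
  \<comment> \<open>As a simple factor of \<open>Hom(H, Y)\<close> for the maximizer
    \<open>Y\<close>, \<open>Z\<close> has the same positive ratio; so \<open>Y\<close> embeds into
    \<open>Hom(H, Z)\<close>.\<close>
  moreover have "ddim ?L Z lz hz * dim Y = ddim ?L Y ly hy * dim Z"
    by (rule ratio[OF CY Y(2) _ Z]) (rule maxY)
  ultimately have "ddim ?L Z lz hz * dim Y > 0" by simp
  then have "ddim ?L Z lz hz > 0" by simp
  then obtain \<theta>' where "partial_hom Y ly hy (G Z) (glm lz) (ghm Z hz) \<theta>'" "inj_on \<theta>' (carrier Y)"
    using embeds_of_ddim_pos[OF Y(1) y0(1) Z.X.left_partial_module_axioms] by blast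
  then have "annihilator (G Z) (glm lz) \<subseteq> ?P" by (rule Y.annihilator_inj_hom)
  then show ?thesis using Z.annihilator_G CZ by (auto simp: C_def)
qed

section \<open>The common kernel in \<open>A # H\<close> of the finite-dimensional irreducible
  modules\<close>

definition fd_radical :: "('a \<times> 'h \<Rightarrow> 'k) set set"
  where "fd_radical = {t \<in> carrier AH.T. \<forall>(X :: ('k, 'a, 'h) umodule) l h.
    irreducible_module X l h \<and> fin X \<longrightarrow> (\<forall>x\<in>carrier X. tact X l h t x = \<zero>\<^bsub>X\<^esub>)}"

lemma fd_radical_mult:
  assumes "s \<in> fd_radical" "t \<in> carrier AH.T"
  shows "s \<bullet> t \<in> fd_radical" "t \<bullet> s \<in> fd_radical"
proof -
  have s: "s \<in> carrier AH.T" using assms(1) by (simp add: fd_radical_def)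
  have "tact X l h (s \<bullet> t) x = \<zero>\<^bsub>X\<^esub> \<and> tact X l h (t \<bullet> s) x = \<zero>\<^bsub>X\<^esub>"
    if X: "irreducible_module X l h" "fin X" and x: "x \<in> carrier X" for X :: "('k, 'a, 'h) umodule" and l h x
  proof -
    interpret X: partial_module_context K H \<Delta> \<epsilon> S A act X l h by (rule irreducible_context[OF X(1)])
    have "X.ten s y = \<zero>\<^bsub>X\<^esub>" if "y \<in> carrier X" for y using assms(1) X that by (simp add: fd_radical_def)
    then show ?thesis
      using s assms(2) x by (simp add: X.ten_mult linear_map_zero[OF X.X_module X.X_module bilinear_map_right[OF X.ten_bilinear linear_map_id]])
  qed
  then show "s \<bullet> t \<in> fd_radical" "t \<bullet> s \<in> fd_radical"
    using s assms(2) by (simp_all add: fd_radical_def)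
qed

text \<open>
  With \<open>J = fd_radical\<close> and \<open>W = Hom(H, X)\<close>, the splitting modulo \<open>U = JW\<close> gives \<open>JW = J(JW)\<close>, which is
  impossible if \<open>JW\<close> has a simple quotient.
\<close>

lemma fd_radical_kills_G:
  fixes X :: "('k, 'a, 'h) umodule"
  assumes ss: "semisimple H" and X: "irreducible_module X l h" "fin X"
    and bound: "\<And>U V (Z :: ('k, 'a, 'h) umodule) lz hz \<pi>. simple_factor (G X) (glm l) (ghm X h) U V Z lz hz \<pi> \<Longrightarrow>
      ddim fd_radical Z lz hz * dim X \<le> ddim fd_radical X l h * dim Z"
    and t: "t \<in> fd_radical" and w: "w \<in> carrier (G X)"
  shows "tact (G X) (glm l) (ghm X h) t w = \<zero>\<^bsub>G X\<^esub>"
proof -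
  have fH: "fin H" by (rule H.semisimple_finite_dimensional[OF ss])
  obtain \<Lambda> where \<Lambda>: "\<Lambda> \<in> carrier H" "\<epsilon> \<Lambda> = \<one>\<^bsub>K\<^esub>" "\<And>h. h \<in> carrier H \<Longrightarrow> \<Lambda> \<star> h = \<epsilon> h \<odot>\<^bsub>H\<^esub> \<Lambda>"
    using H.semisimple_integral[OF ss] by blast
  interpret X: partial_module_context K H \<Delta> \<epsilon> S A act X l h by (rule irreducible_context[OF X(1)])
  interpret W: partial_module_context K H \<Delta> \<epsilon> S A act "G X" "glm l" "ghm X h" by (rule X.G_context)
  interpret VW: vector_space K "G X" by (rule W.X_vector_space)
  have J: "fd_radical \<subseteq> carrier AH.T" by (auto simp: fd_radical_def)
  have Jc: "t \<in> carrier AH.T" if "t \<in> fd_radical" for t using J that by auto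
  note fW = X.dim_G(1)[OF fH X(2)]
  let ?g = "(\<lambda>(t, w). W.ten t w) ` (fd_radical \<times> carrier (G X))"
  define U where "U = submodule_span K (G X) ?g"
  have g: "?g \<subseteq> carrier (G X)" using Jc by auto
  have sU: "submodule U K (G X)" unfolding U_def by (rule submodule_span_submodule[OF W.X_module g])
  have gU: "W.ten t w \<in> U" if "t \<in> fd_radical" "w \<in> carrier (G X)" for t w
    using submodule_span_subset[of ?g K "G X"] that by (auto simp: U_def)
  have least: "U \<subseteq> N" if "submodule N K (G X)" "\<And>t w. t \<in> fd_radical \<Longrightarrow> w \<in> carrier (G X) \<Longrightarrow> W.ten t w \<in> N" for N
    unfolding U_def by (rule submodule_span_least[OF that(1)]) (use that(2) in auto)
  have stU: "stable (G X) (glm l) (ghm X h) U"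
  proof (rule W.stableI_ten[OF sU])
    fix n s assume n: "n \<in> U" and s: "s \<in> carrier AH.T"
    note sl = bilinear_map_right[OF W.ten_bilinear linear_map_id s]
    have "U \<subseteq> {x \<in> carrier (G X). W.ten s x \<in> U}"
    proof (rule least[OF linear_map_vimage_submodule[OF W.X_module W.X_module sl sU]])
      fix t w assume tw: "t \<in> fd_radical" "w \<in> carrier (G X)"
      have "W.ten s (W.ten t w) = W.ten (s \<bullet> t) w" using W.ten_mult s Jc tw by simp
      then show "W.ten t w \<in> {x \<in> carrier (G X). W.ten s x \<in> U}"
        using gU[OF fd_radical_mult(2)[OF tw(1) s] tw(2)] tw Jc by simp
    qed
    then show "W.ten s n \<in> U" using n by blast
  qed
  have "U = {\<zero>\<^bsub>G X\<^esub>}"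
  proof (rule ccontr)
    assume "U \<noteq> {\<zero>\<^bsub>G X\<^esub>}"
    then have z: "{\<zero>\<^bsub>G X\<^esub>} \<subset> U" using VW.subspaceD(3)[OF sU] by blast
    have fU: "VW.fin_subspace U" by (rule VW.vdim_mono(1)[OF fW sU VW.subspaceD(1)[OF sU]])
    obtain V where V: "stable (G X) (glm l) (ghm X h) V" "{\<zero>\<^bsub>G X\<^esub>} \<subseteq> V" "V \<subset> U"
      "\<And>N. stable (G X) (glm l) (ghm X h) N \<Longrightarrow> V \<subseteq> N \<Longrightarrow> N \<subseteq> U \<Longrightarrow> N = V \<or> N = U"
      by (rule W.maximal_stable[OF fU W.stable_zero stU z], rule that)
    obtain Z :: "('k, 'a, 'h) umodule" and lz hz \<pi> where Z: "simple_factor (G X) (glm l) (ghm X h) V U Z lz hz \<pi>"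
      using W.simple_factor_exists[OF V(1) stU V(3,4)] by blast
    then have Z': "irreducible_module Z lz hz" "partial_hom ((G X)\<lparr>carrier := U\<rparr>) (glm l) (ghm X h) Z lz hz \<pi>"
      "\<pi> ` U = carrier Z" "{v \<in> U. \<pi> v = \<zero>\<^bsub>Z\<^esub>} = V"
      by (auto simp: simple_factor_def)
    have fZ: "fin Z"
      by (rule W.vdim_Dset_quotient(1)[OF fH fU J stU V(1) _ Z'(2-4)]) (use V(3) in blast)
    note sp = submodule_partial_module[OF W.X.left_partial_module_axioms stU]
    have JV: "W.ten t u \<in> V" if t: "t \<in> fd_radical" and u: "u \<in> U" for t u
    proof -
      have tu: "tact ((G X)\<lparr>carrier := U\<rparr>) (glm l) (ghm X h) t u = W.ten t u"
        using partial_hom_ten[OF sp(2) Jc[OF t], of u] u by simp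
      have "\<pi> (W.ten t u) = tact Z lz hz t (\<pi> u)"
        using partial_hom_ten[OF Z'(2) Jc[OF t], of u] u tu by simp
      moreover have "\<pi> u \<in> carrier Z" using imageI[OF u, of \<pi>] by (simp only: Z'(3))
      ultimately have "\<pi> (W.ten t u) = \<zero>\<^bsub>Z\<^esub>" using t Z'(1) fZ by (simp add: fd_radical_def)
      moreover have "W.ten t u \<in> U" using W.stableD(4)[OF stU u Jc[OF t]] .
      ultimately show ?thesis unfolding Z'(4)[symmetric] by simp
    qed
    have "U \<subseteq> V"
    proof (rule least[OF W.stableD(1)[OF V(1)]])
      fix t w assume t: "t \<in> fd_radical" and w: "w \<in> carrier (G X)"
      \<comment> \<open>The splitting modulo \<open>U\<close> replaces \<open>w\<close> by a vector
        \<open>u\<close> of \<open>U\<close>, which \<open>fd_radical\<close> sends into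
        \<open>V\<close> because it kills the simple quotient \<open>Z\<close> of
        \<open>U\<close>.\<close>
      obtain y u where yu: "y \<in> carrier (G X)" "u \<in> U" "w = y \<oplus>\<^bsub>G X\<^esub> u"
        "\<And>t. t \<in> fd_radical \<Longrightarrow> W.ten t y = \<zero>\<^bsub>G X\<^esub>"
        by (rule W.annihilated_modulo_split[OF fH fW J X.dim_pos[OF X] _ X.ddim_G_lower[OF fH X(2) J] \<Lambda>(1,2) _ stU w],
            rule bound, assumption, rule \<Lambda>(3), assumption, rule gU[OF _ w], assumption, rule that)
      have uc: "u \<in> carrier (G X)" using W.stableD(5)[OF stU] yu(2) by blast
      have "W.ten t w = W.ten t y \<oplus>\<^bsub>G X\<^esub> W.ten t u"
        unfolding yu(3) by (rule linear_map_add[OF bilinear_map_right[OF W.ten_bilinear linear_map_id Jc[OF t]] yu(1) uc])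
      also have "\<dots> = W.ten t u" using yu(4)[OF t] uc Jc[OF t] by simp
      finally show "W.ten t w \<in> V" using JV[OF t yu(2)] by simp
    qed
    then show False using V(3) by blast
  qed
  then show ?thesis using gU[OF t w] by simp
qed

text \<open>\<open>Y\<close> is exchanged for a module \<open>X\<close> with the same annihilator
  and maximal ratio. The simple factors of \<open>Hom(H, X)\<close> stay in this class by
  \<open>simple_factor_G_annihilator\<close>, so \<open>fd_radical_kills_G\<close> applies to
  \<open>X\<close>, and the slices lie in the annihilator shared by \<open>X\<close> and
  \<open>Y\<close>.\<close>

lemma fd_radical_slice:
  fixes Y :: "('k, 'a, 'h) umodule"
  assumes ss: "semisimple H" and Y: "irreducible_module Y ly hy" "fin Y"
    and t: "t \<in> fd_radical" "t \<bullet> pure \<one>\<^bsub>A\<^esub> \<one>\<^bsub>H\<^esub> = t" and f: "functional K H f"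
  shows "slice f t \<in> annihilator Y ly"
proof -
  have fH: "fin H" by (rule H.semisimple_finite_dimensional[OF ss])
  interpret Y: partial_module_context K H \<Delta> \<epsilon> S A act Y ly hy by (rule irreducible_context[OF Y(1)])
  have J: "fd_radical \<subseteq> carrier AH.T" by (auto simp: fd_radical_def)
  define C where "C Z l h \<longleftrightarrow> irreducible_module Z l h \<and> annihilator Z l = annihilator Y ly" for Z :: "('k, 'a, 'h) umodule" and l h
  obtain M where M: "vector_space.fin_subspace K A M" "\<And>a. a \<in> carrier A \<Longrightarrow> \<exists>m\<in>M. a \<ominus>\<^bsub>A\<^esub> m \<in> annihilator Y ly"
    using Y.annihilator_complement[OF Y(2)] by blast
  obtain X l h where X: "C X l h" "fin X" and max: "\<And>Z l' h'. C Z l' h' \<Longrightarrow> ddim fd_radical Z l' h' * dim X \<le> ddim fd_radical X l h * dim Z"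
    using maximal_ratio_module[OF fH J M, of C Y ly hy] C_def Y(1) by blast
  have X': "irreducible_module X l h" "annihilator X l = annihilator Y ly" using X(1) by (auto simp: C_def)
  interpret X: partial_module_context K H \<Delta> \<epsilon> S A act X l h by (rule irreducible_context[OF X'(1)])
  have "slice f t \<in> annihilator X l"
  proof (rule X.slice_annihilates[OF _ t(2) _ f])
    show "t \<in> carrier AH.T" using t(1) J by blast
    fix \<phi> assume \<phi>: "\<phi> \<in> carrier (G X)"
    show "tact (G X) (glm l) (ghm X h) t \<phi> = \<zero>\<^bsub>G X\<^esub>"
    proof (rule fd_radical_kills_G[OF ss X'(1) X(2) max t(1) \<phi>])
      fix U V and Z :: "('k, 'a, 'h) umodule" and lz hz \<pi>
      assume Z: "simple_factor (G X) (glm l) (ghm X h) U V Z lz hz \<pi>"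
      show "C Z lz hz"
        using simple_factor_G_annihilator[OF fH X'(1) X(2) Z] X'(2) Z by (simp add: C_def simple_factor_def)
    qed
  qed
  then show ?thesis by (simp add: X'(2))
qed

end

section \<open>Coinduction from the base algebra\<close>

locale coinduced_module = hopf_partial_action K H \<Delta> \<epsilon> S A act + U: left_module K U A lm
  for K :: "'k ring" and H :: "('k, 'h) module" and \<Delta> \<epsilon> S and A :: "('k, 'a) module" and act
    and U :: "('k, 'u) module" and lm
begin

lemma U_module: "module K U" and U_vector_space: "vector_space K U"
  using U.module_axioms H.K.field_axioms by (auto simp: vector_space_def)

lemma lm_closed [simp]: "a \<in> carrier A \<Longrightarrow> u \<in> carrier U \<Longrightarrow> lm a u \<in> carrier U"
  using bilinear_map_closed[OF U.lmul_bilinear] .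

lemmas ulin = lin bilinear_map_left[OF U.lmul_bilinear] bilinear_map_right[OF U.lmul_bilinear]

text \<open>Convolution with the function \<open>w \<mapsto> w a\<close> from \<open>H\<close> to
  \<open>A\<close>. This makes \<open>A\<close> act on \<open>Hom(H, U)\<close>, but
  \<open>pr 1\<close> is in general a proper idempotent, because \<open>w 1\<close> need not be
  \<open>\<epsilon>(w) 1\<close>.\<close>

definition pr :: "'a \<Rightarrow> ('h \<Rightarrow> 'u) \<Rightarrow> 'h \<Rightarrow> 'u"
  where "pr a \<psi> = (\<lambda>w\<in>carrier H. H.sw U (\<lambda>p q. lm (act p a) (\<psi> q)) w)"

definition tr :: "'h \<Rightarrow> ('h \<Rightarrow> 'u) \<Rightarrow> 'h \<Rightarrow> 'u"
  where "tr g \<psi> = (\<lambda>w\<in>carrier H. \<psi> (w \<star> g))"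

lemma pr_app: "w \<in> carrier H \<Longrightarrow> pr a \<psi> w = H.sw U (\<lambda>p q. lm (act p a) (\<psi> q)) w"
  and tr_app: "w \<in> carrier H \<Longrightarrow> tr g \<psi> w = \<psi> (w \<star> g)"
  by (simp_all add: pr_def tr_def)

lemma pr_bilinear_aux:
  assumes "a \<in> carrier A" "\<psi> \<in> carrier (G U)"
  shows "bilinear_map K H H U (\<lambda>p q. lm (act p a) (\<psi> q))"
  by (intro bilinear_mapI ulin linear_map_compose[OF _ G_linear[OF assms(2)]]; simp add: assms hom_module_app[OF assms(2)])

lemma pr_closed [simp]:
  assumes "a \<in> carrier A" "\<psi> \<in> carrier (G U)"
  shows "pr a \<psi> \<in> carrier (G U)"
  unfolding pr_def by (rule hom_moduleI[OF H.H_module H.linear_sw[OF U_module linear_map_id pr_bilinear_aux[OF assms]]])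

lemma tr_closed [simp]:
  assumes "g \<in> carrier H" "\<psi> \<in> carrier (G U)"
  shows "tr g \<psi> \<in> carrier (G U)"
  unfolding tr_def by (rule hom_moduleI[OF H.H_module linear_map_compose[OF _ G_linear[OF assms(2)]]]) (intro ulin assms(1))

lemma pr_bilinear: "bilinear_map K A (G U) (G U) pr"
proof (rule bilinear_mapI)
  show "linear_map K (G U) (G U) (\<lambda>\<psi>. pr a \<psi>)" if a: "a \<in> carrier A" for a
  proof (rule linear_map_into_hom[OF G_module[OF U_module] H.H_module U_module pr_closed[OF a]])
    show "linear_map K (G U) U (\<lambda>\<psi>. pr a \<psi> w)" if w: "w \<in> carrier H" for w
      unfolding pr_app[OF w]
      by (rule H.linear_sw_param[OF U_module G_module[OF U_module] w]) (intro ulin linear_map_eval; simp add: a)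
  qed
  show "linear_map K A (G U) (\<lambda>a. pr a \<psi>)" if \<psi>: "\<psi> \<in> carrier (G U)" for \<psi>
  proof (rule linear_map_into_hom[OF A_module H.H_module U_module])
    show "linear_map K A U (\<lambda>a. pr a \<psi> w)" if w: "w \<in> carrier H" for w
      unfolding pr_app[OF w]
      by (rule H.linear_sw_param[OF U_module A_module w]) (intro ulin; simp add: hom_module_app[OF \<psi>])
  qed (simp add: \<psi>)
qed

lemma tr_bilinear: "bilinear_map K H (G U) (G U) tr"
proof (rule bilinear_mapI)
  show "linear_map K (G U) (G U) (\<lambda>\<psi>. tr g \<psi>)" if g: "g \<in> carrier H" for g
    by (rule linear_map_into_hom[OF G_module[OF U_module] H.H_module U_module tr_closed[OF g]])
       (simp_all add: tr_app linear_map_eval g)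
  show "linear_map K H (G U) (\<lambda>g. tr g \<psi>)" if \<psi>: "\<psi> \<in> carrier (G U)" for \<psi>
    by (rule linear_map_into_hom[OF H.H_module H.H_module U_module])
       (simp_all add: tr_app \<psi> linear_map_compose[OF bilinear_map_right[OF H.mult_bilinear linear_map_id] G_linear[OF \<psi>]])
qed

text \<open>By \<open>act_mult\<close>, the functions \<open>w \<mapsto> w a\<close> and
  \<open>w \<mapsto> w b\<close> convolve to \<open>w \<mapsto> w (a b)\<close>; convolution is
  associative by coassociativity.\<close>

lemma pr_pr:
  assumes a: "a \<in> carrier A" and b: "b \<in> carrier A" and \<psi>: "\<psi> \<in> carrier (G U)"
  shows "pr a (pr b \<psi>) = pr (a \<cdot> b) \<psi>"
proof (rule hom_module_eqI)
  note c = a b hom_module_app[OF \<psi>] and pl = linear_map_compose[OF _ G_linear[OF \<psi>]]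
  show "pr a (pr b \<psi>) \<in> carrier (G U)" "pr (a \<cdot> b) \<psi> \<in> carrier (G U)" by (simp_all add: a b \<psi>)
  fix w assume w: "w \<in> carrier H"
  let ?\<gamma> = "\<lambda>p r s. lm (act p a) (lm (act r b) (\<psi> s))"
  have "pr a (pr b \<psi>) w = H.sw U (\<lambda>p q. H.sw U (\<lambda>r s. ?\<gamma> p r s) q) w"
    unfolding pr_app[OF w]
  proof (rule H.sw_cong[OF U_module w])
    fix p q assume pq: "p \<in> carrier H" "q \<in> carrier H"
    show "lm (act p a) (pr b \<psi> q) \<in> carrier U" using pq by (simp add: a hom_module_app[OF pr_closed[OF b \<psi>]])
    show "lm (act p a) (pr b \<psi> q) = H.sw U (\<lambda>r s. ?\<gamma> p r s) q"
      unfolding pr_app[OF pq(2)]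
      by (rule H.sw_comp[OF U_module U_module _ pq(2)]) (intro ulin, simp_all add: pq c)
  qed
  also have "\<dots> = H.sw U (\<lambda>x s. H.sw U (\<lambda>p r. ?\<gamma> p r s) x) w"
    by (rule H.sw_coassoc[OF U_module w, symmetric]) (intro ulin pl; simp add: c)+
  also have "\<dots> = H.sw U (\<lambda>x s. lm (act x (a \<cdot> b)) (\<psi> s)) w"
  proof (rule H.sw_cong[OF U_module w])
    fix x s assume xs: "x \<in> carrier H" "s \<in> carrier H"
    show "H.sw U (\<lambda>p r. ?\<gamma> p r s) x \<in> carrier U" by (rule H.sw_closed[OF U_module]) (simp_all add: c xs)
    have "lm (act x (a \<cdot> b)) (\<psi> s) = H.sw U (\<lambda>p r. lm (act p a \<cdot> act r b) (\<psi> s)) x"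
      unfolding act_mult[OF xs(1) a b]
      by (rule H.sw_comp[OF A_module U_module _ xs(1), of "\<lambda>z. lm z (\<psi> s)"]) (intro ulin, simp_all add: c xs)
    also have "\<dots> = H.sw U (\<lambda>p r. ?\<gamma> p r s) x"
      by (rule H.sw_cong[OF U_module xs(1)]) (simp_all add: c xs U.lmul_mult)
    finally show "H.sw U (\<lambda>p r. ?\<gamma> p r s) x = lm (act x (a \<cdot> b)) (\<psi> s)" ..
  qed
  finally show "pr a (pr b \<psi>) w = pr (a \<cdot> b) \<psi> w" using w by (simp add: pr_app)
qed

text \<open>Translation alone produces \<open>(w1 h1) a\<close>, whereas the right-hand side
  contains \<open>w1 (h1 a)\<close>. In a partial action \<open>w (h a)\<close> is the sum of
  \<open>(w1 1) ((w2 h) a)\<close>, and the missing factor \<open>w1 1\<close> is what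
  \<open>pr 1\<close> contributes.\<close>

lemma pr_tr_pr:
  assumes a: "a \<in> carrier A" and h: "h \<in> carrier H" and \<psi>: "\<psi> \<in> carrier (G U)"
  shows "pr \<one>\<^bsub>A\<^esub> (tr h (pr a \<psi>)) = H.sw (G U) (\<lambda>r s. pr (act r a) (tr s \<psi>)) h"
proof (rule hom_module_eqI)
  note c = a h hom_module_app[OF \<psi>] and pl = linear_map_compose[OF _ G_linear[OF \<psi>]]
  show "pr \<one>\<^bsub>A\<^esub> (tr h (pr a \<psi>)) \<in> carrier (G U)" by (simp add: a h \<psi>)
  show "H.sw (G U) (\<lambda>r s. pr (act r a) (tr s \<psi>)) h \<in> carrier (G U)"
    by (rule H.sw_closed[OF G_module[OF U_module] h]) (simp add: a \<psi>)
  fix w assume w: "w \<in> carrier H"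
  let ?\<gamma> = "\<lambda>r s x p q. lm (act x \<one>\<^bsub>A\<^esub>) (lm (act (p \<star> r) a) (\<psi> (q \<star> s)))"
  have "pr \<one>\<^bsub>A\<^esub> (tr h (pr a \<psi>)) w = H.sw U (\<lambda>x y. H.sw U (\<lambda>p q. H.sw U (\<lambda>r s. ?\<gamma> r s x p q) h) y) w"
    unfolding pr_app[OF w]
  proof (rule H.sw_cong[OF U_module w])
    fix x y assume xy: "x \<in> carrier H" "y \<in> carrier H"
    show "lm (act x \<one>\<^bsub>A\<^esub>) (tr h (pr a \<psi>) y) \<in> carrier U"
      using xy by (simp add: tr_app h hom_module_app[OF pr_closed[OF a \<psi>]])
    have l: "linear_map K U U (lm (act x \<one>\<^bsub>A\<^esub>))" by (rule bilinear_map_right[OF U.lmul_bilinear linear_map_id]) (simp add: xy)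
    have "tr h (pr a \<psi>) y = H.sw U (\<lambda>p q. lm (act p a) (\<psi> q)) (y \<star> h)"
      using xy h by (simp add: tr_app pr_app)
    also have "\<dots> = H.sw U (\<lambda>p q. H.sw U (\<lambda>r s. lm (act (p \<star> r) a) (\<psi> (q \<star> s))) h) y"
      by (rule H.sw_mult[OF U_module pr_bilinear_aux[OF a \<psi>] xy(2) h])
    also have "lm (act x \<one>\<^bsub>A\<^esub>) \<dots> = H.sw U (\<lambda>p q. lm (act x \<one>\<^bsub>A\<^esub>) (H.sw U (\<lambda>r s. lm (act (p \<star> r) a) (\<psi> (q \<star> s))) h)) y"
      by (rule H.sw_comp[OF U_module U_module l xy(2)]) (rule H.sw_closed[OF U_module h], simp add: c)
    also have "\<dots> = H.sw U (\<lambda>p q. H.sw U (\<lambda>r s. ?\<gamma> r s x p q) h) y"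
    proof (rule H.sw_cong[OF U_module xy(2)])
      fix p q assume pq: "p \<in> carrier H" "q \<in> carrier H"
      show "lm (act x \<one>\<^bsub>A\<^esub>) (H.sw U (\<lambda>r s. lm (act (p \<star> r) a) (\<psi> (q \<star> s))) h) \<in> carrier U"
        by (rule linear_map_closed[OF l], rule H.sw_closed[OF U_module h]) (simp add: c pq)
      show "lm (act x \<one>\<^bsub>A\<^esub>) (H.sw U (\<lambda>r s. lm (act (p \<star> r) a) (\<psi> (q \<star> s))) h) = H.sw U (\<lambda>r s. ?\<gamma> r s x p q) h"
        by (rule H.sw_comp[OF U_module U_module l h]) (simp add: c pq)
    qed
    finally show "lm (act x \<one>\<^bsub>A\<^esub>) (tr h (pr a \<psi>) y) = \<dots>" .
  qed
  also have "\<dots> = H.sw U (\<lambda>x y. H.sw U (\<lambda>r s. H.sw U (\<lambda>p q. ?\<gamma> r s x p q) y) h) w"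
  proof (rule H.sw_cong[OF U_module w])
    fix x y assume xy: "x \<in> carrier H" "y \<in> carrier H"
    show "H.sw U (\<lambda>p q. H.sw U (\<lambda>r s. ?\<gamma> r s x p q) h) y \<in> carrier U"
      by (intro H.sw_closed[OF U_module]; simp add: c xy)
    show "H.sw U (\<lambda>p q. H.sw U (\<lambda>r s. ?\<gamma> r s x p q) h) y = H.sw U (\<lambda>r s. H.sw U (\<lambda>p q. ?\<gamma> r s x p q) y) h"
      by (rule H.sw_swap[OF U_module xy(2) h]) (simp add: c xy)
  qed
  also have "\<dots> = H.sw U (\<lambda>r s. H.sw U (\<lambda>x y. H.sw U (\<lambda>p q. ?\<gamma> r s x p q) y) w) h"
    by (rule H.sw_swap[OF U_module w h]) (rule H.sw_closed[OF U_module]; simp add: c)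
  also have "\<dots> = H.sw U (\<lambda>r s. pr (act r a) (tr s \<psi>) w) h"
  proof (rule H.sw_cong[OF U_module h])
    fix r s assume rs: "r \<in> carrier H" "s \<in> carrier H"
    show "H.sw U (\<lambda>x y. H.sw U (\<lambda>p q. ?\<gamma> r s x p q) y) w \<in> carrier U"
      by (intro H.sw_closed[OF U_module]; simp add: c rs w)
    have "H.sw U (\<lambda>x y. H.sw U (\<lambda>p q. ?\<gamma> r s x p q) y) w = H.sw U (\<lambda>z q. H.sw U (\<lambda>x p. ?\<gamma> r s x p q) z) w"
      by (rule H.sw_coassoc[OF U_module w, symmetric]) (intro ulin pl; simp add: c rs)+
    also have "\<dots> = H.sw U (\<lambda>z q. lm (act z (act r a)) (tr s \<psi> q)) w"
    proof (rule H.sw_cong[OF U_module w])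
      fix z q assume zq: "z \<in> carrier H" "q \<in> carrier H"
      show "H.sw U (\<lambda>x p. ?\<gamma> r s x p q) z \<in> carrier U"
        by (rule H.sw_closed[OF U_module]; simp add: c rs zq)
      have "act z (act r a) = H.sw A (\<lambda>x p. act x \<one>\<^bsub>A\<^esub> \<cdot> act (p \<star> r) a) z"
        using A.act_mult_act[of "\<one>\<^bsub>A\<^esub>" a z r] a rs zq by simp
      then have "lm (act z (act r a)) (tr s \<psi> q) = lm (H.sw A (\<lambda>x p. act x \<one>\<^bsub>A\<^esub> \<cdot> act (p \<star> r) a) z) (\<psi> (q \<star> s))"
        using zq by (simp add: tr_app)
      also have "\<dots> = H.sw U (\<lambda>x p. lm (act x \<one>\<^bsub>A\<^esub> \<cdot> act (p \<star> r) a) (\<psi> (q \<star> s))) z"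
        by (rule H.sw_comp[OF A_module U_module _ zq(1), of "\<lambda>y. lm y (\<psi> (q \<star> s))"]) (intro ulin, simp_all add: c rs zq)
      also have "\<dots> = H.sw U (\<lambda>x p. ?\<gamma> r s x p q) z"
        by (rule H.sw_cong[OF U_module zq(1)]) (simp_all add: c rs zq U.lmul_mult)
      finally show "H.sw U (\<lambda>x p. ?\<gamma> r s x p q) z = lm (act z (act r a)) (tr s \<psi> q)" ..
    qed
    finally show "H.sw U (\<lambda>x y. H.sw U (\<lambda>p q. ?\<gamma> r s x p q) y) w = pr (act r a) (tr s \<psi>) w"
      using w by (simp add: pr_app)
  qed
  also have "\<dots> = H.sw (G U) (\<lambda>r s. pr (act r a) (tr s \<psi>)) h w"
    by (rule sw_eval[OF U_module h w, symmetric]) (simp add: a \<psi>)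
  finally show "pr \<one>\<^bsub>A\<^esub> (tr h (pr a \<psi>)) w = H.sw (G U) (\<lambda>r s. pr (act r a) (tr s \<psi>)) h w" .
qed

lemma tr_tr:
  assumes "h \<in> carrier H" "g \<in> carrier H" "\<psi> \<in> carrier (G U)"
  shows "tr h (tr g \<psi>) = tr (h \<star> g) \<psi>"
  by (rule hom_module_eqI[of _ K H U]) (simp_all add: assms tr_app H.A.m_assoc)

lemma tr_one: "\<psi> \<in> carrier (G U) \<Longrightarrow> tr \<one>\<^bsub>H\<^esub> \<psi> = \<psi>"
  by (rule hom_module_eqI[of _ K H U]) (simp_all add: tr_app)

text \<open>The image of the idempotent \<open>pr 1\<close>. Translations followed by projection
  back to it make it the partial module coinduced from \<open>U\<close>.\<close>

definition C :: "('h \<Rightarrow> 'u) set" where "C = {\<psi> \<in> carrier (G U). pr \<one>\<^bsub>A\<^esub> \<psi> = \<psi>}"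

abbreviation CoInd where "CoInd \<equiv> (G U)\<lparr>carrier := C\<rparr>"

abbreviation chm where "chm \<equiv> \<lambda>g \<psi>. pr \<one>\<^bsub>A\<^esub> (tr g \<psi>)"

lemma pr_in_C: "a \<in> carrier A \<Longrightarrow> \<psi> \<in> carrier (G U) \<Longrightarrow> pr a \<psi> \<in> C"
  by (simp add: C_def pr_pr)

lemma C_subspace: "submodule C K (G U)"
proof -
  interpret VG: vector_space K "G U" by (simp add: vector_space_def H.K.field_axioms G_module[OF U_module])
  note l = bilinear_map_right[OF pr_bilinear linear_map_id A.A.one_closed]
  show ?thesis
    by (rule VG.subspaceI)
       (auto simp: C_def linear_map_add[OF l] linear_map_smult[OF l] linear_map_zero[OF VG.module_axioms VG.module_axioms l])
qed

lemma CoInd_partial_module: "partial_module CoInd pr chm"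
proof -
  note mG = G_module[OF U_module]
  have m: "module K CoInd" by (rule submodule.submodule_is_module[OF C_subspace mG])
  have C: "\<psi> \<in> carrier (G U)" if "\<psi> \<in> C" for \<psi> using that by (simp add: C_def)
  have i: "linear_map K CoInd (G U) (\<lambda>\<psi>. \<psi>)" by (rule linear_mapI) (simp_all add: C)
  note pl = bilinear_map_left[OF pr_bilinear] bilinear_map_right[OF pr_bilinear]
    bilinear_map_left[OF tr_bilinear] bilinear_map_right[OF tr_bilinear]
  show ?thesis
  proof (intro left_partial_module.intro left_module.intro left_module_axioms.intro left_partial_module_axioms.intro m)
    show "bilinear_map K A CoInd CoInd pr"
      by (intro bilinear_mapI linear_map_into_submodule pl i linear_map_id) (simp_all add: C pr_in_C)
    show "bilinear_map K H CoInd CoInd chm"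
      by (intro bilinear_mapI linear_map_into_submodule pl i linear_map_id) (simp_all add: C pr_in_C)
    fix \<psi> assume \<psi>: "\<psi> \<in> carrier CoInd"
    then show "pr \<one>\<^bsub>A\<^esub> \<psi> = \<psi>" by (simp add: C_def)
    show "chm \<one>\<^bsub>H\<^esub> \<psi> = \<psi>" using \<psi> by (simp add: C_def tr_one)
    show "pr a (pr b \<psi>) = pr (a \<cdot> b) \<psi>" if "a \<in> carrier A" "b \<in> carrier A" for a b
      using \<psi> that by (simp add: pr_pr C)
    fix a h g assume a: "a \<in> carrier A" and h: "h \<in> carrier H" and g: "g \<in> carrier H"
    have \<psi>G: "\<psi> \<in> carrier (G U)" using \<psi> C by simp
    have "chm h (pr a (chm g \<psi>)) = H.sw (G U) (\<lambda>r s. pr (act r a) (tr s (tr g \<psi>))) h"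
      using a g \<psi>G by (simp add: pr_pr pr_tr_pr[OF a h])
    also have "\<dots> = H.sw (G U) (\<lambda>r s. pr (act r a) (chm (s \<star> g) \<psi>)) h"
      by (rule H.sw_cong[OF mG h]) (simp_all add: a g \<psi>G pr_pr tr_tr)
    also have "\<dots> = H.sw CoInd (\<lambda>r s. pr (act r a) (chm (s \<star> g) \<psi>)) h"
      by (rule H.sw_comp[OF m mG i h, symmetric]) (simp add: a g \<psi>G pr_in_C)
    finally show "chm h (pr a (chm g \<psi>)) = H.sw CoInd (\<lambda>r s. pr (act r a) (chm (s \<star> g) \<psi>)) h" .
  qed
qed

text \<open>It carries facts about the coinduced module back to \<open>U\<close>, as evaluation at
  \<open>1\<close> commutes with the two actions of \<open>A\<close>.\<close>

lemma pr_eval_one: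
  assumes "a \<in> carrier A" "\<psi> \<in> carrier (G U)"
  shows "pr a \<psi> \<one>\<^bsub>H\<^esub> = lm a (\<psi> \<one>\<^bsub>H\<^esub>)"
  by (simp add: pr_app H.sw_one[OF U_module pr_bilinear_aux[OF assms]] A.act_one assms(1))

end

section \<open>Vectors killed by the common annihilator of the finite-dimensional irreducible
  modules\<close>

context partial_module_context
begin

lemma minimal_stable:
  assumes "fin X" "carrier X \<noteq> {\<zero>}"
  obtains V where "stable X lmul hmul V" "V \<noteq> {\<zero>}"
    "\<And>N. stable X lmul hmul N \<Longrightarrow> N \<subseteq> V \<Longrightarrow> N = {\<zero>} \<or> N = V"
proof -
  interpret VX: vector_space K X by (rule X_vector_space)
  let ?Q = "\<lambda>V. stable X lmul hmul V \<and> V \<noteq> {\<zero>}"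
  have "?Q (carrier X)" using stable_carrier assms(2) by blast
  then obtain V where V: "?Q V" "\<And>W. ?Q W \<Longrightarrow> VX.vdim V \<le> VX.vdim W"
    using ex_has_least_nat[of ?Q "carrier X" VX.vdim] by blast
  have fV: "VX.fin_subspace V" by (rule VX.vdim_mono(1)[OF assms(1) stableD(1,5)]) (use V(1) in auto)
  show thesis
  proof (rule that)
    fix N assume N: "stable X lmul hmul N" "N \<subseteq> V"
    have "N = V" if "N \<noteq> {\<zero>}"
    proof (rule VX.vdim_mono(3)[OF fV stableD(1)[OF N(1)] N(2)])
      show "VX.vdim N = VX.vdim V"
        using VX.vdim_mono(2)[OF fV stableD(1)[OF N(1)] N(2)] V(2)[of N] N(1) that by auto
    qed
    then show "N = {\<zero>} \<or> N = V" by blast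
  qed (use V(1) in auto)
qed

end

context hopf_partial_action
begin

text \<open>The ideal \<open>I\<close> of the overview.\<close>

definition fd_annihilator :: "'a set"
  where "fd_annihilator = {a \<in> carrier A. \<forall>(X :: ('k, 'a, 'h) umodule) l h.
    irreducible_module X l h \<and> fin X \<longrightarrow> a \<in> annihilator X l}"

end

context coinduced_module
begin

text \<open>The module coinduced from \<open>U\<close> is finite-dimensional and nonzero, so it has
  an irreducible submodule \<open>V\<close>, which \<open>fd_annihilator\<close> kills. A nonzero
  \<open>\<psi>\<close> in \<open>V\<close> has a nonzero value at some \<open>g\<close>;
  translating by \<open>g\<close> moves this value to \<open>1\<close>, where
  \<open>pr_eval_one\<close> turns it into a vector of \<open>U\<close> killed by
  \<open>fd_annihilator\<close>.\<close>

lemma fd_annihilator_kills: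
  assumes fH: "fin H" and fU: "fin U" and nz: "carrier U \<noteq> {\<zero>\<^bsub>U\<^esub>}"
  obtains u where "u \<in> carrier U" "u \<noteq> \<zero>\<^bsub>U\<^esub>" "\<And>a. a \<in> fd_annihilator \<Longrightarrow> lm a u = \<zero>\<^bsub>U\<^esub>"
proof -
  have VG: "vector_space K (G U)" by (simp add: vector_space_def H.K.field_axioms G_module[OF U_module])
  interpret VG: vector_space K "G U" by (rule VG)
  interpret C: partial_module_context K H \<Delta> \<epsilon> S A act CoInd pr chm by (rule partial_contextI[OF CoInd_partial_module])
  interpret VC: vector_space K CoInd by (rule C.X_vector_space)
  have C: "\<psi> \<in> carrier (G U)" if "\<psi> \<in> C" for \<psi> using that by (simp add: C_def)
  have "{\<phi> \<in> carrier (G U). \<forall>x\<in>carrier H. \<phi> x \<in> carrier U} = carrier (G U)" by (auto simp: hom_module_app)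
  then have "VG.fin_subspace (carrier (G U))" using vdim_hom(1)[OF H.H_vector_space U_vector_space fH fU] by simp
  then have fC: "VG.fin_subspace C" by (rule VG.vdim_mono(1)[OF _ C_subspace]) (auto simp: C_def)
  have "fin CoInd"
    using rank_nullity(1)[OF VG C.X_vector_space fC, of "\<lambda>x. x"] by simp
  moreover have "carrier CoInd \<noteq> {\<zero>\<^bsub>CoInd\<^esub>}"
  proof
    assume *: "carrier CoInd = {\<zero>\<^bsub>CoInd\<^esub>}"
    obtain u where u: "u \<in> carrier U" "u \<noteq> \<zero>\<^bsub>U\<^esub>" using nz vector_space.subspaceD(3)[OF U_vector_space module.carrier_is_submodule[OF U_module]] by blast
    \<comment> \<open>Projected by \<open>pr 1\<close>, this function still has the value
      \<open>u\<close> at \<open>1\<close>, so the coinduced module cannot be zero.\<close>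
    let ?c = "\<lambda>w\<in>carrier H. \<epsilon> w \<odot>\<^bsub>U\<^esub> u"
    have c: "?c \<in> carrier (G U)" by (rule hom_moduleI[OF H.H_module]) (intro ulin U_module u(1))
    have "pr \<one>\<^bsub>A\<^esub> ?c \<in> C" by (rule pr_in_C[OF A.A.one_closed c])
    then have "pr \<one>\<^bsub>A\<^esub> ?c = \<zero>\<^bsub>G U\<^esub>" using * by simp
    then have "pr \<one>\<^bsub>A\<^esub> ?c \<one>\<^bsub>H\<^esub> = \<zero>\<^bsub>U\<^esub>" by (simp add: hom_module_ev)
    then show False using u by (simp add: pr_eval_one[OF A.A.one_closed c] H.counit_one U.lmul_one)
  qed
  ultimately obtain V where V: "stable CoInd pr chm V" "V \<noteq> {\<zero>\<^bsub>CoInd\<^esub>}"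
    "\<And>N. stable CoInd pr chm N \<Longrightarrow> N \<subseteq> V \<Longrightarrow> N = {\<zero>\<^bsub>CoInd\<^esub>} \<or> N = V"
    using C.minimal_stable by metis
  note sV = C.stableD[OF V(1)]
  have zV: "\<zero>\<^bsub>CoInd\<^esub> \<in> V" by (rule VC.subspaceD(3)[OF sV(1)])
  obtain Y :: "('k, 'a, 'h) umodule" and ly hy \<pi> where Y: "simple_factor CoInd pr chm {\<zero>\<^bsub>CoInd\<^esub>} V Y ly hy \<pi>"
  proof (rule C.simple_factor_exists[OF C.stable_zero V(1)])
    show "{\<zero>\<^bsub>CoInd\<^esub>} \<subset> V" using V(2) zV by blast
    show "N = {\<zero>\<^bsub>CoInd\<^esub>} \<or> N = V" if "stable CoInd pr chm N" "N \<subseteq> V" for N by (rule V(3)[OF that])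
  qed (rule that)
  have Y': "irreducible_module Y ly hy" "partial_hom (CoInd\<lparr>carrier := V\<rparr>) pr chm Y ly hy \<pi>"
    "\<pi> ` V = carrier Y" "{v \<in> V. \<pi> v = \<zero>\<^bsub>Y\<^esub>} = {\<zero>\<^bsub>CoInd\<^esub>}"
    using Y by (auto simp: simple_factor_def)
  have fV: "VC.fin_subspace V" by (rule VC.vdim_mono(1)[OF \<open>fin CoInd\<close> sV(1,5)])
  have fY: "fin Y"
    by (rule C.vdim_Dset_quotient(1)[OF fH fV _ V(1) C.stable_zero _ Y'(2-4), of "{}"]) (use zV in auto)
  have kill: "pr a \<psi> = \<zero>\<^bsub>CoInd\<^esub>" if a: "a \<in> fd_annihilator" and \<psi>: "\<psi> \<in> V" for a \<psi>
  proof -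
    have aA: "a \<in> carrier A" using a by (simp add: fd_annihilator_def)
    have "a \<in> annihilator Y ly" using a Y'(1) fY unfolding fd_annihilator_def by blast
    moreover have "\<pi> \<psi> \<in> carrier Y" using imageI[OF \<psi>, of \<pi>] by (simp only: Y'(3))
    ultimately have "\<pi> (pr a \<psi>) = \<zero>\<^bsub>Y\<^esub>"
      using Y'(2) \<psi> aA by (simp add: partial_hom_def annihilator_def)
    then have "pr a \<psi> \<in> {v \<in> V. \<pi> v = \<zero>\<^bsub>Y\<^esub>}" using sV(2)[OF \<psi> aA] by simp
    then show ?thesis by (simp only: Y'(4) singleton_iff)
  qed
  obtain \<psi> where \<psi>: "\<psi> \<in> V" "\<psi> \<noteq> \<zero>\<^bsub>CoInd\<^esub>" using V(2) zV by blast
  have \<psi>G: "\<psi> \<in> carrier (G U)" using \<psi>(1) sV(5) C by auto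
  have "\<exists>g\<in>carrier H. \<psi> g \<noteq> \<zero>\<^bsub>U\<^esub>"
  proof (rule ccontr)
    assume "\<not> ?thesis"
    then have "\<psi> = \<zero>\<^bsub>G U\<^esub>"
      by (intro hom_module_eqI[OF \<psi>G VG.subspaceD(2)[OF C_subspace VG.subspaceD(3)[OF C_subspace]]]) (auto simp: hom_module_ev)
    then show False using \<psi>(2) by simp
  qed
  then obtain g where g: "g \<in> carrier H" "\<psi> g \<noteq> \<zero>\<^bsub>U\<^esub>" by blast
  have cg: "chm g \<psi> \<in> V" by (rule sV(3)[OF \<psi>(1) g(1)])
  have e: "chm g \<psi> \<one>\<^bsub>H\<^esub> = \<psi> g"
    using g(1) \<psi>G by (simp add: pr_eval_one tr_app U.lmul_one hom_module_app[OF \<psi>G])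
  show thesis
  proof (rule that[of "\<psi> g"])
    show "\<psi> g \<in> carrier U" by (rule hom_module_app[OF \<psi>G g(1)])
    show "\<psi> g \<noteq> \<zero>\<^bsub>U\<^esub>" by (rule g(2))
    fix a assume a: "a \<in> fd_annihilator"
    then have aA: "a \<in> carrier A" by (simp add: fd_annihilator_def)
    have "lm a (chm g \<psi> \<one>\<^bsub>H\<^esub>) = pr a (chm g \<psi>) \<one>\<^bsub>H\<^esub>"
      by (rule pr_eval_one[OF aA, symmetric]) (simp add: g(1) \<psi>G)
    also have "pr a (chm g \<psi>) = \<zero>\<^bsub>CoInd\<^esub>" by (rule kill[OF a cg])
    also have "\<zero>\<^bsub>CoInd\<^esub> \<one>\<^bsub>H\<^esub> = \<zero>\<^bsub>U\<^esub>" by (simp add: hom_module_ev)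
    finally show "lm a (\<psi> g) = \<zero>\<^bsub>U\<^esub>" unfolding e .
  qed
qed

end

context hopf_partial_action
begin

interpretation VA: vector_space K A by (rule A_vector_space)

lemma fd_annihilator_subset: "fd_annihilator \<subseteq> carrier A"
  by (auto simp: fd_annihilator_def)

lemma fd_annihilator_subspace: "submodule fd_annihilator K A"
  and fd_annihilator_mult: "i \<in> fd_annihilator \<Longrightarrow> a \<in> carrier A \<Longrightarrow> a \<cdot> i \<in> fd_annihilator"
    "i \<in> fd_annihilator \<Longrightarrow> a \<in> carrier A \<Longrightarrow> i \<cdot> a \<in> fd_annihilator"
  and fd_annihilator_act: "i \<in> fd_annihilator \<Longrightarrow> h \<in> carrier H \<Longrightarrow> act h i \<in> fd_annihilator"
proof -
  have cl: "submodule (annihilator X l) K A \<and>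
    (\<forall>i\<in>annihilator X l. (\<forall>a\<in>carrier A. a \<cdot> i \<in> annihilator X l \<and> i \<cdot> a \<in> annihilator X l) \<and>
      (\<forall>h\<in>carrier H. act h i \<in> annihilator X l))"
    if "irreducible_module X l h" for X :: "('k, 'a, 'h) umodule" and l h
  proof -
    interpret X: partial_module_context K H \<Delta> \<epsilon> S A act X l h by (rule irreducible_context[OF that])
    note bl = bilinear_map_left[OF X.X.lmul_bilinear linear_map_id] and br = bilinear_map_right[OF X.X.lmul_bilinear linear_map_id]
    have "submodule (annihilator X l) K A"
      by (rule VA.subspaceI)
         (auto simp: annihilator_def linear_map_add[OF bl] linear_map_smult[OF bl] linear_map_zero[OF A_module X.X_module bl])
    moreover have "a \<cdot> i \<in> annihilator X l \<and> i \<cdot> a \<in> annihilator X l"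
      if "i \<in> annihilator X l" "a \<in> carrier A" for a i
      using that by (auto simp: annihilator_def linear_map_zero[OF X.X_module X.X_module br] simp flip: X.X.lmul_mult)
    ultimately show ?thesis using X.annihilator_act by blast
  qed
  have I: "a \<in> fd_annihilator"
    if "a \<in> carrier A" "\<And>(X :: ('k, 'a, 'h) umodule) l h. irreducible_module X l h \<Longrightarrow> fin X \<Longrightarrow> a \<in> annihilator X l" for a
    using that by (auto simp: fd_annihilator_def)
  have E: "i \<in> annihilator X l" if "i \<in> fd_annihilator" "irreducible_module X l h" "fin X"
    for i and X :: "('k, 'a, 'h) umodule" and l h
    using that by (auto simp: fd_annihilator_def)
  have c: "i \<in> carrier A" if "i \<in> fd_annihilator" for i using fd_annihilator_subset that by blast
  note sub = VA.subspaceD[OF conjunct1[OF cl]]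
  show "submodule fd_annihilator K A"
  proof (rule VA.subspaceI[OF fd_annihilator_subset])
    show "\<zero>\<^bsub>A\<^esub> \<in> fd_annihilator"
      by (rule I) (simp_all add: sub(3))
    show "x \<oplus>\<^bsub>A\<^esub> y \<in> fd_annihilator" if "x \<in> fd_annihilator" "y \<in> fd_annihilator" for x y
      by (rule I) (use that c in \<open>auto intro: sub(4) E\<close>)
    show "k \<odot>\<^bsub>A\<^esub> x \<in> fd_annihilator" if "k \<in> carrier K" "x \<in> fd_annihilator" for k x
      by (rule I) (use that c in \<open>auto intro: sub(7) E\<close>)
  qed
  show "a \<cdot> i \<in> fd_annihilator" if "i \<in> fd_annihilator" "a \<in> carrier A"
    by (rule I) (use that c E cl in \<open>simp, meson\<close>)
  show "i \<cdot> a \<in> fd_annihilator" if "i \<in> fd_annihilator" "a \<in> carrier A"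
    by (rule I) (use that c E cl in \<open>simp, meson\<close>)
  show "act h i \<in> fd_annihilator" if "i \<in> fd_annihilator" "h \<in> carrier H"
    by (rule I) (use that c E cl in \<open>simp, meson\<close>)
qed

end

section \<open>Quasi-regularity\<close>

text \<open>Multiplication as \<open>\<beta>\<close> gives quotients by maximal left ideals,
  multiplication in reversed order those by maximal right ideals, so one statement serves both
  sides. Maximality is expressed by missing \<open>1\<close>, which for a stable subspace means
  being proper, since \<open>\<beta> a 1 = a\<close>.\<close>

lemma quotient_by_maximal:
  fixes K :: "'k ring" and A :: "('k, 'a) module"
  assumes A: "unital_algebra K A" and \<beta>: "bilinear_map K A A A \<beta>" and \<beta>1: "\<And>a. a \<in> carrier A \<Longrightarrow> \<beta> a \<one>\<^bsub>A\<^esub> = a"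
    and I: "submodule I K A" "\<And>a x. a \<in> carrier A \<Longrightarrow> x \<in> I \<Longrightarrow> \<beta> a x \<in> I" "\<one>\<^bsub>A\<^esub> \<notin> I"
    and max: "\<forall>J. submodule J K A \<and> (\<forall>a\<in>carrier A. \<forall>x\<in>J. \<beta> a x \<in> J) \<and> I \<subseteq> J \<and> \<one>\<^bsub>A\<^esub> \<notin> J \<longrightarrow> J = I"
  obtains W :: "('k, 'a set) module" and \<beta>' j where
    "module K W" "linear_map K A W j" "j ` carrier A = carrier W"
    "\<And>x y. x \<in> carrier A \<Longrightarrow> y \<in> carrier A \<Longrightarrow> j x = j y \<longleftrightarrow> x \<ominus>\<^bsub>A\<^esub> y \<in> I"
    "bilinear_map K A W W \<beta>'" "\<And>a x. a \<in> carrier A \<Longrightarrow> x \<in> carrier A \<Longrightarrow> \<beta>' a (j x) = j (\<beta> a x)"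
    "carrier W \<noteq> {\<zero>\<^bsub>W\<^esub>}"
    "\<forall>N. submodule N K W \<and> (\<forall>a\<in>carrier A. \<forall>x\<in>N. \<beta>' a x \<in> N) \<longrightarrow> N = {\<zero>\<^bsub>W\<^esub>} \<or> N = carrier W"
proof -
  interpret A: unital_algebra K A by (rule A)
  have mA: "module K A" by (rule A.module_axioms)
  interpret VA: vector_space K A using mA A.K.field_axioms by (simp add: vector_space_def)
  define j where "j x = I +>\<^bsub>A\<^esub> x" for x
  have j: "j x = j y \<longleftrightarrow> x \<ominus>\<^bsub>A\<^esub> y \<in> I" if "x \<in> carrier A" "y \<in> carrier A" for x y
    unfolding j_def by (rule coset_eq_iff[OF mA I(1) that])
  let ?W = "transport j A" and ?i = "inv_into (carrier A) j"
  have W: "module K ?W" "linear_map K A ?W j"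
    by (rule transport_quotient[OF VA.vector_space_axioms I(1)], erule (1) j)+
  have c: "carrier ?W = j ` carrier A" by (simp add: transport_simps)
  define \<beta>' where "\<beta>' a y = j (\<beta> a (?i y))" for a y
  note Is = VA.subspaceD[OF I(1)]
  have b: "\<beta>' a (j x) = j (\<beta> a x)" if a: "a \<in> carrier A" and x: "x \<in> carrier A" for a x
  proof -
    have i: "?i (j x) \<in> carrier A" using x by (simp add: inv_into_into)
    have "?i (j x) \<ominus>\<^bsub>A\<^esub> x \<in> I" using j[OF i x] x by (simp add: f_inv_into_f)
    then have "\<beta> a (?i (j x)) \<ominus>\<^bsub>A\<^esub> \<beta> a x \<in> I"
      using I(2)[OF a, of "?i (j x) \<ominus>\<^bsub>A\<^esub> x"] linear_map_minus[OF mA mA bilinear_map_right[OF \<beta> linear_map_id a] i x] by simp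
    then show ?thesis
      using j[of "\<beta> a (?i (j x))" "\<beta> a x"] bilinear_map_closed[OF \<beta> a] i x by (simp add: \<beta>'_def)
  qed
  have ops: "j x \<oplus>\<^bsub>?W\<^esub> j y = j (x \<oplus>\<^bsub>A\<^esub> y)" "k \<in> carrier K \<Longrightarrow> k \<odot>\<^bsub>?W\<^esub> j x = j (k \<odot>\<^bsub>A\<^esub> x)"
    if "x \<in> carrier A" "y \<in> carrier A" for x y k
    using linear_map_add[OF W(2)] linear_map_smult[OF W(2)] that by simp_all
  have bW: "bilinear_map K A ?W ?W \<beta>'"
    using \<beta> unfolding bilinear_map_def linear_map_def by (auto simp: c b ops bilinear_map_closed[OF \<beta>])
  have z: "j \<zero>\<^bsub>A\<^esub> = \<zero>\<^bsub>?W\<^esub>" by (rule linear_map_zero[OF mA W])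
  have jz: "j x = \<zero>\<^bsub>?W\<^esub> \<longleftrightarrow> x \<in> I" if "x \<in> carrier A" for x
    using j[OF that A.M.zero_closed] that by (simp add: z A.M.minus_eq)
  show thesis
  proof (rule that[OF W _ j bW b])
    show "j ` carrier A = carrier ?W" by (simp add: c)
    show "carrier ?W \<noteq> {\<zero>\<^bsub>?W\<^esub>}"
      using jz[of "\<one>\<^bsub>A\<^esub>"] I(3) by (auto simp: c)
    show "\<forall>N. submodule N K ?W \<and> (\<forall>a\<in>carrier A. \<forall>x\<in>N. \<beta>' a x \<in> N) \<longrightarrow> N = {\<zero>\<^bsub>?W\<^esub>} \<or> N = carrier ?W"
    proof (intro allI impI, elim conjE)
    fix N assume N: "submodule N K ?W" "\<forall>a\<in>carrier A. \<forall>x\<in>N. \<beta>' a x \<in> N"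
    interpret VW: vector_space K ?W using W(1) A.K.field_axioms by (simp add: vector_space_def)
    note Ns = VW.subspaceD[OF N(1)]
    let ?J = "{x \<in> carrier A. j x \<in> N}"
    have J: "submodule ?J K A" by (rule linear_map_vimage_submodule[OF mA W(1,2) N(1)])
    have JI: "I \<subseteq> ?J"
    proof
      fix x assume x: "x \<in> I"
      then show "x \<in> ?J" using jz[OF Is(2)[OF x]] Is(2) Ns(3) by simp
    qed
    have Jst: "\<beta> a x \<in> ?J" if "a \<in> carrier A" "x \<in> ?J" for a x
    proof -
      have "\<beta>' a (j x) \<in> N" using N(2) that by blast
      then show ?thesis using that b bilinear_map_closed[OF \<beta>] by simp
    qed
    have NJ: "N = j ` ?J" using Ns(1) by (auto simp: c)
    show "N = {\<zero>\<^bsub>?W\<^esub>} \<or> N = carrier ?W"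
    proof (cases "\<one>\<^bsub>A\<^esub> \<in> ?J")
      case True
      have "carrier A \<subseteq> ?J" using Jst[OF _ True] \<beta>1 by auto
      then have "?J = carrier A" by blast
      then show ?thesis using NJ c by simp
    next
      case False
      then have "?J = I" using max J Jst JI by blast
      then have "N \<subseteq> {\<zero>\<^bsub>?W\<^esub>}" using NJ jz Is(2) by auto
      then show ?thesis using Ns(3) by auto
    qed
    qed
  qed (assumption | rule j b)+
qed

lemma (in vector_space) maximal_stable_subspace_family:
  assumes "submodule N K V" "\<forall>a\<in>B. \<forall>x\<in>N. \<beta> a x \<in> N" "z \<notin> N"
  obtains I where "submodule I K V" "\<forall>a\<in>B. \<forall>x\<in>I. \<beta> a x \<in> I" "N \<subseteq> I" "z \<notin> I"
    "\<forall>J. submodule J K V \<and> (\<forall>a\<in>B. \<forall>x\<in>J. \<beta> a x \<in> J) \<and> I \<subseteq> J \<and> z \<notin> J \<longrightarrow> J = I"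
proof (rule maximal_stable_subspace[OF assms(1), of "\<beta> ` B" z])
  fix M assume M: "submodule M K V" "\<And>f x. f \<in> \<beta> ` B \<Longrightarrow> x \<in> M \<Longrightarrow> f x \<in> M" "N \<subseteq> M" "z \<notin> M"
    and max: "\<And>M'. submodule M' K V \<Longrightarrow> (\<And>f x. f \<in> \<beta> ` B \<Longrightarrow> x \<in> M' \<Longrightarrow> f x \<in> M') \<Longrightarrow> M \<subseteq> M' \<Longrightarrow> z \<notin> M' \<Longrightarrow> M' = M"
  show thesis
  proof (rule that[OF M(1) _ M(3,4)])
    show "\<forall>a\<in>B. \<forall>x\<in>M. \<beta> a x \<in> M" using M(2) by blast
    show "\<forall>J. submodule J K V \<and> (\<forall>a\<in>B. \<forall>x\<in>J. \<beta> a x \<in> J) \<and> M \<subseteq> J \<and> z \<notin> J \<longrightarrow> J = M"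
      using max by blast
  qed
qed (use assms in auto)

lemma (in vector_space) scalar_fin: "vector_space.fin_subspace K (scalar_module K) (carrier (scalar_module K))"
proof -
  interpret S: vector_space K "scalar_module K" by (rule vector_space_scalar)
  obtain U where U: "S.fin_subspace U" "{\<one>\<^bsub>K\<^esub>} \<subseteq> U"
    using S.fin_subspace_cover[of "{\<one>\<^bsub>K\<^esub>}"] by (auto simp: scalar_module_def)
  note Us = S.subspaceD[OF S.fin_subspace_subspace[OF U(1)]]
  have "carrier (scalar_module K) \<subseteq> U"
    using Us(7)[of _ "\<one>\<^bsub>K\<^esub>"] U(2) by (auto simp: scalar_module_def)
  then show ?thesis using U(1) Us(1) by (metis subset_antisym)
qed

section \<open>One-sided inverses of \<open>1 - i\<close>\<close>

context hopf_partial_action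
begin

interpretation VA: vector_space K A by (rule A_vector_space)

lemma coinduced_moduleI: "left_module K U A lm \<Longrightarrow> coinduced_module K H \<Delta> \<epsilon> S A act U lm"
  by (simp add: coinduced_module_def hopf_partial_action_axioms)

text \<open>Otherwise \<open>1 - i\<close> lies in a maximal left ideal \<open>I\<close>. The
  irreducible module \<open>A/I\<close> is finite-dimensional, so it contains a nonzero vector
  \<open>u\<close> killed by \<open>fd_annihilator\<close>. As \<open>u\<close> generates the module
  and \<open>fd_annihilator\<close> is a two-sided ideal, the class of \<open>1\<close> is killed
  too, whence \<open>i\<close> and then \<open>1\<close> lie in \<open>I\<close>.\<close>

lemma fd_annihilator_left_inverse_left:
  assumes fH: "fin H" 
    and hyp: "\<And>(M :: ('k, 'a set) module) lmul. irreducible_left_module K A M lmul \<Longrightarrow> finite_dimensional K M"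
    and i: "i \<in> fd_annihilator"
  shows "\<exists>b\<in>carrier A. b \<cdot> (\<one>\<^bsub>A\<^esub> \<ominus>\<^bsub>A\<^esub> i) = \<one>\<^bsub>A\<^esub>"
proof (rule ccontr)
  assume no: "\<not> ?thesis"
  have iA: "i \<in> carrier A" using i fd_annihilator_subset by blast
  let ?u = "\<one>\<^bsub>A\<^esub> \<ominus>\<^bsub>A\<^esub> i"
  have uA: "?u \<in> carrier A" using iA by simp
  let ?N = "(\<lambda>b. b \<cdot> ?u) ` carrier A"
  have N: "submodule ?N K A"
    by (rule linear_map_image_submodule[OF A_module A_module bilinear_map_left[OF A_mult_bilinear linear_map_id uA]])
  have Nst: "\<forall>a\<in>carrier A. \<forall>x\<in>?N. a \<cdot> x \<in> ?N"
    using uA by (auto simp flip: A.A.m_assoc)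
  have N1: "\<one>\<^bsub>A\<^esub> \<notin> ?N" using no by (auto dest: sym)
  obtain I where I: "submodule I K A" "\<forall>a\<in>carrier A. \<forall>x\<in>I. a \<cdot> x \<in> I" "?N \<subseteq> I" "\<one>\<^bsub>A\<^esub> \<notin> I"
    and max: "\<forall>J. submodule J K A \<and> (\<forall>a\<in>carrier A. \<forall>x\<in>J. a \<cdot> x \<in> J) \<and> I \<subseteq> J \<and> \<one>\<^bsub>A\<^esub> \<notin> J \<longrightarrow> J = I"
    by (rule VA.maximal_stable_subspace_family[OF N Nst N1], rule that)
  obtain W :: "('k, 'a set) module" and lm j where W: "module K W" "linear_map K A W j" "j ` carrier A = carrier W"
    and j: "\<And>x y. x \<in> carrier A \<Longrightarrow> y \<in> carrier A \<Longrightarrow> j x = j y \<longleftrightarrow> x \<ominus>\<^bsub>A\<^esub> y \<in> I"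
    and lm: "bilinear_map K A W W lm" "\<And>a x. a \<in> carrier A \<Longrightarrow> x \<in> carrier A \<Longrightarrow> lm a (j x) = j (a \<cdot> x)"
    and nz: "carrier W \<noteq> {\<zero>\<^bsub>W\<^esub>}"
    and irr: "\<forall>N. submodule N K W \<and> (\<forall>a\<in>carrier A. \<forall>x\<in>N. lm a x \<in> N) \<longrightarrow> N = {\<zero>\<^bsub>W\<^esub>} \<or> N = carrier W"
    by (rule quotient_by_maximal[OF A.unital_algebra_axioms A_mult_bilinear A.A.r_one I(1) bspec[OF bspec[OF I(2)]] I(4) max], assumption+, rule that)
  have rep: "\<exists>x\<in>carrier A. w = j x" if "w \<in> carrier W" for w
    using that unfolding W(3)[symmetric] by blast
  have lW: "left_module K W A lm"
  proof (intro left_module.intro left_module_axioms.intro W(1) lm(1))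
    fix w assume "w \<in> carrier W"
    then obtain x where x: "x \<in> carrier A" "w = j x" using rep by blast
    then show "lm \<one>\<^bsub>A\<^esub> w = w" by (simp add: lm(2))
    show "lm a (lm b w) = lm (a \<cdot> b) w" if "a \<in> carrier A" "b \<in> carrier A" for a b
      using x that by (simp add: lm(2) A.A.m_assoc)
  qed
  then have "irreducible_left_module K A W lm"
    using nz irr by (auto simp: irreducible_left_module_def)
  from hyp[OF this] have fW: "fin W"
    using vector_space.finite_dimensional_fin_subspace[of K W] W(1) by (simp add: vector_space_def H.K.field_axioms)
  interpret W: coinduced_module K H \<Delta> \<epsilon> S A act W lm by (rule coinduced_moduleI[OF lW])
  obtain u where u: "u \<in> carrier W" "u \<noteq> \<zero>\<^bsub>W\<^esub>" "\<And>a. a \<in> fd_annihilator \<Longrightarrow> lm a u = \<zero>\<^bsub>W\<^esub>"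
    using W.fd_annihilator_kills[OF fH fW nz] by blast
  have one: "lm \<one>\<^bsub>A\<^esub> u = u" by (rule W.U.lmul_one[OF u(1)])
  have "(\<lambda>a. lm a u) ` carrier A = {\<zero>\<^bsub>W\<^esub>} \<or> (\<lambda>a. lm a u) ` carrier A = carrier W"
  proof (rule irr[rule_format], intro conjI)
    show "submodule ((\<lambda>a. lm a u) ` carrier A) K W"
      by (rule linear_map_image_submodule[OF A_module W(1) bilinear_map_left[OF lm(1) linear_map_id u(1)]])
  qed (use u(1) W.U.lmul_mult in auto)
  moreover have "u \<in> (\<lambda>a. lm a u) ` carrier A" using one A.A.one_closed by (metis imageI)
  ultimately have gen: "(\<lambda>a. lm a u) ` carrier A = carrier W" using u(2) by (metis singletonD)
  have "j \<one>\<^bsub>A\<^esub> \<in> carrier W" using linear_map_closed[OF W(2)] by simp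
  then have "j \<one>\<^bsub>A\<^esub> \<in> (\<lambda>a. lm a u) ` carrier A" by (simp only: gen)
  then obtain b where b: "b \<in> carrier A" "j \<one>\<^bsub>A\<^esub> = lm b u" by (elim imageE)
  have "j i = lm i (j \<one>\<^bsub>A\<^esub>)" using iA by (simp add: lm(2))
  also have "\<dots> = lm (i \<cdot> b) u" using b iA u(1) by (simp add: W.U.lmul_mult)
  also have "\<dots> = \<zero>\<^bsub>W\<^esub>" by (rule u(3)[OF fd_annihilator_mult(2)[OF i b(1)]])
  also have "\<dots> = j \<zero>\<^bsub>A\<^esub>" by (rule linear_map_zero[OF A_module W(1,2), symmetric])
  finally have "i \<in> I" using j[OF iA A.M.zero_closed] iA by (simp add: A.M.minus_eq)
  moreover have "?u \<in> I" using I(3) uA A.A.one_closed A.A.l_one[OF uA] by (metis imageI subsetD)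
  ultimately have "?u \<oplus>\<^bsub>A\<^esub> i \<in> I" using VA.subspaceD(4)[OF I(1)] by blast
  then show False using I(4) VA.add_minus_cancel(3)[OF A.A.one_closed iA] by simp
qed

text \<open>Coinduction starts from left modules, so the irreducible right module \<open>A/I\<close>
  is replaced by its dual. A nonzero functional killed by \<open>fd_annihilator\<close> vanishes on
  the classes of the elements of that ideal, so the right ideal spanned by \<open>I\<close> and
  \<open>fd_annihilator\<close> is proper, and by maximality \<open>fd_annihilator\<close> lies in
  \<open>I\<close>.\<close>

lemma fd_annihilator_right_inverse:
  assumes fH: "fin H" 
    and hyp: "\<And>(M :: ('k, 'a set) module) rmul. irreducible_right_module K A M rmul \<Longrightarrow> finite_dimensional K M"
    and i: "i \<in> fd_annihilator"
  shows "\<exists>b\<in>carrier A. (\<one>\<^bsub>A\<^esub> \<ominus>\<^bsub>A\<^esub> i) \<cdot> b = \<one>\<^bsub>A\<^esub>"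
proof (rule ccontr)
  assume no: "\<not> ?thesis"
  have iA: "i \<in> carrier A" using i fd_annihilator_subset by blast
  let ?u = "\<one>\<^bsub>A\<^esub> \<ominus>\<^bsub>A\<^esub> i" and ?\<beta> = "\<lambda>a x. x \<cdot> a"
  have uA: "?u \<in> carrier A" using iA by simp
  have \<beta>: "bilinear_map K A A A ?\<beta>"
    using A_mult_bilinear by (auto simp: bilinear_map_def)
  let ?N = "(\<lambda>b. ?u \<cdot> b) ` carrier A"
  have N: "submodule ?N K A"
    by (rule linear_map_image_submodule[OF A_module A_module bilinear_map_right[OF A_mult_bilinear linear_map_id uA]])
  have Nst: "\<forall>a\<in>carrier A. \<forall>x\<in>?N. x \<cdot> a \<in> ?N"
    using uA by (auto simp: A.A.m_assoc)
  have N1: "\<one>\<^bsub>A\<^esub> \<notin> ?N" using no by (auto dest: sym)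
  obtain I where I: "submodule I K A" "\<forall>a\<in>carrier A. \<forall>x\<in>I. ?\<beta> a x \<in> I" "?N \<subseteq> I" "\<one>\<^bsub>A\<^esub> \<notin> I"
    and max: "\<forall>J. submodule J K A \<and> (\<forall>a\<in>carrier A. \<forall>x\<in>J. ?\<beta> a x \<in> J) \<and> I \<subseteq> J \<and> \<one>\<^bsub>A\<^esub> \<notin> J \<longrightarrow> J = I"
    by (rule VA.maximal_stable_subspace_family[OF N Nst N1], rule that)
  obtain W :: "('k, 'a set) module" and rm j where W: "module K W" "linear_map K A W j" "j ` carrier A = carrier W"
    and j: "\<And>x y. x \<in> carrier A \<Longrightarrow> y \<in> carrier A \<Longrightarrow> j x = j y \<longleftrightarrow> x \<ominus>\<^bsub>A\<^esub> y \<in> I"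
    and rm: "bilinear_map K A W W rm" "\<And>a x. a \<in> carrier A \<Longrightarrow> x \<in> carrier A \<Longrightarrow> rm a (j x) = j (?\<beta> a x)"
    and nz: "carrier W \<noteq> {\<zero>\<^bsub>W\<^esub>}"
    and irr: "\<forall>N. submodule N K W \<and> (\<forall>a\<in>carrier A. \<forall>x\<in>N. rm a x \<in> N) \<longrightarrow> N = {\<zero>\<^bsub>W\<^esub>} \<or> N = carrier W"
    by (rule quotient_by_maximal[OF A.unital_algebra_axioms \<beta> A.A.l_one I(1) bspec[OF bspec[OF I(2)]] I(4) max], assumption+, rule that)
  have VW: "vector_space K W" using W(1) by (simp add: vector_space_def H.K.field_axioms)
  interpret VW: vector_space K W by (rule VW)
  have rep: "\<exists>x\<in>carrier A. w = j x" if "w \<in> carrier W" for w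
    using that unfolding W(3)[symmetric] by blast
  have r1: "rm \<one>\<^bsub>A\<^esub> w = w" and rr: "a \<in> carrier A \<Longrightarrow> b \<in> carrier A \<Longrightarrow> rm b (rm a w) = rm (a \<cdot> b) w"
    if "w \<in> carrier W" for w a b
    using rep[OF that] by (auto simp: rm(2) A.A.m_assoc)
  have rc: "rm a w \<in> carrier W" if "a \<in> carrier A" "w \<in> carrier W" for a w by (rule bilinear_map_closed[OF rm(1) that])
  have "right_module K W A (\<lambda>w a. rm a w)"
    using rm(1) r1 rr W(1) by (intro right_module.intro right_module_axioms.intro) (auto simp: bilinear_map_def)
  then have "irreducible_right_module K A W (\<lambda>w a. rm a w)"
    using nz irr by (auto simp: irreducible_right_module_def)
  from hyp[OF this] have fW: "fin W" by (rule VW.finite_dimensional_fin_subspace)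
  let ?S = "scalar_module K" and ?D = "hom_module K W (scalar_module K)"
  have mS: "module K ?S" by (rule scalar_module_module[OF H.K.field_axioms])
  have mD: "module K ?D" by (rule hom_module_module[OF W(1) mS])
  interpret VD: vector_space K ?D using mD by (simp add: vector_space_def H.K.field_axioms)
  define lm where "lm a f = (\<lambda>w\<in>carrier W. f (rm a w))" for a and f :: "'a set \<Rightarrow> 'k"
  have fl: "functional K W f" if "f \<in> carrier ?D" for f using that by (simp add: hom_module_simps)
  have lc: "lm a f \<in> carrier ?D" if "a \<in> carrier A" "f \<in> carrier ?D" for a f
    unfolding lm_def
    by (rule hom_moduleI[OF W(1) linear_map_compose[OF bilinear_map_right[OF rm(1) linear_map_id that(1)] fl[OF that(2)]]])
  have lD: "left_module K ?D A lm"
  proof (intro left_module.intro left_module_axioms.intro mD)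
    show "bilinear_map K A ?D ?D lm"
    proof (rule bilinear_mapI)
      show "linear_map K ?D ?D (\<lambda>f. lm a f)" if a: "a \<in> carrier A" for a
        by (rule linear_map_into_hom[OF mD W(1) mS lc[OF a]]) (simp_all add: lm_def linear_map_eval rc a)
      show "linear_map K A ?D (\<lambda>a. lm a f)" if f: "f \<in> carrier ?D" for f
        by (rule linear_map_into_hom[OF A_module W(1) mS lc[OF _ f]])
           (simp_all add: lm_def linear_map_compose[OF bilinear_map_left[OF rm(1) linear_map_id] fl[OF f]])
    qed
    fix f assume f: "f \<in> carrier ?D"
    show "lm \<one>\<^bsub>A\<^esub> f = f"
      by (rule hom_module_eqI[OF lc[OF A.A.one_closed f] f]) (simp add: lm_def r1)
    show "lm a (lm b f) = lm (a \<cdot> b) f" if "a \<in> carrier A" "b \<in> carrier A" for a b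
      by (rule hom_module_eqI[OF lc[OF that(1) lc[OF that(2) f]] lc[OF _ f]]) (simp_all add: lm_def rc rr that)
  qed
  have "{\<phi> \<in> carrier ?D. \<forall>x\<in>carrier W. \<phi> x \<in> carrier ?S} = carrier ?D" by (auto simp: hom_module_app)
  then have fD: "fin ?D" using vdim_hom(1)[OF VW VW.vector_space_scalar fW VW.scalar_fin] by simp
  have nzD: "carrier ?D \<noteq> {\<zero>\<^bsub>?D\<^esub>}"
  proof -
    obtain w where w: "w \<in> carrier W" "w \<notin> {\<zero>\<^bsub>W\<^esub>}"
      using nz VW.subspaceD(3)[OF module.carrier_is_submodule[OF W(1)]] by blast
    obtain f where f: "functional K W f" "f w = \<one>\<^bsub>K\<^esub>"
      using VW.functional_separates[OF submodule_zero[OF W(1)] w] by blast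
    have "(\<lambda>x\<in>carrier W. f x) \<in> carrier ?D" by (rule hom_moduleI[OF W(1) f(1)])
    moreover have "(\<lambda>x\<in>carrier W. f x) \<noteq> \<zero>\<^bsub>?D\<^esub>"
      using f(2) w(1) by (auto dest!: fun_cong[of _ _ w] simp: hom_module_ev scalar_module_def)
    ultimately show ?thesis by blast
  qed
  interpret D: coinduced_module K H \<Delta> \<epsilon> S A act ?D lm by (rule coinduced_moduleI[OF lD])
  obtain f where f: "f \<in> carrier ?D" "f \<noteq> \<zero>\<^bsub>?D\<^esub>" "\<And>a. a \<in> fd_annihilator \<Longrightarrow> lm a f = \<zero>\<^bsub>?D\<^esub>"
    using D.fd_annihilator_kills[OF fH fD nzD] by blast
  have jW: "j x \<in> carrier W" if "x \<in> carrier A" for x by (rule linear_map_closed[OF W(2) that])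
  have fI: "f (j k) = \<zero>\<^bsub>?S\<^esub>" if k: "k \<in> fd_annihilator" for k
  proof -
    have kA: "k \<in> carrier A" using k fd_annihilator_subset by blast
    have "f (j k) = lm k f (j \<one>\<^bsub>A\<^esub>)" using kA jW by (simp add: lm_def rm(2))
    then show ?thesis using f(3)[OF k] jW by (simp add: hom_module_ev)
  qed
  have fj: "linear_map K A ?S (\<lambda>x. f (j x))" by (rule linear_map_compose[OF W(2) fl[OF f(1)]])
  have fm: "f (j x) = \<zero>\<^bsub>?S\<^esub>" if "x \<in> I" for x
  proof -
    have x: "x \<in> carrier A" using that VA.subspaceD(2)[OF I(1)] by blast
    then have "j x = j \<zero>\<^bsub>A\<^esub>" using j[OF x A.M.zero_closed] that by (simp add: A.M.minus_eq)
    then show ?thesis using linear_map_zero[OF A_module mS fj] by simp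
  qed
  let ?J = "I <+>\<^bsub>A\<^esub> fd_annihilator"
  note J = VA.subspace_sum[OF I(1) fd_annihilator_subspace]
  have Jst: "x \<cdot> a \<in> ?J" if xJ: "x \<in> ?J" and a: "a \<in> carrier A" for x a
  proof -
    obtain y k where yk: "y \<in> I" "k \<in> fd_annihilator" "x = y \<oplus>\<^bsub>A\<^esub> k" using xJ by (auto simp: set_add_def')
    have "x \<cdot> a = y \<cdot> a \<oplus>\<^bsub>A\<^esub> k \<cdot> a"
      using yk a VA.subspaceD(2)[OF I(1)] fd_annihilator_subset by (auto intro!: A.A.l_distr)
    moreover have "y \<cdot> a \<in> I" using I(2) yk(1) a by blast
    ultimately show ?thesis using VA.set_addI fd_annihilator_mult(2)[OF yk(2) a] by simp
  qed
  have fJ: "f (j x) = \<zero>\<^bsub>?S\<^esub>" if xJ: "x \<in> ?J" for x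
  proof -
    obtain y k where yk: "y \<in> I" "k \<in> fd_annihilator" "x = y \<oplus>\<^bsub>A\<^esub> k" using xJ by (auto simp: set_add_def')
    have "f (j (y \<oplus>\<^bsub>A\<^esub> k)) = f (j y) \<oplus>\<^bsub>?S\<^esub> f (j k)"
      by (rule linear_map_add[OF fj]) (use yk VA.subspaceD(2)[OF I(1)] fd_annihilator_subset in auto)
    then show ?thesis using fm[OF yk(1)] fI[OF yk(2)] yk(3) by (simp add: scalar_module_def)
  qed
  have "\<one>\<^bsub>A\<^esub> \<notin> ?J"
  proof
    assume "\<one>\<^bsub>A\<^esub> \<in> ?J"
    then have "x \<in> ?J" if "x \<in> carrier A" for x using Jst[of "\<one>\<^bsub>A\<^esub>" x] that by simp
    then have "f w = \<zero>\<^bsub>?S\<^esub>" if "w \<in> carrier W" for w using rep[OF that] fJ by auto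
    then have "f = \<zero>\<^bsub>?D\<^esub>"
      by (intro hom_module_eqI[OF f(1) VD.subspaceD(3)[OF module.carrier_is_submodule[OF mD]]]) (simp add: hom_module_ev)
    then show False using f(2) by contradiction
  qed
  then have "?J = I" using max J(1,2) Jst by blast
  then have "i \<in> I" using J(3) i by blast
  moreover have "?u \<in> I" using I(3) uA A.A.one_closed A.A.r_one[OF uA] by (metis imageI subsetD)
  ultimately have "?u \<oplus>\<^bsub>A\<^esub> i \<in> I" using VA.subspaceD(4)[OF I(1)] by blast
  then show False using I(4) VA.add_minus_cancel(3)[OF A.A.one_closed iA] by simp
qed

text \<open>A right inverse \<open>c\<close> of \<open>1 - i\<close> satisfies
  \<open>c = 1 + i c\<close>, which is again of the form \<open>1 - k\<close> with \<open>k\<close>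
  in the ideal. So \<open>c\<close> has a right inverse as well as the left inverse
  \<open>1 - i\<close>, and the two coincide.\<close>

lemma fd_annihilator_left_inverse:
  assumes fH: "fin H" 
    and hyp: "(\<forall>(M :: ('k, 'a set) module) rmul. irreducible_right_module K A M rmul \<longrightarrow> finite_dimensional K M) \<or>
      (\<forall>(M :: ('k, 'a set) module) lmul. irreducible_left_module K A M lmul \<longrightarrow> finite_dimensional K M)"
    and i: "i \<in> fd_annihilator"
  shows "\<exists>b\<in>carrier A. b \<cdot> (\<one>\<^bsub>A\<^esub> \<ominus>\<^bsub>A\<^esub> i) = \<one>\<^bsub>A\<^esub>"
  using hyp
proof
  assume "\<forall>(M :: ('k, 'a set) module) lmul. irreducible_left_module K A M lmul \<longrightarrow> finite_dimensional K M"
  then show ?thesis using fd_annihilator_left_inverse_left[OF fH _ i] by blast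
next
  assume r: "\<forall>(M :: ('k, 'a set) module) rmul. irreducible_right_module K A M rmul \<longrightarrow> finite_dimensional K M"
  have inv: "\<exists>b\<in>carrier A. (\<one>\<^bsub>A\<^esub> \<ominus>\<^bsub>A\<^esub> k) \<cdot> b = \<one>\<^bsub>A\<^esub>" if "k \<in> fd_annihilator" for k
    using fd_annihilator_right_inverse[OF fH _ that] r by blast
  note sub = VA.subspaceD[OF fd_annihilator_subspace]
  have iA: "i \<in> carrier A" by (rule sub(2)[OF i])
  let ?u = "\<one>\<^bsub>A\<^esub> \<ominus>\<^bsub>A\<^esub> i"
  have uA: "?u \<in> carrier A" using iA by simp
  obtain c where c: "c \<in> carrier A" "?u \<cdot> c = \<one>\<^bsub>A\<^esub>" using inv[OF i] by blast
  let ?k = "\<ominus>\<^bsub>A\<^esub> (i \<cdot> c)"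
  have k: "?k \<in> fd_annihilator" by (rule sub(5)[OF fd_annihilator_mult(2)[OF i c(1)]])
  have "c \<ominus>\<^bsub>A\<^esub> i \<cdot> c = \<one>\<^bsub>A\<^esub>"
    using c iA by (simp add: A.M.minus_eq A.A.l_distr A.A.l_minus)
  then have "\<one>\<^bsub>A\<^esub> \<ominus>\<^bsub>A\<^esub> ?k = c"
    using VA.add_minus_cancel(3)[of c "i \<cdot> c"] c(1) iA by (simp add: A.M.minus_eq A.M.minus_minus)
  then obtain d where d: "d \<in> carrier A" "c \<cdot> d = \<one>\<^bsub>A\<^esub>" using inv[OF k] by auto
  have "?u = (?u \<cdot> c) \<cdot> d" using uA c(1) d by (simp add: A.A.m_assoc)
  also have "\<dots> = d" using c(2) d(1) by simp
  finally show ?thesis using c(1) d(2) by auto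
qed

end

section \<open>The ideal generated by the annihilator of all finite-dimensional modules\<close>

context hopf_partial_action
begin

abbreviation e where "e \<equiv> pure \<one>\<^bsub>A\<^esub> \<one>\<^bsub>H\<^esub>"

interpretation VT: vector_space K AH.T by (rule AH_vector_space)
interpretation VA: vector_space K A by (rule A_vector_space)
interpretation VH: vector_space K H by (rule H.H_vector_space)

lemma e_closed [simp]: "e \<in> carrier AH.T"
  by simp

text \<open>The subspace \<open>I\<close> tensor \<open>H\<close> of \<open>A # H\<close>, with
  \<open>I = fd_annihilator\<close>, described through slices; \<open>FI_least\<close> justifies
  this for finite-dimensional \<open>H\<close>.\<close>

definition FI :: "('a \<times> 'h \<Rightarrow> 'k) set set"
  where "FI = {t \<in> carrier AH.T. \<forall>f. functional K H f \<longrightarrow> slice f t \<in> fd_annihilator}"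

lemma FI_closed: "t \<in> FI \<Longrightarrow> t \<in> carrier AH.T"
  by (simp add: FI_def)

lemma FI_subspace: "submodule FI K AH.T"
proof (rule VT.subspaceI)
  note I = VA.subspaceD[OF fd_annihilator_subspace]
  show "\<zero>\<^bsub>AH.T\<^esub> \<in> FI"
    using I(3) by (auto simp: FI_def linear_map_zero[OF AH_module A_module slice_linear])
  show "x \<oplus>\<^bsub>AH.T\<^esub> y \<in> FI" if "x \<in> FI" "y \<in> FI" for x y
    using that I(4) by (simp add: FI_def linear_map_add[OF slice_linear])
  show "c \<odot>\<^bsub>AH.T\<^esub> x \<in> FI" if "c \<in> carrier K" "x \<in> FI" for c x
    using that I(7) by (simp add: FI_def linear_map_smult[OF slice_linear])
qed (simp add: FI_def subset_iff)

lemma FI_pure: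
  assumes "i \<in> fd_annihilator" "h \<in> carrier H"
  shows "pure i h \<in> FI"
proof -
  have i: "i \<in> carrier A" using assms(1) fd_annihilator_subset by blast
  have "slice f (pure i h) \<in> fd_annihilator" if f: "functional K H f" for f
    using VA.subspaceD(7)[OF fd_annihilator_subspace, of "f h" i] linear_map_closed[OF f assms(2)] assms
    by (simp add: slice_pure[OF f i assms(2)] scalar_module_def)
  then show ?thesis using i assms(2) by (simp add: FI_def)
qed

text \<open>The expansion of \<open>h\<close> in a dual basis, with the coordinates moved across the
  tensor sign to the factor in \<open>A\<close>.\<close>

lemma slice_expansion:
  assumes fH: "fin H"
  obtains g f where "\<And>i. i < dim H \<Longrightarrow> g i \<in> carrier H" "\<And>i. i < dim H \<Longrightarrow> functional K H (f i)"
    "\<And>t. t \<in> carrier AH.T \<Longrightarrow> t = (\<Oplus>\<^bsub>AH.T\<^esub>i\<in>{..<dim H}. pure (slice (f i) t) (g i))"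
proof -
  obtain g f where g: "\<And>i. i < dim H \<Longrightarrow> g i \<in> carrier H" and f: "\<And>i. i < dim H \<Longrightarrow> functional K H (f i)"
    and "\<And>i j. i < dim H \<Longrightarrow> j < dim H \<Longrightarrow> f i (g j) = (if i = j then \<one>\<^bsub>K\<^esub> else \<zero>\<^bsub>K\<^esub>)"
    and gen: "\<And>x. x \<in> carrier H \<Longrightarrow> x = (\<Oplus>\<^bsub>H\<^esub>i\<in>{..<dim H}. f i x \<odot>\<^bsub>H\<^esub> g i)"
    using VH.dual_basis[OF fH] by blast
  have fK: "f i x \<in> carrier K" if "i < dim H" "x \<in> carrier H" for i x
    using linear_map_closed[OF f[OF that(1)] that(2)] by (simp add: scalar_module_def)
  let ?E = "\<lambda>t. \<Oplus>\<^bsub>AH.T\<^esub>i\<in>{..<dim H}. pure (slice (f i) t) (g i)"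
  have E: "t = ?E t" if t: "t \<in> carrier AH.T" for t
  proof (rule AH.tensor_linear_eqI[OF AH_module linear_map_id _ t])
    show "linear_map K AH.T AH.T ?E"
      by (rule finsum_linear_map[OF AH_module AH_module finite_lessThan])
         (auto intro!: bilinear_map_left[OF AH.pure_tensor_bilinear slice_linear] f g)
    fix a h assume a: "a \<in> carrier A" and h: "h \<in> carrier H"
    note pl = bilinear_map_right[OF AH.pure_tensor_bilinear linear_map_id a]
      and pl' = bilinear_map_left[OF AH.pure_tensor_bilinear linear_map_id]
    have "pure a h = pure a (\<Oplus>\<^bsub>H\<^esub>i\<in>{..<dim H}. f i h \<odot>\<^bsub>H\<^esub> g i)"
      by (rule arg_cong[OF gen[OF h]])
    also have "\<dots> = (\<Oplus>\<^bsub>AH.T\<^esub>i\<in>{..<dim H}. pure a (f i h \<odot>\<^bsub>H\<^esub> g i))"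
      by (rule linear_map_finsum[OF H.H_module AH_module pl]) (use fK g h in auto)
    also have "\<dots> = ?E (pure a h)"
    proof (rule VT.M.finsum_cong')
      show "(\<lambda>i. pure (slice (f i) (pure a h)) (g i)) \<in> {..<dim H} \<rightarrow> carrier AH.T"
        using linear_map_closed[OF slice_linear[OF f]] g a h by auto
      fix i assume "i \<in> {..<dim H}"
      then have i: "i < dim H" by simp
      show "pure a (f i h \<odot>\<^bsub>H\<^esub> g i) = pure (slice (f i) (pure a h)) (g i)"
        using linear_map_smult[OF pl fK[OF i h] g[OF i]] linear_map_smult[OF pl'[OF g[OF i]] fK[OF i h] a]
        by (simp add: slice_pure[OF f[OF i] a h])
    qed simp
    finally show "pure a h = ?E (pure a h)" .
  qed
  show thesis by (rule that[of g f], erule g, erule f, erule E)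
qed

lemma FI_least:
  assumes fH: "fin H" and N: "submodule N K AH.T" "\<And>i h. i \<in> fd_annihilator \<Longrightarrow> h \<in> carrier H \<Longrightarrow> pure i h \<in> N"
  shows "FI \<subseteq> N"
proof
  fix t assume t: "t \<in> FI"
  obtain g f where g: "\<And>i. i < dim H \<Longrightarrow> g i \<in> carrier H" and f: "\<And>i. i < dim H \<Longrightarrow> functional K H (f i)"
    and gen: "\<And>t. t \<in> carrier AH.T \<Longrightarrow> t = (\<Oplus>\<^bsub>AH.T\<^esub>i\<in>{..<dim H}. pure (slice (f i) t) (g i))"
    by (rule slice_expansion[OF fH], rule that)
  have p: "pure (slice (f i) t) (g i) \<in> N" if "i < dim H" for i
    using N(2) t f[OF that] g[OF that] by (simp add: FI_def)
  have "(\<Oplus>\<^bsub>AH.T\<^esub>i\<in>{..<dim H}. pure (slice (f i) t) (g i)) \<in> N"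
    by (rule VT.finsum_in_subspace[OF N(1)]) (use p in auto)
  then show "t \<in> N" by (subst gen[OF FI_closed[OF t]])
qed

text \<open>The coefficients of \<open>(a # h) (i # g)\<close> are \<open>a (h1 i)\<close>, which
  calls for stability of the ideal under \<open>H\<close>; those of \<open>(i # g) (a # h)\<close>
  are \<open>i (g1 a)\<close>.\<close>

lemma FI_mult:
  assumes fH: "fin H" and x: "x \<in> FI" and t: "t \<in> carrier AH.T"
  shows "t \<bullet> x \<in> FI" "x \<bullet> t \<in> FI"
proof -
  have sw: "H.sw AH.T \<beta> h \<in> FI" if "h \<in> carrier H" "\<And>p q. p \<in> carrier H \<Longrightarrow> q \<in> carrier H \<Longrightarrow> \<beta> p q \<in> FI" for \<beta> h
    by (rule tensor_lift_in_submodule[OF H.H_module H.H_module AH_module FI_subspace H.comult_closed[OF that(1)] that(2)])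
  have IA: "i \<in> carrier A" if "i \<in> fd_annihilator" for i using that fd_annihilator_subset by blast
  have L: "pure a h \<bullet> pure i g \<in> FI" and R: "pure i g \<bullet> pure a h \<in> FI"
    if "a \<in> carrier A" "h \<in> carrier H" "i \<in> fd_annihilator" "g \<in> carrier H" for a h i g
    using that IA[OF that(3)]
    by (simp_all add: smash_pure sw FI_pure fd_annihilator_mult fd_annihilator_act)
  have L': "t \<bullet> pure i g \<in> FI \<and> pure i g \<bullet> t \<in> FI" if i: "i \<in> fd_annihilator" and g: "g \<in> carrier H" for i g
  proof -
    have p: "pure i g \<in> carrier AH.T" using IA[OF i] g by simp
    have "carrier AH.T \<subseteq> {t \<in> carrier AH.T. t \<bullet> pure i g \<in> FI}"
      by (rule AH.tensor_span[OF linear_map_vimage_submodule[OF AH_module AH_module smash_left_linear[OF p] FI_subspace]])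
         (simp add: L i g)
    moreover have "carrier AH.T \<subseteq> {t \<in> carrier AH.T. pure i g \<bullet> t \<in> FI}"
      by (rule AH.tensor_span[OF linear_map_vimage_submodule[OF AH_module AH_module smash_right_linear[OF p] FI_subspace]])
         (simp add: R i g)
    ultimately show ?thesis using t by blast
  qed
  have "FI \<subseteq> {x \<in> carrier AH.T. t \<bullet> x \<in> FI}"
    by (rule FI_least[OF fH linear_map_vimage_submodule[OF AH_module AH_module smash_right_linear[OF t] FI_subspace]])
       (simp add: L' IA)
  moreover have "FI \<subseteq> {x \<in> carrier AH.T. x \<bullet> t \<in> FI}"
    by (rule FI_least[OF fH linear_map_vimage_submodule[OF AH_module AH_module smash_left_linear[OF t] FI_subspace]])
       (simp add: L' IA)
  ultimately show "t \<bullet> x \<in> FI" "x \<bullet> t \<in> FI" using x by blast+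
qed

text \<open>Nakayama's lemma by hand. As a left \<open>A\<close>-module the partial smash product is
  generated by the elements \<open>\<gamma> j\<close>, and it is the sum of \<open>N\<close>, the
  left ideal generated by \<open>e - x\<close>, and of all \<open>I \<gamma> j\<close> with
  \<open>I = fd_annihilator\<close>. The latter are removed from the top:
  \<open>\<gamma> k = s + i \<gamma> k\<close> gives \<open>(1 - i) \<gamma> k = s\<close>, and a
  left inverse of \<open>1 - i\<close> puts \<open>\<gamma> k\<close> into the smaller sum.\<close>

lemma FI_left_inverse:
  assumes fH: "fin H" and inv: "\<And>i. i \<in> fd_annihilator \<Longrightarrow> \<exists>b\<in>carrier A. b \<cdot> (\<one>\<^bsub>A\<^esub> \<ominus>\<^bsub>A\<^esub> i) = \<one>\<^bsub>A\<^esub>"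
    and x: "x \<in> FI" "x \<bullet> e = x"
  shows "\<exists>y\<in>carrier AH.T. y \<bullet> e = y \<and> y \<bullet> (e \<ominus>\<^bsub>AH.T\<^esub> x) = e"
proof -
  have xT: "x \<in> carrier AH.T" by (rule FI_closed[OF x(1)])
  let ?u = "e \<ominus>\<^bsub>AH.T\<^esub> x"
  have uT: "?u \<in> carrier AH.T" using xT by simp
  have IA: "i \<in> carrier A" if "i \<in> fd_annihilator" for i using that fd_annihilator_subset by blast
  obtain g f where g: "\<And>i. i < dim H \<Longrightarrow> g i \<in> carrier H" and f: "\<And>i. i < dim H \<Longrightarrow> functional K H (f i)"
    and gen: "\<And>t. t \<in> carrier AH.T \<Longrightarrow> t = (\<Oplus>\<^bsub>AH.T\<^esub>i\<in>{..<dim H}. pure (slice (f i) t) (g i))"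
    by (rule slice_expansion[OF fH], rule that)
  define N where "N = (\<lambda>t. t \<bullet> ?u) ` carrier AH.T"
  define \<gamma> where "\<gamma> j = pure \<one>\<^bsub>A\<^esub> (g j) \<bullet> e" for j
  define B where "B j = (\<lambda>i. pure i \<one>\<^bsub>H\<^esub> \<bullet> \<gamma> j) ` fd_annihilator" for j
  \<comment> \<open>\<open>S k\<close> keeps the first \<open>k\<close> of the summands
    \<open>B j\<close>, so \<open>S 0\<close> is \<open>N\<close>.\<close>
  define S where "S k = rec_nat N (\<lambda>j X. X <+>\<^bsub>AH.T\<^esub> B j) k" for k
  have S: "S 0 = N" "S (Suc k) = S k <+>\<^bsub>AH.T\<^esub> B k" for k by (simp_all add: S_def)
  have \<gamma>T: "\<gamma> j \<in> carrier AH.T" if "j < dim H" for j using g[OF that] by (simp add: \<gamma>_def)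
  have \<gamma>e: "\<gamma> j \<bullet> e = \<gamma> j" if "j < dim H" for j
    using g[OF that] by (simp add: \<gamma>_def smash_assoc smash_one_left)
  have sN: "submodule N K AH.T"
    unfolding N_def by (rule linear_map_image_submodule[OF AH_module AH_module smash_left_linear[OF uT]])
  have pl: "linear_map K A AH.T (\<lambda>a. pure a \<one>\<^bsub>H\<^esub> \<bullet> s)" if "s \<in> carrier AH.T" for s
    by (rule linear_map_compose[OF bilinear_map_left[OF AH.pure_tensor_bilinear linear_map_id H.A.one_closed] smash_left_linear[OF that]])
  have sB: "submodule (B j) K AH.T" if "j < dim H" for j
  proof -
    have mI: "module K (A\<lparr>carrier := fd_annihilator\<rparr>)"
      by (rule submodule.submodule_is_module[OF fd_annihilator_subspace A_module])
    have "linear_map K (A\<lparr>carrier := fd_annihilator\<rparr>) AH.T (\<lambda>i. pure i \<one>\<^bsub>H\<^esub> \<bullet> \<gamma> j)"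
      using pl[OF \<gamma>T[OF that]] IA by (auto simp: linear_map_def)
    from linear_map_image_submodule[OF mI AH_module this] show ?thesis by (simp add: B_def)
  qed
  have sS: "submodule (S k) K AH.T" if "k \<le> dim H" for k
    using that by (induction k) (simp_all add: S sN VT.subspace_sum(1) sB)
  have act: "pure a \<one>\<^bsub>H\<^esub> \<bullet> s \<in> S k" if a: "a \<in> carrier A" and "s \<in> S k" "k \<le> dim H" for a s k
    using that(2,3)
  proof (induction k arbitrary: s)
    case 0
    then obtain t where t: "t \<in> carrier AH.T" "s = t \<bullet> ?u" by (auto simp: S N_def)
    then have "pure a \<one>\<^bsub>H\<^esub> \<bullet> s = (pure a \<one>\<^bsub>H\<^esub> \<bullet> t) \<bullet> ?u" using a uT by (simp add: smash_assoc)
    then show ?case using t(1) a by (auto simp: S N_def)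
  next
    case (Suc k)
    then obtain s' i where si: "s' \<in> S k" "i \<in> fd_annihilator" "s = s' \<oplus>\<^bsub>AH.T\<^esub> pure i \<one>\<^bsub>H\<^esub> \<bullet> \<gamma> k"
      by (auto simp: S set_add_def' B_def)
    have k: "k < dim H" using Suc.prems by simp
    have s'T: "s' \<in> carrier AH.T" using VT.subspaceD(2)[OF sS si(1)] k by simp
    have aT: "pure a \<one>\<^bsub>H\<^esub> \<in> carrier AH.T" and iT: "pure i \<one>\<^bsub>H\<^esub> \<in> carrier AH.T" using a IA[OF si(2)] by simp_all
    have "pure a \<one>\<^bsub>H\<^esub> \<bullet> s = pure a \<one>\<^bsub>H\<^esub> \<bullet> s' \<oplus>\<^bsub>AH.T\<^esub> pure a \<one>\<^bsub>H\<^esub> \<bullet> (pure i \<one>\<^bsub>H\<^esub> \<bullet> \<gamma> k)"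
      unfolding si(3) by (rule linear_map_add[OF smash_right_linear[OF aT] s'T]) (use iT \<gamma>T[OF k] in simp)
    also have "pure a \<one>\<^bsub>H\<^esub> \<bullet> (pure i \<one>\<^bsub>H\<^esub> \<bullet> \<gamma> k) = pure (a \<cdot> i) \<one>\<^bsub>H\<^esub> \<bullet> \<gamma> k"
      using smash_assoc[OF aT iT \<gamma>T[OF k]] pure_one_mult[OF a IA[OF si(2)] H.A.one_closed] by simp
    finally show ?case
      using Suc.IH[OF si(1)] k fd_annihilator_mult(1)[OF si(2) a] unfolding S
      by (auto intro!: VT.set_addI simp: B_def)
  qed
  \<comment> \<open>\<open>r\<close> is split as \<open>r (e - x) + r x\<close>. The second part
    lies in \<open>FI\<close>, and its slices are the coefficients at the
    \<open>\<gamma> j\<close>.\<close>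
  have top: "r \<in> S (dim H)" if r: "r \<in> carrier AH.T" "r \<bullet> e = r" for r
  proof -
    have rx: "r \<bullet> x \<in> FI" by (rule FI_mult(1)[OF fH x(1) r(1)])
    then have rxT: "r \<bullet> x \<in> carrier AH.T" by (rule FI_closed)
    let ?c = "\<lambda>j. slice (f j) (r \<bullet> x)"
    have c: "?c j \<in> fd_annihilator" if "j < dim H" for j using rx f[OF that] by (simp add: FI_def)
    have pc: "pure (?c j) (g j) \<in> carrier AH.T" if "j < dim H" for j using IA[OF c[OF that]] g[OF that] by simp
    have pg: "pure (?c j) (g j) \<bullet> e = pure (?c j) \<one>\<^bsub>H\<^esub> \<bullet> \<gamma> j" if "j < dim H" for j
      using pure_one_mult[OF IA[OF c[OF that]] A.A.one_closed g[OF that]] IA[OF c[OF that]] g[OF that]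
      by (simp add: \<gamma>_def flip: smash_assoc)
    have "r \<bullet> x = (r \<bullet> x) \<bullet> e" using r(1) xT x(2) by (simp add: smash_assoc)
    also have "\<dots> = (\<Oplus>\<^bsub>AH.T\<^esub>j\<in>{..<dim H}. pure (?c j) (g j)) \<bullet> e"
      by (rule arg_cong[OF gen[OF rxT]])
    also have "\<dots> = (\<Oplus>\<^bsub>AH.T\<^esub>j\<in>{..<dim H}. pure (?c j) (g j) \<bullet> e)"
      by (rule linear_map_finsum[OF AH_module AH_module smash_left_linear[OF e_closed]]) (use pc in auto)
    finally have rxe: "r \<bullet> x = (\<Oplus>\<^bsub>AH.T\<^esub>j\<in>{..<dim H}. pure (?c j) (g j) \<bullet> e)" .
    have ru: "r = r \<bullet> ?u \<oplus>\<^bsub>AH.T\<^esub> r \<bullet> x"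
      using linear_map_minus[OF AH_module AH_module smash_right_linear[OF r(1)] e_closed xT] r(2)
        VT.add_minus_cancel(3)[OF r(1) rxT] by simp
    have "r \<bullet> ?u \<oplus>\<^bsub>AH.T\<^esub> (\<Oplus>\<^bsub>AH.T\<^esub>j\<in>{..<k}. pure (?c j) (g j) \<bullet> e) \<in> S k" if "k \<le> dim H" for k
      using that
    proof (induction k)
      case 0
      then show ?case using r(1) uT by (auto simp: S N_def)
    next
      case (Suc k)
      have fs: "(\<lambda>j. pure (?c j) (g j) \<bullet> e) \<in> {..<k} \<rightarrow> carrier AH.T" and k: "k < dim H"
        using pc Suc.prems by auto
      have kT: "pure (?c k) (g k) \<bullet> e \<in> carrier AH.T" using pc[OF k] by simp
      have "r \<bullet> ?u \<oplus>\<^bsub>AH.T\<^esub> (\<Oplus>\<^bsub>AH.T\<^esub>j\<in>{..<Suc k}. pure (?c j) (g j) \<bullet> e) =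
        (r \<bullet> ?u \<oplus>\<^bsub>AH.T\<^esub> (\<Oplus>\<^bsub>AH.T\<^esub>j\<in>{..<k}. pure (?c j) (g j) \<bullet> e)) \<oplus>\<^bsub>AH.T\<^esub> pure (?c k) (g k) \<bullet> e"
        using fs kT r(1) uT VT.M.finsum_closed[OF fs] by (simp add: lessThan_Suc VT.M.a_ac)
      then show ?case
        using Suc pg[OF k] c[OF k] by (auto simp: S B_def intro!: VT.set_addI)
    qed
    from this[of "dim H"] show ?thesis using ru rxe by simp
  qed
  have down: "r \<in> S (dim H - k)" if "r \<in> carrier AH.T" "r \<bullet> e = r" "k \<le> dim H" for r k
    using that
  proof (induction k arbitrary: r)
    case 0
    then show ?case using top by simp
  next
    case (Suc k)
    let ?j = "dim H - Suc k"
    have j: "?j < dim H" and Sj: "dim H - k = Suc ?j" using Suc.prems by simp_all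
    have "\<gamma> ?j \<in> S (Suc ?j)" using Suc.IH[OF \<gamma>T[OF j] \<gamma>e[OF j]] Suc.prems(3) by (simp add: Sj)
    then obtain s i where si: "s \<in> S ?j" "i \<in> fd_annihilator" "\<gamma> ?j = s \<oplus>\<^bsub>AH.T\<^esub> pure i \<one>\<^bsub>H\<^esub> \<bullet> \<gamma> ?j"
      by (auto simp: S set_add_def' B_def)
    have sT: "s \<in> carrier AH.T" using VT.subspaceD(2)[OF sS si(1)] j by simp
    obtain b where b: "b \<in> carrier A" "b \<cdot> (\<one>\<^bsub>A\<^esub> \<ominus>\<^bsub>A\<^esub> i) = \<one>\<^bsub>A\<^esub>" using inv[OF si(2)] by blast
    have iA: "i \<in> carrier A" by (rule IA[OF si(2)])
    have ig: "pure i \<one>\<^bsub>H\<^esub> \<bullet> \<gamma> ?j \<in> carrier AH.T" using iA \<gamma>T[OF j] by simp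
    have "pure (\<one>\<^bsub>A\<^esub> \<ominus>\<^bsub>A\<^esub> i) \<one>\<^bsub>H\<^esub> \<bullet> \<gamma> ?j = \<gamma> ?j \<ominus>\<^bsub>AH.T\<^esub> pure i \<one>\<^bsub>H\<^esub> \<bullet> \<gamma> ?j"
      using linear_map_minus[OF A_module AH_module pl[OF \<gamma>T[OF j]] A.A.one_closed iA] smash_one_left[OF \<gamma>T[OF j]] by simp
    also have "\<dots> = s" using VT.add_minus_cancel(2)[OF sT ig] si(3) by simp
    finally have s: "s = pure (\<one>\<^bsub>A\<^esub> \<ominus>\<^bsub>A\<^esub> i) \<one>\<^bsub>H\<^esub> \<bullet> \<gamma> ?j" ..
    have "pure b \<one>\<^bsub>H\<^esub> \<bullet> s = (pure b \<one>\<^bsub>H\<^esub> \<bullet> pure (\<one>\<^bsub>A\<^esub> \<ominus>\<^bsub>A\<^esub> i) \<one>\<^bsub>H\<^esub>) \<bullet> \<gamma> ?j"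
      unfolding s by (rule smash_assoc[symmetric]) (use b(1) iA \<gamma>T[OF j] in simp_all)
    also have "\<dots> = \<gamma> ?j"
      using pure_one_mult[OF b(1) _ H.A.one_closed, of "\<one>\<^bsub>A\<^esub> \<ominus>\<^bsub>A\<^esub> i"] iA by (simp add: b(2) smash_one_left[OF \<gamma>T[OF j]])
    finally have \<gamma>S: "\<gamma> ?j \<in> S ?j" using act[OF b(1) si(1)] j by simp
    have "S (Suc ?j) \<subseteq> S ?j"
      unfolding S(2)
    proof (rule VT.subspace_sum_least[OF sS])
      show "B ?j \<subseteq> S ?j" using act[OF IA \<gamma>S] j by (auto simp: B_def)
    qed (use j in auto)
    then show ?case using Suc.IH[OF Suc.prems(1,2)] Suc.prems(3) by (auto simp: Sj)
  qed
  have "e \<in> N" using down[of e "dim H"] by (simp add: S smash_one_left)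
  then obtain y where y: "y \<in> carrier AH.T" "y \<bullet> ?u = e" by (auto simp: N_def)
  have "(y \<bullet> e) \<bullet> ?u = e" using y uT by (simp add: smash_assoc smash_one_left)
  moreover have "(y \<bullet> e) \<bullet> e = y \<bullet> e" using y(1) by (simp add: smash_assoc smash_one_left)
  ultimately show ?thesis using y(1) by (intro bexI[of _ "y \<bullet> e"]) simp_all
qed

text \<open>The left inverse \<open>y\<close> equals \<open>e + y x\<close>, again of the form
  \<open>e - x'\<close> with \<open>x'\<close> in \<open>FI\<close>, so it has a left inverse
  \<open>z\<close> itself. Then \<open>z e = e - x\<close>, and multiplying by \<open>y\<close>
  gives \<open>e\<close>. The factor \<open>e\<close> behind \<open>z\<close> stays because
  \<open>e\<close> is an identity of \<open>A # H\<close> from the left.\<close>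

lemma FI_right_inverse:
  assumes fH: "fin H" and inv: "\<And>i. i \<in> fd_annihilator \<Longrightarrow> \<exists>b\<in>carrier A. b \<cdot> (\<one>\<^bsub>A\<^esub> \<ominus>\<^bsub>A\<^esub> i) = \<one>\<^bsub>A\<^esub>"
    and x: "x \<in> FI" "x \<bullet> e = x"
  shows "\<exists>y\<in>carrier AH.T. (e \<ominus>\<^bsub>AH.T\<^esub> x) \<bullet> y = e"
proof -
  have xT: "x \<in> carrier AH.T" by (rule FI_closed[OF x(1)])
  let ?u = "e \<ominus>\<^bsub>AH.T\<^esub> x"
  have uT: "?u \<in> carrier AH.T" using xT by simp
  obtain y where y: "y \<in> carrier AH.T" "y \<bullet> e = y" "y \<bullet> ?u = e"
    using FI_left_inverse[OF fH inv x] by blast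
  have yx: "y \<bullet> x \<in> carrier AH.T" using y(1) xT by simp
  let ?x = "\<ominus>\<^bsub>AH.T\<^esub> (y \<bullet> x)"
  have x': "?x \<in> FI" by (rule VT.subspaceD(5)[OF FI_subspace FI_mult(1)[OF fH x(1) y(1)]])
  have neg: "?x = \<zero>\<^bsub>AH.T\<^esub> \<ominus>\<^bsub>AH.T\<^esub> y \<bullet> x" using yx by (simp add: VT.M.minus_eq)
  have "?x \<bullet> e = ?x"
    unfolding neg
    using linear_map_minus[OF AH_module AH_module smash_left_linear[OF e_closed] VT.subspaceD(3)[OF FI_subspace, THEN FI_closed] yx]
      linear_map_zero[OF AH_module AH_module smash_left_linear[OF e_closed]] x(2) y(1) xT
    by (simp add: smash_assoc)
  from FI_left_inverse[OF fH inv x' this]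
  obtain z where z: "z \<in> carrier AH.T" "z \<bullet> (e \<ominus>\<^bsub>AH.T\<^esub> ?x) = e" by blast
  have "y \<ominus>\<^bsub>AH.T\<^esub> y \<bullet> x = e"
    using linear_map_minus[OF AH_module AH_module smash_right_linear[OF y(1)] e_closed xT] y(2,3) by simp
  then have "e \<ominus>\<^bsub>AH.T\<^esub> ?x = y"
    using VT.add_minus_cancel(3)[OF y(1) yx] yx by (simp add: VT.M.minus_eq VT.M.minus_minus)
  then have zy: "z \<bullet> y = e" using z(2) by simp
  have "z \<bullet> e = (z \<bullet> y) \<bullet> ?u" using z(1) y uT by (simp add: smash_assoc)
  also have "\<dots> = ?u" using zy uT by (simp add: smash_one_left)
  finally have "?u \<bullet> y = (z \<bullet> e) \<bullet> y" by simp
  also have "\<dots> = e" using z(1) y(1) zy by (simp add: smash_assoc smash_one_left)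
  finally show ?thesis using y(1) by blast
qed

end

section \<open>Right partial modules\<close>

context hopf_partial_action
begin

interpretation VT: vector_space K AH.T by (rule AH_vector_space)

text \<open>If \<open>n = m i\<close> were nonzero, it would generate \<open>M\<close>, so that
  \<open>m = n t = m x\<close> with \<open>x = (i # 1) t e\<close> in \<open>FI\<close>. Since
  \<open>e - x\<close> has a right inverse, \<open>m (e - x) = 0\<close> forces
  \<open>m = 0\<close>.\<close>

lemma fd_annihilator_kills_right:
  fixes M :: "('k, 'm) module"
  assumes fH: "fin H" and inv: "\<And>i. i \<in> fd_annihilator \<Longrightarrow> \<exists>b\<in>carrier A. b \<cdot> (\<one>\<^bsub>A\<^esub> \<ominus>\<^bsub>A\<^esub> i) = \<one>\<^bsub>A\<^esub>"
    and irr: "irreducible_right_partial_module K H \<Delta> A act M rmul pact"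
    and i: "i \<in> fd_annihilator" and m: "m \<in> carrier M"
  shows "rmul m i = \<zero>\<^bsub>M\<^esub>"
proof (rule ccontr)
  assume nz: "rmul m i \<noteq> \<zero>\<^bsub>M\<^esub>"
  have iA: "i \<in> carrier A" using i fd_annihilator_subset by blast
  interpret M: right_partial_module K M A rmul H \<Delta> act pact
    using irr by (simp add: irreducible_right_partial_module_def)
  have mM: "module K M" by (rule M.module_axioms)
  note rc = bilinear_map_closed[OF M.rmul_bilinear] and pc = bilinear_map_closed[OF M.pact_bilinear]
  note ml = lin bilinear_map_left[OF M.rmul_bilinear] bilinear_map_right[OF M.rmul_bilinear]
    bilinear_map_left[OF M.pact_bilinear] bilinear_map_right[OF M.pact_bilinear]
  \<comment> \<open>The right-handed counterpart of \<open>tact\<close>; again the compatibility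
    axiom is the product rule on pure tensors.\<close>
  define rten where "rten n t = tensor_lift K M (\<lambda>a h. pact (rmul n a) h) t" for n t
  have b: "bilinear_map K A H M (\<lambda>a h. pact (rmul n a) h)" if "n \<in> carrier M" for n
    by (intro bilinear_mapI ml; simp add: that rc)
  have rp: "rten n (pure a h) = pact (rmul n a) h" if "n \<in> carrier M" "a \<in> carrier A" "h \<in> carrier H" for n a h
    unfolding rten_def by (rule tensor_lift_pure_tensor[OF A_module H.H_module mM b[OF that(1)] that(2,3)])
  have rb: "bilinear_map K M AH.T M rten"
    unfolding rten_def
  proof (rule bilinear_mapI)
    show "linear_map K AH.T M (\<lambda>t. tensor_lift K M (\<lambda>a h. pact (rmul n a) h) t)" if "n \<in> carrier M" for n
      by (rule tensor_lift_linear[OF A_module H.H_module mM b[OF that]])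
    show "linear_map K M M (\<lambda>n. tensor_lift K M (\<lambda>a h. pact (rmul n a) h) t)" if "t \<in> carrier AH.T" for t
      by (rule tensor_lift_param_linear[OF A_module H.H_module mM mM that]) (intro ml linear_map_id; simp)
  qed
  note rl = bilinear_map_left[OF rb linear_map_id] bilinear_map_right[OF rb linear_map_id]
  have rtc: "rten n t \<in> carrier M" if "n \<in> carrier M" "t \<in> carrier AH.T" for n t by (rule bilinear_map_closed[OF rb that])
  have rmult: "rten (rten n s) t = rten n (s \<bullet> t)" if n: "n \<in> carrier M" and st: "s \<in> carrier AH.T" "t \<in> carrier AH.T" for n s t
  proof (rule AH_bilinear_eqI[OF mM _ _ st, of "\<lambda>s t. rten (rten n s) t"])
    show "bilinear_map K AH.T AH.T M (\<lambda>s t. rten (rten n s) t)"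
      by (intro bilinear_mapI bilinear_map_left[OF rb] rl) (simp_all add: n rtc)
    show "bilinear_map K AH.T AH.T M (\<lambda>s t. rten n (s \<bullet> t))"
      by (intro bilinear_mapI bilinear_map_right[OF rb] smash_left_linear smash_right_linear) (simp_all add: n)
    fix a h c k assume *: "a \<in> carrier A" "h \<in> carrier H" "c \<in> carrier A" "k \<in> carrier H"
    have "rten n (pure a h \<bullet> pure c k) = H.sw M (\<lambda>h1 h2. rten n (pure (a \<cdot> act h1 c) (h2 \<star> k))) h"
      unfolding smash_pure[OF *]
      by (rule H.sw_comp[OF AH_module mM rl(2)[OF n] *(2)]) (simp add: *)
    also have "\<dots> = H.sw M (\<lambda>h1 h2. pact (rmul (rmul n a) (act h1 c)) (h2 \<star> k)) h"
      by (rule H.sw_cong[OF mM *(2)]) (simp_all add: * n rp rc pc rtc M.rmul_mult)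
    also have "\<dots> = rten (rten n (pure a h)) (pure c k)"
      using M.pact_rmul_pact[of "rmul n a" c h k] * n by (simp add: rp rc pc)
    finally show "rten (rten n (pure a h)) (pure c k) = rten n (pure a h \<bullet> pure c k)" ..
  qed
  have re: "rten n e = n" if "n \<in> carrier M" for n using that by (simp add: rp M.rmul_one M.pact_one)
  let ?n = "rmul m i" and ?O = "(\<lambda>t. rten (rmul m i) t) ` carrier AH.T"
  have nM: "?n \<in> carrier M" by (rule rc[OF m iA])
  have "?O = {\<zero>\<^bsub>M\<^esub>} \<or> ?O = carrier M"
  proof -
    have "submodule ?O K M" by (rule linear_map_image_submodule[OF AH_module mM rl(2)[OF nM]])
    moreover have "rmul v a \<in> ?O" if v: "v \<in> ?O" and a: "a \<in> carrier A" for v a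
    proof -
      obtain t where t: "t \<in> carrier AH.T" "v = rten ?n t" using v by blast
      have "rmul v a = rten ?n (t \<bullet> pure a \<one>\<^bsub>H\<^esub>)"
        using t a nM rtc by (simp add: rp rc M.pact_one flip: rmult)
      then show ?thesis using t a by simp
    qed
    moreover have "pact v h \<in> ?O" if v: "v \<in> ?O" and h: "h \<in> carrier H" for v h
    proof -
      obtain t where t: "t \<in> carrier AH.T" "v = rten ?n t" using v by blast
      have "pact v h = rten ?n (t \<bullet> pure \<one>\<^bsub>A\<^esub> h)"
        using t h nM rtc by (simp add: rp rc M.rmul_one flip: rmult)
      then show ?thesis using t h by simp
    qed
    ultimately show ?thesis using irr by (simp add: irreducible_right_partial_module_def)
  qed
  moreover have "?n \<in> ?O" using imageI[OF e_closed, of "rten ?n"] by (simp add: re[OF nM])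
  ultimately have "m \<in> ?O" using nz m by (metis singletonD)
  then obtain t where t: "t \<in> carrier AH.T" "m = rten ?n t" by (elim imageE)
  have pi: "pure i \<one>\<^bsub>H\<^esub> \<in> carrier AH.T" using iA by simp
  let ?x = "pure i \<one>\<^bsub>H\<^esub> \<bullet> t \<bullet> e"
  have x: "?x \<in> FI"
    using FI_mult(2)[OF fH FI_mult(2)[OF fH FI_pure[OF i H.A.one_closed] t(1)] e_closed] .
  have xT: "?x \<in> carrier AH.T" by (rule FI_closed[OF x])
  have xe: "?x \<bullet> e = ?x" using pi t(1) by (simp add: smash_assoc smash_one_left)
  obtain y where y: "y \<in> carrier AH.T" "(e \<ominus>\<^bsub>AH.T\<^esub> ?x) \<bullet> y = e"
    using FI_right_inverse[OF fH inv x xe] by blast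
  have "rten m (pure i \<one>\<^bsub>H\<^esub>) = ?n" using m iA nM by (simp add: rp M.pact_one)
  then have "rten m ?x = m" using m pi t by (simp add: re rtc nM flip: rmult)
  moreover have "rten m (e \<ominus>\<^bsub>AH.T\<^esub> ?x) = rten m e \<ominus>\<^bsub>M\<^esub> rten m ?x"
    by (rule linear_map_minus[OF AH_module mM rl(2)[OF m] e_closed xT])
  ultimately have "rten m (e \<ominus>\<^bsub>AH.T\<^esub> ?x) = \<zero>\<^bsub>M\<^esub>" using re[OF m] m by (simp add: M.M.minus_eq M.M.r_neg)
  then have "rten (rten m (e \<ominus>\<^bsub>AH.T\<^esub> ?x)) y = \<zero>\<^bsub>M\<^esub>"
    using linear_map_zero[OF mM mM rl(1)[OF y(1)]] by simp
  then have "m = \<zero>\<^bsub>M\<^esub>" using rmult[OF m _ y(1), of "e \<ominus>\<^bsub>AH.T\<^esub> ?x"] xT y(2) re[OF m] by simp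
  then have "?n = \<zero>\<^bsub>M\<^esub>"
    using linear_map_zero[OF mM mM bilinear_map_left[OF M.rmul_bilinear linear_map_id iA]] by simp
  then show False using nz by contradiction
qed

text \<open>A faithful irreducible module of the quotient, pulled back to \<open>A\<close>, is an
  irreducible partial module there. \<open>fd_annihilator_kills_right\<close> applies to it, and
  faithfulness makes the image of \<open>fd_annihilator\<close> in the quotient zero.\<close>

lemma fd_annihilator_subset_primitive:
  assumes fH: "fin H" and inv: "\<And>i. i \<in> fd_annihilator \<Longrightarrow> \<exists>b\<in>carrier A. b \<cdot> (\<one>\<^bsub>A\<^esub> \<ominus>\<^bsub>A\<^esub> i) = \<one>\<^bsub>A\<^esub>"
    and I: "right_H_primitive K H \<Delta> A act I"
  shows "fd_annihilator \<subseteq> I"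
proof -
  let ?Q = "quotient_module A I" and ?act = "quotient_action A act I" and ?q = "\<lambda>a. I +>\<^bsub>A\<^esub> a"
  interpret I: ideal I A using I by (simp add: right_H_primitive_def)
  have Iact: "act h a \<in> I" if "h \<in> carrier H" "a \<in> I" for h a
    using I that by (simp add: right_H_primitive_def)
  obtain M :: "('k, ('a set \<times> 'h \<Rightarrow> 'k) set) module" and rmul pact where
    irr: "irreducible_right_partial_module K H \<Delta> ?Q ?act M rmul pact" and faith: "faithful_right_module ?Q M rmul"
    using I by (auto simp: right_H_primitive_def)
  interpret M: right_partial_module K M ?Q rmul H \<Delta> ?act pact
    using irr by (simp add: irreducible_right_partial_module_def)
  have mM: "module K M" by (rule M.module_axioms)
  have sI: "submodule I K A"
  proof (rule A.submoduleI)
    show "c \<odot>\<^bsub>A\<^esub> x \<in> I" if "c \<in> carrier K" "x \<in> I" for c x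
    proof -
      have "c \<odot>\<^bsub>A\<^esub> x = (c \<odot>\<^bsub>A\<^esub> \<one>\<^bsub>A\<^esub>) \<cdot> x"
        using that I.a_subset by (simp add: A.smult_mult_left subset_iff)
      then show ?thesis using I.I_l_closed[OF that(2), of "c \<odot>\<^bsub>A\<^esub> \<one>\<^bsub>A\<^esub>"] that(1) by simp
    qed
  qed (use I.a_subset I.a_closed in auto)
  note q = quotient_module_module[OF A_module sI]
  note qc = quotient_module_carrier[of A I]
  have qcl: "?q a \<in> carrier ?Q" if "a \<in> carrier A" for a using that by (simp add: qc)
  have qm: "?q a \<otimes>\<^bsub>?Q\<^esub> ?q b = ?q (a \<cdot> b)" if "a \<in> carrier A" "b \<in> carrier A" for a b
    using I.rcoset_mult_add[OF that] by (simp add: quotient_module_def FactRing_def)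
  have q1: "\<one>\<^bsub>?Q\<^esub> = ?q \<one>\<^bsub>A\<^esub>" by (simp add: quotient_module_def FactRing_def)
  have qz: "?q a = \<zero>\<^bsub>?Q\<^esub> \<longleftrightarrow> a \<in> I" if "a \<in> carrier A" for a
    using coset_eq_iff[OF A_module sI that, of "\<zero>\<^bsub>A\<^esub>"] linear_map_zero[OF A_module q] that by (simp add: A.M.minus_eq)
  \<comment> \<open>\<open>quotient_action\<close> is a union over the members of a coset; as
    \<open>I\<close> is stable under \<open>H\<close>, all sets in the union are the same
    coset.\<close>
  have qa: "?act h (?q a) = ?q (act h a)" if h: "h \<in> carrier H" and a: "a \<in> carrier A" for h a
  proof -
    have "?q (act h x) = ?q (act h a)" if x: "x \<in> ?q a" for x
    proof -
      obtain k where k: "k \<in> I" "x = k \<oplus>\<^bsub>A\<^esub> a" using x by (auto simp: a_r_coset_def')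
      have kA: "k \<in> carrier A" using k(1) I.a_subset by blast
      have "act h x = act h k \<oplus>\<^bsub>A\<^esub> act h a"
        unfolding k(2) by (rule linear_map_add[OF bilinear_map_right[OF A.act_bilinear linear_map_id h] kA a])
      then have "act h x \<ominus>\<^bsub>A\<^esub> act h a = act h k"
        using vector_space.add_minus_cancel(2)[OF A_vector_space, of "act h k" "act h a"] h a kA by simp
      then show ?thesis
        using coset_eq_iff[OF A_module sI, of "act h x" "act h a"] Iact[OF h k(1)] h a kA k(2) by simp
    qed
    moreover have "a \<in> ?q a" using I.a_rcos_self[OF a] by simp
    ultimately show ?thesis unfolding quotient_action_def by blast
  qed
  let ?r = "\<lambda>m a. rmul m (?q a)"
  have "right_partial_module K M A ?r H \<Delta> act pact"
  proof (intro right_partial_module.intro right_partial_module_axioms.intro right_module.intro right_module_axioms.intro mM)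
    show "bilinear_map K M A M ?r"
    proof (rule bilinear_mapI)
      show "linear_map K A M (\<lambda>a. ?r m a)" if "m \<in> carrier M" for m
        by (rule bilinear_map_right[OF M.rmul_bilinear q(2) that])
      show "linear_map K M M (\<lambda>m. ?r m a)" if "a \<in> carrier A" for a
        by (rule bilinear_map_left[OF M.rmul_bilinear linear_map_id qcl[OF that]])
    qed
    show "bilinear_map K M H M pact" by (rule M.pact_bilinear)
    fix m assume m: "m \<in> carrier M"
    show "?r m \<one>\<^bsub>A\<^esub> = m" using M.rmul_one[OF m] by (simp add: q1)
    show "?r (?r m a) b = ?r m (a \<cdot> b)" if "a \<in> carrier A" "b \<in> carrier A" for a b
      using M.rmul_mult[OF m qcl[OF that(1)] qcl[OF that(2)]] qm[OF that] by simp
    show "pact m \<one>\<^bsub>H\<^esub> = m" by (rule M.pact_one[OF m])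
    fix a h g assume a: "a \<in> carrier A" and h: "h \<in> carrier H" and g: "g \<in> carrier H"
    have "pact (?r (pact m h) a) g = H.sw M (\<lambda>h1 h2. pact (rmul m (?act h1 (?q a))) (h2 \<star> g)) h"
      by (rule M.pact_rmul_pact[OF m qcl[OF a] h g])
    also have "\<dots> = H.sw M (\<lambda>h1 h2. pact (?r m (act h1 a)) (h2 \<star> g)) h"
    proof (rule H.sw_cong[OF mM h])
      fix p s assume ps: "p \<in> carrier H" "s \<in> carrier H"
      show "pact (rmul m (?act p (?q a))) (s \<star> g) = pact (?r m (act p a)) (s \<star> g)"
        by (simp add: qa[OF ps(1) a])
      show "pact (rmul m (?act p (?q a))) (s \<star> g) \<in> carrier M"
        using ps a g bilinear_map_closed[OF M.pact_bilinear bilinear_map_closed[OF M.rmul_bilinear m qcl]]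
        by (simp add: qa[OF ps(1) a])
    qed
    finally show "pact (?r (pact m h) a) g = H.sw M (\<lambda>h1 h2. pact (?r m (act h1 a)) (h2 \<star> g)) h" .
  qed
  moreover have "N = {\<zero>\<^bsub>M\<^esub>} \<or> N = carrier M"
    if N: "submodule N K M" "\<forall>n\<in>N. \<forall>a\<in>carrier A. ?r n a \<in> N" "\<forall>n\<in>N. \<forall>h\<in>carrier H. pact n h \<in> N" for N
  proof -
    have "\<forall>n\<in>N. \<forall>c\<in>carrier ?Q. rmul n c \<in> N" using N(2) by (auto simp: qc)
    then show ?thesis using irr N by (simp add: irreducible_right_partial_module_def)
  qed
  ultimately have irr': "irreducible_right_partial_module K H \<Delta> A act M ?r pact"
    using irr by (simp add: irreducible_right_partial_module_def)
  show ?thesis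
  proof
    fix i assume i: "i \<in> fd_annihilator"
    have iA: "i \<in> carrier A" using i fd_annihilator_subset by blast
    have "?r m i = \<zero>\<^bsub>M\<^esub>" if "m \<in> carrier M" for m
      by (rule fd_annihilator_kills_right[OF fH inv irr' i that])
    then have "?q i \<in> {c \<in> carrier ?Q. \<forall>m\<in>carrier M. rmul m c = \<zero>\<^bsub>M\<^esub>}" using qcl[OF iA] by simp
    then have "?q i = \<zero>\<^bsub>?Q\<^esub>" using faith unfolding faithful_right_module_def by blast
    then show "i \<in> I" using qz[OF iA] by simp
  qed
qed

lemma fd_annihilator_zero:
  assumes "fin H" "\<And>i. i \<in> fd_annihilator \<Longrightarrow> \<exists>b\<in>carrier A. b \<cdot> (\<one>\<^bsub>A\<^esub> \<ominus>\<^bsub>A\<^esub> i) = \<one>\<^bsub>A\<^esub>"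
    "H_semiprimitive K H \<Delta> A act"
  shows "fd_annihilator \<subseteq> {\<zero>\<^bsub>A\<^esub>}"
  using fd_annihilator_subset_primitive[OF assms(1,2)] fd_annihilator_subset assms(3)
  unfolding H_semiprimitive_def H_jacobson_radical_def by blast

end

section \<open>The Jacobson radical of the partial smash product\<close>

context hopf_partial_action
begin

interpretation VT: vector_space K AH.T by (rule AH_vector_space)

abbreviation R where "R \<equiv> partial_smash_product K H \<Delta> A act"

lemma R_simps:
  "t \<in> carrier R \<longleftrightarrow> t \<in> carrier AH.T \<and> t \<bullet> e = t" "\<zero>\<^bsub>R\<^esub> = \<zero>\<^bsub>AH.T\<^esub>" "s \<oplus>\<^bsub>R\<^esub> t = s \<oplus>\<^bsub>AH.T\<^esub> t"
  "c \<odot>\<^bsub>R\<^esub> t = c \<odot>\<^bsub>AH.T\<^esub> t" "s \<otimes>\<^bsub>R\<^esub> t = s \<bullet> t"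
proof -
  have "carrier R = (\<lambda>s. s \<bullet> e) ` carrier AH.T"
    by (simp add: partial_smash_product_def Let_def smash_simps)
  then show "t \<in> carrier R \<longleftrightarrow> t \<in> carrier AH.T \<and> t \<bullet> e = t"
    by (auto simp: smash_assoc smash_one_left image_iff intro!: bexI[of _ t])
qed (simp_all add: partial_smash_product_def Let_def smash_simps)

lemma R_module: "module K R"
proof (rule Module.module.intro)
  show "cring K" by (rule H.K.is_cring)
  have cl: "a \<in> carrier R \<Longrightarrow> b \<in> carrier R \<Longrightarrow> a \<oplus>\<^bsub>R\<^esub> b \<in> carrier R" "\<zero>\<^bsub>R\<^esub> \<in> carrier R"
    "k \<in> carrier K \<Longrightarrow> a \<in> carrier R \<Longrightarrow> k \<odot>\<^bsub>R\<^esub> a \<in> carrier R" for a b k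
    by (simp_all add: R_simps linear_map_add[OF smash_left_linear[OF e_closed]]
      linear_map_zero[OF AH_module AH_module smash_left_linear[OF e_closed]]
      linear_map_smult[OF smash_left_linear[OF e_closed]] module.smult_closed[OF AH_module] VT.M.add.m_closed)
  show "abelian_group R"
  proof (rule abelian_groupI)
    fix x assume x: "x \<in> carrier R"
    have "\<zero>\<^bsub>AH.T\<^esub> \<ominus>\<^bsub>AH.T\<^esub> x \<in> carrier R"
      using x cl(2) linear_map_minus[OF AH_module AH_module smash_left_linear[OF e_closed], of "\<zero>\<^bsub>AH.T\<^esub>" x] by (simp add: R_simps)
    moreover have "(\<zero>\<^bsub>AH.T\<^esub> \<ominus>\<^bsub>AH.T\<^esub> x) \<oplus>\<^bsub>AH.T\<^esub> x = \<zero>\<^bsub>AH.T\<^esub>"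
      by (rule VT.add_minus_cancel(3)) (use x cl(2) in \<open>simp_all add: R_simps\<close>)
    ultimately show "\<exists>y\<in>carrier R. y \<oplus>\<^bsub>R\<^esub> x = \<zero>\<^bsub>R\<^esub>" by (auto simp: R_simps(2,3))
  qed (use cl in \<open>simp_all add: R_simps VT.M.a_ac\<close>)
  show "module_axioms K R"
    by (rule module_axioms.intro)
       (use cl in \<open>simp_all add: R_simps module.smult_l_distr[OF AH_module] module.smult_r_distr[OF AH_module] module.smult_assoc1[OF AH_module] module.smult_one[OF AH_module]\<close>)
qed

lemma R_vector_space: "vector_space K R"
  by (simp add: vector_space_def R_module H.K.field_axioms)

text \<open>If \<open>e - x s\<close> generated a proper right ideal, a maximal one above it would
  contain \<open>x s\<close> as well, since it contains \<open>x\<close>, and hence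
  \<open>e\<close>.\<close>

lemma jacobson_radical_right_inverse:
  assumes x: "x \<in> jacobson_radical R" and s: "s \<in> carrier R"
  shows "\<exists>c\<in>carrier R. (e \<ominus>\<^bsub>AH.T\<^esub> x \<bullet> s) \<bullet> c = e"
proof (rule ccontr)
  assume no: "\<not> ?thesis"
  interpret VR: vector_space K R by (rule R_vector_space)
  have xR: "x \<in> carrier R" using x by (simp add: jacobson_radical_def)
  let ?r = "x \<bullet> s" and ?u = "e \<ominus>\<^bsub>AH.T\<^esub> x \<bullet> s"
  have rT: "?r \<in> carrier AH.T" "?r \<bullet> e = ?r" using xR s by (simp_all add: R_simps smash_assoc)
  have uT: "?u \<in> carrier AH.T" using rT by simp
  have ue: "?u \<bullet> e = ?u"
    using linear_map_minus[OF AH_module AH_module smash_left_linear[OF e_closed] e_closed rT(1)] rT(2)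
    by (simp add: smash_one_left)
  have eR: "e \<in> carrier R" by (simp add: R_simps smash_one_left)
  have mc: "a \<bullet> b \<in> carrier R" if "a \<in> carrier AH.T" "b \<in> carrier R" for a b
    using that by (simp add: R_simps smash_assoc)
  let ?N = "(\<lambda>c. ?u \<bullet> c) ` carrier R" and ?\<beta> = "\<lambda>a y. y \<bullet> a"
  have "linear_map K R R (\<lambda>c. ?u \<bullet> c)"
    using smash_right_linear[OF uT] mc[OF uT] by (auto simp: linear_map_def R_simps)
  then have N: "submodule ?N K R" by (rule linear_map_image_submodule[OF R_module R_module])
  have Nst: "\<forall>a\<in>carrier R. \<forall>y\<in>?N. ?\<beta> a y \<in> ?N"
  proof (intro ballI)
    fix a y assume a: "a \<in> carrier R" and "y \<in> ?N"
    then obtain c where c: "c \<in> carrier R" "y = ?u \<bullet> c" by blast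
    then have "y \<bullet> a = ?u \<bullet> (c \<bullet> a)" using uT a by (simp add: R_simps smash_assoc)
    then show "y \<bullet> a \<in> ?N" using mc[OF _ a, of c] c(1) by (simp add: R_simps(1))
  qed
  have N1: "e \<notin> ?N" using no by (auto dest: sym)
  obtain I where I: "submodule I K R" "\<forall>a\<in>carrier R. \<forall>y\<in>I. ?\<beta> a y \<in> I" "?N \<subseteq> I" "e \<notin> I"
    and max: "\<forall>J. submodule J K R \<and> (\<forall>a\<in>carrier R. \<forall>y\<in>J. ?\<beta> a y \<in> J) \<and> I \<subseteq> J \<and> e \<notin> J \<longrightarrow> J = I"
    by (rule VR.maximal_stable_subspace_family[OF N Nst N1], rule that)
  have "maximal_right_ideal I R"
    unfolding maximal_right_ideal_def right_ideal_def
  proof (intro conjI allI impI)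
    show "additive_subgroup I R" using submodule.axioms(1)[OF I(1)] by (simp add: additive_subgroup_def)
    show "\<forall>x\<in>I. \<forall>r\<in>carrier R. x \<otimes>\<^bsub>R\<^esub> r \<in> I" using I(2) by (simp add: R_simps(5))
    show "I \<noteq> carrier R" using I(4) eR by blast
    fix J assume J: "(additive_subgroup J R \<and> (\<forall>x\<in>J. \<forall>r\<in>carrier R. x \<otimes>\<^bsub>R\<^esub> r \<in> J)) \<and> I \<subseteq> J"
    then interpret J: additive_subgroup J R by simp
    have JR: "y \<in> carrier R" if "y \<in> J" for y using that J.a_subset by blast
    have Jst: "y \<bullet> a \<in> J" if "y \<in> J" "a \<in> carrier R" for y a using J that by (simp add: R_simps(5))
    \<comment> \<open>A right ideal is by definition a mere additive subgroup, while maximality was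
      obtained among subspaces. The identity \<open>k y = y (k e)\<close> closes the gap.\<close>
    have "submodule J K R"
    proof (rule VR.subspaceI[OF J.a_subset J.zero_closed J.a_closed])
      fix k y assume k: "k \<in> carrier K" and y: "y \<in> J"
      have "y \<bullet> (k \<odot>\<^bsub>R\<^esub> e) = k \<odot>\<^bsub>R\<^esub> y"
        using JR[OF y] linear_map_smult[OF smash_right_linear k e_closed, of y] by (simp add: R_simps)
      then show "k \<odot>\<^bsub>R\<^esub> y \<in> J" using Jst[OF y, of "k \<odot>\<^bsub>R\<^esub> e"] VR.smult_closed[OF k eR] by simp
    qed
    moreover have "J = carrier R" if "e \<in> J"
      using Jst[OF that] J.a_subset by (auto simp: R_simps(1) smash_one_left)
    ultimately show "J = I \<or> J = carrier R" using max J Jst by blast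
  qed
  then have "x \<in> I" using x by (simp add: jacobson_radical_def)
  then have "?r \<in> I" using I(2) s by blast
  moreover have "?u \<in> I"
  proof -
    have "?u \<bullet> e \<in> ?N" using eR by (rule imageI)
    then show ?thesis unfolding ue by (rule subsetD[OF I(3)])
  qed
  ultimately have "?u \<oplus>\<^bsub>R\<^esub> ?r \<in> I" using VR.subspaceD(4)[OF I(1)] by blast
  then show False using I(4) VT.add_minus_cancel(3)[OF e_closed rT(1)] by (simp add: R_simps)
qed

text \<open>The radical is defined by maximal right ideals but has to kill left modules. If
  \<open>w = x v\<close> were nonzero, then \<open>v = t w\<close> for some \<open>t\<close>, so
  \<open>r = x t e\<close> fixes \<open>w\<close>; a left inverse \<open>c\<close> of
  \<open>e - r\<close> then gives \<open>w = c (e - r) w = 0\<close>. Quasi-regularity yields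
  \<open>c\<close> as a right inverse, and it is turned into a left one as in
  \<open>fd_annihilator_left_inverse\<close>.\<close>

lemma jacobson_radical_subset_fd_radical:
  assumes x: "x \<in> jacobson_radical R"
  shows "x \<in> fd_radical"
proof -
  have xR: "x \<in> carrier AH.T" using x by (simp add: jacobson_radical_def R_simps)
  have "tact X l h x v = \<zero>\<^bsub>X\<^esub>" if X: "irreducible_module X l h" and v: "v \<in> carrier X"
    for X :: "('k, 'a, 'h) umodule" and l h v
  proof (rule ccontr)
    interpret X: partial_module_context K H \<Delta> \<epsilon> S A act X l h by (rule irreducible_context[OF X])
    interpret VX: vector_space K X by (rule X.X_vector_space)
    let ?w = "X.ten x v"
    assume w: "?w \<noteq> \<zero>\<^bsub>X\<^esub>"
    have wX: "?w \<in> carrier X" using xR v by simp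
    have "(\<lambda>t. X.ten t ?w) ` carrier AH.T = carrier X"
      using X.orbit_stable[OF wX] X w unfolding irreducible_module_def by (metis singletonD)
    then have "v \<in> (\<lambda>t. X.ten t ?w) ` carrier AH.T" using v by simp
    then obtain t where t: "t \<in> carrier AH.T" "v = X.ten t ?w" by (elim imageE)
    let ?s = "t \<bullet> e"
    have s: "?s \<in> carrier R" using t(1) by (simp add: R_simps smash_assoc smash_one_left)
    have sT: "?s \<in> carrier AH.T" using t(1) by simp
    let ?r = "x \<bullet> ?s"
    have rT: "?r \<in> carrier AH.T" using xR sT by simp
    obtain c where c: "c \<in> carrier R" "(e \<ominus>\<^bsub>AH.T\<^esub> ?r) \<bullet> c = e"
      using jacobson_radical_right_inverse[OF x s] by blast
    have cT: "c \<in> carrier AH.T" "c \<bullet> e = c" using c(1) by (simp_all add: R_simps)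
    let ?u = "e \<ominus>\<^bsub>AH.T\<^esub> ?r"
    have uT: "?u \<in> carrier AH.T" using rT by simp
    have ue: "?u \<bullet> e = ?u"
      using linear_map_minus[OF AH_module AH_module smash_left_linear[OF e_closed] e_closed rT] xR t(1)
      by (simp add: smash_one_left smash_assoc)
    have rcT: "?r \<bullet> c \<in> carrier AH.T" using rT cT by simp
    have c1: "c \<ominus>\<^bsub>AH.T\<^esub> ?r \<bullet> c = e"
      using linear_map_minus[OF AH_module AH_module smash_left_linear[OF cT(1)] e_closed rT] c(2)
      by (simp add: smash_one_left[OF cT(1)])
    \<comment> \<open>\<open>c = e + r c\<close> is rewritten as \<open>e - x s'\<close>, so that
      quasi-regularity of \<open>x\<close> also gives \<open>c\<close> a right inverse.\<close>
    let ?s' = "\<zero>\<^bsub>AH.T\<^esub> \<ominus>\<^bsub>AH.T\<^esub> ?s \<bullet> c"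
    have zT: "\<zero>\<^bsub>AH.T\<^esub> \<in> carrier AH.T" by (rule VT.M.zero_closed)
    have scT: "?s \<bullet> c \<in> carrier AH.T" using sT cT by simp
    have s'T: "?s' \<in> carrier AH.T" using scT zT by simp
    have "?s' \<bullet> e = ?s'"
      using linear_map_minus[OF AH_module AH_module smash_left_linear[OF e_closed] zT scT]
        linear_map_zero[OF AH_module AH_module smash_left_linear[OF e_closed]] smash_assoc[OF sT cT(1) e_closed] cT(2)
      by simp
    then have s'R: "?s' \<in> carrier R" using s'T by (simp add: R_simps)
    have xs': "x \<bullet> ?s' = \<zero>\<^bsub>AH.T\<^esub> \<ominus>\<^bsub>AH.T\<^esub> ?r \<bullet> c"
      using linear_map_minus[OF AH_module AH_module smash_right_linear[OF xR] zT scT]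
        linear_map_zero[OF AH_module AH_module smash_right_linear[OF xR]] smash_assoc[OF xR sT cT(1)] by simp
    have "c = e \<oplus>\<^bsub>AH.T\<^esub> ?r \<bullet> c" using VT.add_minus_cancel(3)[OF cT(1) rcT] c1 by simp
    then have "e \<ominus>\<^bsub>AH.T\<^esub> x \<bullet> ?s' = c"
      unfolding xs' using rcT by (simp add: VT.M.minus_eq VT.M.minus_minus)
    then obtain d where d: "d \<in> carrier R" "c \<bullet> d = e"
      using jacobson_radical_right_inverse[OF x s'R] by auto
    have dT: "d \<in> carrier AH.T" using d(1) by (simp add: R_simps)
    have "c \<bullet> ?u = c \<bullet> (?u \<bullet> (c \<bullet> d))" unfolding d(2) ue ..
    also have "\<dots> = c \<bullet> ((?u \<bullet> c) \<bullet> d)" using smash_assoc[OF uT cT(1) dT] by simp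
    also have "\<dots> = e" unfolding c(2) smash_one_left[OF dT] by (rule d(2))
    finally have cu: "c \<bullet> ?u = e" .
    have "X.ten ?r ?w = X.ten x (X.ten t ?w)"
      using X.ten_mult[OF xR sT wX] X.ten_mult[OF t(1) e_closed wX] X.ten_one[OF wX] by simp
    then have rw: "X.ten ?r ?w = ?w" by (simp flip: t(2))
    have "X.ten ?u ?w = X.ten e ?w \<ominus>\<^bsub>X\<^esub> X.ten ?r ?w"
      by (rule linear_map_minus[OF AH_module X.X_module bilinear_map_left[OF X.ten_bilinear linear_map_id wX] e_closed rT])
    then have uw: "X.ten ?u ?w = \<zero>\<^bsub>X\<^esub>"
      unfolding rw X.ten_one[OF wX] using VX.minus_eq_zero_iff[OF wX wX] by simp
    have "?w = X.ten (c \<bullet> ?u) ?w" unfolding cu by (rule X.ten_one[OF wX, symmetric])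
    also have "\<dots> = X.ten c \<zero>\<^bsub>X\<^esub>" unfolding X.ten_mult[OF cT(1) uT wX] uw ..
    also have "\<dots> = \<zero>\<^bsub>X\<^esub>"
      by (rule linear_map_zero[OF X.X_module X.X_module bilinear_map_right[OF X.ten_bilinear linear_map_id cT(1)]])
    finally show False using w by contradiction
  qed
  then show ?thesis using xR by (simp add: fd_radical_def)
qed

text \<open>The slices of an element of the radical lie in \<open>fd_annihilator\<close>, which is
  zero, and its slices at a dual basis of \<open>H\<close> determine the element.\<close>

lemma semiprimitive_partial_smash_product:
  assumes ss: "semisimple H"
    and hs: "H_semiprimitive K H \<Delta> A act"
    and hyp: "(\<forall>(M :: ('k, 'a set) module) rmul. irreducible_right_module K A M rmul \<longrightarrow> finite_dimensional K M) \<or>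
      (\<forall>(M :: ('k, 'a set) module) lmul. irreducible_left_module K A M lmul \<longrightarrow> finite_dimensional K M)"
  shows "semiprimitive R"
proof -
  have fH: "fin H" by (rule H.semisimple_finite_dimensional[OF ss])
  have zero: "fd_annihilator \<subseteq> {\<zero>\<^bsub>A\<^esub>}"
    by (rule fd_annihilator_zero[OF fH fd_annihilator_left_inverse[OF fH hyp] hs])
  have sub: "x \<in> {\<zero>\<^bsub>R\<^esub>}" if x: "x \<in> jacobson_radical R" for x
  proof -
    have xT: "x \<in> carrier AH.T" "x \<bullet> e = x" using x by (simp_all add: jacobson_radical_def R_simps)
    have sl: "slice f x = \<zero>\<^bsub>A\<^esub>" if f: "functional K H f" for f
    proof -
      have "slice f x \<in> fd_annihilator"
        using fd_radical_slice[OF ss _ _ jacobson_radical_subset_fd_radical[OF x] xT(2) f]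
          linear_map_closed[OF slice_linear[OF f] xT(1)] by (auto simp: fd_annihilator_def)
      then show ?thesis using zero by blast
    qed
    obtain g f where g: "\<And>i. i < dim H \<Longrightarrow> g i \<in> carrier H" and f: "\<And>i. i < dim H \<Longrightarrow> functional K H (f i)"
      and gen: "\<And>t. t \<in> carrier AH.T \<Longrightarrow> t = (\<Oplus>\<^bsub>AH.T\<^esub>i\<in>{..<dim H}. pure (slice (f i) t) (g i))"
      by (rule slice_expansion[OF fH], rule that)
    have "x = (\<Oplus>\<^bsub>AH.T\<^esub>i\<in>{..<dim H}. pure (slice (f i) x) (g i))" by (rule gen[OF xT(1)])
    also have "\<dots> = (\<Oplus>\<^bsub>AH.T\<^esub>i\<in>{..<dim H}. \<zero>\<^bsub>AH.T\<^esub>)"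
      by (rule VT.M.finsum_cong')
         (use g f sl in \<open>auto simp: linear_map_zero[OF A_module AH_module bilinear_map_left[OF AH.pure_tensor_bilinear linear_map_id]]\<close>)
    finally show ?thesis by (simp add: R_simps(2))
  qed
  have zR: "\<zero>\<^bsub>R\<^esub> \<in> jacobson_radical R"
    using module.carrier_is_submodule[OF R_module]
      vector_space.subspaceD(3)[OF R_vector_space module.carrier_is_submodule[OF R_module]]
    by (auto simp: jacobson_radical_def maximal_right_ideal_def right_ideal_def additive_subgroup.zero_closed)
  show ?thesis
    unfolding semiprimitive_def by (rule equalityI, rule subsetI, erule sub) (use zR in blast)
qed

end

theorem theorem5p1:
  fixes K :: "'k ring"
    and H :: "('k, 'h) module"
    and \<Delta> :: "'h \<Rightarrow> ('h \<times> 'h \<Rightarrow> 'k) set"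
    and \<epsilon> :: "'h \<Rightarrow> 'k"
    and S :: "'h \<Rightarrow> 'h"
    and A :: "('k, 'a) module"
    and act :: "'h \<Rightarrow> 'a \<Rightarrow> 'a"
  assumes "hopf_algebra K H \<Delta> \<epsilon> S"
    and "semisimple H"
    and "partial_module_algebra K A H \<Delta> act"
    and "H_semiprimitive K H \<Delta> A act"
    and "(\<forall>(M :: ('k, 'a set) module) rmul.
            irreducible_right_module K A M rmul \<longrightarrow> finite_dimensional K M) \<or>
         (\<forall>(M :: ('k, 'a set) module) lmul.
            irreducible_left_module K A M lmul \<longrightarrow> finite_dimensional K M)"
  shows "semiprimitive (partial_smash_product K H \<Delta> A act)"
proof -
  interpret hopf_partial_action K H \<Delta> \<epsilon> S A act
    using assms(1,3) by (rule hopf_partial_action.intro)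
  show ?thesis by (rule semiprimitive_partial_smash_product[OF assms(2,4,5)])
qed

end
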